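(* Let $\ell\ge2$ be an integer, let $\delta,\beta,\kappa,\Omega_1,\dots,\Omega_\ell>0$ be constants with $\kappa<1$, and consider the system of second-order coupled oscillators $$\dot{I}_j=\epsilon\biggl(-\delta I_j+\Omega_j+\beta\sum_{k=1}^\ell\frac{\sin(\theta_k-\theta_j)}{1-\kappa\cos(\theta_k-\theta_j)}\biggr),\qquad \dot{\theta}_j=I_j,\qquad j=1,\dots,\ell,$$ on $(I,\theta)\in\mathbb{R}^\ell\times\mathbb{T}^\ell$, where $\epsilon$ is a small parameter. Let $I\in\mathbb{R}^\ell$ satisfy $2I_1=I_2=\cdots=I_\ell\neq0$, let $\theta\in\mathbb{T}^\ell$, and put $\omega^\ast=I_1$, $T^\ast=2\pi/\omega^\ast$ and $$\tau^\ast=\frac{\theta_1-\theta_2}{\omega^\ast}+\frac{i}{\omega^\ast}\operatorname{arccosh}\Bigl(\frac1\kappa\Bigr).$$ Let $\Gamma$ be a domain in $\mathbb{C}/T^\ast\mathbb{Z}$ containing $\mathbb{R}/T^\ast\mathbb{Z}$ and $\tau=\tau^\ast$. Then the system is not meromorphically integrable in the Bogoyavlenskij sense near the periodic orbit $$\{(I,\,I\tau+\theta)\mid\tau\in\Gamma\}$$ of the system with $\epsilon=0$, in such a way that the first integrals and commutative vector fields also depend meromorphically on $\epsilon$ near $\epsilon=0$.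
   Context: $\mathbb{T}^\ell=(\mathbb{R}/2\pi\mathbb{Z})^\ell$. Time and the state variables are complexified, the state space becoming $\mathbb{C}^\ell\times(\mathbb{C}/2\pi\mathbb{Z})^\ell$. Bogoyavlenskij integrability: an $N$-dimensional system $\dot y=f(y)$ is $(q,N-q)$-integrable, or simply integrable, if there are $q$ vector fields $f_1:=f,f_2,\dots,f_q$ and $N-q$ scalar functions $F_1,\dots,F_{N-q}$ such that (i) $f_1,\dots,f_q$ are linearly independent almost everywhere and commute, $[f_j,f_k]=\mathrm{D}f_k\,f_j-\mathrm{D}f_j\,f_k\equiv0$; (ii) $\mathrm{D}F_1,\dots,\mathrm{D}F_{N-q}$ are linearly independent almost everywhere and $\mathrm{D}F_k\cdot f_j\equiv0$ for all $j,k$. It is meromorphically integrable if the $f_j$ and $F_k$ are meromorphic. For a family $\dot y=f(y;\epsilon)$, "not meromorphically integrable near an orbit $\mathcal{O}$ such that the first integrals and commutative vector fields also depend meromorphically on $\epsilon$ near $\epsilon=0$" means: for no $q\in\{1,\dots,N\}$ and no neighborhood of $\mathcal{O}\times\{\epsilon=0\}$ in the complexified (state, parameter) space do there exist $f_1=f(\cdot;\epsilon),f_2,\dots,f_q$ and $F_1,\dots,F_{N-q}$, meromorphic in $(y,\epsilon)$ on that neighborhood, satisfying (i) and (ii) (brackets and derivatives taken in $y$, identities holding identically in $(y,\epsilon)$, independence almost everywhere). Here $N=2\ell$, $y=(I,\theta)$. *)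

theory Defs
  imports "HOL-Analysis.Analysis"
begin

section \<open>Holomorphic and meromorphic functions of \<open>(y, \<epsilon>) \<in> \<complex>\<^sup>N \<times> \<complex>\<close>\<close>

text \<open>Complex differentiability: the real Frechet derivative exists and commutes with complex
  scalars.\<close>

definition scv_holomorphic_on ::
    "((complex ^ 'n) \<times> complex \<Rightarrow> complex) \<Rightarrow> ((complex ^ 'n) \<times> complex) set \<Rightarrow> bool" where
  "scv_holomorphic_on F S \<longleftrightarrow>
     (\<forall>z\<in>S. \<exists>D. (F has_derivative D) (at z) \<and> (\<forall>c v e. D (c *s v, c * e) = c * D (v, e)))"

definition scv_analytic_at ::
    "((complex ^ 'n) \<times> complex \<Rightarrow> complex) \<Rightarrow> (complex ^ 'n) \<times> complex \<Rightarrow> bool" where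
  "scv_analytic_at F z \<longleftrightarrow> (\<exists>V. open V \<and> z \<in> V \<and> scv_holomorphic_on F V)"

text \<open>Meromorphic means locally a quotient of holomorphic functions whose denominator vanishes
  identically on no nonempty open set.  A meromorphic function is represented by a total
  function, whose values on the (nowhere dense, null) zero set of the denominator are irrelevant.\<close>

definition scv_meromorphic_on ::
    "((complex ^ 'n) \<times> complex \<Rightarrow> complex) \<Rightarrow> ((complex ^ 'n) \<times> complex) set \<Rightarrow> bool" where
  "scv_meromorphic_on F U \<longleftrightarrow>
     (\<forall>z\<in>U. \<exists>V g h. open V \<and> z \<in> V \<and> V \<subseteq> U \<and>
        scv_holomorphic_on g V \<and> scv_holomorphic_on h V \<and>
        (\<forall>W. open W \<and> W \<noteq> {} \<and> W \<subseteq> V \<longrightarrow> (\<exists>w\<in>W. h w \<noteq> 0)) \<and>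
        (\<forall>w\<in>V. h w \<noteq> 0 \<longrightarrow> F w = g w / h w))"

section \<open>Derivatives with respect to \<open>y\<close>\<close>

definition pderiv_state ::
    "'n \<Rightarrow> ((complex ^ 'n) \<times> complex \<Rightarrow> complex) \<Rightarrow> (complex ^ 'n) \<times> complex \<Rightarrow> complex" where
  "pderiv_state m F = (\<lambda>(y, e). deriv (\<lambda>w. F (\<chi> k. if k = m then w else y $ k, e)) (y $ m))"

definition grad_state ::
    "((complex ^ 'n) \<times> complex \<Rightarrow> complex) \<Rightarrow> (complex ^ 'n) \<times> complex \<Rightarrow> complex ^ 'n" where
  "grad_state F z = (\<chi> m. pderiv_state m F z)"

definition jacobian_state ::
    "((complex ^ 'n) \<times> complex \<Rightarrow> complex ^ 'n) \<Rightarrow> (complex ^ 'n) \<times> complex \<Rightarrow> complex ^ 'n ^ 'n" where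
  "jacobian_state X z = (\<chi> i m. pderiv_state m (\<lambda>w. X w $ i) z)"

definition lie_bracket_state ::
    "((complex ^ 'n) \<times> complex \<Rightarrow> complex ^ 'n) \<Rightarrow> ((complex ^ 'n) \<times> complex \<Rightarrow> complex ^ 'n) \<Rightarrow>
     (complex ^ 'n) \<times> complex \<Rightarrow> complex ^ 'n" where
  "lie_bracket_state X Y z = jacobian_state Y z *v X z - jacobian_state X z *v Y z"

section \<open>Bogoyavlenskij integrability of a family \<open>y' = f(y; \<epsilon>)\<close>\<close>

definition lin_indep_family :: "(nat \<Rightarrow> complex ^ 'n) \<Rightarrow> nat set \<Rightarrow> bool" where
  "lin_indep_family v J \<longleftrightarrow> (\<forall>c. (\<Sum>j\<in>J. c j *s v j) = 0 \<longrightarrow> (\<forall>j\<in>J. c j = 0))"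

text \<open>The state space is the quotient of \<open>\<complex>\<^sup>N\<close> by the period group \<open>P\<close>.  Subsets of the quotient and
  functions on it are represented by their \<open>P\<close>-invariant lifts to \<open>\<complex>\<^sup>N\<close>.\<close>

definition periodic_set :: "(complex ^ 'n) set \<Rightarrow> ((complex ^ 'n) \<times> complex) set \<Rightarrow> bool" where
  "periodic_set P U \<longleftrightarrow> (\<forall>(y, e)\<in>U. \<forall>p\<in>P. (y + p, e) \<in> U)"

definition periodic_fun_on ::
    "(complex ^ 'n) set \<Rightarrow> ((complex ^ 'n) \<times> complex \<Rightarrow> 'b) \<Rightarrow> ((complex ^ 'n) \<times> complex) set \<Rightarrow> bool" where
  "periodic_fun_on P F U \<longleftrightarrow> (\<forall>(y, e)\<in>U. \<forall>p\<in>P. F (y + p, e) = F (y, e))"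

text \<open>Identities between meromorphic functions are required wherever the functions involved are
  holomorphic, which is an open dense subset of full measure of \<open>U\<close>.\<close>

definition bogoyavlenskij_integrable_on ::
    "(complex ^ 'n) set \<Rightarrow> ((complex ^ 'n) \<times> complex \<Rightarrow> complex ^ 'n) \<Rightarrow>
     ((complex ^ 'n) \<times> complex) set \<Rightarrow> nat \<Rightarrow> bool" where
  "bogoyavlenskij_integrable_on P f U q \<longleftrightarrow>
     (\<exists>(X :: nat \<Rightarrow> (complex ^ 'n) \<times> complex \<Rightarrow> complex ^ 'n)
       (F :: nat \<Rightarrow> (complex ^ 'n) \<times> complex \<Rightarrow> complex).
        let J = {1..q}; K = {1..CARD('n) - q} in
        (\<forall>z\<in>U. X 1 z = f z) \<and>
        (\<forall>j\<in>J. periodic_fun_on P (X j) U \<and> (\<forall>i. scv_meromorphic_on (\<lambda>z. X j z $ i) U)) \<and>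
        (\<forall>k\<in>K. periodic_fun_on P (F k) U \<and> scv_meromorphic_on (F k) U) \<and>
        (AE z in lborel. z \<in> U \<longrightarrow> lin_indep_family (\<lambda>j. X j z) J) \<and>
        (\<forall>j\<in>J. \<forall>k\<in>J. \<forall>z\<in>U.
           (\<forall>i. scv_analytic_at (\<lambda>w. X j w $ i) z \<and> scv_analytic_at (\<lambda>w. X k w $ i) z) \<longrightarrow>
           lie_bracket_state (X j) (X k) z = 0) \<and>
        (AE z in lborel. z \<in> U \<longrightarrow> lin_indep_family (\<lambda>k. grad_state (F k) z) K) \<and>
        (\<forall>k\<in>K. \<forall>j\<in>J. \<forall>z\<in>U.
           scv_analytic_at (F k) z \<and> (\<forall>i. scv_analytic_at (\<lambda>w. X j w $ i) z) \<longrightarrow>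
           (\<Sum>m\<in>UNIV. grad_state (F k) z $ m * X j z $ m) = 0))"

text \<open>\<open>Orb\<close> is a lift of the orbit; a \<open>P\<close>-invariant \<open>U\<close> containing \<open>Orb \<times> {0}\<close> contains
  all its translates.\<close>

definition meromorphically_integrable_near ::
    "(complex ^ 'n) set \<Rightarrow> ((complex ^ 'n) \<times> complex \<Rightarrow> complex ^ 'n) \<Rightarrow> (complex ^ 'n) set \<Rightarrow> bool" where
  "meromorphically_integrable_near P f Orb \<longleftrightarrow>
     (\<exists>q\<in>{1..CARD('n)}. \<exists>U. open U \<and> periodic_set P U \<and> Orb \<times> {0} \<subseteq> U \<and>
        bogoyavlenskij_integrable_on P f U q)"

section \<open>Domains in \<open>\<complex>/T\<int>\<close>\<close>

text \<open>Subsets of \<open>\<complex>/T\<int>\<close> are represented by their preimages in \<open>\<complex>\<close>.  Such a set is open in the quotient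
  topology iff its preimage is open; connectedness below is that of the subset of the quotient.\<close>

definition mod_invariant :: "real \<Rightarrow> complex set \<Rightarrow> bool" where
  "mod_invariant T A \<longleftrightarrow> (\<forall>z\<in>A. \<forall>k::int. z + of_int k * of_real T \<in> A)"

definition domain_mod :: "real \<Rightarrow> complex set \<Rightarrow> bool" where
  "domain_mod T G \<longleftrightarrow> open G \<and> mod_invariant T G \<and> G \<noteq> {} \<and>
     \<not> (\<exists>A B. open A \<and> open B \<and> mod_invariant T A \<and> mod_invariant T B \<and>
            A \<noteq> {} \<and> B \<noteq> {} \<and> A \<inter> B = {} \<and> A \<union> B = G)"

section \<open>The coupled oscillators\<close>

text \<open>A state \<open>(I, \<theta>)\<close> is a vector \<open>y\<close> with \<open>y $ Inl j = I\<^sub>j\<close> and \<open>y $ Inr j = \<theta>\<^sub>j\<close>.\<close>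

definition angle_periods :: "(complex ^ ('l::finite + 'l)) set" where
  "angle_periods = {p. (\<forall>j. p $ Inl j = 0) \<and> (\<forall>j. \<exists>k::int. p $ Inr j = 2 * of_real pi * of_int k)}"

definition oscillator_field ::
    "real \<Rightarrow> real \<Rightarrow> real \<Rightarrow> real ^ 'l \<Rightarrow> (complex ^ ('l::finite + 'l)) \<times> complex \<Rightarrow> complex ^ ('l + 'l)" where
  "oscillator_field \<delta> \<beta> \<kappa> \<Omega> = (\<lambda>(y, \<epsilon>). \<chi> i. case i of
       Inl j \<Rightarrow> \<epsilon> * (- of_real \<delta> * y $ Inl j + of_real (\<Omega> $ j) +
                 of_real \<beta> * (\<Sum>k\<in>UNIV. sin (y $ Inr k - y $ Inr j) /
                                      (1 - of_real \<kappa> * cos (y $ Inr k - y $ Inr j))))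
     | Inr j \<Rightarrow> y $ Inl j)"

definition unperturbed_orbit ::
    "real ^ 'l \<Rightarrow> real ^ 'l \<Rightarrow> complex set \<Rightarrow> (complex ^ ('l::finite + 'l)) set" where
  "unperturbed_orbit I \<theta> \<Gamma> =
     (\<lambda>\<tau>. \<chi> i. case i of Inl j \<Rightarrow> of_real (I $ j)
                     | Inr j \<Rightarrow> of_real (I $ j) * \<tau> + of_real (\<theta> $ j)) ` \<Gamma>"

end

theory Submission
  imports Defs "HOL-Complex_Analysis.Complex_Analysis" "HOL-Computational_Algebra.Fraction_Field"
begin

text \<open>Blow up a neighbourhood of a point of the unperturbed orbit by \<open>I = I\<^sup>* + \<mu>\<^sup>2 \<xi>\<close>, \<open>\<theta> = \<theta>\<^sup>* + \<mu> \<eta>\<close>,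
  \<open>\<epsilon> = \<mu>\<^sup>3\<close>. Taylor expansion in \<open>\<mu>\<close> embeds germs of meromorphic functions into the fraction field of
  the power series in \<open>\<mu>\<close> with polynomial coefficients in \<open>(\<xi>, \<eta>)\<close>. Linear transport by the flow along
  a loop in complex time induces on these series an automorphism \<open>E\<close> with \<open>E = 1\<close> modulo \<open>\<mu>\<close>, which fixes
  the first integrals and commutes with the commuting fields. Its logarithm is a derivation with
  the same properties, hence a combination of the commuting fields with coefficients annihilated
  by all of them; so the logarithms of any two loops commute. Take a small loop around \<open>\<tau>\<^sup>*\<close>, where
  the force on the first oscillator has a simple pole, and a path over one real period. The
  leading term of the commutator of their logarithms is the residue times the period, which does
  not vanish.\<close>

section \<open>Polynomial functions\<close>

text \<open>A first integral or a commuting field may have poles along the whole unperturbed orbit,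
  so it cannot simply be restricted to it. Keeping all directions as polynomial variables leaves
  every admissible denominator nonzero, and the series ring is an integral domain, so each germ
  survives as a fraction. The price is that identities between fractions must be carried along a
  path although the denominators need not be units; this is done by counting orders of vanishing in
  time. In the blown-up variables the system reads \<open>\<xi>' = \<mu> * force\<close> and
  \<open>\<eta>' = \<mu> * \<xi>\<close>. At first order the small loop translates
  \<open>\<xi>\<close> of the first oscillator by a multiple of the residue, while the path over one
  period shears each \<open>\<eta>\<close> by the period times its \<open>\<xi>\<close>; a
  translation and a shear do not commute. The logarithm is taken because derivations, unlike
  automorphisms, are vectors over the fraction field: there a dimension count places them in the
  span of the commuting fields. It exists because, at each order in \<mu>, the \<open>n\<close>-th
  iterate of the automorphism is polynomial in \<open>n\<close>.\<close>

inductive polyfun :: "(complex ^ 'n \<Rightarrow> complex) \<Rightarrow> bool" where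
  const: "polyfun (\<lambda>_. c)"
| var: "polyfun (\<lambda>p. p $ i)"
| add: "polyfun f \<Longrightarrow> polyfun g \<Longrightarrow> polyfun (\<lambda>p. f p + g p)"
| mult: "polyfun f \<Longrightarrow> polyfun g \<Longrightarrow> polyfun (\<lambda>p. f p * g p)"

lemma polyfun_line:
  assumes "polyfun f"
  shows "\<exists>q. \<forall>t. f (a + t *s b) = poly q t"
  using assms
proof induction
  case (const c)
  show ?case by (rule exI[of _ "[:c:]"]) simp
next
  case (var i)
  show ?case by (rule exI[of _ "[:a $ i, b $ i:]"]) (simp add: algebra_simps)
next
  case (add f g)
  then show ?case by (metis poly_add)
next
  case (mult f g)
  then show ?case by (metis poly_mult)
qed

text \<open>A point where \<open>f\<close> is nonzero and a point where \<open>g\<close> is nonzero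
  lie on one complex line; on it both restrict to nonzero polynomials in one variable, whose product
  cannot vanish identically.\<close>

lemma polyfun_no_zero_divisors:
  fixes f g :: "complex ^ 'n \<Rightarrow> complex"
  assumes "polyfun f" "polyfun g" and fg: "\<And>p. f p * g p = 0"
  shows "(\<forall>p. f p = 0) \<or> (\<forall>p. g p = 0)"
proof (rule ccontr)
  assume "\<not> ?thesis"
  then obtain a b where ab: "f a \<noteq> 0" "g b \<noteq> 0" by blast
  obtain q where q: "\<And>t. f (a + t *s (b - a)) = poly q t" using polyfun_line[OF assms(1)] by metis
  obtain r where r: "\<And>t. g (a + t *s (b - a)) = poly r t" using polyfun_line[OF assms(2)] by metis
  have "q \<noteq> 0" using q[of 0] ab by auto
  moreover have "r \<noteq> 0" using r[of 1] ab by auto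
  moreover have "poly (q * r) t = 0" for t using q r fg by (metis poly_mult)
  ultimately show False using poly_all_0_iff_0 by (metis mult_eq_0_iff)
qed

definition upd :: "complex ^ 'n \<Rightarrow> 'n \<Rightarrow> complex \<Rightarrow> complex ^ 'n" where
  "upd p i w = (\<chi> k. if k = i then w else p $ k)"

lemma upd_same [simp]: "upd p i (p $ i) = p"
  by (simp add: upd_def vec_eq_iff)

lemma polyfun_partial:
  assumes "polyfun f"
  shows "\<exists>g. polyfun g \<and> (\<forall>p. ((\<lambda>w. f (upd p i w)) has_field_derivative g p) (at (p $ i)))"
  using assms
proof induction
  case (const c)
  show ?case by (rule exI[of _ "\<lambda>_. 0"]) (auto intro: polyfun.intros)
next
  case (var k)
  show ?case
    by (rule exI[of _ "\<lambda>_. if k = i then 1 else 0"])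
      (auto intro: polyfun.intros simp: upd_def)
next
  case (add f g)
  then obtain f' g' where "polyfun f'" "polyfun g'"
    "\<And>p. ((\<lambda>w. f (upd p i w)) has_field_derivative f' p) (at (p $ i))"
    "\<And>p. ((\<lambda>w. g (upd p i w)) has_field_derivative g' p) (at (p $ i))" by blast
  then show ?case
    by (intro exI[of _ "\<lambda>p. f' p + g' p"]) (auto intro: polyfun.intros derivative_intros)
next
  case (mult f g)
  then obtain f' g' where *: "polyfun f'" "polyfun g'"
    "\<And>p. ((\<lambda>w. f (upd p i w)) has_field_derivative f' p) (at (p $ i))"
    "\<And>p. ((\<lambda>w. g (upd p i w)) has_field_derivative g' p) (at (p $ i))" by blast
  have "((\<lambda>w. f (upd p i w) * g (upd p i w)) has_field_derivative f' p * g p + g' p * f p) (at (p $ i))" for p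
    using DERIV_mult[OF *(3)[of p] *(4)[of p]] by simp
  then show ?case using * mult
    by (intro exI[of _ "\<lambda>p. f' p * g p + g' p * f p"]) (auto intro: polyfun.intros)
qed

text \<open>Polynomials are represented by the functions they define on \<open>complex ^ 'n\<close>.
  Over an infinite field this loses nothing; equality becomes pointwise, and partial derivations can
  be obtained from complex differentiation.\<close>

typedef (overloaded) ('n::finite) pol = "{f :: complex ^ 'n \<Rightarrow> complex. polyfun f}"
  morphisms ev Abs_pol
  by (auto intro: polyfun.const)

setup_lifting type_definition_pol

instantiation pol :: (finite) comm_ring_1
begin
lift_definition zero_pol :: "'a pol" is "\<lambda>_. 0" by (rule polyfun.const)
lift_definition one_pol :: "'a pol" is "\<lambda>_. 1" by (rule polyfun.const)
lift_definition plus_pol :: "'a pol \<Rightarrow> 'a pol \<Rightarrow> 'a pol" is "\<lambda>f g p. f p + g p" by (rule polyfun.add)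
lift_definition times_pol :: "'a pol \<Rightarrow> 'a pol \<Rightarrow> 'a pol" is "\<lambda>f g p. f p * g p" by (rule polyfun.mult)
lift_definition uminus_pol :: "'a pol \<Rightarrow> 'a pol" is "\<lambda>f p. - f p"
proof -
  fix f :: "complex ^ 'a \<Rightarrow> complex" assume "polyfun f"
  from polyfun.mult[OF polyfun.const[of "-1"] this] show "polyfun (\<lambda>p. - f p)" by simp
qed
lift_definition minus_pol :: "'a pol \<Rightarrow> 'a pol \<Rightarrow> 'a pol" is "\<lambda>f g p. f p - g p"
proof -
  fix f g :: "complex ^ 'a \<Rightarrow> complex" assume "polyfun f" "polyfun g"
  from polyfun.add[OF this(1) polyfun.mult[OF polyfun.const[of "-1"] this(2)]]
  show "polyfun (\<lambda>p. f p - g p)" by simp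
qed
instance by standard (transfer; simp add: algebra_simps fun_eq_iff)+
end

instance pol :: (finite) idom
proof
  fix a b :: "'a pol" assume "a \<noteq> 0" "b \<noteq> 0"
  then show "a * b \<noteq> 0"
    by transfer (metis polyfun_no_zero_divisors)
qed

lemma pol_eqI: "(\<And>p. ev a p = ev b p) \<Longrightarrow> a = b"
  by (metis ev_inject ext)

lemma ev_0 [simp]: "ev 0 p = 0" by transfer simp
lemma ev_1 [simp]: "ev 1 p = 1" by transfer simp
lemma ev_add [simp]: "ev (a + b) p = ev a p + ev b p" by transfer simp
lemma ev_diff [simp]: "ev (a - b) p = ev a p - ev b p" by transfer simp
lemma ev_minus [simp]: "ev (- a) p = - ev a p" by transfer simp
lemma ev_mult [simp]: "ev (a * b) p = ev a p * ev b p" by transfer simp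
lemma ev_sum [simp]: "ev (sum f A) p = (\<Sum>x\<in>A. ev (f x) p)"
  by (induction A rule: infinite_finite_induct) auto
lemma ev_of_nat [simp]: "ev (of_nat n) p = of_nat n" by (induction n) auto

instance pol :: (finite) ring_char_0
proof
  show "inj (of_nat :: nat \<Rightarrow> 'a pol)"
    by (rule injI) (metis ev_of_nat of_nat_eq_iff)
qed

lift_definition cst :: "complex \<Rightarrow> ('n::finite) pol" is "\<lambda>c _. c" by (rule polyfun.const)
lift_definition pvar :: "'n \<Rightarrow> ('n::finite) pol" is "\<lambda>i (p :: complex ^ 'n). p $ i" by (rule polyfun.var)

lemma ev_cst [simp]: "ev (cst c) p = c" by transfer simp
lemma ev_pvar [simp]: "ev (pvar i) p = p $ i" by transfer simp

lemma cst_hom: "cst 0 = 0" "cst 1 = 1" "cst (a + b) = cst a + cst b" "cst (a * b) = cst a * cst b"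
  "cst (a - b) = cst a - cst b" "cst (- a) = - cst a" "cst (of_nat n) = of_nat n"
  by (auto intro!: pol_eqI)

lemma cst_eq_0_iff [simp]: "cst c = (0 :: ('n::finite) pol) \<longleftrightarrow> c = 0"
  by (metis ev_cst ev_0 cst_hom(1))

lemma pol_induct [case_names cst pvar add mult]:
  assumes "\<And>c. P (cst c)" "\<And>i. P (pvar i)"
    "\<And>a b. P a \<Longrightarrow> P b \<Longrightarrow> P (a + b)" "\<And>a b. P a \<Longrightarrow> P b \<Longrightarrow> P (a * b)"
  shows "P a"
proof -
  have "polyfun f \<Longrightarrow> \<forall>a. ev a = f \<longrightarrow> P a" for f
  proof (induction rule: polyfun.induct)
    case (const c)
    then show ?case using assms(1)[of c] by (metis ev_cst ev_inject ext)
  next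
    case (var i)
    then show ?case using assms(2)[of i] by (metis ev_pvar ev_inject ext)
  next
    case (add f g)
    show ?case
    proof safe
      fix a assume a: "ev a = (\<lambda>p. f p + g p)"
      have "a = Abs_pol f + Abs_pol g"
        by (rule pol_eqI) (simp add: a Abs_pol_inverse add.hyps)
      then show "P a" using assms(3) add.IH add.hyps by (simp add: Abs_pol_inverse)
    qed
  next
    case (mult f g)
    show ?case
    proof safe
      fix a assume a: "ev a = (\<lambda>p. f p * g p)"
      have "a = Abs_pol f * Abs_pol g"
        by (rule pol_eqI) (simp add: a Abs_pol_inverse mult.hyps)
      then show "P a" using assms(4) mult.IH mult.hyps by (simp add: Abs_pol_inverse)
    qed
  qed
  then show ?thesis using ev by blast
qed

definition dpol :: "'n \<Rightarrow> ('n::finite) pol \<Rightarrow> 'n pol" where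
  "dpol i a = (THE b. \<forall>p. ((\<lambda>w. ev a (upd p i w)) has_field_derivative ev b p) (at (p $ i)))"

lemma dpol: "((\<lambda>w. ev a (upd p i w)) has_field_derivative ev (dpol i a) p) (at (p $ i))"
proof -
  obtain g where g: "polyfun g" "\<And>p. ((\<lambda>w. ev a (upd p i w)) has_field_derivative g p) (at (p $ i))"
    using polyfun_partial[of "ev a" i] ev[of a] by auto
  have "dpol i a = Abs_pol g"
    unfolding dpol_def
    using g by (intro the_equality) (auto simp: Abs_pol_inverse intro!: pol_eqI DERIV_unique)
  then show ?thesis using g by (simp add: Abs_pol_inverse)
qed

lemma dpol_eqI:
  "(\<And>p. ((\<lambda>w. ev a (upd p i w)) has_field_derivative ev b p) (at (p $ i))) \<Longrightarrow> dpol i a = b"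
  using dpol[of a _ i] by (intro pol_eqI) (rule DERIV_unique, auto)

lemma dpol_add [simp]: "dpol i (a + b) = dpol i a + dpol i b"
  by (rule dpol_eqI) (auto intro!: derivative_eq_intros dpol)

lemma dpol_cst [simp]: "dpol i (cst c) = 0"
  by (rule dpol_eqI) (auto intro!: derivative_eq_intros)

lemma dpol_pvar: "dpol i (pvar k) = (if k = i then 1 else 0)"
  by (rule dpol_eqI) (auto simp: upd_def intro!: derivative_eq_intros)

lemma dpol_mult: "dpol i (a * b) = dpol i a * b + a * dpol i b"
proof (rule dpol_eqI)
  fix p
  show "((\<lambda>w. ev (a * b) (upd p i w)) has_field_derivative ev (dpol i a * b + a * dpol i b) p) (at (p $ i))"
    using DERIV_mult[OF dpol[of a p i] dpol[of b p i]] by (simp add: algebra_simps)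
qed

lemma dpol_0 [simp]: "dpol i 0 = 0" using dpol_cst[of i 0] by (simp add: cst_hom)
lemma dpol_1 [simp]: "dpol i 1 = 0" using dpol_cst[of i 1] by (simp add: cst_hom)

lemma dpol_sum [simp]: "dpol i (sum f A) = (\<Sum>x\<in>A. dpol i (f x))"
  by (induction A rule: infinite_finite_induct) auto

lemma dpol_cst_mult [simp]: "dpol i (cst c * a) = cst c * dpol i a"
  by (simp add: dpol_mult)

lemma dpol_commute: "dpol i (dpol k a) = dpol k (dpol i a)"
  by (induction a rule: pol_induct) (auto simp: dpol_pvar dpol_mult)

text \<open>The power series variable is the blow-up parameter \<mu>. It counts as a constant here,
  so the derivation acts on coefficients.\<close>

definition dR :: "'n \<Rightarrow> ('n::finite) pol fps \<Rightarrow> 'n pol fps" where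
  "dR i A = Abs_fps (\<lambda>n. dpol i (A $ n))"

lemma dR_nth [simp]: "dR i A $ n = dpol i (A $ n)"
  by (simp add: dR_def)

lemma dR_add: "dR i (A + B) = dR i A + dR i B"
  by (simp add: fps_eq_iff)

lemma dR_mult: "dR i (A * B) = dR i A * B + A * dR i B"
  by (simp add: fps_eq_iff fps_mult_nth dpol_mult sum.distrib)

lemma dR_commute: "dR i (dR k A) = dR k (dR i A)"
  by (simp add: fps_eq_iff dpol_commute)

lemma dR_X_power [simp]: "dR i (fps_X ^ k) = 0"
  by (simp add: fps_eq_iff fps_X_power_nth)

section \<open>Holomorphic functions of several variables\<close>

definition cscale :: "complex \<Rightarrow> (complex ^ 'n) \<times> complex \<Rightarrow> (complex ^ 'n) \<times> complex" where
  "cscale c v = (c *s fst v, c * snd v)"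

lemma norm_cscale: "norm (cscale c v) = cmod c * norm v"
proof -
  have "norm (c *s fst v) = cmod c * norm (fst v)"
    by (simp add: norm_vec_def L2_set_right_distrib norm_mult)
  then show ?thesis
    by (simp add: cscale_def norm_prod_def norm_mult power_mult_distrib real_sqrt_mult flip: distrib_left)
qed

lemma cscale_simps [simp]: "cscale 0 v = 0" "cscale 1 v = v" "cscale c 0 = 0"
  by (auto simp: cscale_def zero_prod_def)

lemma cscale_add: "cscale (a + b) v = cscale a v + cscale b v"
  "cscale c (v + w) = cscale c v + cscale c w"
  "cscale a (cscale b v) = cscale (a * b) v"
  "cscale (a - b) v = cscale a v - cscale b v"
  by (auto simp: cscale_def prod_eq_iff vec_eq_iff algebra_simps)

lemma cscale_of_real: "cscale (of_real r) v = r *\<^sub>R v"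
  unfolding cscale_def prod_eq_iff vec_eq_iff
  by (simp add: scaleR_conv_of_real[where 'a = complex])

lemma bounded_linear_cscale: "bounded_linear (\<lambda>c. cscale c v)"
proof (rule bounded_linear_intro[of _ "norm v"])
  show "cscale (r *\<^sub>R x) v = r *\<^sub>R cscale x v" for r x
    by (simp add: cscale_of_real[symmetric] cscale_add scaleR_conv_of_real[where 'a = complex])
qed (auto simp: cscale_add norm_cscale)

lemma continuous_on_cscale [continuous_intros]:
  "continuous_on A f \<Longrightarrow> continuous_on A (\<lambda>x. cscale (f x) v)"
  by (rule bounded_linear.continuous_on[OF bounded_linear_cscale])

text \<open>A one-variable complex derivative along the complex line through \<open>z\<close>. The
  direction \<open>bas m\<close> gives the state derivatives of the problem, \<open>(0, 1)\<close>
  the derivative in \<epsilon>.\<close>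

definition dir :: "((complex ^ 'n) \<times> complex \<Rightarrow> complex) \<Rightarrow> (complex ^ 'n) \<times> complex \<Rightarrow>
    (complex ^ 'n) \<times> complex \<Rightarrow> complex" where
  "dir F v z = deriv (\<lambda>t. F (z + cscale t v)) 0"

lemma scv_derivative:
  assumes "scv_holomorphic_on F S" "z \<in> S"
  shows "(F has_derivative (\<lambda>v. dir F v z)) (at z)"
    and "dir F (cscale c v) z = c * dir F v z"
    and "dir F (v + w) z = dir F v z + dir F w z"
proof -
  obtain D where D: "(F has_derivative D) (at z)" "\<And>c v e. D (c *s v, c * e) = c * D (v, e)"
    using assms unfolding scv_holomorphic_on_def by blast
  have lin: "D (cscale c v) = c * D v" for c v
    using D(2)[of c "fst v" "snd v"] by (simp add: cscale_def)
  have eq: "dir F v z = D v" for v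
  proof -
    have "((\<lambda>t. F (z + cscale t v)) has_derivative (\<lambda>t. D (cscale t v))) (at 0)"
      by (rule has_derivative_compose[of "\<lambda>t. z + cscale t v" "\<lambda>t. cscale t v" 0 _ F D])
        (use D(1) in \<open>auto intro!: derivative_eq_intros bounded_linear_imp_has_derivative bounded_linear_cscale\<close>)
    then have "((\<lambda>t. F (z + cscale t v)) has_field_derivative D v) (at 0)"
      by (simp add: has_field_derivative_def lin mult.commute[of _ "D v"])
    then show ?thesis by (simp add: dir_def DERIV_imp_deriv)
  qed
  have "(\<lambda>v. dir F v z) = D" using eq by auto
  with D(1) show "(F has_derivative (\<lambda>v. dir F v z)) (at z)" by simp
  show "dir F (cscale c v) z = c * dir F v z" by (simp add: eq lin)
  show "dir F (v + w) z = dir F v z + dir F w z"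
    using D(1) by (simp add: eq has_derivative_def bounded_linear.linear linear_add)
qed

lemma scv_chain:
  assumes "scv_holomorphic_on F S" "\<gamma> t \<in> S"
    and "(\<gamma> has_derivative (\<lambda>h. cscale h u)) (at t)"
  shows "((\<lambda>t. F (\<gamma> t)) has_field_derivative dir F u (\<gamma> t)) (at t)"
proof -
  have "((\<lambda>t. F (\<gamma> t)) has_derivative (\<lambda>h. dir F (cscale h u) (\<gamma> t))) (at t)"
    by (rule has_derivative_compose[OF assms(3) scv_derivative(1)[OF assms(1,2)]])
  then show ?thesis
    by (simp add: has_field_derivative_def scv_derivative(2)[OF assms(1,2)] mult.commute[of _ "dir F u (\<gamma> t)"])
qed

lemma scv_line:
  assumes "scv_holomorphic_on F S" "z + cscale t v \<in> S"
  shows "((\<lambda>t. F (z + cscale t v)) has_field_derivative dir F v (z + cscale t v)) (at t)"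
  by (rule scv_chain[of F S "\<lambda>t. z + cscale t v", OF assms])
    (auto intro!: derivative_eq_intros bounded_linear_imp_has_derivative bounded_linear_cscale)

lemma scv_subset: "scv_holomorphic_on F S \<Longrightarrow> T \<subseteq> S \<Longrightarrow> scv_holomorphic_on F T"
  unfolding scv_holomorphic_on_def by blast

lemma scv_continuous_on: "scv_holomorphic_on F S \<Longrightarrow> continuous_on S F"
  using scv_derivative(1) has_derivative_continuous continuous_at_imp_continuous_on by metis

text \<open>Cauchy's inequality bounds the second derivative on the unit disc through circles of
  radius \<open>R / 4\<close>, which stay inside \<open>ball 0 R\<close> because
  \<open>R \<ge> 2\<close>; the constant is \<open>32 = 2 * 4\<^sup>2\<close>. The bound depends on
  the function only through \<open>M\<close> and decays like \<open>R\<^sup>-\<^sup>2\<close>, which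
  makes remainders of difference quotients uniform in the base point.\<close>

lemma complex_remainder_bound:
  assumes "\<phi> holomorphic_on ball 0 R" "R \<ge> 2" "\<And>t. t \<in> ball 0 R \<Longrightarrow> cmod (\<phi> t) \<le> M"
  shows "cmod (\<phi> 1 - \<phi> 0 - deriv \<phi> 0) \<le> 32 * M / R\<^sup>2"
proof -
  define r where "r = R / 4"
  have r: "r > 0" using assms by (simp add: r_def)
  have sub: "cball x r \<subseteq> ball 0 R" if "cmod x \<le> 1" for x
  proof
    fix y assume "y \<in> cball x r"
    then have "cmod (y - x) \<le> r" by (simp add: dist_norm norm_minus_commute)
    then show "y \<in> ball 0 R"
      using norm_triangle_sub[of y x] that assms by (simp add: r_def)
  qed
  have B: "cmod ((deriv ^^ 2) \<phi> x) \<le> 32 * M / R\<^sup>2" if "cmod x \<le> 1" for x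
  proof -
    have "cmod ((deriv ^^ 2) \<phi> x) \<le> fact 2 * M / r ^ 2"
    proof (rule Cauchy_inequality)
      show "\<phi> holomorphic_on ball x r"
        using sub[OF that] assms(1) ball_subset_cball holomorphic_on_subset by blast
      show "continuous_on (cball x r) \<phi>"
        using sub[OF that] assms(1) holomorphic_on_imp_continuous_on holomorphic_on_subset by blast
      show "cmod (\<phi> y) \<le> M" if "cmod (x - y) = r" for y
        using assms(3)[of y] sub[OF \<open>cmod x \<le> 1\<close>] that by (auto simp: dist_norm)
    qed (use r in auto)
    then show ?thesis by (simp add: r_def power_divide)
  qed
  have der: "((deriv ^^ i) \<phi> has_field_derivative (deriv ^^ Suc i) \<phi> x) (at x within cball 0 1)"
    if "x \<in> cball 0 1" for i x
  proof -
    have "x \<in> ball 0 R" using that assms(2) by auto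
    then have "((deriv ^^ i) \<phi> has_field_derivative (deriv ^^ Suc i) \<phi> x) (at x)"
      using holomorphic_derivI[OF holomorphic_higher_deriv[OF assms(1) open_ball] open_ball] by auto
    then show ?thesis by (rule has_field_derivative_at_within)
  qed
  have "cmod ((deriv ^^ 0) \<phi> 1 - (\<Sum>i\<le>1. (deriv ^^ i) \<phi> 0 * (1 - 0) ^ i / fact i))
      \<le> (32 * M / R\<^sup>2) * cmod (1 - 0) ^ (Suc 1) / fact 1"
    by (rule complex_Taylor[of "cball 0 1"]) (use der B in \<open>auto simp: numeral_2_eq_2\<close>)
  then show ?thesis by (simp add: algebra_simps)
qed

text \<open>Cauchy's estimate for the first derivative on the disc of radius
  \<open>r / (2 * norm v)\<close> in the line through \<open>z\<close>; this disc moves the argument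
  by at most \<open>r / 2\<close>.\<close>

lemma dir_bound:
  assumes F: "scv_holomorphic_on F (ball z0 (2 * r))" "\<And>x. x \<in> ball z0 (2 * r) \<Longrightarrow> cmod (F x) \<le> M"
    and r: "r > 0" and z: "z \<in> ball z0 r"
  shows "cmod (dir F v z) \<le> 2 * M * norm v / r"
proof (cases "v = 0")
  case True
  have "M \<ge> 0" using F(2)[of z0] r by (metis centre_in_ball mult_pos_pos norm_ge_zero order_trans zero_less_numeral)
  then show ?thesis using True r scv_derivative(2)[OF F(1), of z 0 0] z by (auto simp: dist_norm)
next
  case False
  define \<rho> where "\<rho> = r / (2 * norm v)"
  have \<rho>: "\<rho> > 0" using r False by (simp add: \<rho>_def)
  have sub: "z + cscale t v \<in> ball z0 (2 * r)" if "cmod t \<le> \<rho>" for t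
  proof -
    have "norm (cscale t v) \<le> r / 2"
      using that False by (simp add: norm_cscale \<rho>_def field_simps)
    moreover have "dist z0 (z + cscale t v) \<le> dist z0 z + norm (cscale t v)"
      using norm_triangle_ineq[of "z - z0" "cscale t v"]
      by (simp add: dist_norm norm_minus_commute algebra_simps)
    ultimately show ?thesis using z r by auto
  qed
  have hol: "(\<lambda>t. F (z + cscale t v)) holomorphic_on cball 0 \<rho>"
    unfolding holomorphic_on_def field_differentiable_def
    using scv_line[OF F(1)] sub has_field_derivative_at_within by (metis dist_0_norm mem_cball)
  have "cmod ((deriv ^^ 1) (\<lambda>t. F (z + cscale t v)) 0) \<le> fact 1 * M / \<rho> ^ 1"
    by (rule Cauchy_inequality)
      (use \<rho> hol sub F(2) in \<open>auto intro: holomorphic_on_subset holomorphic_on_imp_continuous_on\<close>)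
  then show ?thesis using False r by (simp add: dir_def \<rho>_def field_simps)
qed

lemma scv_locally_bounded:
  assumes F: "scv_holomorphic_on F S" "open S" "z0 \<in> S"
  obtains r M where "r > 0" "ball z0 r \<subseteq> S" "\<And>x. x \<in> ball z0 r \<Longrightarrow> cmod (F x) \<le> M"
proof -
  obtain r where r: "r > 0" "cball z0 r \<subseteq> S" using assms open_contains_cball by blast
  have "compact (F ` cball z0 r)"
    by (rule compact_continuous_image)
      (use r scv_continuous_on[OF F(1)] continuous_on_subset in \<open>auto simp: compact_cball\<close>)
  then obtain M where "\<And>x. x \<in> cball z0 r \<Longrightarrow> cmod (F x) \<le> M"
    using compact_imp_bounded bounded_iff by (metis image_eqI)
  then show ?thesis using r that[of r M] ball_subset_cball[of z0 r] by blast
qed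

text \<open>Difference quotients converge locally uniformly, so that directional derivatives are again
  holomorphic along lines, and mixed derivatives agree as limits of derivatives.\<close>

lemma dir_derivative_along_line:
  assumes F: "scv_holomorphic_on F (ball z0 (4 * r))" "\<forall>x \<in> ball z0 (4 * r). cmod (F x) \<le> M"
    and r: "r > 0"
  shows "\<exists>g'. \<forall>t. z + cscale t w \<in> ball z0 (2 * r) \<longrightarrow>
     ((\<lambda>t. dir F v (z + cscale t w)) has_field_derivative g' t) (at t) \<and>
     (\<lambda>n. of_nat (Suc n) * (dir F w (z + cscale t w + cscale (1 / of_nat (Suc n)) v) - dir F w (z + cscale t w)))
        \<longlonglongrightarrow> g' t"
proof (cases "v = 0")
  case True
  have "dir F 0 x = 0" for x by (simp add: dir_def)
  then show ?thesis using True by (intro exI[of _ "\<lambda>_. 0"]) auto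
next
  case False
  define f where "f n t = of_nat (Suc n) * (F (z + cscale t w + cscale (1 / of_nat (Suc n)) v) - F (z + cscale t w))" for n t
  define f' where "f' n t = of_nat (Suc n) * (dir F w (z + cscale t w + cscale (1 / of_nat (Suc n)) v) - dir F w (z + cscale t w))" for n t
  define U where "U = (\<lambda>t. z + cscale t w) -` ball z0 (2 * r)"
  have U: "open U"
    unfolding U_def by (intro open_vimage open_ball continuous_intros)
  \<comment> \<open>The first quotients are discarded, since their shifted argument may leave the
    ball on which \<open>F\<close> is controlled.\<close>
  obtain N where N: "norm v / r < real N" using reals_Archimedean2 by blast
  have small: "cmod (1 / of_nat (Suc n)) * norm v < r" if "n \<ge> N" for n
  proof -
    have "norm v / r < real (Suc n)" using N that by linarith
    then show ?thesis using r by (simp add: norm_divide field_simps del: of_nat_Suc)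
  qed
  have inb: "y + cscale c v \<in> ball z0 (4 * r)" if "y \<in> ball z0 (2 * r)" "cmod c * norm v < 2 * r" for y c
  proof -
    have "dist z0 (y + cscale c v) \<le> dist z0 y + norm (cscale c v)"
      using norm_triangle_ineq[of "y - z0" "cscale c v"]
      by (simp add: dist_norm norm_minus_commute algebra_simps)
    then show ?thesis using that by (simp add: norm_cscale)
  qed
  have quad: "cmod (of_nat (Suc n) * (F (y + cscale (1 / of_nat (Suc n)) v) - F y) - dir F v y) \<le> (8 * M * norm v ^ 2 / r\<^sup>2) * inverse (real (Suc n))"
    if "n \<ge> N" "y \<in> ball z0 (2 * r)" for n y
  proof -
    define h :: complex where "h = 1 / of_nat (Suc n)"
    have h0: "h \<noteq> 0" by (simp add: h_def del: of_nat_Suc)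
    \<comment> \<open>On the disc of radius \<open>R\<close> the displacement
      \<open>t * h * v\<close> is shorter than \<open>2 * r\<close>, so the argument stays in the
      ball of radius \<open>4 * r\<close>. Since \<open>R\<close> is proportional to
      \<open>1 / cmod h\<close>, the remainder is quadratic in \<open>h\<close> and the quotient
      error linear.\<close>
    define R where "R = 2 * r / (cmod h * norm v)"
    have ch: "cmod h * norm v < r" using small[OF that(1)] by (simp add: h_def)
    have pos: "cmod h * norm v > 0" using False h0 by simp
    have R: "R \<ge> 2" using ch pos by (simp add: R_def field_simps)
    have mem: "y + cscale (t * h) v \<in> ball z0 (4 * r)" if "t \<in> ball 0 R" for t
      by (rule inb) (use that pos \<open>y \<in> ball z0 (2 * r)\<close> in \<open>auto simp: R_def norm_mult pos_less_divide_eq mult.assoc\<close>)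
    define \<phi> where "\<phi> t = F (y + cscale t (cscale h v))" for t
    have d: "(\<phi> has_field_derivative dir F (cscale h v) (y + cscale t (cscale h v))) (at t)" if "t \<in> ball 0 R" for t
      unfolding \<phi>_def by (rule scv_line[OF F(1)]) (use mem[OF that] in \<open>simp add: cscale_add\<close>)
    have "cmod (\<phi> 1 - \<phi> 0 - deriv \<phi> 0) \<le> 32 * M / R\<^sup>2"
    proof (rule complex_remainder_bound[OF _ R])
      show "\<phi> holomorphic_on ball 0 R"
        using d holomorphic_on_open by blast
      show "cmod (\<phi> t) \<le> M" if "t \<in> ball 0 R" for t
        using bspec[OF F(2) mem[OF that]] by (simp add: \<phi>_def cscale_add)
    qed
    moreover have "deriv \<phi> 0 = h * dir F v y"
      using DERIV_imp_deriv[OF d[of 0]] R inb[OF that(2), of 0] r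
      by (simp add: scv_derivative(2)[OF F(1)])
    ultimately have "cmod (F (y + cscale h v) - F y - h * dir F v y) \<le> 8 * M * (cmod h * norm v)\<^sup>2 / r\<^sup>2"
      by (simp add: \<phi>_def R_def power_divide power_mult_distrib)
    then have "cmod (inverse h) * cmod (F (y + cscale h v) - F y - h * dir F v y)
       \<le> cmod (inverse h) * (8 * M * (cmod h * norm v)\<^sup>2 / r\<^sup>2)"
      by (intro mult_left_mono) auto
    also have "\<dots> = (8 * M * norm v ^ 2 / r\<^sup>2) * cmod h"
      using h0 by (simp add: norm_inverse norm_divide power2_eq_square field_simps)
    also have "cmod (inverse h) * cmod (F (y + cscale h v) - F y - h * dir F v y)
      = cmod (inverse h * (F (y + cscale h v) - F y) - dir F v y)"
    proof -
      have "inverse h * (F (y + cscale h v) - F y) - dir F v y = inverse h * (F (y + cscale h v) - F y - h * dir F v y)"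
        using h0 by (simp add: field_simps)
      then show ?thesis by (simp add: norm_mult)
    qed
    finally show ?thesis by (simp add: h_def norm_divide inverse_eq_divide del: of_nat_Suc)
  qed
  have "\<exists>g'. \<forall>x\<in>U. ((\<lambda>t. dir F v (z + cscale t w)) has_field_derivative g' x) (at x) \<and> ((\<lambda>n. f' (n + N) x) \<longlonglongrightarrow> g' x)"
  proof (rule has_complex_derivative_uniform_sequence[OF U, of "\<lambda>n. f (n + N)"])
    fix n x assume x: "x \<in> U"
    have *: "((\<lambda>t. F (z + cscale t w)) has_field_derivative dir F w (z + cscale x w)) (at x)"
      by (rule scv_line[OF F(1)]) (use x r in \<open>auto simp: U_def\<close>)
    have "z + cscale x w + cscale (1 / of_nat (Suc (n + N))) v \<in> ball z0 (4 * r)"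
      by (rule inb) (use x small[of "n + N"] r in \<open>auto simp: U_def\<close>)
    then have **: "((\<lambda>t. F ((z + cscale (1 / of_nat (Suc (n + N))) v) + cscale t w)) has_field_derivative
         dir F w ((z + cscale (1 / of_nat (Suc (n + N))) v) + cscale x w)) (at x)"
      by (intro scv_line[OF F(1)]) (auto simp: algebra_simps)
    have "((\<lambda>t. of_nat (Suc (n + N)) * (F ((z + cscale (1 / of_nat (Suc (n + N))) v) + cscale t w) - F (z + cscale t w)))
        has_field_derivative of_nat (Suc (n + N)) * (dir F w ((z + cscale (1 / of_nat (Suc (n + N))) v) + cscale x w) - dir F w (z + cscale x w))) (at x)"
      by (intro DERIV_cmult DERIV_diff * **)
    then show "(f (n + N) has_field_derivative f' (n + N) x) (at x)"
      unfolding f_def f'_def by (simp add: algebra_simps)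
  next
    fix x assume x: "x \<in> U"
    then obtain d where d: "d > 0" "cball x d \<subseteq> U" using U open_contains_cball by blast
    have "uniform_limit (cball x d) (\<lambda>n. f (n + N)) (\<lambda>t. dir F v (z + cscale t w)) sequentially"
    proof (rule uniform_limitI)
      fix e :: real assume e: "e > 0"
      define C where "C = 8 * M * norm v ^ 2 / r\<^sup>2"
      have "(\<lambda>n. C * inverse (real (Suc (n + N)))) \<longlonglongrightarrow> C * 0"
        using LIMSEQ_ignore_initial_segment[OF LIMSEQ_inverse_real_of_nat, of N]
        by (intro tendsto_intros) simp
      then have "\<forall>\<^sub>F n in sequentially. C * inverse (real (Suc (n + N))) < e"
        using e order_tendstoD(2) by fastforce
      then show "\<forall>\<^sub>F n in sequentially. \<forall>t\<in>cball x d. dist (f (n + N) t) (dir F v (z + cscale t w)) < e"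
      proof eventually_elim
        case (elim n)
        show ?case
        proof
          fix t assume "t \<in> cball x d"
          then have "z + cscale t w \<in> ball z0 (2 * r)" using d by (auto simp: U_def)
          from quad[of "n + N", OF _ this] elim show "dist (f (n + N) t) (dir F v (z + cscale t w)) < e"
            unfolding C_def by (auto simp: dist_norm f_def)
        qed
      qed
    qed
    then show "\<exists>d>0. cball x d \<subseteq> U \<and> uniform_limit (cball x d) (\<lambda>n. f (n + N)) (\<lambda>t. dir F v (z + cscale t w)) sequentially"
      using d by blast
  qed
  then obtain g' where g': "\<And>x. x \<in> U \<Longrightarrow> ((\<lambda>t. dir F v (z + cscale t w)) has_field_derivative g' x) (at x)"
    "\<And>x. x \<in> U \<Longrightarrow> (\<lambda>n. f' (n + N) x) \<longlonglongrightarrow> g' x" by blast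
  have "(\<lambda>n. f' n x) \<longlonglongrightarrow> g' x" if "x \<in> U" for x
    using LIMSEQ_offset[OF g'(2)[OF that]] .
  then show ?thesis using g'(1) unfolding f'_def U_def by (intro exI[of _ g']) auto
qed

text \<open>Holomorphy only provides a first derivative, so its stability under differentiation has
  to be earned. Along each line it follows from uniform convergence of difference quotients; the
  same quotients exhibit the mixed derivatives as one common limit. Remainder bounds that are
  uniform in the direction then assemble the line derivatives into a total derivative.\<close>

theorem dir_holomorphic:
  assumes F: "scv_holomorphic_on F S" "open S"
  shows "scv_holomorphic_on (dir F v) S"
    and "z \<in> S \<Longrightarrow> dir (dir F v) w z = dir (dir F w) v z"
proof -
  have main: "\<exists>r>0. \<exists>M. scv_holomorphic_on F (ball z0 (4 * r)) \<and> (\<forall>x \<in> ball z0 (4 * r). cmod (F x) \<le> M)"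
    if z0: "z0 \<in> S" for z0
  proof -
    obtain r M where "r > 0" "ball z0 r \<subseteq> S" "\<And>x. x \<in> ball z0 r \<Longrightarrow> cmod (F x) \<le> M"
      using scv_locally_bounded[OF F z0] by blast
    moreover have "scv_holomorphic_on F (ball z0 (4 * (r / 4)))"
      using scv_subset[OF F(1) calculation(2)] by simp
    ultimately show ?thesis by (intro exI[of _ "r / 4"] conjI exI[of _ M]) auto
  qed
  have sym: "dir (dir F v) w z = dir (dir F w) v z \<and>
     (\<lambda>n. of_nat (Suc n) * (dir F w (z + cscale (1 / of_nat (Suc n)) v) - dir F w z)) \<longlonglongrightarrow> dir (dir F v) w z"
    if z: "z \<in> S" for v w z
  proof -
    obtain r M where r: "r > 0" "scv_holomorphic_on F (ball z (4 * r))" "\<forall>x \<in> ball z (4 * r). cmod (F x) \<le> M"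
      using main[OF z] by blast
    obtain g where g: "((\<lambda>t. dir F v (z + cscale t w)) has_field_derivative g) (at 0)"
       "(\<lambda>n. of_nat (Suc n) * (dir F w (z + cscale (1 / of_nat (Suc n)) v) - dir F w z)) \<longlonglongrightarrow> g"
    proof -
      obtain g' where "\<And>t. z + cscale t w \<in> ball z (2 * r) \<Longrightarrow>
        ((\<lambda>t. dir F v (z + cscale t w)) has_field_derivative g' t) (at t) \<and>
        (\<lambda>n. of_nat (Suc n) * (dir F w (z + cscale t w + cscale (1 / of_nat (Suc n)) v) - dir F w (z + cscale t w))) \<longlonglongrightarrow> g' t"
        using dir_derivative_along_line[OF r(2,3,1), of z w v] by blast
      from this[of 0] show ?thesis using r(1) that[of "g' 0"] by simp
    qed
    obtain g' where g': "((\<lambda>t. dir F w (z + cscale t v)) has_field_derivative g') (at 0)"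
    proof -
      obtain g' where "\<And>t. z + cscale t v \<in> ball z (2 * r) \<Longrightarrow>
        ((\<lambda>t. dir F w (z + cscale t v)) has_field_derivative g' t) (at t)"
        using dir_derivative_along_line[OF r(2,3,1), of z v w] by blast
      from this[of 0] show ?thesis using r(1) that[of "g' 0"] by simp
    qed
    have e1: "dir (dir F v) w z = g" "dir (dir F w) v z = g'"
      using g(1) g' by (auto simp: dir_def[of "dir F v"] dir_def[of "dir F w"] DERIV_imp_deriv)
    \<comment> \<open>The sequence that converges to the derivative of \<open>dir F v\<close> along
      \<open>w\<close> consists of difference quotients of \<open>dir F w\<close> along
      \<open>v\<close>. As the latter derivative exists, it must be the same limit.\<close>
    have "((\<lambda>h. (dir F w (z + cscale h v) - dir F w z) / h) \<longlongrightarrow> g') (at 0)"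
      using g' by (simp add: DERIV_def)
    moreover have "filterlim (\<lambda>n. 1 / of_nat (Suc n) :: complex) (at 0) sequentially"
      unfolding filterlim_at using lim_inverse_n[where 'a = complex]
      using LIMSEQ_Suc[OF lim_inverse_n[where 'a = complex]]
      by (auto simp: inverse_eq_divide simp del: of_nat_Suc)
    ultimately have "(\<lambda>n. (dir F w (z + cscale (1 / of_nat (Suc n)) v) - dir F w z) / (1 / of_nat (Suc n))) \<longlonglongrightarrow> g'"
      by (rule filterlim_compose)
    then have "(\<lambda>n. of_nat (Suc n) * (dir F w (z + cscale (1 / of_nat (Suc n)) v) - dir F w z)) \<longlonglongrightarrow> g'"
      by (simp add: mult.commute del: of_nat_Suc)
    with g(2) have "g = g'" using LIMSEQ_unique by blast
    with e1 g(2) show ?thesis by simp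
  qed
  then show "z \<in> S \<Longrightarrow> dir (dir F v) w z = dir (dir F w) v z" by blast
  show "scv_holomorphic_on (dir F v) S"
    unfolding scv_holomorphic_on_def
  proof
    fix z assume z: "z \<in> S"
    \<comment> \<open>The candidate for the total derivative. Its linearity is not clear from the
      definition, but by \<open>sym\<close> it is a limit of differences of \<open>dir F w\<close>,
      which are linear in \<open>w\<close>.\<close>
    define B where "B w = dir (dir F v) w z" for w
    obtain r M where r: "r > 0" "scv_holomorphic_on F (ball z (4 * r))"
      "\<forall>x \<in> ball z (4 * r). cmod (F x) \<le> M"
      using main[OF z] by blast
    have lim: "(\<lambda>n. of_nat (Suc n) * (dir F w (z + cscale (1 / of_nat (Suc n)) v) - dir F w z)) \<longlonglongrightarrow> B w" for w
      using sym[OF z] by (simp add: B_def)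
    have ev: "\<forall>\<^sub>F n in sequentially. z + cscale (1 / of_nat (Suc n)) v \<in> S"
    proof -
      have "(\<lambda>n. cscale (inverse (of_nat (Suc n))) v) \<longlonglongrightarrow> cscale 0 v"
        using bounded_linear.tendsto[OF bounded_linear_cscale LIMSEQ_Suc[OF lim_inverse_n]] .
      then have "(\<lambda>n. z + cscale (1 / of_nat (Suc n)) v) \<longlonglongrightarrow> z + cscale 0 v"
        by (intro tendsto_intros) (simp add: inverse_eq_divide)
      then show ?thesis using F(2) z topological_tendstoD by fastforce
    qed
    have B_cs: "B (cscale c w) = c * B w" for c w
    proof (rule LIMSEQ_unique[OF lim])
      have "(\<lambda>n. c * (of_nat (Suc n) * (dir F w (z + cscale (1 / of_nat (Suc n)) v) - dir F w z))) \<longlonglongrightarrow> c * B w"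
        by (intro tendsto_intros lim)
      then show "(\<lambda>n. of_nat (Suc n) * (dir F (cscale c w) (z + cscale (1 / of_nat (Suc n)) v) - dir F (cscale c w) z)) \<longlonglongrightarrow> c * B w"
        by (rule Lim_transform_eventually)
          (use ev in eventually_elim, simp add: scv_derivative(2)[OF F(1)] z algebra_simps)
    qed
    have B_add: "B (w + w') = B w + B w'" for w w'
    proof (rule LIMSEQ_unique[OF lim])
      have "(\<lambda>n. of_nat (Suc n) * (dir F w (z + cscale (1 / of_nat (Suc n)) v) - dir F w z) +
          of_nat (Suc n) * (dir F w' (z + cscale (1 / of_nat (Suc n)) v) - dir F w' z)) \<longlonglongrightarrow> B w + B w'"
        by (intro tendsto_add lim)
      then show "(\<lambda>n. of_nat (Suc n) * (dir F (w + w') (z + cscale (1 / of_nat (Suc n)) v) - dir F (w + w') z)) \<longlonglongrightarrow> B w + B w'"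
        by (rule Lim_transform_eventually)
          (use ev in eventually_elim, simp add: scv_derivative(3)[OF F(1)] z algebra_simps)
    qed
    have "linear B"
      using B_add B_cs by (intro linearI) (auto simp: scaleR_conv_of_real simp flip: cscale_of_real)
    then have bl: "bounded_linear B" by (rule linear_conv_bounded_linear[THEN iffD1])
    define M' where "M' = 2 * M * norm v / (2 * r)"
    have M': "cmod (dir F v x) \<le> M'" if "x \<in> ball z (2 * r)" for x
      unfolding M'_def by (rule dir_bound[OF _ _ _ that]) (use r in auto)
    have quad: "cmod (dir F v (z + w) - dir F v z - B w) \<le> (8 * M' / r\<^sup>2) * (norm w)\<^sup>2" if w: "norm w < r" for w
    proof (cases "w = 0")
      case True
      then show ?thesis using B_cs[of 0 0] by simp
    next
      case False
      define \<phi> where "\<phi> t = dir F v (z + cscale t w)" for t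
      define R where "R = 2 * r / norm w"
      have R: "R \<ge> 2" using w False by (simp add: R_def field_simps)
      have mem: "z + cscale t w \<in> ball z (2 * r)" if "t \<in> ball 0 R" for t
        using that False by (auto simp: R_def dist_norm norm_cscale pos_less_divide_eq)
      obtain g' where g': "\<And>t. z + cscale t w \<in> ball z (2 * r) \<Longrightarrow> (\<phi> has_field_derivative g' t) (at t)"
        using dir_derivative_along_line[OF r(2,3,1), of z w v] unfolding \<phi>_def by blast
      have "cmod (\<phi> 1 - \<phi> 0 - deriv \<phi> 0) \<le> 32 * M' / R\<^sup>2"
      proof (rule complex_remainder_bound[OF _ R])
        show "\<phi> holomorphic_on ball 0 R"
          using g' mem holomorphic_on_open by blast
        show "cmod (\<phi> t) \<le> M'" if "t \<in> ball 0 R" for t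
          using M'[OF mem[OF that]] by (simp add: \<phi>_def)
      qed
      moreover have "deriv \<phi> 0 = B w"
        by (simp add: B_def dir_def[of "dir F v"] \<phi>_def[abs_def])
      ultimately show ?thesis
        using False by (simp add: \<phi>_def R_def power_divide power_mult_distrib mult.assoc)
    qed
    have "(dir F v has_derivative B) (at z)"
      unfolding has_derivative_at_alt
    proof (intro conjI bl allI impI)
      fix e :: real assume e: "e > 0"
      define C where "C = 8 * M' / r\<^sup>2"
      define d where "d = min r (e / (\<bar>C\<bar> + 1))"
      show "\<exists>d>0. \<forall>y. norm (y - z) < d \<longrightarrow> norm (dir F v y - dir F v z - B (y - z)) \<le> e * norm (y - z)"
      proof (intro exI[of _ d] conjI allI impI)
        show "d > 0" using r e by (simp add: d_def)
        fix y assume y: "norm (y - z) < d"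
        have "norm (dir F v y - dir F v z - B (y - z)) \<le> C * (norm (y - z))\<^sup>2"
          using quad[of "y - z"] y by (simp add: C_def d_def)
        also have "\<dots> \<le> (\<bar>C\<bar> + 1) * (norm (y - z))\<^sup>2"
          by (intro mult_right_mono) auto
        also have "\<dots> = ((\<bar>C\<bar> + 1) * norm (y - z)) * norm (y - z)" by (simp add: power2_eq_square)
        also have "\<dots> \<le> e * norm (y - z)"
          using y by (intro mult_right_mono) (auto simp: d_def field_simps)
        finally show "norm (dir F v y - dir F v z - B (y - z)) \<le> e * norm (y - z)" .
      qed
    qed
    then show "\<exists>D. (dir F v has_derivative D) (at z) \<and> (\<forall>c v e. D (c *s v, c * e) = c * D (v, e))"
      using B_cs by (intro exI[of _ B]) (auto simp: cscale_def)
  qed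
qed

section \<open>Closure rules for holomorphic functions and calculus of directional
  derivatives\<close>

lemma scv_const [simp]: "scv_holomorphic_on (\<lambda>_. c) S"
  unfolding scv_holomorphic_on_def by (auto intro!: exI[of _ "\<lambda>_. 0"])

lemma scv_coord: "scv_holomorphic_on (\<lambda>z. fst z $ i) S"
proof -
  have "((\<lambda>z :: (complex ^ 'a) \<times> complex. fst z $ i) has_derivative (\<lambda>z. fst z $ i)) (at z)" for z
    by (intro bounded_linear_imp_has_derivative bounded_linear_compose[OF bounded_linear_vec_nth bounded_linear_fst])
  then show ?thesis
    unfolding scv_holomorphic_on_def by (intro ballI exI[of _ "\<lambda>z. fst z $ i"]) auto
qed

lemma scv_snd: "scv_holomorphic_on snd S"
proof -
  have "(snd has_derivative snd) (at (z :: (complex ^ 'a) \<times> complex))" for z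
    by (intro bounded_linear_imp_has_derivative bounded_linear_snd)
  then show ?thesis
    unfolding scv_holomorphic_on_def by (intro ballI exI[of _ snd]) auto
qed

lemma scv_add: "scv_holomorphic_on F S \<Longrightarrow> scv_holomorphic_on G S \<Longrightarrow> scv_holomorphic_on (\<lambda>z. F z + G z) S"
  unfolding scv_holomorphic_on_def
proof
  fix z assume *: "\<forall>z\<in>S. \<exists>D. (F has_derivative D) (at z) \<and> (\<forall>c v e. D (c *s v, c * e) = c * D (v, e))"
    "\<forall>z\<in>S. \<exists>D. (G has_derivative D) (at z) \<and> (\<forall>c v e. D (c *s v, c * e) = c * D (v, e))" "z \<in> S"
  then obtain D D' where "(F has_derivative D) (at z)" "\<forall>c v e. D (c *s v, c * e) = c * D (v, e)"
    "(G has_derivative D') (at z)" "\<forall>c v e. D' (c *s v, c * e) = c * D' (v, e)" by meson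
  then show "\<exists>D. ((\<lambda>z. F z + G z) has_derivative D) (at z) \<and> (\<forall>c v e. D (c *s v, c * e) = c * D (v, e))"
    by (intro exI[of _ "\<lambda>v. D v + D' v"]) (auto intro: has_derivative_add simp: distrib_left)
qed

lemma scv_mult: "scv_holomorphic_on F S \<Longrightarrow> scv_holomorphic_on G S \<Longrightarrow> scv_holomorphic_on (\<lambda>z. F z * G z) S"
  unfolding scv_holomorphic_on_def
proof
  fix z assume *: "\<forall>z\<in>S. \<exists>D. (F has_derivative D) (at z) \<and> (\<forall>c v e. D (c *s v, c * e) = c * D (v, e))"
    "\<forall>z\<in>S. \<exists>D. (G has_derivative D) (at z) \<and> (\<forall>c v e. D (c *s v, c * e) = c * D (v, e))" "z \<in> S"
  then obtain D D' where **: "(F has_derivative D) (at z)" "\<forall>c v e. D (c *s v, c * e) = c * D (v, e)"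
    "(G has_derivative D') (at z)" "\<forall>c v e. D' (c *s v, c * e) = c * D' (v, e)" by meson
  have "((\<lambda>z. F z * G z) has_derivative (\<lambda>h. F z * D' h + D h * G z)) (at z)"
    by (rule has_derivative_mult[OF **(1,3)])
  then show "\<exists>D. ((\<lambda>z. F z * G z) has_derivative D) (at z) \<and> (\<forall>c v e. D (c *s v, c * e) = c * D (v, e))"
    using ** by (intro exI[of _ "\<lambda>v. F z * D' v + D v * G z"]) (auto simp: algebra_simps)
qed

lemma scv_compose:
  assumes "scv_holomorphic_on F S" "\<And>z. z \<in> S \<Longrightarrow> \<phi> field_differentiable at (F z)"
  shows "scv_holomorphic_on (\<lambda>z. \<phi> (F z)) S"
  unfolding scv_holomorphic_on_def
proof
  fix z assume z: "z \<in> S"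
  then obtain d where d: "(\<phi> has_derivative (*) d) (at (F z))"
    using assms(2) unfolding field_differentiable_def has_field_derivative_def by blast
  have "((\<lambda>z. \<phi> (F z)) has_derivative (\<lambda>v. d * dir F v z)) (at z)"
    by (rule has_derivative_compose[OF scv_derivative(1)[OF assms(1) z] d])
  moreover have "\<forall>c v e. d * dir F (c *s v, c * e) z = c * (d * dir F (v, e) z)"
    using scv_derivative(2)[OF assms(1) z] by (auto simp: cscale_def)
  ultimately show "\<exists>D. ((\<lambda>z. \<phi> (F z)) has_derivative D) (at z) \<and> (\<forall>c v e. D (c *s v, c * e) = c * D (v, e))"
    by blast
qed

lemma scv_cmult: "scv_holomorphic_on F S \<Longrightarrow> scv_holomorphic_on (\<lambda>z. c * F z) S"
  using scv_mult[OF scv_const] .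

lemma scv_diff: "scv_holomorphic_on F S \<Longrightarrow> scv_holomorphic_on G S \<Longrightarrow> scv_holomorphic_on (\<lambda>z. F z - G z) S"
  using scv_add[OF _ scv_cmult[of G S "-1"], of F] by simp

lemma scv_divide:
  assumes "scv_holomorphic_on F S" "scv_holomorphic_on G S" "\<And>z. z \<in> S \<Longrightarrow> G z \<noteq> 0"
  shows "scv_holomorphic_on (\<lambda>z. F z / G z) S"
proof -
  have "scv_holomorphic_on (\<lambda>z. inverse (G z)) S"
    by (rule scv_compose[OF assms(2)]) (auto intro!: derivative_intros simp: assms(3))
  then show ?thesis using scv_mult[OF assms(1)] by (simp add: divide_inverse)
qed

lemma scv_sum: "(\<And>i. i \<in> A \<Longrightarrow> scv_holomorphic_on (F i) S) \<Longrightarrow> scv_holomorphic_on (\<lambda>z. \<Sum>i\<in>A. F i z) S"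
  by (induction A rule: infinite_finite_induct) (auto intro: scv_add)

lemma scv_cong:
  assumes "open S" "\<And>z. z \<in> S \<Longrightarrow> F z = G z" "scv_holomorphic_on F S"
  shows "scv_holomorphic_on G S"
  unfolding scv_holomorphic_on_def
proof
  fix z assume z: "z \<in> S"
  then obtain D where D: "(F has_derivative D) (at z)" "\<forall>c v e. D (c *s v, c * e) = c * D (v, e)"
    using assms(3) unfolding scv_holomorphic_on_def by blast
  then have "(G has_derivative D) (at z)"
    using has_derivative_transform_within_open[OF D(1) assms(1) z] assms(2) by blast
  then show "\<exists>D. (G has_derivative D) (at z) \<and> (\<forall>c v e. D (c *s v, c * e) = c * D (v, e))"
    using D(2) by blast
qed

lemma scv_translate:
  assumes "scv_holomorphic_on F S"
  shows "scv_holomorphic_on (\<lambda>z. F (z + a)) ((\<lambda>z. z + a) -` S)"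
  unfolding scv_holomorphic_on_def
proof
  fix z assume "z \<in> (\<lambda>z. z + a) -` S"
  then obtain D where D: "(F has_derivative D) (at (z + a))" "\<forall>c v e. D (c *s v, c * e) = c * D (v, e)"
    using assms unfolding scv_holomorphic_on_def by blast
  have "((\<lambda>z. F (z + a)) has_derivative D) (at z)"
    by (rule has_derivative_compose[of "\<lambda>z. z + a" "\<lambda>v. v" z _ F D])
      (use D(1) in \<open>auto intro!: derivative_eq_intros\<close>)
  then show "\<exists>D. ((\<lambda>z. F (z + a)) has_derivative D) (at z) \<and> (\<forall>c v e. D (c *s v, c * e) = c * D (v, e))"
    using D(2) by blast
qed

lemma dir_cong:
  assumes "open S" "\<And>z. z \<in> S \<Longrightarrow> F z = G z" "z \<in> S"
  shows "dir F v z = dir G v z"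
  unfolding dir_def
proof (rule deriv_cong_ev)
  have "open ((\<lambda>t. z + cscale t v) -` S)"
    by (intro open_vimage assms continuous_intros)
  then have "\<forall>\<^sub>F t in nhds 0. t \<in> (\<lambda>t. z + cscale t v) -` S"
    using assms(3) by (intro eventually_nhds_in_open) auto
  then show "\<forall>\<^sub>F t in nhds 0. F (z + cscale t v) = G (z + cscale t v)"
    by eventually_elim (simp add: assms(2))
qed auto

lemma dir_simps:
  assumes F: "scv_holomorphic_on F S" and G: "scv_holomorphic_on G S" and z: "z \<in> S"
  shows "dir (\<lambda>z. F z + G z) v z = dir F v z + dir G v z"
    and "dir (\<lambda>z. F z * G z) v z = dir F v z * G z + F z * dir G v z"
    and "dir (\<lambda>z. c * F z) v z = c * dir F v z"
    and "dir (\<lambda>z. F z - G z) v z = dir F v z - dir G v z"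
    and "G z \<noteq> 0 \<Longrightarrow> dir (\<lambda>z. F z / G z) v z = (dir F v z * G z - F z * dir G v z) / (G z)\<^sup>2"
proof -
  have d: "((\<lambda>t. F (z + cscale t v)) has_field_derivative dir F v z) (at 0)"
    "((\<lambda>t. G (z + cscale t v)) has_field_derivative dir G v z) (at 0)"
    using scv_line[OF F, of z 0 v] scv_line[OF G, of z 0 v] z by auto
  show "dir (\<lambda>z. F z + G z) v z = dir F v z + dir G v z"
    unfolding dir_def[of "\<lambda>z. F z + G z"] by (rule DERIV_imp_deriv, rule DERIV_add[OF d])
  show "dir (\<lambda>z. F z - G z) v z = dir F v z - dir G v z"
    unfolding dir_def[of "\<lambda>z. F z - G z"] by (rule DERIV_imp_deriv, rule DERIV_diff[OF d])
  show "dir (\<lambda>z. c * F z) v z = c * dir F v z"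
    unfolding dir_def[of "\<lambda>z. c * F z"] by (rule DERIV_imp_deriv, rule DERIV_cmult[OF d(1)])
  show "dir (\<lambda>z. F z * G z) v z = dir F v z * G z + F z * dir G v z"
    unfolding dir_def[of "\<lambda>z. F z * G z"]
    by (rule DERIV_imp_deriv) (use DERIV_mult[OF d] in \<open>simp add: algebra_simps\<close>)
  show "dir (\<lambda>z. F z / G z) v z = (dir F v z * G z - F z * dir G v z) / (G z)\<^sup>2" if "G z \<noteq> 0"
    unfolding dir_def[of "\<lambda>z. F z / G z"]
    by (rule DERIV_imp_deriv) (use DERIV_divide[OF d] that in \<open>simp add: power2_eq_square\<close>)
qed

lemma dir_translate: "dir (\<lambda>z. F (z + a)) v z = dir F v (z + a)"
  by (simp add: dir_def algebra_simps)

definition bas :: "'n \<Rightarrow> (complex ^ 'n) \<times> complex" where "bas m = (axis m 1, 0)"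

lemma pderiv_state_dir: "pderiv_state m F = dir F (bas m)"
proof
  fix z :: "(complex ^ 'a) \<times> complex"
  obtain y e where z: "z = (y, e)" by force
  have "(\<lambda>w. F (\<chi> k. if k = m then w else y $ k, e)) \<circ> (+) (y $ m) = (\<lambda>t. F (z + cscale t (bas m)))"
  proof
    fix t
    have "(\<chi> k. if k = m then y $ m + t else y $ k) = y + t *s axis m 1"
      by (auto simp: vec_eq_iff axis_def)
    then show "((\<lambda>w. F (\<chi> k. if k = m then w else y $ k, e)) \<circ> (+) (y $ m)) t = F (z + cscale t (bas m))"
      by (simp add: z cscale_def bas_def)
  qed
  then show "pderiv_state m F z = dir F (bas m) z"
    unfolding pderiv_state_def dir_def z prod.case by (simp add: deriv_shift_0[of _ "y $ m"])
qed

lemma dir_expand: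
  assumes F: "scv_holomorphic_on F S" and z: "z \<in> S"
  shows "dir F v z = (\<Sum>m\<in>UNIV. fst v $ m * dir F (bas m) z) + snd v * dir F (0, 1) z"
proof -
  have sum: "dir F (\<Sum>m\<in>A. cscale (fst v $ m) (bas m)) z = (\<Sum>m\<in>A. fst v $ m * dir F (bas m) z)" for A
  proof (induction A rule: infinite_finite_induct)
    case (insert x A)
    then show ?case by (simp add: scv_derivative(2,3)[OF F z])
  qed (auto simp: dir_def)
  have "v = (\<Sum>m\<in>UNIV. cscale (fst v $ m) (bas m)) + cscale (snd v) (0, 1)"
    by (simp add: prod_eq_iff fst_sum snd_sum cscale_def bas_def vec_eq_iff axis_def if_distrib cong: if_cong)
  then have "dir F v z = dir F ((\<Sum>m\<in>UNIV. cscale (fst v $ m) (bas m)) + cscale (snd v) (0, 1)) z"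
    by simp
  also have "\<dots> = (\<Sum>m\<in>UNIV. fst v $ m * dir F (bas m) z) + snd v * dir F (0, 1) z"
    by (simp only: scv_derivative(2,3)[OF F z] sum)
  finally show ?thesis .
qed

section \<open>Weighted Taylor series\<close>

text \<open>Blow-up weights: actions scale like \<open>\<mu>\<^sup>2\<close>, angles like \<open>\<mu>\<close> and \<open>\<epsilon>\<close> like \<open>\<mu>\<^sup>3\<close>. With this choice
  the force and the drift of the angles both act at first order in \<open>\<mu>\<close>.\<close>

definition wt :: "'l + 'l \<Rightarrow> nat" where
  "wt i = (case i of Inl _ \<Rightarrow> 2 | Inr _ \<Rightarrow> 1)"

lemma wt_simps [simp]: "wt (Inl j) = 2" "wt (Inr j) = 1"
  by (auto simp: wt_def)

lemma wt_pos [simp]: "0 < wt i" and wt_le [simp]: "wt i \<le> 2"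
  by (cases i; simp)+

lemma wt_neq_0 [simp]: "wt i \<noteq> 0" and wt_leq_3 [simp]: "wt i \<le> 3"
  by (cases i; simp)+

text \<open>The blow-up map around the origin: \<open>p\<close> holds the rescaled state variables
  and \<open>t\<close> is \<mu>.\<close>

definition curve :: "complex ^ ('l + 'l) \<Rightarrow> complex \<Rightarrow> (complex ^ ('l::finite + 'l)) \<times> complex" where
  "curve p t = (\<chi> i. t ^ wt i * p $ i, t ^ 3)"

text \<open>The Taylor coefficients of \<open>g\<close> along the curve, computed from Euler's identity
  \<open>t d/dt g = (\<Sum>i. wt i * y\<^sub>i * \<partial>\<^sub>i g) + 3 * \<epsilon> * \<partial>\<^sub>\<epsilon> g\<close>.\<close>

function tc :: "nat \<Rightarrow> ((complex ^ ('l::finite + 'l)) \<times> complex \<Rightarrow> complex) \<Rightarrow>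
    (complex ^ ('l + 'l)) \<times> complex \<Rightarrow> ('l + 'l) pol" where
  "tc n g z = (if n = 0 then cst (g z) else cst (1 / of_nat n) *
     ((\<Sum>i\<in>UNIV. if wt i \<le> n then cst (of_nat (wt i)) * pvar i * tc (n - wt i) (dir g (bas i)) z else 0) +
      (if 3 \<le> n then cst 3 * tc (n - 3) (dir g (0, 1)) z else 0)))"
  by auto
termination
  by (relation "Wellfounded.measure (\<lambda>(n, g, z). n)") auto

declare tc.simps [simp del]

lemma tc_0: "tc 0 g z = cst (g z)"
  by (simp add: tc.simps)

lemma tc_pos: "n > 0 \<Longrightarrow> of_nat n * tc n g z =
     (\<Sum>i\<in>UNIV. if wt i \<le> n then cst (of_nat (wt i)) * pvar i * tc (n - wt i) (dir g (bas i)) z else 0) +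
      (if 3 \<le> n then cst 3 * tc (n - 3) (dir g (0, 1)) z else 0)"
  by (subst tc.simps) (simp add: cst_hom(7)[symmetric] mult.assoc[symmetric] cst_hom(4)[symmetric] cst_hom(2))

definition tay :: "(complex ^ ('l::finite + 'l)) \<times> complex \<Rightarrow> ((complex ^ ('l + 'l)) \<times> complex \<Rightarrow> complex) \<Rightarrow>
    ('l + 'l) pol fps" where
  "tay z g = Abs_fps (\<lambda>n. tc n g z)"

lemma tay_nth [simp]: "tay z g $ n = tc n g z"
  by (simp add: tay_def)

text \<open>Freezing \<open>p\<close> turns a formal series into an ordinary one-variable Taylor
  series along the curve through \<open>p\<close>. Since polynomials are determined by their values,
  identities of formal series can be proved for each \<open>p\<close> separately.\<close>

definition evf :: "complex ^ 'n \<Rightarrow> ('n::finite) pol fps \<Rightarrow> complex fps" where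
  "evf p A = Abs_fps (\<lambda>n. ev (A $ n) p)"

lemma evf_nth [simp]: "evf p A $ n = ev (A $ n) p"
  by (simp add: evf_def)

lemma evf_eqI: "(\<And>p. evf p A = evf p B) \<Longrightarrow> A = B"
  by (simp add: fps_eq_iff pol_eqI)

lemma evf_add: "evf p (A + B) = evf p A + evf p B" by (simp add: fps_eq_iff)
lemma evf_diff: "evf p (A - B) = evf p A - evf p B" by (simp add: fps_eq_iff)
lemma evf_mult: "evf p (A * B) = evf p A * evf p B" by (simp add: fps_eq_iff fps_mult_nth)
lemma evf_0 [simp]: "evf p 0 = 0" by (simp add: fps_eq_iff)
lemma evf_const [simp]: "evf p (fps_const a) = fps_const (ev a p)" by (simp add: fps_eq_iff)

section \<open>Germs analytic at a point and their weighted Taylor homomorphism\<close>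

lemma analytic_mono: "scv_holomorphic_on g S \<Longrightarrow> open S \<Longrightarrow> z \<in> S \<Longrightarrow> scv_analytic_at g z"
  unfolding scv_analytic_at_def by blast

lemma analytic_dir: "scv_analytic_at g z \<Longrightarrow> scv_analytic_at (dir g v) z"
  unfolding scv_analytic_at_def using dir_holomorphic(1) by blast

lemma analytic_pairE:
  assumes "scv_analytic_at g z" "scv_analytic_at h z"
  obtains S where "open S" "z \<in> S" "scv_holomorphic_on g S" "scv_holomorphic_on h S"
proof -
  obtain S S' where "open S" "z \<in> S" "scv_holomorphic_on g S" "open S'" "z \<in> S'" "scv_holomorphic_on h S'"
    using assms unfolding scv_analytic_at_def by blast
  then show ?thesis
    using that[of "S \<inter> S'"] scv_subset[of g S "S \<inter> S'"] scv_subset[of h S' "S \<inter> S'"] by auto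
qed

lemma analytic_const [simp]: "scv_analytic_at (\<lambda>_. c) z"
  unfolding scv_analytic_at_def by (auto intro: exI[of _ UNIV])

lemma analytic_coord: "scv_analytic_at (\<lambda>z. fst z $ i) z"
  unfolding scv_analytic_at_def by (auto intro!: exI[of _ UNIV] scv_coord)

lemma analytic_snd: "scv_analytic_at snd z"
  unfolding scv_analytic_at_def by (auto intro!: exI[of _ UNIV] scv_snd)

lemma analytic_add: "scv_analytic_at g z \<Longrightarrow> scv_analytic_at h z \<Longrightarrow> scv_analytic_at (\<lambda>z. g z + h z) z"
  by (erule (1) analytic_pairE) (rule analytic_mono[OF scv_add])

lemma analytic_mult: "scv_analytic_at g z \<Longrightarrow> scv_analytic_at h z \<Longrightarrow> scv_analytic_at (\<lambda>z. g z * h z) z"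
  by (erule (1) analytic_pairE) (rule analytic_mono[OF scv_mult])

lemma analytic_diff: "scv_analytic_at g z \<Longrightarrow> scv_analytic_at h z \<Longrightarrow> scv_analytic_at (\<lambda>z. g z - h z) z"
  by (erule (1) analytic_pairE) (rule analytic_mono[OF scv_diff])

lemma analytic_sum: "(\<And>i. i \<in> A \<Longrightarrow> scv_analytic_at (g i) z) \<Longrightarrow> scv_analytic_at (\<lambda>z. \<Sum>i\<in>A. g i z) z"
  by (induction A rule: infinite_finite_induct) (auto intro: analytic_add)

lemma curve_derivative:
  "(curve p has_derivative (\<lambda>h. cscale h (\<chi> i. of_nat (wt i) * t ^ (wt i - 1) * p $ i, 3 * t\<^sup>2))) (at t)"
proof -
  have 1: "((\<lambda>t. \<chi> i. t ^ wt i * p $ i) has_derivative (\<lambda>h. h *s (\<chi> i. of_nat (wt i) * t ^ (wt i - 1) * p $ i))) (at t)"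
  proof -
    have "((\<lambda>t. (\<chi> i. t ^ wt i * p $ i) $ i) has_derivative (\<lambda>h. (h *s (\<chi> i. of_nat (wt i) * t ^ (wt i - 1) * p $ i)) $ i)) (at t)" for i
    proof -
      have "((\<lambda>t. t ^ wt i * p $ i) has_field_derivative (of_nat (wt i) * t ^ (wt i - 1) * p $ i)) (at t)"
        by (auto intro!: derivative_eq_intros)
      from this[unfolded has_field_derivative_def] show ?thesis
        by (auto elim!: has_derivative_eq_rhs simp: fun_eq_iff mult_ac)
    qed
    note comp = this
    have "((\<lambda>t. (\<chi> i. t ^ wt i * p $ i) \<bullet> b) has_derivative (\<lambda>h. (h *s (\<chi> i. of_nat (wt i) * t ^ (wt i - 1) * p $ i)) \<bullet> b)) (at t)"
      if bB: "b \<in> Basis" for b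
    proof -
      obtain i u where b: "b = axis i u" using bB by (auto simp: Basis_vec_def)
      show ?thesis unfolding b inner_axis by (intro has_derivative_inner_left comp)
    qed
    then show ?thesis by (subst has_derivative_componentwise_within) blast
  qed
  have 2: "((\<lambda>t. t ^ 3) has_derivative (\<lambda>h. h * (3 * t\<^sup>2))) (at t)" for t :: complex
    by (auto intro!: derivative_eq_intros simp: algebra_simps)
  show ?thesis
    using has_derivative_Pair[OF 1 2] by (simp add: curve_def[abs_def] cscale_def)
qed

lemma curve_0 [simp]: "curve p 0 = 0"
  by (auto simp: curve_def zero_prod_def vec_eq_iff power_0_left)

lemma curve_continuous: "continuous_on A (curve p)"
  by (rule continuous_at_imp_continuous_on) (blast intro: has_derivative_continuous curve_derivative)

lemma curve_analytic:
  assumes "scv_analytic_at g z"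
  shows "(\<lambda>t. g (z + curve p t)) analytic_on {0}"
    and "\<forall>\<^sub>F t in nhds 0. ((\<lambda>t. g (z + curve p t)) has_field_derivative
       ((\<Sum>i\<in>UNIV. of_nat (wt i) * t ^ (wt i - 1) * p $ i * dir g (bas i) (z + curve p t)) + 3 * t\<^sup>2 * dir g (0, 1) (z + curve p t))) (at t)"
proof -
  obtain S where S: "open S" "z \<in> S" "scv_holomorphic_on g S"
    using assms unfolding scv_analytic_at_def by blast
  define U where "U = (\<lambda>t. z + curve p t) -` S"
  have U: "open U" "0 \<in> U"
    unfolding U_def using S by (auto intro!: open_vimage continuous_intros curve_continuous)
  have d: "((\<lambda>t. g (z + curve p t)) has_field_derivative
       ((\<Sum>i\<in>UNIV. of_nat (wt i) * t ^ (wt i - 1) * p $ i * dir g (bas i) (z + curve p t)) + 3 * t\<^sup>2 * dir g (0, 1) (z + curve p t))) (at t)"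
    if "t \<in> U" for t
  proof -
    have mem: "z + curve p t \<in> S" using that by (simp add: U_def)
    have "((\<lambda>t. g (z + curve p t)) has_field_derivative
       dir g (\<chi> i. of_nat (wt i) * t ^ (wt i - 1) * p $ i, 3 * t\<^sup>2) (z + curve p t)) (at t)"
      by (rule scv_chain[OF S(3), of "\<lambda>t. z + curve p t"])
        (use mem in \<open>auto intro!: derivative_eq_intros curve_derivative\<close>)
    then show ?thesis by (subst (asm) dir_expand[OF S(3) mem]) simp
  qed
  show "(\<lambda>t. g (z + curve p t)) analytic_on {0}"
    unfolding analytic_at
  proof (intro exI conjI)
    show "(\<lambda>t. g (z + curve p t)) holomorphic_on U"
      unfolding holomorphic_on_open[OF U(1)] using d by (intro ballI exI)
  qed (rule U)+
  show "\<forall>\<^sub>F t in nhds 0. ((\<lambda>t. g (z + curve p t)) has_field_derivative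
       ((\<Sum>i\<in>UNIV. of_nat (wt i) * t ^ (wt i - 1) * p $ i * dir g (bas i) (z + curve p t)) + 3 * t\<^sup>2 * dir g (0, 1) (z + curve p t))) (at t)"
    using eventually_nhds_in_open[OF U] by eventually_elim (rule d)
qed

text \<open>The chain rule along the curve, multiplied by \<open>t\<close>, is Euler's identity;
  comparing coefficients of \<open>t ^ n\<close> reproduces the recursion of \<open>tc\<close>. All
  weights are positive, so the derivatives of \<open>g\<close> enter only with smaller
  index.\<close>

lemma tay_coeff:
  assumes "scv_analytic_at g z"
  shows "fps_expansion (\<lambda>t. g (z + curve p t)) 0 $ n = ev (tc n g z) p"
  using assms
proof (induction n arbitrary: g rule: less_induct)
  case (less n)
  define X where "X g = fps_expansion (\<lambda>t. g (z + curve p t)) 0" for g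
  have X: "(\<lambda>t. g (z + curve p t)) has_fps_expansion X g" if "scv_analytic_at g z" for g
    unfolding X_def by (rule analytic_at_imp_has_fps_expansion_0) (rule curve_analytic(1)[OF that])
  show ?case
  proof (cases "n = 0")
    case True
    have "X g $ 0 = g z" using has_fps_expansion_imp_0_eq_fps_nth_0[OF X[OF less.prems]] by simp
    then show ?thesis using True by (simp add: tc_0 X_def)
  next
    case False
    have d1: "(\<lambda>t. t * deriv (\<lambda>t. g (z + curve p t)) t) has_fps_expansion fps_X * fps_deriv (X g)"
      by (intro fps_expansion_intros X less.prems)
    have "(\<lambda>t. (\<Sum>i\<in>UNIV. of_nat (wt i) * p $ i * (t ^ wt i * dir g (bas i) (z + curve p t))) + 3 * (t ^ 3 * dir g (0, 1) (z + curve p t)))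
      has_fps_expansion (\<Sum>i\<in>UNIV. fps_const (of_nat (wt i) * p $ i) * (fps_X ^ wt i * X (dir g (bas i)))) + fps_const 3 * (fps_X ^ 3 * X (dir g (0, 1)))"
      by (intro fps_expansion_intros X analytic_dir less.prems)
    note exp2 = this
    have ev2: "\<forall>\<^sub>F t in nhds 0. t * deriv (\<lambda>t. g (z + curve p t)) t =
       (\<Sum>i\<in>UNIV. of_nat (wt i) * p $ i * (t ^ wt i * dir g (bas i) (z + curve p t))) + 3 * (t ^ 3 * dir g (0, 1) (z + curve p t))"
      using curve_analytic(2)[OF less.prems, of p]
    proof eventually_elim
      case (elim t)
      have w: "t * (t ^ (wt i - 1) * a) = t ^ wt i * a" for i :: "'a + 'a" and a
        by (cases i) (auto simp: power2_eq_square)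
      have "t * (\<Sum>i\<in>UNIV. of_nat (wt i) * t ^ (wt i - 1) * p $ i * dir g (bas i) (z + curve p t)) =
        (\<Sum>i\<in>UNIV. of_nat (wt i) * p $ i * (t ^ wt i * dir g (bas i) (z + curve p t)))"
        unfolding sum_distrib_left
      proof (rule sum.cong[OF refl])
        fix i :: "'a + 'a"
        show "t * (of_nat (wt i) * t ^ (wt i - 1) * p $ i * dir g (bas i) (z + curve p t)) =
          of_nat (wt i) * p $ i * (t ^ wt i * dir g (bas i) (z + curve p t))"
          unfolding w[symmetric] by (simp only: mult_ac)
      qed
      moreover have "t * (3 * t\<^sup>2 * a) = 3 * (t ^ 3 * a)" for a
        by (simp add: power3_eq_cube power2_eq_square)
      ultimately show ?case
        unfolding DERIV_imp_deriv[OF elim] distrib_left by simp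
    qed
    note exp3 = has_fps_expansion_cong[OF ev2 refl, THEN iffD2, OF exp2]
    from fps_expansion_unique_complex[OF d1 exp3]
    have eq: "fps_X * fps_deriv (X g) = (\<Sum>i\<in>UNIV. fps_const (of_nat (wt i) * p $ i) * (fps_X ^ wt i * X (dir g (bas i)))) + fps_const 3 * (fps_X ^ 3 * X (dir g (0, 1)))" .
    have IH: "X (dir g v) $ m = ev (tc m (dir g v) z) p" if "m < n" for m v
      unfolding X_def by (rule less.IH[OF that analytic_dir[OF less.prems]])
    have "of_nat n * X g $ n = (fps_X * fps_deriv (X g)) $ n"
      using False by (cases n) auto
    also have "\<dots> = (\<Sum>i\<in>UNIV. if wt i \<le> n then of_nat (wt i) * p $ i * X (dir g (bas i)) $ (n - wt i) else 0)
        + (if 3 \<le> n then 3 * X (dir g (0, 1)) $ (n - 3) else 0)"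
      unfolding eq by (auto simp: fps_sum_nth fps_X_power_mult_nth intro!: sum.cong)
    also have "\<dots> = ev (of_nat n * tc n g z) p"
      unfolding tc_pos[OF False[unfolded neq0_conv]]
      using False by (auto simp: IH intro!: sum.cong)
    finally show ?thesis using False by (simp add: X_def)
  qed
qed

lemma tay_expansion:
  assumes "scv_analytic_at g z"
  shows "(\<lambda>t. g (z + curve p t)) has_fps_expansion evf p (tay z g)"
proof -
  have "fps_expansion (\<lambda>t. g (z + curve p t)) 0 = evf p (tay z g)"
    by (simp add: fps_eq_iff tay_coeff[OF assms])
  then show ?thesis
    using analytic_at_imp_has_fps_expansion_0[OF curve_analytic(1)[OF assms]] by metis
qed

lemma tay_eqI:
  assumes "scv_analytic_at g z" "\<And>p. (\<lambda>t. g (z + curve p t)) has_fps_expansion evf p A"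
  shows "tay z g = A"
  by (rule evf_eqI) (rule fps_expansion_unique_complex[OF tay_expansion[OF assms(1)] assms(2)])

lemma tay_add: "scv_analytic_at g z \<Longrightarrow> scv_analytic_at h z \<Longrightarrow> tay z (\<lambda>x. g x + h x) = tay z g + tay z h"
  by (rule tay_eqI, erule (1) analytic_add) (unfold evf_add, intro has_fps_expansion_add tay_expansion)

lemma tay_diff: "scv_analytic_at g z \<Longrightarrow> scv_analytic_at h z \<Longrightarrow> tay z (\<lambda>x. g x - h x) = tay z g - tay z h"
  by (rule tay_eqI, erule (1) analytic_diff) (unfold evf_diff, intro has_fps_expansion_diff tay_expansion)

lemma tay_mult: "scv_analytic_at g z \<Longrightarrow> scv_analytic_at h z \<Longrightarrow> tay z (\<lambda>x. g x * h x) = tay z g * tay z h"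
  by (rule tay_eqI, erule (1) analytic_mult) (unfold evf_mult, intro has_fps_expansion_mult tay_expansion)

lemma tay_const: "tay z (\<lambda>_. c) = fps_const (cst c)"
  by (rule tay_eqI) simp_all

lemma tay_sum: "(\<And>i. i \<in> A \<Longrightarrow> scv_analytic_at (g i) z) \<Longrightarrow> tay z (\<lambda>x. \<Sum>i\<in>A. g i x) = (\<Sum>i\<in>A. tay z (g i))"
  by (induction A rule: infinite_finite_induct) (auto simp: tay_const tay_add analytic_sum cst_hom)

lemma tay_coord: "tay z (\<lambda>x. fst x $ i) = fps_const (cst (fst z $ i)) + fps_X ^ wt i * fps_const (pvar i)"
proof (rule tay_eqI[OF analytic_coord])
  fix p
  have "(\<lambda>t. fst z $ i + t ^ wt i * p $ i) has_fps_expansion fps_const (fst z $ i) + fps_X ^ wt i * fps_const (p $ i)"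
    by (intro fps_expansion_intros)
  moreover have "evf p (fps_const (cst (fst z $ i)) + fps_X ^ wt i * fps_const (pvar i)) = fps_const (fst z $ i) + fps_X ^ wt i * fps_const (p $ i)"
    by (simp add: fps_eq_iff fps_X_power_mult_nth)
  ultimately show "(\<lambda>t. fst (z + curve p t) $ i) has_fps_expansion evf p (fps_const (cst (fst z $ i)) + fps_X ^ wt i * fps_const (pvar i))"
    by (simp add: curve_def)
qed

lemma tay_snd:
  fixes z :: "(complex ^ ('l::finite + 'l)) \<times> complex"
  assumes z: "snd z = 0"
  shows "tay z snd = fps_X ^ 3"
proof (rule tay_eqI[OF analytic_snd])
  fix p :: "complex ^ ('l + 'l)"
  have "(\<lambda>t. t ^ 3) has_fps_expansion fps_X ^ 3"
    by (intro fps_expansion_intros)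
  moreover have "evf p (fps_X ^ 3) = fps_X ^ 3"
    by (simp add: fps_eq_iff fps_X_power_nth)
  ultimately show "(\<lambda>t. snd (z + curve p t)) has_fps_expansion evf p (fps_X ^ 3)"
    by (simp add: curve_def z)
qed

lemma tc_cong:
  assumes "open S" "z \<in> S" "\<And>x. x \<in> S \<Longrightarrow> g x = h x"
  shows "tc n g z = tc n h z"
  using assms(3)
proof (induction n arbitrary: g h rule: less_induct)
  case (less n)
  have IH: "tc m (dir g v) z = tc m (dir h v) z" if "m < n" for m v
    by (rule less.IH[OF that]) (rule dir_cong[OF assms(1) less.prems])
  then show ?case
    unfolding tc.simps[of n g z] tc.simps[of n h z] less.prems[OF assms(2)]
    by (simp add: IH cong: if_cong)
qed

lemma tay_cong:
  assumes "open S" "z \<in> S" "\<And>x. x \<in> S \<Longrightarrow> g x = h x"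
  shows "tay z g = tay z h"
  using tc_cong[OF assms] by (simp add: tay_def)

lemma tay_translate: "tay z (\<lambda>x. g (x + a)) = tay (z + a) g"
proof -
  have "tc n (\<lambda>x. g (x + a)) z = tc n g (z + a)" for n
  proof (induction n arbitrary: g rule: less_induct)
    case (less n)
    have "dir (\<lambda>x. g (x + a)) v = (\<lambda>x. dir g v (x + a))" for v
      by (rule ext) (rule dir_translate)
    then have IH: "tc m (dir (\<lambda>x. g (x + a)) v) z = tc m (dir g v) (z + a)" if "m < n" for m v
      using less.IH[OF that, of "dir g v"] by simp
    then show ?case
      unfolding tc.simps[of n g "z + a"] tc.simps[of n "\<lambda>x. g (x + a)" z]
      by (simp add: IH cong: if_cong)
  qed
  then show ?thesis by (simp add: tay_def)
qed

text \<open>The factor is \<open>2 ^ 3\<close>, from the largest weight. A curve that reaches a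
  nearby point at parameter \<open>s\<close> therefore stays near the origin on the disc of radius
  \<open>2 * cmod s\<close>, where the identity theorem can be applied.\<close>

lemma curve_norm_mono:
  assumes "cmod t \<le> 2 * cmod s"
  shows "norm (curve p t) \<le> 8 * norm (curve p s)"
proof -
  have pw: "cmod t ^ k \<le> 8 * cmod s ^ k" if "k \<le> 3" for k
  proof -
    have "cmod t ^ k \<le> (2 * cmod s) ^ k" using assms by (intro power_mono) auto
    also have "\<dots> = 2 ^ k * cmod s ^ k" by (simp add: power_mult_distrib)
    also have "\<dots> \<le> 8 * cmod s ^ k"
      using power_increasing[OF that, of "2::real"] by (intro mult_right_mono) auto
    finally show ?thesis .
  qed
  have 1: "norm (\<chi> i. t ^ wt i * p $ i) \<le> 8 * norm (\<chi> i. s ^ wt i * p $ i)"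
  proof -
    have "norm (\<chi> i. t ^ wt i * p $ i) \<le> norm ((8::real) *\<^sub>R (\<chi> i. s ^ wt i * p $ i))"
    proof (rule norm_le_componentwise_cart)
      fix i
      have "cmod t ^ wt i * cmod (p $ i) \<le> (8 * cmod s ^ wt i) * cmod (p $ i)"
        using wt_le[of i] by (intro mult_right_mono pw) auto
      then show "norm ((\<chi> i. t ^ wt i * p $ i) $ i) \<le> norm (((8::real) *\<^sub>R (\<chi> i. s ^ wt i * p $ i)) $ i)"
        by (simp add: norm_mult norm_power)
    qed
    then show ?thesis by simp
  qed
  have 2: "cmod (t ^ 3) \<le> 8 * cmod (s ^ 3)" using pw[of 3] by (simp add: norm_power)
  have "norm (curve p t) = sqrt ((norm (\<chi> i. t ^ wt i * p $ i))\<^sup>2 + (cmod (t ^ 3))\<^sup>2)"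
    by (simp add: curve_def norm_prod_def)
  also have "\<dots> \<le> sqrt ((8 * norm (\<chi> i. s ^ wt i * p $ i))\<^sup>2 + (8 * cmod (s ^ 3))\<^sup>2)"
    by (intro real_sqrt_le_mono add_mono power_mono 1 2) auto
  also have "\<dots> = 8 * norm (curve p s)"
  proof -
    have "sqrt ((8 * a)\<^sup>2 + (8 * b)\<^sup>2) = 8 * sqrt (a\<^sup>2 + b\<^sup>2)" for a b :: real
    proof -
      have "(8 * a)\<^sup>2 + (8 * b)\<^sup>2 = 8\<^sup>2 * (a\<^sup>2 + b\<^sup>2)" by (simp add: power_mult_distrib)
      then show ?thesis by (simp only: real_sqrt_mult real_sqrt_abs abs_numeral)
    qed
    then show ?thesis by (simp add: curve_def norm_prod_def)
  qed
  finally show ?thesis .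
qed

text \<open>Every nearby point whose \<epsilon> differs from that of \<open>z\<close> lies on some
  weighted curve through \<open>z\<close>. Along that curve the Taylor series of \<open>g\<close>
  vanishes, and the one-variable identity theorem carries the zero out to the point.\<close>

lemma tay_eq_0_imp:
  fixes z :: "(complex ^ ('l::finite + 'l)) \<times> complex"
  assumes g: "scv_analytic_at g z" and 0: "tay z g = 0" and V: "open V" "z \<in> V"
  shows "\<exists>W. open W \<and> W \<noteq> {} \<and> W \<subseteq> V \<and> (\<forall>x\<in>W. g x = 0)"
proof -
  obtain S where S: "open S" "z \<in> S" "scv_holomorphic_on g S"
    using g unfolding scv_analytic_at_def by blast
  obtain r where r: "r > 0" "ball z r \<subseteq> S \<inter> V"
    using S V open_contains_ball[of "S \<inter> V"] by blast
  \<comment> \<open>The radius compensates the factor 8 of \<open>curve_norm_mono\<close>. The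
    hyperplane of equal \<epsilon> is removed because its points would require the curve parameter
    0.\<close>
  define W where "W = ball z (r / 8) \<inter> {x. snd x \<noteq> snd z}"
  have "open W"
    unfolding W_def by (intro open_Int open_ball open_Collect_neq continuous_intros)
  moreover have "z + (0, of_real (r / 16)) \<in> W"
    using r(1) by (simp add: W_def dist_norm norm_Pair)
  moreover have "W \<subseteq> V"
  proof -
    have "ball z (r / 8) \<subseteq> ball z r" using r(1) by (intro subset_ball) simp
    then show ?thesis using r(2) by (auto simp: W_def)
  qed
  moreover have "g x = 0" if x: "x \<in> W" for x
  proof -
    \<comment> \<open>Taking a cube root of the \<epsilon>-difference first, and then dividing each
      state difference by the matching power, puts \<open>x\<close> on the curve at parameter
      \<open>s\<close>.\<close>
    obtain s where s': "snd (x - z) = s ^ 3"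
      by (rule exists_complex_root[of 3 "snd (x - z)"]) simp_all
    note s = s'[symmetric]
    have s0: "s \<noteq> 0" using s x by (auto simp: W_def)
    define p :: "complex ^ ('l + 'l)" where "p = (\<chi> i. fst (x - z) $ i / s ^ wt i)"
    have cs: "curve p s = x - z"
      using s s0 by (simp add: curve_def p_def prod_eq_iff vec_eq_iff)
    have mem: "z + curve p t \<in> ball z r" if "t \<in> ball 0 (2 * cmod s)" for t
    proof -
      have "norm (curve p t) \<le> 8 * norm (curve p s)"
        using that by (intro curve_norm_mono) auto
      also have "\<dots> < r" using x by (simp add: cs W_def dist_norm norm_minus_commute)
      finally show ?thesis by (simp add: dist_norm)
    qed
    have hol: "(\<lambda>t. g (z + curve p t)) holomorphic_on ball 0 (2 * cmod s)"
    proof -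
      have "\<exists>d. ((\<lambda>t. g (z + curve p t)) has_field_derivative d) (at t)" if "t \<in> ball 0 (2 * cmod s)" for t
      proof
        show "((\<lambda>t. g (z + curve p t)) has_field_derivative
          dir g (\<chi> i. of_nat (wt i) * t ^ (wt i - 1) * p $ i, 3 * t\<^sup>2) (z + curve p t)) (at t)"
          by (rule scv_chain[OF S(3), of "\<lambda>t. z + curve p t"])
            (use subsetD[OF r(2) mem[OF that]] in \<open>auto intro!: derivative_eq_intros curve_derivative\<close>)
      qed
      then show ?thesis unfolding holomorphic_on_open[OF open_ball] by blast
    qed
    have "(\<lambda>t. g (z + curve p t)) has_fps_expansion 0"
      using tay_expansion[OF g, of p] 0 by simp
    then have ev0: "\<forall>\<^sub>F t in nhds 0. g (z + curve p t) = 0"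
      by (simp only: has_fps_expansion_0_iff)
    then obtain d where d: "d > 0" "\<And>t. dist t 0 < d \<Longrightarrow> g (z + curve p t) = 0"
      unfolding eventually_nhds_metric by blast
    have "g (z + curve p s) = 0"
    proof (rule analytic_continuation_open[of "ball 0 (min d (2 * cmod s))" "ball 0 (2 * cmod s)" "\<lambda>t. g (z + curve p t)" "\<lambda>_. 0"])
      show "\<And>t. t \<in> ball 0 (min d (2 * cmod s)) \<Longrightarrow> g (z + curve p t) = 0"
        by (rule d(2)) (simp add: dist_commute)
      show "ball 0 (min d (2 * cmod s)) \<noteq> ({} :: complex set)" using d(1) s0 by (simp add: not_le)
      show "ball 0 (min d (2 * cmod s)) \<subseteq> (ball 0 (2 * cmod s) :: complex set)" by (intro subset_ball) simp
      show "s \<in> ball 0 (2 * cmod s)" using s0 by simp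
    qed (simp_all add: hol)
    then show ?thesis by (simp add: cs)
  qed
  ultimately show ?thesis by blast
qed

text \<open>This is the chain rule of the blow-up at the level of coefficients: differentiation in a
  rescaled variable lowers the order by the weight and passes to the partial derivative of
  \<open>g\<close>.\<close>

lemma dpol_tc:
  assumes "open S" "scv_holomorphic_on g S" "z \<in> S"
  shows "dpol k (tc n g z) = (if wt k \<le> n then tc (n - wt k) (dir g (bas k)) z else 0)"
  using assms(2)
proof (induction n arbitrary: g rule: less_induct)
  case (less n)
  show ?case
  proof (cases "n = 0")
    case True
    then show ?thesis by (simp add: tc_0)
  next
    case False
    have sw: "tc m (dir (dir g v) (bas k)) z = tc m (dir (dir g (bas k)) v) z" for m v
      by (rule tc_cong[OF assms(1,3)]) (rule dir_holomorphic(2)[OF less.prems assms(1)])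
    have IH: "dpol k (tc m (dir g v) z) = (if wt k \<le> m then tc (m - wt k) (dir (dir g (bas k)) v) z else 0)"
      if "m < n" for m v
      using less.IH[OF that dir_holomorphic(1)[OF less.prems assms(1)]] by (simp add: sw)
    have "of_nat n * dpol k (tc n g z) = dpol k (of_nat n * tc n g z)"
      by (simp add: cst_hom(7)[symmetric])
    also have "\<dots> = (\<Sum>i\<in>UNIV. if wt i \<le> n then cst (of_nat (wt i)) * dpol k (pvar i * tc (n - wt i) (dir g (bas i)) z) else 0)
      + (if 3 \<le> n then cst 3 * dpol k (tc (n - 3) (dir g (0, 1)) z) else 0)"
      unfolding tc_pos[OF False[unfolded neq0_conv]]
      by (simp add: mult.assoc if_distrib[of "dpol k"] cong: if_cong)
    also have "\<dots> = (\<Sum>i\<in>UNIV. (if i = k then (if wt k \<le> n then cst (of_nat (wt k)) * tc (n - wt k) (dir g (bas k)) z else 0) else 0) +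
        (if wt i + wt k \<le> n then cst (of_nat (wt i)) * pvar i * tc (n - wt i - wt k) (dir (dir g (bas k)) (bas i)) z else 0))
      + (if 3 + wt k \<le> n then cst 3 * tc (n - 3 - wt k) (dir (dir g (bas k)) (0, 1)) z else 0)"
    proof (rule arg_cong2[of _ _ _ _ "(+)"], rule sum.cong[OF refl])
      fix i :: "'a + 'a"
      show "(if wt i \<le> n then cst (of_nat (wt i)) * dpol k (pvar i * tc (n - wt i) (dir g (bas i)) z) else 0) =
        (if i = k then (if wt k \<le> n then cst (of_nat (wt k)) * tc (n - wt k) (dir g (bas k)) z else 0) else 0) +
        (if wt i + wt k \<le> n then cst (of_nat (wt i)) * pvar i * tc (n - wt i - wt k) (dir (dir g (bas k)) (bas i)) z else 0)"
      proof (cases "wt i \<le> n")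
        case True
        have "n - wt i < n" using False by simp
        moreover have "wt k \<le> n - wt i \<longleftrightarrow> wt i + wt k \<le> n" using True by linarith
        ultimately show ?thesis
          using True by (cases "i = k"; cases "wt i + wt k \<le> n") (simp_all add: dpol_mult dpol_pvar IH distrib_left mult.assoc)
      qed auto
      have "n - 3 < n" using False by simp
      moreover have "3 \<le> n \<Longrightarrow> wt k \<le> n - 3 \<longleftrightarrow> 3 + wt k \<le> n" by linarith
      ultimately show "(if 3 \<le> n then cst 3 * dpol k (tc (n - 3) (dir g (0, 1)) z) else 0) =
        (if 3 + wt k \<le> n then cst 3 * tc (n - 3 - wt k) (dir (dir g (bas k)) (0, 1)) z else 0)"
        by (cases "3 \<le> n") (simp_all add: IH)
    qed
    also have "\<dots> = (if wt k \<le> n then cst (of_nat (wt k)) * tc (n - wt k) (dir g (bas k)) z else 0) +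
      ((\<Sum>i\<in>UNIV. (if wt i + wt k \<le> n then cst (of_nat (wt i)) * pvar i * tc (n - wt i - wt k) (dir (dir g (bas k)) (bas i)) z else 0))
      + (if 3 + wt k \<le> n then cst 3 * tc (n - 3 - wt k) (dir (dir g (bas k)) (0, 1)) z else 0))"
      by (simp add: sum.distrib)
    \<comment> \<open>The product rule on \<open>pvar k\<close> contributes \<open>wt k\<close>
      copies, the recursion for the derivative in direction \<open>k\<close> the remaining
      \<open>n - wt k\<close>.\<close>
    also have "\<dots> = (if wt k \<le> n then of_nat n * tc (n - wt k) (dir g (bas k)) z else 0)"
    proof (cases "wt k \<le> n")
      case True
      show ?thesis
      proof (cases "n = wt k")
        case eq: True
        have "\<not> wt i + wt k \<le> wt k" for i :: "'a + 'a" using wt_pos[of i] by linarith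
        then show ?thesis using eq by (simp add: cst_hom)
      next
        case ne: False
        then have pos: "n - wt k > 0" using True by simp
        have "(\<Sum>i\<in>UNIV. (if wt i + wt k \<le> n then cst (of_nat (wt i)) * pvar i * tc (n - wt i - wt k) (dir (dir g (bas k)) (bas i)) z else 0))
          + (if 3 + wt k \<le> n then cst 3 * tc (n - 3 - wt k) (dir (dir g (bas k)) (0, 1)) z else 0)
          = of_nat (n - wt k) * tc (n - wt k) (dir g (bas k)) z"
        proof -
          have e1: "wt i \<le> n - wt k \<longleftrightarrow> wt i + wt k \<le> n" "n - wt k - wt i = n - wt i - wt k" for i :: "'a + 'a"
            using True by linarith+
          have e2: "3 \<le> n - wt k \<longleftrightarrow> 3 + wt k \<le> n" "n - wt k - 3 = n - 3 - wt k"
            using True by linarith+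
          show ?thesis unfolding tc_pos[OF pos] by (simp only: e1 e2)
        qed
        moreover have "of_nat n * a = cst (of_nat (wt k)) * a + of_nat (n - wt k) * a" for a :: "('a + 'a) pol"
        proof -
          have "of_nat n = (of_nat (wt k + (n - wt k)) :: ('a + 'a) pol)" using True by simp
          then show ?thesis by (simp only: of_nat_add cst_hom(7) distrib_right)
        qed
        ultimately show ?thesis using True by simp
      qed
    next
      case F: False
      then have "\<not> wt i + wt k \<le> n" "\<not> 3 + wt k \<le> n" for i :: "'a + 'a" by linarith+
      then show ?thesis using F by simp
    qed
    finally have "of_nat n * dpol k (tc n g z) = of_nat n * (if wt k \<le> n then tc (n - wt k) (dir g (bas k)) z else 0)"
      by (simp split: if_split)
    then show ?thesis using False by simp
  qed
qed

lemma dR_tay: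
  assumes "scv_analytic_at g z"
  shows "dR k (tay z g) = fps_X ^ wt k * tay z (dir g (bas k))"
proof -
  obtain S where S: "open S" "z \<in> S" "scv_holomorphic_on g S"
    using assms unfolding scv_analytic_at_def by blast
  show ?thesis
    by (auto simp: fps_eq_iff fps_X_power_mult_nth dpol_tc[OF S(1,3,2)])
qed

section \<open>Holomorphic families of polynomials and power series\<close>

text \<open>Families of polynomials depending holomorphically on a parameter in the strong sense of being
  finite sums of scalar holomorphic functions times fixed polynomials.\<close>

inductive fhp :: "complex set \<Rightarrow> (complex \<Rightarrow> ('n::finite) pol) \<Rightarrow> bool" for S where
  base: "\<phi> holomorphic_on S \<Longrightarrow> \<forall>\<zeta>\<in>S. a \<zeta> = cst (\<phi> \<zeta>) * b \<Longrightarrow> fhp S a"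
| add: "fhp S a \<Longrightarrow> fhp S b \<Longrightarrow> \<forall>\<zeta>\<in>S. c \<zeta> = a \<zeta> + b \<zeta> \<Longrightarrow> fhp S c"

definition HDp :: "complex set \<Rightarrow> (complex \<Rightarrow> ('n::finite) pol) \<Rightarrow> (complex \<Rightarrow> 'n pol) \<Rightarrow> bool" where
  "HDp S a a' \<longleftrightarrow> (\<forall>\<zeta>\<in>S. \<forall>p. ((\<lambda>\<zeta>. ev (a \<zeta>) p) has_field_derivative ev (a' \<zeta>) p) (at \<zeta>))"

lemma holomorphic_on_derivI:
  assumes "\<And>x. x \<in> S \<Longrightarrow> (f has_field_derivative f' x) (at x)"
  shows "f holomorphic_on S"
  unfolding holomorphic_on_def field_differentiable_def
proof
  fix x assume "x \<in> S"
  from has_field_derivative_at_within[OF assms[OF this]]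
  show "\<exists>f'. (f has_field_derivative f') (at x within S)" by (rule exI)
qed

lemma fhp_cong:
  assumes "fhp S a" and eq: "\<And>\<zeta>. \<zeta> \<in> S \<Longrightarrow> b \<zeta> = a \<zeta>"
  shows "fhp S b"
  by (rule fhp.add[OF assms(1) fhp.base[of "\<lambda>_. 0" S "\<lambda>_. 0" 0]]) (simp_all add: eq)

lemma fhp_scalar: "\<phi> holomorphic_on S \<Longrightarrow> fhp S (\<lambda>\<zeta>. cst (\<phi> \<zeta>))"
  by (rule fhp.base[of \<phi> _ _ 1]) auto

lemma fhp_const [simp]: "fhp S (\<lambda>_. b)"
  by (rule fhp.base[of "\<lambda>_. 1" _ _ b]) (auto simp: cst_hom)

lemma fhp_add: "fhp S a \<Longrightarrow> fhp S b \<Longrightarrow> fhp S (\<lambda>\<zeta>. a \<zeta> + b \<zeta>)"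
  by (rule fhp.add[of S a b]) auto

lemma fhp_sum: "(\<And>i. i \<in> I \<Longrightarrow> fhp S (a i)) \<Longrightarrow> fhp S (\<lambda>\<zeta>. \<Sum>i\<in>I. a i \<zeta>)"
  by (induction I rule: infinite_finite_induct) (auto intro: fhp_add)

lemma fhp_mult:
  assumes "fhp S a" "fhp S b"
  shows "fhp S (\<lambda>\<zeta>. a \<zeta> * b \<zeta>)"
  using assms(1)
proof induction
  case (base \<phi> a a0)
  show ?case using assms(2)
  proof induction
    case (base \<psi> b b0)
    show ?case
    proof (rule fhp.base[of "\<lambda>\<zeta>. \<phi> \<zeta> * \<psi> \<zeta>" _ _ "a0 * b0"])
      show "(\<lambda>\<zeta>. \<phi> \<zeta> * \<psi> \<zeta>) holomorphic_on S"
        by (rule holomorphic_on_mult[OF \<open>\<phi> holomorphic_on S\<close> base(1)])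
      show "\<forall>\<zeta>\<in>S. a \<zeta> * b \<zeta> = cst (\<phi> \<zeta> * \<psi> \<zeta>) * (a0 * b0)"
        using base(2) \<open>\<forall>\<zeta>\<in>S. a \<zeta> = cst (\<phi> \<zeta>) * a0\<close> by (simp add: cst_hom mult_ac)
    qed
  next
    case (add b1 b2 b)
    show ?case by (rule fhp.add[OF add.IH]) (use add.hyps in \<open>auto simp: distrib_left\<close>)
  qed
next
  case (add a1 a2 a)
  show ?case by (rule fhp.add[OF add.IH]) (use add.hyps in \<open>auto simp: distrib_right\<close>)
qed

lemma fhp_minus: "fhp S a \<Longrightarrow> fhp S (\<lambda>\<zeta>. - a \<zeta>)"
  using fhp_mult[OF fhp_const[of S "-1"]] by simp

lemma fhp_dpol: "fhp S a \<Longrightarrow> fhp S (\<lambda>\<zeta>. dpol i (a \<zeta>))"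
proof (induction rule: fhp.induct)
  case (base \<phi> a a0)
  show ?case by (rule fhp.base[OF base(1), of _ "dpol i a0"]) (simp add: base(2))
next
  case (add a1 a2 a)
  show ?case by (rule fhp.add[OF add.IH]) (use add.hyps in auto)
qed

lemma fhp_subset: "fhp S a \<Longrightarrow> T \<subseteq> S \<Longrightarrow> fhp T a"
proof (induction rule: fhp.induct)
  case (base \<phi> a a0)
  show ?case by (rule fhp.base[of \<phi> _ _ a0]) (use base in \<open>auto intro: holomorphic_on_subset\<close>)
next
  case (add a1 a2 a)
  show ?case by (rule fhp.add[of _ a1 a2]) (use add in auto)
qed

lemma HDp_add: "HDp S a a' \<Longrightarrow> HDp S b b' \<Longrightarrow> HDp S (\<lambda>\<zeta>. a \<zeta> + b \<zeta>) (\<lambda>\<zeta>. a' \<zeta> + b' \<zeta>)"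
  by (auto simp: HDp_def intro: DERIV_add)

lemma HDp_mult: "HDp S a a' \<Longrightarrow> HDp S b b' \<Longrightarrow> HDp S (\<lambda>\<zeta>. a \<zeta> * b \<zeta>) (\<lambda>\<zeta>. a' \<zeta> * b \<zeta> + a \<zeta> * b' \<zeta>)"
  unfolding HDp_def ev_mult ev_add
proof (intro ballI allI)
  fix \<zeta> p assume *: "\<zeta> \<in> S"
    "\<forall>\<zeta>\<in>S. \<forall>p. ((\<lambda>\<zeta>. ev (a \<zeta>) p) has_field_derivative ev (a' \<zeta>) p) (at \<zeta>)"
    "\<forall>\<zeta>\<in>S. \<forall>p. ((\<lambda>\<zeta>. ev (b \<zeta>) p) has_field_derivative ev (b' \<zeta>) p) (at \<zeta>)"
  from DERIV_mult[OF bspec[OF *(2,1), THEN spec] bspec[OF *(3,1), THEN spec], of p p]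
  show "((\<lambda>\<zeta>. ev (a \<zeta>) p * ev (b \<zeta>) p) has_field_derivative ev (a' \<zeta>) p * ev (b \<zeta>) p + ev (a \<zeta>) p * ev (b' \<zeta>) p) (at \<zeta>)"
    by (simp add: mult.commute)
qed

lemma HDp_const: "HDp S (\<lambda>_. b) (\<lambda>_. 0)"
  by (auto simp: HDp_def)

lemma HDp_sum: "(\<And>i. i \<in> I \<Longrightarrow> HDp S (a i) (a' i)) \<Longrightarrow> HDp S (\<lambda>\<zeta>. \<Sum>i\<in>I. a i \<zeta>) (\<lambda>\<zeta>. \<Sum>i\<in>I. a' i \<zeta>)"
  by (induction I rule: infinite_finite_induct) (auto intro: HDp_add HDp_const)

lemma HDp_unique: "HDp S a a' \<Longrightarrow> HDp S a b' \<Longrightarrow> \<zeta> \<in> S \<Longrightarrow> a' \<zeta> = b' \<zeta>"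
  unfolding HDp_def by (rule pol_eqI) (blast intro: DERIV_unique)

lemma HDp_cong:
  assumes "open S" "\<And>\<zeta>. \<zeta> \<in> S \<Longrightarrow> a \<zeta> = b \<zeta>" "\<And>\<zeta>. \<zeta> \<in> S \<Longrightarrow> a' \<zeta> = b' \<zeta>" "HDp S a a'"
  shows "HDp S b b'"
  unfolding HDp_def
proof (intro ballI allI)
  fix \<zeta> p assume z: "\<zeta> \<in> S"
  have "((\<lambda>\<zeta>. ev (a \<zeta>) p) has_field_derivative ev (a' \<zeta>) p) (at \<zeta>)"
    using assms(4) z by (auto simp: HDp_def)
  from has_field_derivative_transform_within_open[OF this assms(1) z, of "\<lambda>\<zeta>. ev (b \<zeta>) p"]
  show "((\<lambda>\<zeta>. ev (b \<zeta>) p) has_field_derivative ev (b' \<zeta>) p) (at \<zeta>)"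
    using assms(2,3) z by simp
qed

lemma HDp_subset: "HDp S a a' \<Longrightarrow> T \<subseteq> S \<Longrightarrow> HDp T a a'"
  by (auto simp: HDp_def)

lemma HDp_scalar:
  assumes "\<And>\<zeta>. \<zeta> \<in> S \<Longrightarrow> (\<phi> has_field_derivative \<phi>' \<zeta>) (at \<zeta>)"
  shows "HDp S (\<lambda>\<zeta>. cst (\<phi> \<zeta>)) (\<lambda>\<zeta>. cst (\<phi>' \<zeta>))"
  using assms by (auto simp: HDp_def)

text \<open>In a finite sum of products of a scalar function and a fixed polynomial, the parameter
  derivative acts on the first factor and \<open>dpol\<close> on the second. Hence the two
  operations commute, which a merely pointwise notion of holomorphic family would not show.\<close>

lemma fhp_deriv:
  assumes S: "open S" and "fhp S a"
  shows "\<exists>a'. fhp S a' \<and> HDp S a a' \<and> (\<forall>i. HDp S (\<lambda>\<zeta>. dpol i (a \<zeta>)) (\<lambda>\<zeta>. dpol i (a' \<zeta>)))"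
  using assms(2)
proof induction
  case (base \<phi> a a0)
  have d: "HDp S (\<lambda>\<zeta>. cst (\<phi> \<zeta>)) (\<lambda>\<zeta>. cst (deriv \<phi> \<zeta>))"
    by (rule HDp_scalar) (rule holomorphic_derivI[OF base(1) S])
  have *: "HDp S (\<lambda>\<zeta>. cst (\<phi> \<zeta>) * b) (\<lambda>\<zeta>. cst (deriv \<phi> \<zeta>) * b)" for b :: "'a pol"
    by (rule HDp_cong[OF S refl _ HDp_mult[OF d HDp_const]]) simp
  show ?case
  proof (intro exI conjI allI)
    show "fhp S (\<lambda>\<zeta>. cst (deriv \<phi> \<zeta>) * a0)"
      by (intro fhp_mult fhp_const fhp_scalar holomorphic_deriv base S)
    show "HDp S a (\<lambda>\<zeta>. cst (deriv \<phi> \<zeta>) * a0)"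
      by (rule HDp_cong[OF S _ refl *]) (simp add: base(2))
    show "HDp S (\<lambda>\<zeta>. dpol i (a \<zeta>)) (\<lambda>\<zeta>. dpol i (cst (deriv \<phi> \<zeta>) * a0))" for i
      by (rule HDp_cong[OF S _ _ *[of "dpol i a0"]]) (simp_all add: base(2))
  qed
next
  case (add a b c)
  then obtain a' b' where ab: "fhp S a'" "HDp S a a'" "\<forall>i. HDp S (\<lambda>\<zeta>. dpol i (a \<zeta>)) (\<lambda>\<zeta>. dpol i (a' \<zeta>))"
    "fhp S b'" "HDp S b b'" "\<forall>i. HDp S (\<lambda>\<zeta>. dpol i (b \<zeta>)) (\<lambda>\<zeta>. dpol i (b' \<zeta>))" by blast
  show ?case
  proof (intro exI conjI allI)
    show "fhp S (\<lambda>\<zeta>. a' \<zeta> + b' \<zeta>)" by (rule fhp_add[OF ab(1,4)])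
    show "HDp S c (\<lambda>\<zeta>. a' \<zeta> + b' \<zeta>)"
      by (rule HDp_cong[OF S _ refl HDp_add[OF ab(2,5)]]) (simp add: add.hyps)
    show "HDp S (\<lambda>\<zeta>. dpol i (c \<zeta>)) (\<lambda>\<zeta>. dpol i (a' \<zeta> + b' \<zeta>))" for i
      by (rule HDp_cong[OF S _ _ HDp_add[OF ab(3)[rule_format] ab(6)[rule_format]]]) (simp_all add: add.hyps)
  qed
qed

lemma HDp_dpol:
  assumes "open S" "fhp S a" "HDp S a a'"
  shows "HDp S (\<lambda>\<zeta>. dpol i (a \<zeta>)) (\<lambda>\<zeta>. dpol i (a' \<zeta>))" "fhp S a'"
proof -
  obtain b where b: "fhp S b" "HDp S a b" "HDp S (\<lambda>\<zeta>. dpol i (a \<zeta>)) (\<lambda>\<zeta>. dpol i (b \<zeta>))"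
    using fhp_deriv[OF assms(1,2)] by blast
  have eq: "\<And>\<zeta>. \<zeta> \<in> S \<Longrightarrow> b \<zeta> = a' \<zeta>" using HDp_unique[OF b(2) assms(3)] .
  show "HDp S (\<lambda>\<zeta>. dpol i (a \<zeta>)) (\<lambda>\<zeta>. dpol i (a' \<zeta>))"
    by (rule HDp_cong[OF assms(1) refl _ b(3)]) (simp add: eq)
  show "fhp S a'" by (rule fhp_cong[OF b(1)]) (simp add: eq)
qed

lemma fhp_holomorphic: "fhp S a \<Longrightarrow> (\<lambda>\<zeta>. ev (a \<zeta>) p) holomorphic_on S"
proof (induction rule: fhp.induct)
  case (base \<phi> a a0)
  have "(\<lambda>\<zeta>. \<phi> \<zeta> * ev a0 p) holomorphic_on S" by (intro holomorphic_intros base)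
  then show ?case by (rule holomorphic_transform) (simp add: base(2))
next
  case (add a b c)
  have "(\<lambda>\<zeta>. ev (a \<zeta>) p + ev (b \<zeta>) p) holomorphic_on S" by (intro holomorphic_intros add.IH)
  then show ?case by (rule holomorphic_transform) (simp add: add.hyps)
qed

text \<open>On a convex domain each scalar factor has a single-valued primitive; a constant
  polynomial then adjusts the initial value.\<close>

lemma fhp_primitive:
  assumes S: "open S" "convex S" "\<zeta>0 \<in> S" and "fhp S f"
  shows "\<exists>F. fhp S F \<and> HDp S F f \<and> F \<zeta>0 = b"
proof -
  have "\<exists>F. fhp S F \<and> HDp S F f" using assms(4)
  proof induction
    case (base \<phi> a a0)
    obtain \<Phi> where "\<And>\<zeta>. \<zeta> \<in> S \<Longrightarrow> (\<Phi> has_field_derivative \<phi> \<zeta>) (at \<zeta> within S)"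
    proof (rule holomorphic_convex_primitive'[OF S(2,1) base(1)])
      fix g assume "\<And>x. x \<in> S \<Longrightarrow> (g has_field_derivative \<phi> x) (at x within S)"
      then show thesis by (rule that)
    qed
    note \<Phi>0 = this
    have \<Phi>: "(\<Phi> has_field_derivative \<phi> \<zeta>) (at \<zeta>)" if "\<zeta> \<in> S" for \<zeta>
      using \<Phi>0[OF that] by (simp only: at_within_open[OF that S(1)])
    have "\<Phi> holomorphic_on S"
      by (rule holomorphic_on_derivI[of S, OF \<Phi>])
    then have "fhp S (\<lambda>\<zeta>. cst (\<Phi> \<zeta>) * a0)" by (intro fhp_mult fhp_scalar fhp_const)
    moreover have "HDp S (\<lambda>\<zeta>. cst (\<Phi> \<zeta>) * a0) a"
      by (rule HDp_cong[OF S(1) refl _ HDp_mult[OF HDp_scalar[OF \<Phi>] HDp_const]]) (auto simp: base(2))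
    ultimately show ?case by blast
  next
    case (add a b c)
    then obtain A B where AB: "fhp S A" "HDp S A a" "fhp S B" "HDp S B b" by blast
    have "HDp S (\<lambda>\<zeta>. A \<zeta> + B \<zeta>) c"
      by (rule HDp_cong[OF S(1) refl _ HDp_add[OF AB(2,4)]]) (simp add: add.hyps)
    then show ?case using fhp_add[OF AB(1,3)] by blast
  qed
  then obtain F where F: "fhp S F" "HDp S F f" by blast
  have "HDp S (\<lambda>\<zeta>. F \<zeta> + (b - F \<zeta>0)) f"
    by (rule HDp_cong[OF S(1) refl _ HDp_add[OF F(2) HDp_const]]) simp
  then show ?thesis
    by (intro exI[of _ "\<lambda>\<zeta>. F \<zeta> + (b - F \<zeta>0)"] conjI fhp_add[OF F(1) fhp_const]) simp_all
qed

lemma fhp_divide: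
  assumes S: "open S" "\<zeta>1 \<in> S" and "fhp S a"
  shows "\<exists>a1. fhp S a1 \<and> (\<forall>\<zeta>\<in>S. a \<zeta> = a \<zeta>1 + cst (\<zeta> - \<zeta>1) * a1 \<zeta>)"
  using assms(3)
proof induction
  case (base \<phi> a a0)
  define \<psi> where "\<psi> \<zeta> = (if \<zeta> = \<zeta>1 then deriv \<phi> \<zeta>1 else (\<phi> \<zeta> - \<phi> \<zeta>1) / (\<zeta> - \<zeta>1))" for \<zeta>
  have "\<psi> holomorphic_on S"
    unfolding \<psi>_def[abs_def] by (rule pole_lemma_open[OF base(1) S(1)])
  then have "fhp S (\<lambda>\<zeta>. cst (\<psi> \<zeta>) * a0)" by (intro fhp_mult fhp_scalar fhp_const)
  moreover have "a \<zeta> = a \<zeta>1 + cst (\<zeta> - \<zeta>1) * (cst (\<psi> \<zeta>) * a0)" if "\<zeta> \<in> S" for \<zeta>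
  proof -
    have "\<phi> \<zeta> = \<phi> \<zeta>1 + (\<zeta> - \<zeta>1) * \<psi> \<zeta>" by (simp add: \<psi>_def)
    then have "cst (\<phi> \<zeta>) = cst (\<phi> \<zeta>1) + cst (\<zeta> - \<zeta>1) * cst (\<psi> \<zeta>)" by (simp only: cst_hom(3,4)[symmetric])
    note q = this
    have "cst (\<phi> \<zeta>) * a0 = cst (\<phi> \<zeta>1) * a0 + cst (\<zeta> - \<zeta>1) * (cst (\<psi> \<zeta>) * a0)"
      unfolding q by (simp only: distrib_right mult.assoc)
    then show ?thesis by (simp only: bspec[OF base(2) that] bspec[OF base(2) S(2)])
  qed
  ultimately show ?case by blast
next
  case (add a b c)
  then obtain a1 b1 where *: "fhp S a1" "\<forall>\<zeta>\<in>S. a \<zeta> = a \<zeta>1 + cst (\<zeta> - \<zeta>1) * a1 \<zeta>"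
    "fhp S b1" "\<forall>\<zeta>\<in>S. b \<zeta> = b \<zeta>1 + cst (\<zeta> - \<zeta>1) * b1 \<zeta>" by blast
  have "c \<zeta> = c \<zeta>1 + cst (\<zeta> - \<zeta>1) * (a1 \<zeta> + b1 \<zeta>)" if "\<zeta> \<in> S" for \<zeta>
  proof -
    have "c \<zeta> = (a \<zeta>1 + cst (\<zeta> - \<zeta>1) * a1 \<zeta>) + (b \<zeta>1 + cst (\<zeta> - \<zeta>1) * b1 \<zeta>)"
      by (simp only: bspec[OF *(2) that, symmetric] bspec[OF *(4) that, symmetric] bspec[OF add.hyps(3) that])
    also have "\<dots> = (a \<zeta>1 + b \<zeta>1) + cst (\<zeta> - \<zeta>1) * (a1 \<zeta> + b1 \<zeta>)"
      by (simp only: distrib_left add_ac)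
    also have "a \<zeta>1 + b \<zeta>1 = c \<zeta>1" by (simp only: bspec[OF add.hyps(3) S(2)])
    finally show ?thesis .
  qed
  then show ?case using fhp_add[OF *(1,3)] by blast
qed

section \<open>Power series with holomorphically varying coefficients\<close>

definition fh :: "complex set \<Rightarrow> (complex \<Rightarrow> ('n::finite) pol fps) \<Rightarrow> bool" where
  "fh S A \<longleftrightarrow> (\<forall>n. fhp S (\<lambda>\<zeta>. A \<zeta> $ n))"

definition HD :: "complex set \<Rightarrow> (complex \<Rightarrow> ('n::finite) pol fps) \<Rightarrow> (complex \<Rightarrow> 'n pol fps) \<Rightarrow> bool" where
  "HD S A A' \<longleftrightarrow> (\<forall>n. HDp S (\<lambda>\<zeta>. A \<zeta> $ n) (\<lambda>\<zeta>. A' \<zeta> $ n))"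

lemma fh_const [simp]: "fh S (\<lambda>_. b)" by (simp add: fh_def)

lemma fh_scalar: "\<phi> holomorphic_on S \<Longrightarrow> fh S (\<lambda>\<zeta>. fps_const (cst (\<phi> \<zeta>)))"
  unfolding fh_def
proof
  fix n assume "\<phi> holomorphic_on S"
  then show "fhp S (\<lambda>\<zeta>. fps_const (cst (\<phi> \<zeta>)) $ n)"
    by (cases "n = 0") (simp_all add: fhp_scalar)
qed

lemma fh_add: "fh S a \<Longrightarrow> fh S b \<Longrightarrow> fh S (\<lambda>\<zeta>. a \<zeta> + b \<zeta>)"
  by (auto simp: fh_def intro: fhp_add)

lemma fh_mult: "fh S a \<Longrightarrow> fh S b \<Longrightarrow> fh S (\<lambda>\<zeta>. a \<zeta> * b \<zeta>)"
  by (auto simp: fh_def fps_mult_nth intro!: fhp_sum fhp_mult)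

lemma fh_minus: "fh S a \<Longrightarrow> fh S (\<lambda>\<zeta>. - a \<zeta>)"
  by (auto simp: fh_def intro: fhp_minus)

lemma fh_diff: "fh S a \<Longrightarrow> fh S b \<Longrightarrow> fh S (\<lambda>\<zeta>. a \<zeta> - b \<zeta>)"
  using fh_add[OF _ fh_minus, of S a b] by simp

lemma fh_sum: "(\<And>i. i \<in> I \<Longrightarrow> fh S (a i)) \<Longrightarrow> fh S (\<lambda>\<zeta>. \<Sum>i\<in>I. a i \<zeta>)"
  by (induction I rule: infinite_finite_induct) (auto intro: fh_add)

lemma fh_dR: "fh S a \<Longrightarrow> fh S (\<lambda>\<zeta>. dR i (a \<zeta>))"
  by (auto simp: fh_def intro: fhp_dpol)

lemma fh_subset: "fh S a \<Longrightarrow> T \<subseteq> S \<Longrightarrow> fh T a"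
  by (auto simp: fh_def intro: fhp_subset)

lemma HD_cong:
  assumes "open S" "\<And>\<zeta>. \<zeta> \<in> S \<Longrightarrow> a \<zeta> = b \<zeta>" "\<And>\<zeta>. \<zeta> \<in> S \<Longrightarrow> a' \<zeta> = b' \<zeta>" "HD S a a'"
  shows "HD S b b'"
  unfolding HD_def
proof
  fix n
  show "HDp S (\<lambda>\<zeta>. b \<zeta> $ n) (\<lambda>\<zeta>. b' \<zeta> $ n)"
    by (rule HDp_cong[OF assms(1), of "\<lambda>\<zeta>. a \<zeta> $ n" _ "\<lambda>\<zeta>. a' \<zeta> $ n"])
      (use assms in \<open>simp_all add: HD_def\<close>)
qed

lemma HD_const: "HD S (\<lambda>_. b) (\<lambda>_. 0)" by (simp add: HD_def HDp_const)

lemma HD_scalar: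
  assumes "\<And>\<zeta>. \<zeta> \<in> S \<Longrightarrow> (\<phi> has_field_derivative \<phi>' \<zeta>) (at \<zeta>)"
  shows "HD S (\<lambda>\<zeta>. fps_const (cst (\<phi> \<zeta>))) (\<lambda>\<zeta>. fps_const (cst (\<phi>' \<zeta>)))"
  unfolding HD_def
proof
  fix n
  show "HDp S (\<lambda>\<zeta>. fps_const (cst (\<phi> \<zeta>)) $ n) (\<lambda>\<zeta>. fps_const (cst (\<phi>' \<zeta>)) $ n)"
    using HDp_scalar[OF assms] HDp_const[of S 0] by (cases "n = 0") simp_all
qed

lemma HD_add: "HD S a a' \<Longrightarrow> HD S b b' \<Longrightarrow> HD S (\<lambda>\<zeta>. a \<zeta> + b \<zeta>) (\<lambda>\<zeta>. a' \<zeta> + b' \<zeta>)"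
  by (auto simp: HD_def intro: HDp_add)

lemma HD_mult: "HD S a a' \<Longrightarrow> HD S b b' \<Longrightarrow> HD S (\<lambda>\<zeta>. a \<zeta> * b \<zeta>) (\<lambda>\<zeta>. a' \<zeta> * b \<zeta> + a \<zeta> * b' \<zeta>)"
  unfolding HD_def fps_mult_nth fps_add_nth sum.distrib[symmetric]
  by (auto intro!: HDp_sum HDp_mult)

lemma HD_minus: "HD S a a' \<Longrightarrow> HD S (\<lambda>\<zeta>. - a \<zeta>) (\<lambda>\<zeta>. - a' \<zeta>)"
  using HD_mult[OF HD_const[of S "-1"]] by simp

lemma HD_diff: "HD S a a' \<Longrightarrow> HD S b b' \<Longrightarrow> HD S (\<lambda>\<zeta>. a \<zeta> - b \<zeta>) (\<lambda>\<zeta>. a' \<zeta> - b' \<zeta>)"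
  using HD_add[OF _ HD_minus, of S a a' b b'] by simp

lemma HD_sum: "(\<And>i. i \<in> I \<Longrightarrow> HD S (a i) (a' i)) \<Longrightarrow> HD S (\<lambda>\<zeta>. \<Sum>i\<in>I. a i \<zeta>) (\<lambda>\<zeta>. \<Sum>i\<in>I. a' i \<zeta>)"
  by (induction I rule: infinite_finite_induct) (auto intro: HD_add HD_const)

lemma HD_subset: "HD S a a' \<Longrightarrow> T \<subseteq> S \<Longrightarrow> HD T a a'"
  by (auto simp: HD_def intro: HDp_subset)

lemma HD_dR:
  assumes "open S" "fh S a" "HD S a a'"
  shows "HD S (\<lambda>\<zeta>. dR i (a \<zeta>)) (\<lambda>\<zeta>. dR i (a' \<zeta>))" "fh S a'"
proof -
  have 1: "fhp S (\<lambda>\<zeta>. a \<zeta> $ n)" "HDp S (\<lambda>\<zeta>. a \<zeta> $ n) (\<lambda>\<zeta>. a' \<zeta> $ n)" for n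
    using assms(2,3) unfolding HD_def fh_def by blast+
  show "HD S (\<lambda>\<zeta>. dR i (a \<zeta>)) (\<lambda>\<zeta>. dR i (a' \<zeta>))" "fh S a'"
    unfolding HD_def fh_def dR_nth by (intro allI HDp_dpol[OF assms(1) 1])+
qed

lemma fh_deriv: "open S \<Longrightarrow> fh S a \<Longrightarrow> \<exists>a'. HD S a a'"
proof -
  assume *: "open S" "fh S a"
  have "\<exists>b. HDp S (\<lambda>\<zeta>. a \<zeta> $ n) b" for n
    using fhp_deriv[OF *(1) *(2)[unfolded fh_def, rule_format, of n]] by blast
  then obtain b where "\<And>n. HDp S (\<lambda>\<zeta>. a \<zeta> $ n) (b n)" by metis
  then show "\<exists>a'. HD S a a'" by (intro exI[of _ "\<lambda>\<zeta>. Abs_fps (\<lambda>n. b n \<zeta>)"]) (simp add: HD_def)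
qed

lemma fh_punctured:
  assumes S: "open S" "\<zeta>1 \<in> S" and "fh S G" "\<And>\<zeta>. \<zeta> \<in> S \<Longrightarrow> \<zeta> \<noteq> \<zeta>1 \<Longrightarrow> G \<zeta> = 0"
  shows "G \<zeta>1 = 0"
proof -
  have "ev (G \<zeta>1 $ n) p = 0" for n p
  proof -
    have "(\<lambda>\<zeta>. ev (G \<zeta> $ n) p) holomorphic_on S"
      using assms(3) by (auto simp: fh_def intro: fhp_holomorphic)
    then have "isCont (\<lambda>\<zeta>. ev (G \<zeta> $ n) p) \<zeta>1"
      using S continuous_on_eq_continuous_at holomorphic_on_imp_continuous_on by blast
    then have "((\<lambda>\<zeta>. ev (G \<zeta> $ n) p) \<longlongrightarrow> ev (G \<zeta>1 $ n) p) (at \<zeta>1)" by (simp add: isCont_def)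
    moreover have "\<forall>\<^sub>F \<zeta> in at \<zeta>1. ev (G \<zeta> $ n) p = 0"
      unfolding eventually_at_topological using S assms(4) by (intro exI[of _ S]) auto
    then have "((\<lambda>\<zeta>. ev (G \<zeta> $ n) p) \<longlongrightarrow> 0) (at \<zeta>1)" by (rule tendsto_eventually)
    ultimately show ?thesis using tendsto_unique[OF at_neq_bot] by blast
  qed
  then show ?thesis by (simp add: fps_eq_iff pol_eqI)
qed

lemma fh_divide:
  assumes S: "open S" "\<zeta>1 \<in> S" and "fh S C" "C \<zeta>1 = 0"
  shows "\<exists>C1. fh S C1 \<and> (\<forall>\<zeta>\<in>S. C \<zeta> = fps_const (cst (\<zeta> - \<zeta>1)) * C1 \<zeta>)"
proof -
  have "\<forall>n. \<exists>b. fhp S b \<and> (\<forall>\<zeta>\<in>S. C \<zeta> $ n = cst (\<zeta> - \<zeta>1) * b \<zeta>)"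
  proof
    fix n
    have "fhp S (\<lambda>\<zeta>. C \<zeta> $ n)" using assms(3) by (simp add: fh_def)
    from fhp_divide[OF S this] show "\<exists>b. fhp S b \<and> (\<forall>\<zeta>\<in>S. C \<zeta> $ n = cst (\<zeta> - \<zeta>1) * b \<zeta>)"
      by (simp add: assms(4))
  qed
  then obtain b where "\<And>n. fhp S (b n)" "\<And>n \<zeta>. \<zeta> \<in> S \<Longrightarrow> C \<zeta> $ n = cst (\<zeta> - \<zeta>1) * b n \<zeta>" by metis
  then show ?thesis
    by (intro exI[of _ "\<lambda>\<zeta>. Abs_fps (\<lambda>n. b n \<zeta>)"]) (auto simp: fh_def fps_eq_iff)
qed

text \<open>A nonzero function would split at \<open>\<zeta>1\<close> into a power of finite order
  \<open>n\<close> and a nonvanishing factor; divisibility by the power \<open>Suc n\<close> forces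
  that factor to vanish at \<open>\<zeta>1\<close>.\<close>

lemma holomorphic_infinite_order:
  assumes "open S" "connected S" "\<zeta>1 \<in> S" "f holomorphic_on S"
    and "\<And>k. \<exists>g. g holomorphic_on S \<and> (\<forall>\<zeta>\<in>S. f \<zeta> = (\<zeta> - \<zeta>1) ^ k * g \<zeta>)" and "\<zeta> \<in> S"
  shows "f \<zeta> = 0"
proof (rule ccontr)
  assume nz: "f \<zeta> \<noteq> 0"
  have f1: "f \<zeta>1 = 0" using assms(5)[of 1] assms(3) by auto
  have nc: "\<not> f constant_on S" using nz f1 assms(3,6) unfolding constant_on_def by metis
  obtain g r n where g: "0 < n" "0 < r" "ball \<zeta>1 r \<subseteq> S" "g holomorphic_on ball \<zeta>1 r"
    "\<And>w. w \<in> ball \<zeta>1 r \<Longrightarrow> f w = (w - \<zeta>1) ^ n * g w" "\<And>w. w \<in> ball \<zeta>1 r \<Longrightarrow> g w \<noteq> 0"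
  proof (rule holomorphic_factor_zero_nonconstant[OF assms(4,1,2,3) f1 nc])
    fix g r n assume "0 < n" "0 < r" "ball \<zeta>1 r \<subseteq> S" "g holomorphic_on ball \<zeta>1 r"
      "\<And>w. w \<in> ball \<zeta>1 r \<Longrightarrow> f w = (w - \<zeta>1) ^ n * g w" "\<And>w. w \<in> ball \<zeta>1 r \<Longrightarrow> g w \<noteq> 0"
    then show thesis by (rule that)
  qed
  obtain h where h: "h holomorphic_on S" "\<And>\<zeta>. \<zeta> \<in> S \<Longrightarrow> f \<zeta> = (\<zeta> - \<zeta>1) ^ Suc n * h \<zeta>"
    using assms(5)[of "Suc n"] by blast
  have eq: "g w = (w - \<zeta>1) * h w" if "w \<in> ball \<zeta>1 r" "w \<noteq> \<zeta>1" for w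
  proof -
    have "(w - \<zeta>1) ^ n * g w = (w - \<zeta>1) ^ n * ((w - \<zeta>1) * h w)"
      using g(5)[OF that(1)] h(2)[of w] that g(3) by (auto simp: mult_ac)
    then show ?thesis using that by simp
  qed
  have c1: "isCont g \<zeta>1"
    using holomorphic_on_imp_continuous_on[OF g(4)] g(2) by (simp add: continuous_on_eq_continuous_at)
  have c2: "isCont (\<lambda>w. (w - \<zeta>1) * h w) \<zeta>1"
    using holomorphic_on_imp_continuous_on[OF h(1)] assms(1,3)
    by (intro continuous_intros) (simp add: continuous_on_eq_continuous_at)
  have "((\<lambda>w. (w - \<zeta>1) * h w) \<longlongrightarrow> 0) (at \<zeta>1)" using c2 by (simp add: isCont_def)
  moreover have "\<forall>\<^sub>F w in at \<zeta>1. (w - \<zeta>1) * h w = g w"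
    unfolding eventually_at_topological using eq g(2) by (intro exI[of _ "ball \<zeta>1 r"]) auto
  ultimately have "(g \<longlongrightarrow> 0) (at \<zeta>1)" by (rule Lim_transform_eventually)
  then have "g \<zeta>1 = 0" using c1 tendsto_unique[OF at_neq_bot] by (auto simp: isCont_def)
  then show False using g(2,6) by auto
qed

lemma fh_infinite_order:
  assumes S: "open S" "connected S" "\<zeta>1 \<in> S" and C: "fh S C"
    and "\<And>k. \<exists>C1. fh S C1 \<and> (\<forall>\<zeta>\<in>S. C \<zeta> = fps_const (cst ((\<zeta> - \<zeta>1) ^ k)) * C1 \<zeta>)" and z: "\<zeta> \<in> S"
  shows "C \<zeta> = 0"
proof -
  have "ev (C \<zeta> $ n) p = 0" for n p
  proof (rule holomorphic_infinite_order[OF S _ _ z, of "\<lambda>\<zeta>. ev (C \<zeta> $ n) p"])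
    show "(\<lambda>\<zeta>. ev (C \<zeta> $ n) p) holomorphic_on S"
      using C by (auto simp: fh_def intro: fhp_holomorphic)
    fix k
    obtain C1 where "fh S C1" "\<forall>\<zeta>\<in>S. C \<zeta> = fps_const (cst ((\<zeta> - \<zeta>1) ^ k)) * C1 \<zeta>"
      using assms(5) by blast
    then show "\<exists>g. g holomorphic_on S \<and> (\<forall>\<zeta>\<in>S. ev (C \<zeta> $ n) p = (\<zeta> - \<zeta>1) ^ k * g \<zeta>)"
      by (intro exI[of _ "\<lambda>\<zeta>. ev (C1 \<zeta> $ n) p"]) (auto simp: fh_def intro: fhp_holomorphic)
  qed
  then show ?thesis by (simp add: fps_eq_iff pol_eqI)
qed

lemma dR_0 [simp]: "dR i 0 = 0" by (simp add: fps_eq_iff)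

lemma dR_scalar [simp]: "dR i (fps_const (cst c)) = 0" by (simp add: fps_eq_iff)

lemma HDp_cmult: "HDp S a a' \<Longrightarrow> HDp S (\<lambda>\<zeta>. b * a \<zeta>) (\<lambda>\<zeta>. b * a' \<zeta>)"
  by (auto simp: HDp_def intro: DERIV_cmult)

text \<open>The expansion centre moves along a complex line while the coefficients stay polynomials
  in the rescaled variables. The recursion of \<open>tc\<close> reduces the claim to order 0, where
  it is the chain rule; symmetry of mixed derivatives lets the direction \<open>v\<close> pass
  through the recursion.\<close>

lemma tc_family:
  assumes S: "open S" and c: "\<And>\<zeta>. \<zeta> \<in> S \<Longrightarrow> (c has_field_derivative c' \<zeta>) (at \<zeta>)"
    and U: "open U" "\<And>\<zeta>. \<zeta> \<in> S \<Longrightarrow> z0 + cscale (c \<zeta>) v \<in> U" and g: "scv_holomorphic_on g U"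
  shows "fhp S (\<lambda>\<zeta>. tc n g (z0 + cscale (c \<zeta>) v)) \<and>
    HDp S (\<lambda>\<zeta>. tc n g (z0 + cscale (c \<zeta>) v)) (\<lambda>\<zeta>. cst (c' \<zeta>) * tc n (dir g v) (z0 + cscale (c \<zeta>) v))"
  using g
proof (induction n arbitrary: g rule: less_induct)
  case (less n)
  define Z where "Z \<zeta> = z0 + cscale (c \<zeta>) v" for \<zeta>
  show ?case
  proof (cases "n = 0")
    case True
    have d: "((\<lambda>\<zeta>. g (Z \<zeta>)) has_field_derivative c' \<zeta> * dir g v (Z \<zeta>)) (at \<zeta>)" if "\<zeta> \<in> S" for \<zeta>
    proof -
      have "(Z has_derivative (\<lambda>h. cscale h (cscale (c' \<zeta>) v))) (at \<zeta>)"
        unfolding Z_def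
      proof (rule has_derivative_eq_rhs[OF has_derivative_add[OF has_derivative_const
            bounded_linear.has_derivative[OF bounded_linear_cscale c[OF that, unfolded has_field_derivative_def]]]])
        show "(\<lambda>x. 0 + cscale (c' \<zeta> * x) v) = (\<lambda>h. cscale h (cscale (c' \<zeta>) v))"
          by (simp add: cscale_add mult.commute)
      qed
      moreover have "Z \<zeta> \<in> U" using U(2)[OF that] by (simp add: Z_def)
      ultimately show ?thesis
        using scv_chain[OF less.prems] scv_derivative(2)[OF less.prems] by metis
    qed
    have "(\<lambda>\<zeta>. g (Z \<zeta>)) holomorphic_on S" by (rule holomorphic_on_derivI[OF d])
    then have 1: "fhp S (\<lambda>\<zeta>. cst (g (Z \<zeta>)))" by (rule fhp_scalar)
    have 2: "HDp S (\<lambda>\<zeta>. cst (g (Z \<zeta>))) (\<lambda>\<zeta>. cst (c' \<zeta> * dir g v (Z \<zeta>)))" by (rule HDp_scalar[OF d])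
    show ?thesis using True 1 2 by (simp add: tc_0 Z_def cst_hom)
  next
    case False
    have IH: "fhp S (\<lambda>\<zeta>. tc m (dir g w) (Z \<zeta>))"
      "HDp S (\<lambda>\<zeta>. tc m (dir g w) (Z \<zeta>)) (\<lambda>\<zeta>. cst (c' \<zeta>) * tc m (dir (dir g w) v) (Z \<zeta>))" if "m < n" for m w
      using less.IH[OF that dir_holomorphic(1)[OF less.prems U(1)]] by (auto simp: Z_def)
    have sw: "tc m (dir (dir g w) v) (Z \<zeta>) = tc m (dir (dir g v) w) (Z \<zeta>)" if "\<zeta> \<in> S" for m w \<zeta>
      by (rule tc_cong[OF U(1)]) (use U(2)[OF that] dir_holomorphic(2)[OF less.prems U(1)] in \<open>auto simp: Z_def\<close>)
    have t: "fhp S (\<lambda>\<zeta>. if wt i \<le> n then cst (of_nat (wt i)) * pvar i * tc (n - wt i) (dir g (bas i)) (Z \<zeta>) else 0)" for i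
      using False by (cases "wt i \<le> n") (auto intro!: fhp_mult fhp_const IH)
    have t3: "fhp S (\<lambda>\<zeta>. if 3 \<le> n then cst 3 * tc (n - 3) (dir g (0, 1)) (Z \<zeta>) else 0)"
      using False by (cases "3 \<le> n") (auto intro!: fhp_mult fhp_const IH)
    have 1: "fhp S (\<lambda>\<zeta>. tc n g (Z \<zeta>))"
      unfolding tc.simps[of n g] using False by (simp, intro fhp_mult fhp_const fhp_add fhp_sum t t3)
    have h: "HDp S (\<lambda>\<zeta>. if wt i \<le> n then cst (of_nat (wt i)) * pvar i * tc (n - wt i) (dir g (bas i)) (Z \<zeta>) else 0)
       (\<lambda>\<zeta>. if wt i \<le> n then cst (of_nat (wt i)) * pvar i * (cst (c' \<zeta>) * tc (n - wt i) (dir (dir g (bas i)) v) (Z \<zeta>)) else 0)" for i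
      using False by (cases "wt i \<le> n") (auto intro!: HDp_cmult HDp_const IH)
    have h3: "HDp S (\<lambda>\<zeta>. if 3 \<le> n then cst 3 * tc (n - 3) (dir g (0, 1)) (Z \<zeta>) else 0)
       (\<lambda>\<zeta>. if 3 \<le> n then cst 3 * (cst (c' \<zeta>) * tc (n - 3) (dir (dir g (0, 1)) v) (Z \<zeta>)) else 0)"
      using False by (cases "3 \<le> n") (auto intro!: HDp_cmult HDp_const IH)
    have "HDp S (\<lambda>\<zeta>. tc n g (Z \<zeta>)) (\<lambda>\<zeta>. cst (c' \<zeta>) * tc n (dir g v) (Z \<zeta>))"
    proof (rule HDp_cong[OF S _ _ HDp_cmult[OF HDp_add[OF HDp_sum[OF h] h3], where b = "cst (1 / of_nat n)"]])
      fix \<zeta> assume z: "\<zeta> \<in> S"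
      show "cst (1 / of_nat n) * ((\<Sum>i\<in>UNIV. if wt i \<le> n then cst (of_nat (wt i)) * pvar i * tc (n - wt i) (dir g (bas i)) (Z \<zeta>) else 0)
        + (if 3 \<le> n then cst 3 * tc (n - 3) (dir g (0, 1)) (Z \<zeta>) else 0)) = tc n g (Z \<zeta>)"
        using False by (simp add: tc.simps[of n g])
      show "cst (1 / of_nat n) * ((\<Sum>i\<in>UNIV. if wt i \<le> n then cst (of_nat (wt i)) * pvar i * (cst (c' \<zeta>) * tc (n - wt i) (dir (dir g (bas i)) v) (Z \<zeta>)) else 0)
        + (if 3 \<le> n then cst 3 * (cst (c' \<zeta>) * tc (n - 3) (dir (dir g (0, 1)) v) (Z \<zeta>)) else 0)) = cst (c' \<zeta>) * tc n (dir g v) (Z \<zeta>)"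
        unfolding tc.simps[of n "dir g v"] sw[OF z] using False
        by (simp add: distrib_left sum_distrib_left if_distrib[of "(*) _"] mult_ac cong: if_cong)
    qed
    with 1 show ?thesis by (simp add: Z_def)
  qed
qed

lemma tay_family:
  assumes S: "open S" and c: "\<And>\<zeta>. \<zeta> \<in> S \<Longrightarrow> (c has_field_derivative c' \<zeta>) (at \<zeta>)"
    and U: "open U" "\<And>\<zeta>. \<zeta> \<in> S \<Longrightarrow> z0 + cscale (c \<zeta>) v \<in> U" and g: "scv_holomorphic_on g U"
  shows "fh S (\<lambda>\<zeta>. tay (z0 + cscale (c \<zeta>) v) g)"
    and "HD S (\<lambda>\<zeta>. tay (z0 + cscale (c \<zeta>) v) g) (\<lambda>\<zeta>. fps_const (cst (c' \<zeta>)) * tay (z0 + cscale (c \<zeta>) v) (dir g v))"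
  using tc_family[OF assms] by (auto simp: fh_def HD_def)

section \<open>Linear transport along a path\<close>

definition prim :: "complex set \<Rightarrow> complex \<Rightarrow> ('n::finite) pol \<Rightarrow> (complex \<Rightarrow> 'n pol) \<Rightarrow> complex \<Rightarrow> 'n pol" where
  "prim S \<zeta>0 b f = (SOME F. fhp S F \<and> HDp S F f \<and> F \<zeta>0 = b)"

text \<open>Coefficients of the solution of \<open>J' + L J = 0\<close> with \<open>J \<zeta>0 = a\<close>. The recursion is well founded because
  \<open>\<kappa>\<close> has no constant term.\<close>

function solc :: "complex set \<Rightarrow> complex \<Rightarrow> (complex \<Rightarrow> 'n \<Rightarrow> ('n::finite) pol fps) \<Rightarrow> 'n pol fps \<Rightarrow> nat \<Rightarrow> complex \<Rightarrow> 'n pol" where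
  "solc S \<zeta>0 \<kappa> a n = prim S \<zeta>0 (a $ n)
     (\<lambda>\<zeta>. - (\<Sum>m\<in>UNIV. \<Sum>i\<in>{1..n}. \<kappa> \<zeta> m $ i * dpol m (solc S \<zeta>0 \<kappa> a (n - i) \<zeta>)))"
  by auto
termination
  by (relation "Wellfounded.measure (\<lambda>(S, \<zeta>0, \<kappa>, a, n). n)") auto

declare solc.simps [simp del]

text \<open>\<open>\<kappa>\<close> is a time-dependent formal vector field in the rescaled
  variables. Its vanishing at order 0 makes the transport equation triangular in powers of \<mu>,
  and convexity of the parameter domain lets each order be integrated.\<close>

locale transport =
  fixes S :: "complex set" and \<kappa> :: "complex \<Rightarrow> 'n \<Rightarrow> ('n::finite) pol fps"
  assumes S_open: "open S" and S_convex: "convex S"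
    and \<kappa>_fh: "\<And>m. fh S (\<lambda>\<zeta>. \<kappa> \<zeta> m)"
    and \<kappa>_0: "\<And>\<zeta> m. \<zeta> \<in> S \<Longrightarrow> \<kappa> \<zeta> m $ 0 = 0"
begin

definition L :: "complex \<Rightarrow> 'n pol fps \<Rightarrow> 'n pol fps" where
  "L \<zeta> A = (\<Sum>m\<in>UNIV. \<kappa> \<zeta> m * dR m A)"

lemma L_add: "L \<zeta> (A + B) = L \<zeta> A + L \<zeta> B"
  by (simp add: L_def dR_add distrib_left sum.distrib)

lemma L_diff: "L \<zeta> (A - B) = L \<zeta> A - L \<zeta> B"
  using L_add[of \<zeta> "A - B" B] by simp

lemma L_mult: "L \<zeta> (A * B) = L \<zeta> A * B + A * L \<zeta> B"
  unfolding L_def dR_mult distrib_left sum.distrib sum_distrib_left sum_distrib_right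
  by (simp add: mult_ac)

lemma L_scalar [simp]: "L \<zeta> (fps_const (cst c)) = 0" by (simp add: L_def)
lemma L_0 [simp]: "L \<zeta> 0 = 0" by (simp add: L_def)
lemma L_X [simp]: "L \<zeta> (fps_X ^ k) = 0" by (simp add: L_def)

lemma L_nth:
  assumes "\<zeta> \<in> S"
  shows "L \<zeta> A $ n = (\<Sum>m\<in>UNIV. \<Sum>i\<in>{1..n}. \<kappa> \<zeta> m $ i * dpol m (A $ (n - i)))"
proof -
  have "(\<Sum>i=0..n. \<kappa> \<zeta> m $ i * dpol m (A $ (n - i))) = (\<Sum>i\<in>{1..n}. \<kappa> \<zeta> m $ i * dpol m (A $ (n - i)))" for m
    using \<kappa>_0[OF assms] by (simp add: sum.atLeast_Suc_atMost)
  then show ?thesis by (simp add: L_def fps_sum_nth fps_mult_nth)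
qed

lemma L_fh: "T \<subseteq> S \<Longrightarrow> fh T A \<Longrightarrow> fh T (\<lambda>\<zeta>. L \<zeta> (A \<zeta>))"
  unfolding L_def by (intro fh_sum fh_mult fh_dR fh_subset[OF \<kappa>_fh])

text \<open>Such a \<open>J\<close> is constant along the formal flow of \<open>\<kappa>\<close>.
  Because \<open>L\<close> is a derivation, products of solutions are solutions, which later makes
  the monodromy multiplicative.\<close>

definition sol :: "(complex \<Rightarrow> 'n pol fps) \<Rightarrow> bool" where
  "sol J \<longleftrightarrow> fh S J \<and> HD S J (\<lambda>\<zeta>. - L \<zeta> (J \<zeta>))"

lemma sol_exists:
  assumes z0: "\<zeta>0 \<in> S"
  shows "\<exists>J. sol J \<and> J \<zeta>0 = a"
proof -
  define J where "J \<zeta> = Abs_fps (\<lambda>n. solc S \<zeta>0 \<kappa> a n \<zeta>)" for \<zeta>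
  have main: "fhp S (\<lambda>\<zeta>. J \<zeta> $ n) \<and> HDp S (\<lambda>\<zeta>. J \<zeta> $ n)
     (\<lambda>\<zeta>. - (\<Sum>m\<in>UNIV. \<Sum>i\<in>{1..n}. \<kappa> \<zeta> m $ i * dpol m (J \<zeta> $ (n - i)))) \<and> J \<zeta>0 $ n = a $ n" for n
  proof (induction n rule: less_induct)
    case (less n)
    define f where "f \<zeta> = - (\<Sum>m\<in>UNIV. \<Sum>i\<in>{1..n}. \<kappa> \<zeta> m $ i * dpol m (J \<zeta> $ (n - i)))" for \<zeta>
    have "fhp S f"
      unfolding f_def
    proof (intro fhp_minus fhp_sum fhp_mult fhp_dpol)
      show "fhp S (\<lambda>\<zeta>. \<kappa> \<zeta> m $ i)" for m i using \<kappa>_fh[of m] by (simp add: fh_def)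
      show "fhp S (\<lambda>\<zeta>. J \<zeta> $ (n - i))" if "i \<in> {1..n}" for i
        using less[of "n - i"] that by auto
    qed
    from fhp_primitive[OF S_open S_convex z0 this, of "a $ n"]
    have "fhp S (prim S \<zeta>0 (a $ n) f) \<and> HDp S (prim S \<zeta>0 (a $ n) f) f \<and> prim S \<zeta>0 (a $ n) f \<zeta>0 = a $ n"
      unfolding prim_def by (rule someI_ex)
    moreover have "(\<lambda>\<zeta>. J \<zeta> $ n) = prim S \<zeta>0 (a $ n) f"
      unfolding J_def f_def by (simp add: solc.simps[of S \<zeta>0 \<kappa> a n])
    moreover from this have "J \<zeta>0 $ n = prim S \<zeta>0 (a $ n) f \<zeta>0" by (rule fun_cong)
    ultimately show ?case by (simp only: f_def[abs_def])
  qed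
  have "HD S J (\<lambda>\<zeta>. - L \<zeta> (J \<zeta>))"
    unfolding HD_def
  proof
    fix n
    show "HDp S (\<lambda>\<zeta>. J \<zeta> $ n) (\<lambda>\<zeta>. (- L \<zeta> (J \<zeta>)) $ n)"
      by (rule HDp_cong[OF S_open refl _ main[of n, THEN conjunct2, THEN conjunct1]]) (simp add: L_nth)
  qed
  moreover have "fh S J" using main by (simp add: fh_def)
  moreover have "J \<zeta>0 = a" using main by (simp add: fps_eq_iff)
  ultimately show ?thesis unfolding sol_def by blast
qed

lemma HDp_zero_const:
  assumes "HDp S b (\<lambda>_. 0)" "\<zeta>0 \<in> S" "\<zeta> \<in> S"
  shows "b \<zeta> = b \<zeta>0"
proof (rule pol_eqI)
  fix p
  have "\<exists>c. \<forall>x\<in>S. ev (b x) p = c"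
    by (rule has_field_derivative_zero_constant[OF S_convex])
      (use assms(1) in \<open>auto simp: HDp_def intro: has_field_derivative_at_within\<close>)
  then show "ev (b \<zeta>) p = ev (b \<zeta>0) p" using assms by auto
qed

text \<open>\<open>L\<close> raises the order in \<mu>, so the lowest coefficient of a solution has
  derivative zero. This gives uniqueness, and also that transport is the identity modulo higher
  order.\<close>

lemma sol_const_coeff:
  fixes J :: "complex \<Rightarrow> 'n pol fps"
  assumes J: "sol J" and lo: "\<And>m. m < n \<Longrightarrow> J \<zeta>0 $ m = 0" and z: "\<zeta>0 \<in> S" "\<zeta> \<in> S"
  shows "J \<zeta> $ n = J \<zeta>0 $ n"
  using lo z(2)
proof (induction n arbitrary: \<zeta> rule: less_induct)
  case (less n)
  have zero: "J \<zeta> $ m = 0" if "m < n" "\<zeta> \<in> S" for m \<zeta>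
    using less.IH[OF that(1) _ that(2)] less.prems(1) that(1) by simp
  have "HDp S (\<lambda>\<zeta>. J \<zeta> $ n) (\<lambda>\<zeta>. 0)"
  proof (rule HDp_cong[OF S_open refl])
    show "HDp S (\<lambda>\<zeta>. J \<zeta> $ n) (\<lambda>\<zeta>. (- L \<zeta> (J \<zeta>)) $ n)" using J by (simp add: sol_def HD_def)
    show "(- L \<zeta> (J \<zeta>)) $ n = 0" if "\<zeta> \<in> S" for \<zeta>
      using that by (simp add: L_nth zero)
  qed
  from HDp_zero_const[OF this z(1) less.prems(2)] show ?case .
qed

lemma sol_unique:
  assumes "sol J" "J \<zeta>0 = 0" "\<zeta>0 \<in> S" "\<zeta> \<in> S"
  shows "J \<zeta> = 0"
  using sol_const_coeff[OF assms(1) _ assms(3,4)] assms(2) by (simp add: fps_eq_iff)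

lemma sol_add: "sol J \<Longrightarrow> sol J' \<Longrightarrow> sol (\<lambda>\<zeta>. J \<zeta> + J' \<zeta>)"
  unfolding sol_def
  using HD_add[of S J "\<lambda>\<zeta>. - L \<zeta> (J \<zeta>)" J' "\<lambda>\<zeta>. - L \<zeta> (J' \<zeta>)"]
  by (simp add: fh_add L_add)

lemma sol_mult: "sol J \<Longrightarrow> sol J' \<Longrightarrow> sol (\<lambda>\<zeta>. J \<zeta> * J' \<zeta>)"
  unfolding sol_def
  using HD_mult[of S J "\<lambda>\<zeta>. - L \<zeta> (J \<zeta>)" J' "\<lambda>\<zeta>. - L \<zeta> (J' \<zeta>)"]
  by (simp add: fh_mult L_mult)

lemma sol_constant: "(\<And>\<zeta>. L \<zeta> b = 0) \<Longrightarrow> sol (\<lambda>_. b)"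
  unfolding sol_def by (simp add: HD_const)

lemma sol_eq:
  assumes "sol J" "sol J'" "J \<zeta>0 = J' \<zeta>0" "\<zeta>0 \<in> S" "\<zeta> \<in> S"
  shows "J \<zeta> = J' \<zeta>"
proof -
  have "sol (\<lambda>\<zeta>. - 1 * J' \<zeta>)"
  proof -
    have s: "sol (\<lambda>_. fps_const (cst (- 1)))" by (rule sol_constant) simp
    have e: "fps_const (cst (- 1)) = (- 1 :: 'n pol fps)"
      by (simp add: cst_hom flip: fps_const_neg)
    from sol_mult[OF s assms(2)] show ?thesis by (simp only: e)
  qed
  from sol_unique[OF sol_add[OF assms(1) this] _ assms(4,5)] assms(3) show ?thesis by simp
qed

text \<open>\<open>eq\<close> says, with denominators cleared, that \<open>A / B\<close> solves the
  transport equation; so does \<open>Jy / Jd\<close>. Since \<open>B\<close> need not be a unit,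
  order-by-order uniqueness does not apply to \<open>C = A * Jd - Jy * B\<close>, which satisfies
  only \<open>(C' + L C) * B = C * (B' + L B)\<close>. Instead \<open>C\<close> is shown to vanish
  at \<open>\<zeta>1\<close> to infinite order in \<zeta>.\<close>

lemma quotient_propagation:
  assumes T: "open T" "connected T" "T \<subseteq> S" "\<zeta>1 \<in> T"
    and A: "fh T A" "HD T A A'" and B: "fh T B" "HD T B B'"
    and eq: "\<And>\<zeta>. \<zeta> \<in> T \<Longrightarrow> (A' \<zeta> + L \<zeta> (A \<zeta>)) * B \<zeta> = A \<zeta> * (B' \<zeta> + L \<zeta> (B \<zeta>))"
    and J: "sol Jy" "sol Jd" and B1: "B \<zeta>1 \<noteq> 0" and start: "A \<zeta>1 * Jd \<zeta>1 = Jy \<zeta>1 * B \<zeta>1"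
    and z: "\<zeta> \<in> T"
  shows "A \<zeta> * Jd \<zeta> = Jy \<zeta> * B \<zeta>"
proof -
  define C where "C \<zeta> = A \<zeta> * Jd \<zeta> - Jy \<zeta> * B \<zeta>" for \<zeta>
  define C' where "C' \<zeta> = (A' \<zeta> * Jd \<zeta> + A \<zeta> * (- L \<zeta> (Jd \<zeta>))) - ((- L \<zeta> (Jy \<zeta>)) * B \<zeta> + Jy \<zeta> * B' \<zeta>)" for \<zeta>
  define FB where "FB \<zeta> = B' \<zeta> + L \<zeta> (B \<zeta>)" for \<zeta>
  have JT: "fh T Jy" "fh T Jd" "HD T Jy (\<lambda>\<zeta>. - L \<zeta> (Jy \<zeta>))" "HD T Jd (\<lambda>\<zeta>. - L \<zeta> (Jd \<zeta>))"
    using J fh_subset[OF _ T(3)] HD_subset[OF _ T(3)] by (auto simp: sol_def)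
  have C: "fh T C" "HD T C C'"
    unfolding C_def[abs_def] C'_def[abs_def]
    by (intro fh_diff fh_mult A B JT) (intro HD_diff HD_mult A B JT)
  have fFB: "fh T FB"
    unfolding FB_def[abs_def] by (intro fh_add HD_dR(2)[OF T(1) B] L_fh[OF T(3)] B)
  have CF: "(C' \<zeta> + L \<zeta> (C \<zeta>)) * B \<zeta> = C \<zeta> * FB \<zeta>" if "\<zeta> \<in> T" for \<zeta>
  proof -
    have "C' \<zeta> + L \<zeta> (C \<zeta>) = (A' \<zeta> + L \<zeta> (A \<zeta>)) * Jd \<zeta> - Jy \<zeta> * FB \<zeta>"
      by (simp add: C_def C'_def FB_def L_diff L_mult algebra_simps)
    then have "(C' \<zeta> + L \<zeta> (C \<zeta>)) * B \<zeta> = ((A' \<zeta> + L \<zeta> (A \<zeta>)) * B \<zeta>) * Jd \<zeta> - Jy \<zeta> * FB \<zeta> * B \<zeta>"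
      by (simp only: left_diff_distrib right_diff_distrib mult_ac)
    also have "\<dots> = C \<zeta> * FB \<zeta>"
      unfolding eq[OF that] by (simp add: C_def FB_def algebra_simps)
    finally show ?thesis .
  qed
  define q where "q k \<zeta> = fps_const (cst ((\<zeta> - \<zeta>1) ^ k) :: 'n pol)" for k \<zeta>
  have qS: "q (Suc k) \<zeta> = q 1 \<zeta> * q k \<zeta>" for k \<zeta> by (simp add: q_def cst_hom)
  have q_fh: "fh T (q k)" for k
    unfolding q_def[abs_def] by (intro fh_scalar holomorphic_intros)
  have q_HD: "HD T (q (Suc k)) (\<lambda>\<zeta>. of_nat (Suc k) * q k \<zeta>)" for k
  proof -
    have "HD T (q (Suc k)) (\<lambda>\<zeta>. fps_const (cst (of_nat (Suc k) * (\<zeta> - \<zeta>1) ^ k)))"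
      unfolding q_def[abs_def] 
    proof (rule HD_scalar)
      fix \<zeta>
      show "((\<lambda>\<zeta>. (\<zeta> - \<zeta>1) ^ Suc k) has_field_derivative of_nat (Suc k) * (\<zeta> - \<zeta>1) ^ k) (at \<zeta>)"
        by (rule DERIV_cong[OF DERIV_power_Suc[where f = "\<lambda>\<zeta>. \<zeta> - \<zeta>1" and D = 1]])
          (auto intro!: derivative_eq_intros)
    qed
    moreover have "fps_const (cst (of_nat (Suc k) * (\<zeta> - \<zeta>1) ^ k)) = of_nat (Suc k) * q k \<zeta>" for \<zeta>
      by (simp only: q_def cst_hom fps_of_nat[symmetric] fps_const_mult)
    ultimately show ?thesis by simp
  qed
  have "\<exists>C1. fh T C1 \<and> (\<forall>\<zeta>\<in>T. C \<zeta> = q k \<zeta> * C1 \<zeta>)" for k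
  proof (induction k)
    case 0
    show ?case using C(1) by (intro exI[of _ C]) (simp add: q_def cst_hom)
  next
    case (Suc k)
    then obtain D where D: "fh T D" "\<And>\<zeta>. \<zeta> \<in> T \<Longrightarrow> C \<zeta> = q k \<zeta> * D \<zeta>" by blast
    have "D \<zeta>1 = 0"
    proof (cases k)
      case 0
      then show ?thesis using D(2)[OF T(4)] start by (simp add: C_def q_def cst_hom)
    next
      case (Suc j)
      obtain D' where D': "HD T D D'" using fh_deriv[OF T(1) D(1)] by blast
      \<comment> \<open>Inserting \<open>C = q k * D\<close> into \<open>CF\<close> and cancelling
        \<open>q j\<close> leaves \<open>G = 0\<close> away from \<open>\<zeta>1\<close>, and by
        continuity also there. At \<open>\<zeta>1\<close> only \<open>k * D * B\<close> survives, so
        \<open>D\<close> vanishes because \<open>B\<close> does not and the characteristic is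
        zero.\<close>
      define G where "G \<zeta> = of_nat k * D \<zeta> * B \<zeta> + q 1 \<zeta> * (D' \<zeta> + L \<zeta> (D \<zeta>)) * B \<zeta> - q 1 \<zeta> * D \<zeta> * FB \<zeta>" for \<zeta>
      have "fh T G"
        unfolding G_def[abs_def]
        by (intro fh_diff fh_add fh_mult fh_const q_fh D(1) B(1) fFB HD_dR(2)[OF T(1) D(1) D'] L_fh[OF T(3)])
      moreover have "G \<zeta> = 0" if zT: "\<zeta> \<in> T" and ne: "\<zeta> \<noteq> \<zeta>1" for \<zeta>
      proof -
        have HD2: "HD T C (\<lambda>\<zeta>. of_nat k * q j \<zeta> * D \<zeta> + q k \<zeta> * D' \<zeta>)"
        proof (rule HD_cong[OF T(1) _ refl])
          show "HD T (\<lambda>\<zeta>. q k \<zeta> * D \<zeta>) (\<lambda>\<zeta>. of_nat k * q j \<zeta> * D \<zeta> + q k \<zeta> * D' \<zeta>)"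
            unfolding Suc by (rule HD_mult[OF q_HD D'])
        qed (simp add: D(2))
        have C'eq: "C' \<zeta> = of_nat k * q j \<zeta> * D \<zeta> + q k \<zeta> * D' \<zeta>"
          using C(2) HD2 HDp_unique[OF _ _ zT] unfolding HD_def fps_eq_iff by blast
        have "L \<zeta> (C \<zeta>) = q k \<zeta> * L \<zeta> (D \<zeta>)"
          unfolding D(2)[OF zT] L_mult by (simp add: q_def)
        with CF[OF zT] C'eq D(2)[OF zT]
        have "(of_nat k * q j \<zeta> * D \<zeta> + q k \<zeta> * D' \<zeta> + q k \<zeta> * L \<zeta> (D \<zeta>)) * B \<zeta> - q k \<zeta> * D \<zeta> * FB \<zeta> = 0"
          by simp
        moreover have "(of_nat k * q j \<zeta> * D \<zeta> + q k \<zeta> * D' \<zeta> + q k \<zeta> * L \<zeta> (D \<zeta>)) * B \<zeta> - q k \<zeta> * D \<zeta> * FB \<zeta> = q j \<zeta> * G \<zeta>"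
          unfolding Suc qS[of j] G_def by (simp only: distrib_left distrib_right right_diff_distrib mult_ac add_ac)
        moreover have "q j \<zeta> \<noteq> 0" using ne by (simp add: q_def)
        ultimately show ?thesis by simp
      qed
      ultimately have "G \<zeta>1 = 0" by (rule fh_punctured[OF T(1,4)])
      then have "of_nat k * D \<zeta>1 * B \<zeta>1 = 0" by (simp add: G_def q_def cst_hom)
      then show ?thesis using B1 Suc by (simp del: of_nat_Suc)
    qed
    from fh_divide[OF T(1,4) D(1) this] obtain D1 where
      D1: "fh T D1" "\<And>\<zeta>. \<zeta> \<in> T \<Longrightarrow> D \<zeta> = fps_const (cst (\<zeta> - \<zeta>1)) * D1 \<zeta>" by blast
    have "C \<zeta> = q (Suc k) \<zeta> * D1 \<zeta>" if "\<zeta> \<in> T" for \<zeta>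
      using D(2)[OF that] D1(2)[OF that] by (simp add: qS[of k] mult_ac) (simp add: q_def mult_ac)
    with D1(1) show ?case by blast
  qed
  from fh_infinite_order[OF T(1,2,4) C(1) this[unfolded q_def] z]
  show ?thesis by (simp add: C_def)
qed

end

section \<open>Linear algebra and derivations over a field\<close>

definition lin_indep :: "(nat \<Rightarrow> 'a::field ^ 'n) \<Rightarrow> nat set \<Rightarrow> bool" where
  "lin_indep v J \<longleftrightarrow> (\<forall>c. (\<Sum>j\<in>J. c j *s v j) = 0 \<longrightarrow> (\<forall>j\<in>J. c j = 0))"

text \<open>A family completed to a square matrix by unit rows, so that independence becomes the
  nonvanishing of a determinant.\<close>

definition rowmat :: "(nat \<Rightarrow> 'a::comm_ring_1 ^ 'n) \<Rightarrow> ('n \<Rightarrow> nat + 'n) \<Rightarrow> 'a ^ 'n ^ 'n" where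
  "rowmat v r = (\<chi> i. case r i of Inl j \<Rightarrow> v j | Inr k \<Rightarrow> axis k 1)"

lemma lin_indepD: "lin_indep v J \<Longrightarrow> (\<Sum>j\<in>J. c j *s v j) = 0 \<Longrightarrow> j \<in> J \<Longrightarrow> c j = 0"
  unfolding lin_indep_def by simp

lemma lin_indep_imp_set:
  assumes "lin_indep v J" "finite J"
  shows "inj_on v J" "vec.independent (v ` J)"
proof -
  show inj: "inj_on v J"
  proof (rule inj_onI, rule ccontr)
    fix j k assume jk: "j \<in> J" "k \<in> J" "v j = v k" "j \<noteq> k"
    define c :: "nat \<Rightarrow> 'a" where "c = (\<lambda>i. if i = j then 1 else if i = k then -1 else 0)"
    have "(\<Sum>i\<in>J. c i *s v i) = (\<Sum>i\<in>{j, k}. c i *s v i)"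
      using jk assms(2) by (intro sum.mono_neutral_right) (auto simp: c_def)
    also have "\<dots> = 0" using jk by (simp add: c_def)
    finally have "c j = 0" using assms(1) jk unfolding lin_indep_def by blast
    then show False by (simp add: c_def)
  qed
  show "vec.independent (v ` J)"
  proof (rule vec.independent_if_scalars_zero)
    fix f x assume 0: "(\<Sum>x\<in>v ` J. f x *s x) = 0" and "x \<in> v ` J"
    then obtain j where j: "j \<in> J" "x = v j" by blast
    have "(\<Sum>j\<in>J. f (v j) *s v j) = 0" using 0 by (simp add: sum.reindex[OF inj])
    from lin_indepD[OF assms(1) this j(1)] show "f x = 0" using j(2) by simp
  qed (use assms(2) in auto)
qed

lemma rowmat_det_imp_indep:
  fixes v :: "nat \<Rightarrow> 'a::field ^ 'n"
  assumes "det (rowmat v r) \<noteq> 0" "\<And>j. j \<in> J \<Longrightarrow> \<exists>i. r i = Inl j" "finite J"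
  shows "lin_indep v J"
  unfolding lin_indep_def
proof (intro allI impI)
  fix c assume 0: "(\<Sum>j\<in>J. c j *s v j) = 0"
  obtain i where i: "\<And>j. j \<in> J \<Longrightarrow> r (i j) = Inl j" using assms(2) by metis
  have inj: "inj_on i J" by (rule inj_onI) (metis i sum.inject(1))
  define c' where "c' k = (if k \<in> i ` J then c (inv_into J i k) else 0)" for k
  have "\<exists>B. rowmat v r ** B = mat 1"
    using assms(1) invertible_det_nz invertible_right_inverse by blast
  then have *: "\<forall>c. (\<Sum>k\<in>UNIV. c k *s row k (rowmat v r)) = 0 \<longrightarrow> (\<forall>k. c k = 0)"
    by (simp add: matrix_right_invertible_independent_rows)
  have "(\<Sum>k\<in>UNIV. c' k *s row k (rowmat v r)) = (\<Sum>k\<in>i ` J. c' k *s row k (rowmat v r))"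
    by (intro sum.mono_neutral_right) (auto simp: c'_def)
  also have "\<dots> = (\<Sum>j\<in>J. c j *s v j)"
    unfolding sum.reindex[OF inj] comp_def
    by (intro sum.cong) (auto simp: c'_def inj row_def rowmat_def i)
  finally have "c' k = 0" for k using * 0 by metis
  then have "c' (i j) = 0" for j .
  then show "\<forall>j\<in>J. c j = 0" by (simp add: c'_def inj) (metis image_eqI inj inv_into_f_f)
qed

lemma indep_imp_rowmat_det:
  fixes v :: "nat \<Rightarrow> 'a::field ^ 'n"
  assumes "lin_indep v J" "finite J"
  shows "\<exists>r. (\<forall>j\<in>J. \<exists>i. r i = Inl j) \<and> (\<forall>i j. r i = Inl j \<longrightarrow> j \<in> J) \<and> det (rowmat v r) \<noteq> 0"
proof -
  note li = lin_indep_imp_set[OF assms]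
  obtain B where B: "v ` J \<subseteq> B" "B \<subseteq> v ` J \<union> cart_basis" "vec.independent B" "v ` J \<union> cart_basis \<subseteq> vec.span B"
    by (rule vec.maximal_independent_subset_extend[OF _ li(2), of "v ` J \<union> cart_basis"]) auto
  have span: "vec.span B = UNIV"
    using B(4) vec.span_mono[of cart_basis "vec.span B"] by (auto simp: vec.span_span)
  have "card B = CARD('n)"
    using vec.dim_eq_card_independent[OF B(3)] vec.dim_span[of B] span card_cart_basis[where 'a = 'a and 'i = 'n] by (simp add: vec_dim_card)
  moreover have finB: "finite B" using B(3) by (rule vec.finiteI_independent)
  ultimately obtain h where h: "bij_betw h (UNIV :: 'n set) B"
    using finite_same_card_bij[of "UNIV :: 'n set" B] by auto
  \<comment> \<open>A basis vector may be both a member of the family and a unit vector. Preferring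
    the label \<open>Inl\<close> in that case guarantees that every \<open>j\<close> in
    \<open>J\<close> appears as a row.\<close>
  have Bcase: "\<exists>s. (case s of Inl j \<Rightarrow> v j | Inr k \<Rightarrow> axis k 1) = h i \<and> (\<forall>j. s = Inl j \<longrightarrow> j \<in> J) \<and> (h i \<in> v ` J \<longrightarrow> (\<exists>j. s = Inl j))" for i
  proof -
    have "h i \<in> v ` J \<union> cart_basis" using h B(2) by (auto simp: bij_betw_def)
    then show ?thesis
    proof (cases "h i \<in> v ` J")
      case True
      then obtain j where "j \<in> J" "h i = v j" by blast
      then show ?thesis by (intro exI[of _ "Inl j"]) auto
    next
      case False
      then have "h i \<in> cart_basis" using \<open>h i \<in> v ` J \<union> cart_basis\<close> by blast
      then obtain k where "h i = axis k 1" by (auto simp: cart_basis_def)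
      then show ?thesis using False by (intro exI[of _ "Inr k"]) auto
    qed
  qed
  then obtain r where r: "\<And>i. (case r i of Inl j \<Rightarrow> v j | Inr k \<Rightarrow> axis k 1) = h i"
     "\<And>i j. r i = Inl j \<Longrightarrow> j \<in> J" "\<And>i. h i \<in> v ` J \<Longrightarrow> \<exists>j. r i = Inl j"
    by metis
  have "row i (rowmat v r) = h i" for i
    by (simp add: row_def rowmat_def r(1))
  then have "rows (rowmat v r) = B" using h by (auto simp: rows_def bij_betw_def)
  then have "\<exists>A. A ** rowmat v r = mat 1"
    by (simp add: matrix_left_invertible_span_rows_gen span)
  then have "det (rowmat v r) \<noteq> 0"
    by (metis invertible_det_nz invertible_left_inverse)
  moreover have "\<exists>i. r i = Inl j" if jJ: "j \<in> J" for j
  proof -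
    have "v j \<in> B" using B(1) jJ by auto
    then obtain i where i: "h i = v j" using h unfolding bij_betw_def by (metis imageE)
    then obtain j' where j': "r i = Inl j'" using r(3)[of i] jJ by auto
    then have "v j' = v j" "j' \<in> J" using r(1)[of i] i r(2) by auto
    then show ?thesis using li(1) jJ j' by (metis inj_onD)
  qed
  ultimately show ?thesis using r(2) by (intro exI[of _ r]) auto
qed

text \<open>The completed matrix of the covectors is injective and maps their common kernel
  \<open>V\<close> into the coordinate subspace belonging to the unit rows. So \<open>V\<close> has
  dimension at most \<open>CARD('n) - card K = card J\<close>, and the independent vectors
  \<open>x j\<close>, which lie in \<open>V\<close>, span it.\<close>

lemma in_span_of_annihilator:
  fixes x \<phi> :: "nat \<Rightarrow> 'a::field ^ 'n"
  assumes x: "lin_indep x J" "finite J" and f: "lin_indep \<phi> K" "finite K"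
    and card: "card J + card K = CARD('n)"
    and ann: "\<And>j k. j \<in> J \<Longrightarrow> k \<in> K \<Longrightarrow> (\<Sum>m\<in>UNIV. \<phi> k $ m * x j $ m) = 0"
    and d: "\<And>k. k \<in> K \<Longrightarrow> (\<Sum>m\<in>UNIV. \<phi> k $ m * d $ m) = 0"
  shows "\<exists>a. d = (\<Sum>j\<in>J. a j *s x j)"
proof -
  obtain r where r: "\<And>k. k \<in> K \<Longrightarrow> \<exists>i. r i = Inl k" "\<And>i k. r i = Inl k \<Longrightarrow> k \<in> K" "det (rowmat \<phi> r) \<noteq> 0"
    using indep_imp_rowmat_det[OF f] by blast
  define M where "M = rowmat \<phi> r"
  define V where "V = {v. \<forall>k\<in>K. (\<Sum>m\<in>UNIV. \<phi> k $ m * v $ m) = 0}"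
  define I where "I = {i. \<exists>k. r i = Inr k}"
  have inj: "inj ((*v) M)"
    using r(3) by (simp add: M_def det_nz_iff_inj_gen[symmetric] matrix_of_matrix_vector_mul)
  have "(*v) M ` V \<subseteq> {w. \<forall>i. i \<notin> I \<longrightarrow> w $ i = 0}"
  proof safe
    fix v i assume v: "v \<in> V" and i: "i \<notin> I"
    then obtain k where k: "r i = Inl k" by (cases "r i") (auto simp: I_def)
    then show "(M *v v) $ i = 0"
      using v r(2)[OF k] by (simp add: M_def rowmat_def matrix_vector_mult_def V_def)
  qed
  then have "vec.dim ((*v) M ` V) \<le> vec.dim {w :: 'a ^ 'n. \<forall>i. i \<notin> I \<longrightarrow> w $ i = 0}"
    by (rule vec.dim_subset)
  also have "\<dots> = card I" by (rule dim_substandard_cart)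
  finally have "vec.dim ((*v) M ` V) \<le> card I" .
  moreover have "vec.dim ((*v) M ` V) = vec.dim V"
    by (rule vec.dim_image_eq) (use inj in \<open>auto intro: inj_on_subset matrix_vector_mul_linear_gen\<close>)
  moreover have "card K + card I \<le> CARD('n)"
  proof -
    obtain i where i: "\<And>k. k \<in> K \<Longrightarrow> r (i k) = Inl k" using r(1) by metis
    have "inj_on i K" by (rule inj_onI) (metis i sum.inject(1))
    then have "card (i ` K) = card K" by (rule card_image)
    moreover have "i ` K \<inter> I = {}" using i by (auto simp: I_def)
    ultimately have "card K + card I = card (i ` K \<union> I)" using f(2) by (simp add: card_Un_disjoint)
    also have "\<dots> \<le> CARD('n)" by (intro card_mono) auto
    finally show ?thesis .
  qed
  ultimately have dim: "vec.dim V \<le> card J" using card by linarith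
  note lx = lin_indep_imp_set[OF x]
  have "V \<subseteq> vec.span (x ` J)"
    by (rule vec.card_ge_dim_independent) (use lx ann dim in \<open>auto simp: V_def card_image\<close>)
  moreover have "d \<in> V" using d by (simp add: V_def)
  ultimately have "d \<in> vec.span (x ` J)" by blast
  then obtain u where "d = (\<Sum>v\<in>x ` J. u v *s v)"
    using vec.span_finite[of "x ` J"] x(2) by auto
  then show ?thesis
    by (intro exI[of _ "\<lambda>j. u (x j)"]) (simp add: sum.reindex[OF lx(1)])
qed

section \<open>Derivations, the commutation argument, and extension to fractions\<close>

definition is_derivation :: "('a::comm_ring_1 \<Rightarrow> 'a) \<Rightarrow> bool" where
  "is_derivation \<delta> \<longleftrightarrow> (\<forall>a b. \<delta> (a + b) = \<delta> a + \<delta> b) \<and> (\<forall>a b. \<delta> (a * b) = \<delta> a * b + a * \<delta> b)"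

lemma is_derivationD:
  assumes "is_derivation \<delta>"
  shows "\<delta> (a + b) = \<delta> a + \<delta> b" "\<delta> (a * b) = \<delta> a * b + a * \<delta> b" "\<delta> 0 = 0" "\<delta> 1 = 0"
    "\<delta> (- a) = - \<delta> a" "\<delta> (a - b) = \<delta> a - \<delta> b" "\<delta> (sum f A) = (\<Sum>x\<in>A. \<delta> (f x))"
proof -
  show 1: "\<delta> (a + b) = \<delta> a + \<delta> b" for a b using assms by (simp add: is_derivation_def)
  show 2: "\<delta> (a * b) = \<delta> a * b + a * \<delta> b" for a b using assms by (simp add: is_derivation_def)
  show 3: "\<delta> 0 = 0" using 1[of 0 0] by simp
  show "\<delta> 1 = 0" using 2[of 1 1] by simp
  show 4: "\<delta> (- a) = - \<delta> a" for a using 1[of a "- a"] 3 by (simp add: eq_neg_iff_add_eq_0 add.commute)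
  show "\<delta> (a - b) = \<delta> a - \<delta> b" using 1[of a "- b"] 4 by simp
  show "\<delta> (sum f A) = (\<Sum>x\<in>A. \<delta> (f x))"
    by (induction A rule: infinite_finite_induct) (auto simp: 1 3)
qed

text \<open>Vectors act as derivations through \<open>vf\<close>, and the components of a bracket
  are \<open>vf v (w $ i) - vf w (v $ i)\<close>. Once the coefficients of \<open>d'\<close> in the
  \<open>x j\<close> are known to be constants for all \<open>x j\<close>, hence for
  \<open>d\<close>, the Leibniz rule reduces the bracket of \<open>d\<close> and \<open>d'\<close>
  to brackets that vanish by assumption.\<close>

lemma bogoyavlenskij_commute:
  fixes e :: "'n::finite \<Rightarrow> 'k::field \<Rightarrow> 'k" and x :: "nat \<Rightarrow> 'k ^ 'n" and \<phi> :: "nat \<Rightarrow> 'k" and d d' :: "'k ^ 'n"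
  defines "vf \<equiv> \<lambda>(v :: 'k ^ 'n) y. \<Sum>m\<in>UNIV. v $ m * e m y"
  assumes e: "\<And>m. is_derivation (e m)"
    and x: "lin_indep x J" "finite J" and f: "lin_indep (\<lambda>k. \<chi> m. e m (\<phi> k)) K" "finite K"
    and card: "card J + card K = CARD('n)"
    and ann: "\<And>j k. j \<in> J \<Longrightarrow> k \<in> K \<Longrightarrow> vf (x j) (\<phi> k) = 0"
    and d: "\<And>k. k \<in> K \<Longrightarrow> vf d (\<phi> k) = 0" "\<And>k. k \<in> K \<Longrightarrow> vf d' (\<phi> k) = 0"
    and comm: "\<And>j k i. j \<in> J \<Longrightarrow> k \<in> J \<Longrightarrow> vf (x j) (x k $ i) = vf (x k) (x j $ i)"
    and dx: "\<And>j i. j \<in> J \<Longrightarrow> vf d (x j $ i) = vf (x j) (d $ i)"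
      "\<And>j i. j \<in> J \<Longrightarrow> vf d' (x j $ i) = vf (x j) (d' $ i)"
  shows "vf d (d' $ i) = vf d' (d $ i)"
proof -
  have span: "\<exists>a. d = (\<Sum>j\<in>J. a j *s x j)" if "\<And>k. k \<in> K \<Longrightarrow> vf d (\<phi> k) = 0" for d
    by (rule in_span_of_annihilator[OF x f card])
      (use ann that in \<open>auto simp: vf_def mult.commute\<close>)
  obtain a b where a: "d = (\<Sum>j\<in>J. a j *s x j)" and b: "d' = (\<Sum>j\<in>J. b j *s x j)"
    using span[OF d(1)] span[OF d(2)] by blast
  have vfD: "is_derivation (vf v)" for v
    unfolding is_derivation_def vf_def
    by (auto simp: is_derivationD(1,2)[OF e] distrib_left sum.distrib sum_distrib_left sum_distrib_right mult_ac)
  have vf_sum: "vf (\<Sum>j\<in>J. c j *s x j) y = (\<Sum>j\<in>J. c j * vf (x j) y)" for c y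
    unfolding vf_def by (simp add: sum_distrib_left sum_distrib_right mult.assoc) (rule sum.swap)
  have comp: "(\<Sum>j\<in>J. c j *s x j) $ i = (\<Sum>j\<in>J. c j * x j $ i)" for c i
    by simp
  \<comment> \<open>Expanding the vanishing bracket of \<open>x j\<close> with \<open>d'\<close>
    leaves a linear relation among the \<open>x k\<close> whose coefficients are these derivatives;
    independence makes them zero.\<close>
  have b0: "vf (x j) (b k) = 0" if jk: "j \<in> J" "k \<in> J" for j k
  proof -
    have "(\<Sum>k\<in>J. vf (x j) (b k) *s x k) = 0"
    proof (subst vec_eq_iff, rule allI)
      fix i
      have "vf d' (x j $ i) = vf (x j) (\<Sum>k\<in>J. b k * x k $ i)"
        using dx(2)[OF jk(1), of i] by (simp add: b)
      also have "\<dots> = (\<Sum>k\<in>J. vf (x j) (b k) * x k $ i) + (\<Sum>k\<in>J. b k * vf (x j) (x k $ i))"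
        by (simp add: is_derivationD(2,7)[OF vfD] sum.distrib)
      also have "(\<Sum>k\<in>J. b k * vf (x j) (x k $ i)) = (\<Sum>k\<in>J. b k * vf (x k) (x j $ i))"
        using comm[OF jk(1)] by (intro sum.cong) auto
      also have "\<dots> = vf d' (x j $ i)" by (simp add: b vf_sum)
      finally show "(\<Sum>k\<in>J. vf (x j) (b k) *s x k) $ i = 0 $ i" by simp
    qed
    from lin_indepD[OF x(1) this jk(2)] show ?thesis .
  qed
  have "vf d (d' $ i) = (\<Sum>k\<in>J. vf d (b k) * x k $ i) + (\<Sum>k\<in>J. b k * vf d (x k $ i))"
    by (simp add: b is_derivationD(2,7)[OF vfD] sum.distrib)
  also have "(\<Sum>k\<in>J. vf d (b k) * x k $ i) = 0"
    by (intro sum.neutral) (simp add: a vf_sum b0)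
  also have "(\<Sum>k\<in>J. b k * vf d (x k $ i)) = vf d' (d $ i)"
    by (simp add: b vf_sum dx(1))
  finally show ?thesis by simp
qed

text \<open>The quotient rule applied to an arbitrarily chosen representative. Independence of the
  choice comes from differentiating the equation \<open>a * d = c * b\<close> between two
  representatives.\<close>

definition fder :: "('a::idom \<Rightarrow> 'a) \<Rightarrow> 'a fract \<Rightarrow> 'a fract" where
  "fder \<delta> x = (let (a, b) = (SOME (a, b). b \<noteq> 0 \<and> x = Fract a b) in Fract (\<delta> a * b - a * \<delta> b) (b * b))"

lemma fder_Fract:
  assumes \<delta>: "is_derivation \<delta>" and b: "b \<noteq> 0"
  shows "fder \<delta> (Fract a b) = Fract (\<delta> a * b - a * \<delta> b) (b * b)"
proof -
  obtain c d where cd: "(SOME (c, d). d \<noteq> 0 \<and> Fract a b = Fract c d) = (c, d)" by force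
  have "case (c, d) of (c, d) \<Rightarrow> d \<noteq> 0 \<and> Fract a b = Fract c d"
    unfolding cd[symmetric] by (rule someI[of _ "(a, b)"]) (simp add: b)
  then have d: "d \<noteq> 0" and eq: "a * d = c * b" using b by (auto simp: eq_fract)
  have "\<delta> a * d + a * \<delta> d = \<delta> c * b + c * \<delta> b"
    using arg_cong[OF eq, of \<delta>] by (simp add: is_derivationD(2)[OF \<delta>])
  then have "(\<delta> a * b - a * \<delta> b) * (d * d) = (\<delta> c * d - c * \<delta> d) * (b * b)"
    using eq by algebra
  then have "Fract (\<delta> a * b - a * \<delta> b) (b * b) = Fract (\<delta> c * d - c * \<delta> d) (d * d)"
    using b d by (simp add: eq_fract)
  then show ?thesis by (simp add: fder_def cd)
qed

lemma fder_derivation: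
  assumes \<delta>: "is_derivation \<delta>"
  shows "is_derivation (fder \<delta>)"
  unfolding is_derivation_def
proof (intro conjI allI)
  fix x y :: "'a fract"
  obtain a b c d where xy: "x = Fract a b" "b \<noteq> 0" "y = Fract c d" "d \<noteq> 0"
    by (metis Fract_cases)
  note ad = is_derivationD(1,2)[OF \<delta>]
  show "fder \<delta> (x + y) = fder \<delta> x + fder \<delta> y"
    using xy by (simp add: fder_Fract[OF \<delta>] eq_fract ad algebra_simps)
  show "fder \<delta> (x * y) = fder \<delta> x * y + x * fder \<delta> y"
    using xy by (simp add: fder_Fract[OF \<delta>] eq_fract ad algebra_simps)
qed

abbreviation emb :: "'a::idom \<Rightarrow> 'a fract" where "emb a \<equiv> Fract a 1"

lemma emb_simps: "emb (a + b) = emb a + emb b" "emb (a * b) = emb a * emb b" "emb (a - b) = emb a - emb b"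
  "emb 0 = 0" "emb 1 = 1"
  by (simp_all add: Zero_fract_def One_fract_def)

lemma emb_sum: "emb (sum f A) = (\<Sum>x\<in>A. emb (f x))"
  by (induction A rule: infinite_finite_induct) (auto simp: emb_simps)

lemma emb_eq_iff [simp]: "emb a = emb b \<longleftrightarrow> a = b"
  by (simp add: eq_fract)

section \<open>The logarithm of a formal automorphism\<close>

text \<open>The binomial coefficient \<open>X choose k\<close> as a polynomial in its upper
  argument.\<close>

definition binpoly :: "nat \<Rightarrow> ('n::finite) pol poly" where
  "binpoly k = smult (cst (1 / fact k)) (\<Prod>i<k. [:- of_nat i, 1:])"

lemma binpoly_of_nat: "poly (binpoly k) (of_nat n) = of_nat (n choose k)"
proof (rule pol_eqI)
  fix p
  have prod: "ev (prod f A) p = (\<Prod>i\<in>A. ev (f i) p)" for f :: "nat \<Rightarrow> 'a pol" and A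
    by (induction A rule: infinite_finite_induct) auto
  have "ev (poly (binpoly k) (of_nat n)) p = (\<Prod>i<k. of_nat n - of_nat i) / fact k"
    by (simp add: binpoly_def poly_prod prod)
  also have "\<dots> = of_nat n gchoose k"
    by (simp add: gbinomial_prod_rev atLeast0LessThan)
  finally show "ev (poly (binpoly k) (of_nat n)) p = ev (of_nat (n choose k)) p"
    by (simp add: binomial_gbinomial)
qed

lemma binpoly_simps [simp]: "binpoly 0 = 1" "binpoly (Suc 0) = [:0, 1:]"
  by (simp_all add: binpoly_def cst_hom one_pCons)

text \<open>A series over \<open>pol poly\<close> models a family that at each order in \<mu> is
  polynomial in a formal exponent. \<open>evn n\<close> sets the exponent to \<open>n\<close>,
  \<open>lowc j\<close> takes the coefficient of its \<open>j\<close>-th power, and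
  \<open>con\<close> embeds families independent of it.\<close>

definition evn :: "nat \<Rightarrow> ('n::finite) pol poly fps \<Rightarrow> 'n pol fps" where
  "evn n A = Abs_fps (\<lambda>m. poly (A $ m) (of_nat n))"

definition lowc :: "nat \<Rightarrow> ('n::finite) pol poly fps \<Rightarrow> 'n pol fps" where
  "lowc j A = Abs_fps (\<lambda>m. coeff (A $ m) j)"

definition con :: "('n::finite) pol fps \<Rightarrow> 'n pol poly fps" where
  "con A = Abs_fps (\<lambda>m. [:A $ m:])"

definition dP :: "'n \<Rightarrow> ('n::finite) pol poly fps \<Rightarrow> 'n pol poly fps" where
  "dP i A = Abs_fps (\<lambda>m. map_poly (dpol i) (A $ m))"

lemma evn_simps: "evn n (A + B) = evn n A + evn n B" "evn n (A * B) = evn n A * evn n B"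
  "evn n (A - B) = evn n A - evn n B" "evn n (con C) = C" "evn n (sum f I) = (\<Sum>x\<in>I. evn n (f x))"
proof -
  have sum: "poly (sum f A) x = (\<Sum>i\<in>A. poly (f i) x)" for f :: "nat \<Rightarrow> 'a pol poly" and A x
    by (simp add: poly_sum)
  show 1: "evn n (A + B) = evn n A + evn n B" for A B by (simp add: evn_def fps_eq_iff)
  show "evn n (A * B) = evn n A * evn n B" by (simp add: evn_def fps_eq_iff fps_mult_nth sum)
  show "evn n (A - B) = evn n A - evn n B" by (simp add: evn_def fps_eq_iff)
  show "evn n (con C) = C" by (simp add: evn_def con_def fps_eq_iff)
  have "evn n 0 = 0" by (simp add: evn_def fps_eq_iff)
  then show "evn n (sum f I) = (\<Sum>x\<in>I. evn n (f x))"
    by (induction I rule: infinite_finite_induct) (simp_all add: 1)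
qed

lemma evn_dP: "evn n (dP i A) = dR i (evn n A)"
proof -
  have "poly (map_poly (dpol i) q) (of_nat n) = dpol i (poly q (of_nat n))" for q
  proof (induction q)
    case 0
    show ?case by simp
  next
    case (pCons a q)
    have "dpol i (of_nat n) = 0" using dpol_cst[of i "of_nat n"] by (simp add: cst_hom)
    then show ?case using pCons by (simp add: map_poly_pCons dpol_mult)
  qed
  then show ?thesis by (simp add: evn_def dP_def fps_eq_iff)
qed

text \<open>A polynomial over a domain of characteristic zero is determined by its values at the
  natural numbers. In this way identities valid for all iterates of an automorphism pass to its
  logarithm.\<close>

lemma evn_inject:
  assumes "\<And>n. evn n A = evn n B"
  shows "A = B"
proof -
  have "A $ m = B $ m" for m
  proof (rule ccontr)
    assume ne: "A $ m \<noteq> B $ m"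
    have "poly (A $ m - B $ m) (of_nat n) = 0" for n
      using arg_cong[OF assms, of "\<lambda>x. fps_nth x m"] by (simp add: evn_def)
    then have "range of_nat \<subseteq> {x. poly (A $ m - B $ m) x = 0}" by auto
    moreover have "finite {x. poly (A $ m - B $ m) x = 0}" by (rule poly_roots_finite) (use ne in simp)
    ultimately have "finite (range (of_nat :: nat \<Rightarrow> 'a pol))" by (rule finite_subset)
    moreover have "infinite (range (of_nat :: nat \<Rightarrow> 'a pol))"
      by (intro range_inj_infinite) (rule inj_of_nat)
    ultimately show False by blast
  qed
  then show ?thesis by (simp add: fps_eq_iff)
qed

lemma lowc_add: "lowc j (A + B) = lowc j A + lowc j B"
  by (simp_all add: lowc_def fps_eq_iff)

lemma lowc_sum: "lowc j (sum f I) = (\<Sum>x\<in>I. lowc j (f x))"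
proof -
  have "lowc j 0 = 0" by (simp add: lowc_def fps_eq_iff)
  then show ?thesis by (induction I rule: infinite_finite_induct) (simp_all add: lowc_add)
qed

text \<open>Multiplication modulo the square of the exponent, as for dual numbers; the second
  equation is the source of the Leibniz rule for the logarithm.\<close>

lemma lowc_mult: "lowc 0 (A * B) = lowc 0 A * lowc 0 B"
  "lowc (Suc 0) (A * B) = lowc (Suc 0) A * lowc 0 B + lowc 0 A * lowc (Suc 0) B"
  by (simp_all add: lowc_def fps_eq_iff fps_mult_nth coeff_sum coeff_mult atMost_Suc sum.distrib add.commute)

lemma lowc_con: "lowc 0 (con A) = A" "lowc (Suc 0) (con A) = 0"
  by (simp_all add: lowc_def con_def fps_eq_iff)

lemma lowc_dP: "lowc j (dP i A) = dR i (lowc j A)"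
  by (simp add: lowc_def dP_def fps_eq_iff coeff_map_poly)

lemma lowc_0_evn: "lowc 0 A = evn 0 A"
  by (simp add: lowc_def evn_def fps_eq_iff poly_0_coeff_0)

text \<open>\<open>E_low\<close> is unipotence: \<open>E - 1\<close> strictly raises the order in
  \<mu>. This makes the binomial series in \<open>E - 1\<close> finite at every order.\<close>

locale formal_automorphism =
  fixes E :: "('n::finite) pol fps \<Rightarrow> 'n pol fps"
  assumes E_add: "E (a + b) = E a + E b" and E_mult: "E (a * b) = E a * E b"
    and E_X: "E fps_X = fps_X" and E_cst: "E (fps_const (cst c)) = fps_const (cst c)"
    and E_low: "(\<And>m. m < n \<Longrightarrow> a $ m = 0) \<Longrightarrow> E a $ n = a $ n"
begin

lemma E_0: "E 0 = 0" using E_add[of 0 0] by simp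

lemma E_sum: "E (sum f A) = (\<Sum>x\<in>A. E (f x))"
  by (induction A rule: infinite_finite_induct) (auto simp: E_add E_0)

lemma E_nonzero: "a \<noteq> 0 \<Longrightarrow> E a \<noteq> 0"
proof
  assume a: "a \<noteq> 0" and "E a = 0"
  then have "E a $ subdegree a = 0" by simp
  moreover have "E a $ subdegree a = a $ subdegree a" by (rule E_low) (rule nth_less_subdegree_zero)
  ultimately show False using a by simp
qed

definition \<Delta> :: "'n pol fps \<Rightarrow> 'n pol fps" where "\<Delta> a = E a - a"

lemma \<Delta>_sum: "\<Delta> (sum f A) = (\<Sum>x\<in>A. \<Delta> (f x))"
  by (simp add: \<Delta>_def E_sum sum_subtractf)

lemma E_of_nat: "E (of_nat n) = of_nat n"
  using E_cst[of "of_nat n"] by (simp add: cst_hom fps_of_nat)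

lemma \<Delta>_of_nat: "\<Delta> (of_nat n * a) = of_nat n * \<Delta> a"
  by (simp add: \<Delta>_def E_mult E_of_nat right_diff_distrib)

lemma \<Delta>_low: "m < k \<Longrightarrow> (\<Delta> ^^ k) a $ m = 0"
proof (induction k arbitrary: m)
  case (Suc k)
  have "E ((\<Delta> ^^ k) a) $ m = (\<Delta> ^^ k) a $ m"
    by (rule E_low) (use Suc in auto)
  then show ?case by (simp add: \<Delta>_def[of "(\<Delta> ^^ k) a"])
qed simp

lemma E_power: "(E ^^ n) a = (\<Sum>k\<le>n. of_nat (n choose k) * (\<Delta> ^^ k) a)"
proof (induction n)
  case (Suc n)
  let ?T = "\<lambda>k. (\<Delta> ^^ k) a"
  have "(E ^^ Suc n) a = (E ^^ n) a + \<Delta> ((E ^^ n) a)" by (simp add: \<Delta>_def)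
  also have "\<dots> = (\<Sum>k\<le>n. of_nat (n choose k) * ?T k) + (\<Sum>k\<le>n. of_nat (n choose k) * ?T (Suc k))"
    by (simp add: Suc \<Delta>_sum \<Delta>_of_nat)
  also have "(\<Sum>k\<le>n. of_nat (n choose k) * ?T k) = ?T 0 + (\<Sum>k\<le>n. of_nat (n choose Suc k) * ?T (Suc k))"
  proof -
    have "(\<Sum>k\<le>n. of_nat (n choose k) * ?T k) = (\<Sum>k\<le>Suc n. of_nat (n choose k) * ?T k)"
      by (simp add: binomial_eq_0)
    also have "\<dots> = ?T 0 + (\<Sum>k\<le>n. of_nat (n choose Suc k) * ?T (Suc k))"
      by (subst sum.atMost_Suc_shift) simp
    finally show ?thesis .
  qed
  also have "?T 0 + (\<Sum>k\<le>n. of_nat (n choose Suc k) * ?T (Suc k)) + (\<Sum>k\<le>n. of_nat (n choose k) * ?T (Suc k))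
     = ?T 0 + (\<Sum>k\<le>n. of_nat (Suc n choose Suc k) * ?T (Suc k))"
    by (simp add: sum.distrib distrib_right add_ac)
  also have "\<dots> = (\<Sum>k\<le>Suc n. of_nat (Suc n choose k) * ?T k)"
    by (subst sum.atMost_Suc_shift) simp
  finally show ?case .
qed simp

text \<open>Newton's binomial expansion of the iterates, with the exponent left formal. Truncation
  at \<open>k \<le> m\<close> is exact for the coefficient of order \<open>m\<close>, because the
  \<open>k\<close>-th difference starts at order \<open>k\<close>.\<close>

definition Epoly :: "'n pol fps \<Rightarrow> 'n pol poly fps" where
  "Epoly a = Abs_fps (\<lambda>m. \<Sum>k\<le>m. smult ((\<Delta> ^^ k) a $ m) (binpoly k))"

lemma evn_Epoly: "evn n (Epoly a) = (E ^^ n) a"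
proof (rule fps_ext)
  fix m
  have "evn n (Epoly a) $ m = (\<Sum>k\<le>m. of_nat (n choose k) * (\<Delta> ^^ k) a $ m)"
    by (simp add: evn_def Epoly_def poly_sum binpoly_of_nat mult.commute)
  also have "\<dots> = (\<Sum>k\<le>max m n. of_nat (n choose k) * (\<Delta> ^^ k) a $ m)"
    by (intro sum.mono_neutral_left) (auto simp: \<Delta>_low)
  also have "\<dots> = (\<Sum>k\<le>n. of_nat (n choose k) * (\<Delta> ^^ k) a $ m)"
    by (intro sum.mono_neutral_right) (auto simp: binomial_eq_0)
  also have "\<dots> = (E ^^ n) a $ m"
    by (simp add: E_power fps_sum_nth fps_of_nat[symmetric])
  finally show "evn n (Epoly a) $ m = (E ^^ n) a $ m" .
qed

lemma E_power_hom: "(E ^^ n) (a + b) = (E ^^ n) a + (E ^^ n) b" "(E ^^ n) (a * b) = (E ^^ n) a * (E ^^ n) b"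
  by (induction n) (simp_all add: E_add E_mult)

lemma Epoly_hom: "Epoly (a + b) = Epoly a + Epoly b" "Epoly (a * b) = Epoly a * Epoly b"
  by (rule evn_inject, simp add: evn_Epoly evn_simps E_power_hom)+

lemma Epoly_fixed: "E a = a \<Longrightarrow> Epoly a = con a"
proof (rule evn_inject)
  fix n assume "E a = a"
  then have "(E ^^ n) a = a" by (induction n) auto
  then show "evn n (Epoly a) = evn n (con a)" by (simp add: evn_Epoly evn_simps)
qed

text \<open>The logarithm of the automorphism, obtained as the coefficient of \<open>n\<close> in its \<open>n\<close>-th power.\<close>

definition D :: "'n pol fps \<Rightarrow> 'n pol fps" where
  "D a = lowc (Suc 0) (Epoly a)"

lemma lowc_0_Epoly: "lowc 0 (Epoly a) = a"
  by (simp add: lowc_0_evn evn_Epoly)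

lemma D_derivation: "is_derivation D"
  by (simp add: is_derivation_def D_def Epoly_hom lowc_add lowc_mult lowc_0_Epoly)

lemma D_fixed: "E a = a \<Longrightarrow> D a = 0"
  by (simp add: D_def Epoly_fixed lowc_con)

lemma D_nth_0: "D a $ 0 = 0"
  by (simp add: D_def lowc_def Epoly_def)

text \<open>The logarithm series starts with \<open>E - 1\<close>, and the square of
  \<open>E - 1\<close> contributes only from order 2 on.\<close>

lemma D_nth_1: "D a $ 1 = E a $ 1 - a $ 1"
  by (simp add: D_def lowc_def Epoly_def \<Delta>_def)

text \<open>The difference \<open>W\<close> of both sides is a derivation that kills constants,
  \<mu> and the variables, hence every polynomial in them.\<close>

lemma D_chain: "D a = (\<Sum>i\<in>UNIV. D (fps_const (pvar i)) * dR i a)"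
proof -
  define W where "W a = D a - (\<Sum>i\<in>UNIV. D (fps_const (pvar i)) * dR i a)" for a
  have W: "is_derivation W"
    unfolding is_derivation_def W_def
    by (simp add: is_derivationD(1,2)[OF D_derivation] dR_add dR_mult distrib_left distrib_right sum.distrib
        sum_distrib_left sum_distrib_right algebra_simps)
  have X: "W fps_X = 0"
  proof -
    have "dR i fps_X = 0" for i :: 'n using dR_X_power[of i 1] by simp
    then show ?thesis by (simp add: W_def D_fixed[OF E_X])
  qed
  have c: "W (fps_const (cst c)) = 0" for c
    by (simp add: W_def D_fixed[OF E_cst])
  have v: "W (fps_const (pvar k)) = 0" for k
  proof -
    have dd: "dR i (fps_const (pvar k)) = (if k = i then 1 else 0)" for i
      by (auto simp: fps_eq_iff dpol_pvar)
    show ?thesis unfolding W_def dd by (simp add: if_distrib cong: if_cong)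
  qed
  have p: "W (fps_const b) = 0" for b
  proof (induction b rule: pol_induct)
    case (add a b)
    then show ?case using is_derivationD(1)[OF W, of "fps_const a" "fps_const b"] by simp
  next
    case (mult a b)
    then show ?case using is_derivationD(2)[OF W, of "fps_const a" "fps_const b"] by simp
  qed (simp_all add: c v)
  have Xp: "W (fps_X ^ n) = 0" for n
    by (induction n) (simp_all add: is_derivationD(2,4)[OF W] X)
  \<comment> \<open>Continuity in \<mu> comes for free: a series is a polynomial in \<mu> plus a
    multiple of \<open>fps_X ^ Suc m\<close>, and \<open>W\<close> takes the power out as a
    constant.\<close>
  have "W a $ m = 0" for m
  proof -
    define b where "b = fps_shift (Suc m) a"
    have "a = (\<Sum>j\<le>m. fps_const (a $ j) * fps_X ^ j) + fps_X ^ Suc m * b"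
    proof (rule fps_ext)
      fix n
      have "(\<Sum>j\<le>m. (fps_const (a $ j) * fps_X ^ j) $ n) = (\<Sum>j\<le>m. if j = n then a $ j else 0)"
        by (intro sum.cong) (auto simp: fps_X_power_nth)
      also have "\<dots> = (if n \<le> m then a $ n else 0)" by simp
      finally show "a $ n = ((\<Sum>j\<le>m. fps_const (a $ j) * fps_X ^ j) + fps_X ^ Suc m * b) $ n"
        by (simp add: fps_sum_nth fps_X_power_mult_nth b_def del: power_Suc)
    qed
    then have "W a = W ((\<Sum>j\<le>m. fps_const (a $ j) * fps_X ^ j) + fps_X ^ Suc m * b)" by simp
    also have "\<dots> = fps_X ^ Suc m * W b"
      by (simp only: is_derivationD(1,2,7)[OF W] p Xp) simp
    finally show ?thesis by (simp add: fps_X_power_mult_nth del: power_Suc)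
  qed
  then have "W a = 0" by (simp add: fps_eq_iff)
  then show ?thesis by (simp add: W_def)
qed

text \<open>The assumption states, with denominators cleared, that \<open>g / h\<close> is fixed by
  \<open>E\<close>. Then it is fixed by all iterates, and the linear coefficient of the resulting
  polynomial identity in the exponent is the claim.\<close>

lemma D_first_integral:
  assumes "E g * h = E h * g"
  shows "D g * h = D h * g"
proof (cases "h = 0")
  case True
  then show ?thesis by (simp add: is_derivationD(3)[OF D_derivation])
next
  case False
  have "(E ^^ n) g * h = (E ^^ n) h * g" for n
  proof (induction n)
    case (Suc n)
    have "E ((E ^^ n) g * h) = E ((E ^^ n) h * g)" using Suc by simp
    then have "(E ((E ^^ n) g) * E h) * h = E ((E ^^ n) h) * (E g * h)" by (simp add: E_mult mult_ac)
    then have "(E ((E ^^ n) g) * h) * E h = (E ((E ^^ n) h) * g) * E h"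
      unfolding assms by (simp add: mult_ac)
    then show ?case using E_nonzero[OF False] by simp
  qed simp
  then have "Epoly g * con h = Epoly h * con g"
    by (intro evn_inject) (simp add: evn_simps evn_Epoly)
  from arg_cong[OF this, of "lowc (Suc 0)"] show ?thesis
    by (simp add: lowc_mult lowc_con D_def)
qed

text \<open>The field in question is \<open>X / d\<close>, with \<open>d\<close> a common
  denominator; \<open>com\<close> says that it commutes with \<open>E\<close>. As for first
  integrals, the relation is iterated and its linear coefficient in the exponent is read
  off.\<close>

lemma D_vector_field:
  fixes x :: "'n \<Rightarrow> 'n pol fps"
  defines "X \<equiv> \<lambda>a. \<Sum>i\<in>UNIV. x i * dR i a"
  assumes d: "d \<noteq> 0" and com: "\<And>a. E (X a) * d = E d * X (E a)"
  shows "D (X a) * d = D d * X a + d * X (D a)"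
proof -
  have "(E ^^ n) (X a) * d = (E ^^ n) d * X ((E ^^ n) a)" for n
  proof (induction n)
    case (Suc n)
    have "E ((E ^^ n) (X a) * d) = E ((E ^^ n) d * X ((E ^^ n) a))" using Suc by simp
    then have "E ((E ^^ n) (X a)) * E d * d = E ((E ^^ n) d) * (E (X ((E ^^ n) a)) * d)"
      by (simp add: E_mult mult_ac)
    also have "\<dots> = E ((E ^^ n) d) * (E d * X (E ((E ^^ n) a)))" by (simp only: com)
    finally have "(E ((E ^^ n) (X a)) * d) * E d = (E ((E ^^ n) d) * X (E ((E ^^ n) a))) * E d"
      by (simp add: mult_ac)
    then show ?case using E_nonzero[OF d] by simp
  qed (simp add: mult.commute)
  then have "Epoly (X a) * con d = Epoly d * (\<Sum>i\<in>UNIV. con (x i) * dP i (Epoly a))"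
    by (intro evn_inject) (simp add: evn_simps evn_Epoly evn_dP X_def)
  from arg_cong[OF this, of "lowc (Suc 0)"]
  have "D (X a) * d = D d * (\<Sum>i\<in>UNIV. x i * dR i a) + d * (\<Sum>i\<in>UNIV. x i * dR i (D a))"
    by (simp add: lowc_mult lowc_con lowc_sum lowc_dP lowc_0_Epoly D_def)
  then show ?thesis by (simp add: X_def)
qed

end

section \<open>Germs of meromorphic functions\<close>

definition dense_nz :: "((complex ^ 'n) \<times> complex) set \<Rightarrow> ((complex ^ 'n) \<times> complex \<Rightarrow> complex) \<Rightarrow> bool" where
  "dense_nz V h \<longleftrightarrow> open V \<and> scv_holomorphic_on h V \<and>
     (\<forall>W. open W \<and> W \<noteq> {} \<and> W \<subseteq> V \<longrightarrow> (\<exists>w\<in>W. h w \<noteq> 0))"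

lemma dense_nzD:
  assumes "dense_nz V h"
  shows "open V" "scv_holomorphic_on h V" "open W \<Longrightarrow> W \<noteq> {} \<Longrightarrow> W \<subseteq> V \<Longrightarrow> \<exists>w\<in>W. h w \<noteq> 0"
  using assms unfolding dense_nz_def by simp_all

lemma dense_nzI:
  assumes "open V" "scv_holomorphic_on h V" "\<And>W. open W \<Longrightarrow> W \<noteq> {} \<Longrightarrow> W \<subseteq> V \<Longrightarrow> \<exists>w\<in>W. h w \<noteq> 0"
  shows "dense_nz V h"
  using assms unfolding dense_nz_def by simp

lemma dense_nz_subset:
  assumes "dense_nz V h" "open V'" "V' \<subseteq> V"
  shows "dense_nz V' h"
  by (rule dense_nzI[OF assms(2) scv_subset[OF dense_nzD(2)[OF assms(1)] assms(3)]])
    (rule dense_nzD(3)[OF assms(1)], use assms(3) in auto)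

lemma dense_nz_open:
  assumes "dense_nz V h" "open W" "W \<subseteq> V"
  shows "open {w \<in> W. h w \<noteq> 0}"
proof -
  have "continuous_on W h"
    by (rule scv_continuous_on[OF scv_subset[OF dense_nzD(2)[OF assms(1)] assms(3)]])
  then have "open (W \<inter> h -` (- {0}))"
    by (rule continuous_open_preimage) (use assms(2) in auto)
  moreover have "W \<inter> h -` (- {0}) = {w \<in> W. h w \<noteq> 0}" by auto
  ultimately show ?thesis by simp
qed

lemma dense_nz_ex: "dense_nz V h \<Longrightarrow> open W \<Longrightarrow> W \<noteq> {} \<Longrightarrow> W \<subseteq> V \<Longrightarrow> {w \<in> W. h w \<noteq> 0} \<noteq> {}"
  by (drule (3) dense_nzD(3)) auto

lemma dense_nz_mult:
  assumes "dense_nz V h" "dense_nz V k"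
  shows "dense_nz V (\<lambda>w. h w * k w)"
proof (rule dense_nzI)
  show "open V" by (rule dense_nzD(1)[OF assms(1)])
  show "scv_holomorphic_on (\<lambda>w. h w * k w) V"
    by (intro scv_mult dense_nzD(2)[OF assms(1)] dense_nzD(2)[OF assms(2)])
  fix W assume W: "open W" "W \<noteq> {}" "W \<subseteq> V"
  have "open {w \<in> W. h w \<noteq> 0}" by (rule dense_nz_open[OF assms(1) W(1,3)])
  moreover have "{w \<in> W. h w \<noteq> 0} \<noteq> {}" by (rule dense_nz_ex[OF assms(1) W])
  moreover have "{w \<in> W. h w \<noteq> 0} \<subseteq> V" using W(3) by auto
  ultimately have "\<exists>w\<in>{w \<in> W. h w \<noteq> 0}. k w \<noteq> 0" by (rule dense_nzD(3)[OF assms(2)])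
  then show "\<exists>w\<in>W. h w * k w \<noteq> 0" by auto
qed

lemma dense_nz_1: "open V \<Longrightarrow> dense_nz V (\<lambda>_. 1)"
  by (rule dense_nzI) auto

lemma dense_nz_zero:
  assumes "dense_nz V h" "scv_holomorphic_on g V" "\<And>w. w \<in> V \<Longrightarrow> h w \<noteq> 0 \<Longrightarrow> g w = 0" "w \<in> V"
  shows "g w = 0"
proof (rule ccontr)
  assume nz: "g w \<noteq> 0"
  have "open (V \<inter> g -` (- {0}))"
    by (rule continuous_open_preimage[OF scv_continuous_on[OF assms(2)] dense_nzD(1)[OF assms(1)]]) auto
  moreover have "V \<inter> g -` (- {0}) \<noteq> {}" using nz assms(4) by auto
  ultimately have "\<exists>w'\<in>V \<inter> g -` (- {0}). h w' \<noteq> 0"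
    by (rule dense_nzD(3)[OF assms(1)]) auto
  then obtain w' where "w' \<in> V \<inter> g -` (- {0})" "h w' \<noteq> 0" by blast
  then show False using assms(3)[of w'] by simp
qed

text \<open>Truth near \<open>z\<close> off the zeros of one admissible denominator. Products of
  denominators make this stable under finite conjunction, and the good set contains a nonempty open
  set, so it meets every set of full measure.\<close>

definition generically :: "(complex ^ 'n) \<times> complex \<Rightarrow> ((complex ^ 'n) \<times> complex \<Rightarrow> bool) \<Rightarrow> bool" where
  "generically z Q \<longleftrightarrow> (\<exists>V h. z \<in> V \<and> dense_nz V h \<and> (\<forall>w\<in>V. h w \<noteq> 0 \<longrightarrow> Q w))"

lemma generically_mono: "generically z Q \<Longrightarrow> (\<And>w. Q w \<Longrightarrow> R w) \<Longrightarrow> generically z R"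
  unfolding generically_def by blast

lemma generically_open: "open V \<Longrightarrow> z \<in> V \<Longrightarrow> generically z (\<lambda>w. w \<in> V)"
  unfolding generically_def using dense_nz_1 by blast

lemma generically_conj:
  assumes "generically z Q" "generically z R"
  shows "generically z (\<lambda>w. Q w \<and> R w)"
proof -
  obtain V h V' h' where *: "z \<in> V" "dense_nz V h" "\<And>w. w \<in> V \<Longrightarrow> h w \<noteq> 0 \<Longrightarrow> Q w"
    "z \<in> V'" "dense_nz V' h'" "\<And>w. w \<in> V' \<Longrightarrow> h' w \<noteq> 0 \<Longrightarrow> R w"
    using assms unfolding generically_def by blast
  have o: "open (V \<inter> V')" using *(2,5) by (auto simp: dense_nz_def)
  have "dense_nz (V \<inter> V') (\<lambda>w. h w * h' w)"
    by (rule dense_nz_mult[OF dense_nz_subset[OF *(2) o] dense_nz_subset[OF *(5) o]]) auto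
  then show ?thesis unfolding generically_def
    using * by (intro exI[of _ "V \<inter> V'"] exI[of _ "\<lambda>w. h w * h' w"]) auto
qed

lemma generically_finite:
  assumes "finite I" "\<And>i. i \<in> I \<Longrightarrow> generically z (Q i)"
  shows "generically z (\<lambda>w. \<forall>i\<in>I. Q i w)"
  using assms
proof (induction I rule: finite_induct)
  case empty
  show ?case using generically_open[of UNIV z] by (auto intro: generically_mono)
next
  case (insert x I)
  then have "generically z (\<lambda>w. Q x w \<and> (\<forall>i\<in>I. Q i w))" by (intro generically_conj) auto
  then show ?case by (rule generically_mono) auto
qed

text \<open>Nonempty open sets are not null; this is the bridge from the almost-everywhere
  independence in the definition of integrability to the fraction field.\<close>

lemma generically_AE:
  assumes "generically z Q" "AE w in lborel. w \<in> U \<longrightarrow> R w" "open U" "z \<in> U"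
  shows "\<exists>w. Q w \<and> R w"
proof -
  obtain V h where V: "z \<in> V" "dense_nz V h" "\<And>w. w \<in> V \<Longrightarrow> h w \<noteq> 0 \<Longrightarrow> Q w"
    using assms(1) unfolding generically_def by blast
  define W where "W = {w \<in> V \<inter> U. h w \<noteq> 0}"
  have o: "open (V \<inter> U)" using V(2) assms(3) by (auto simp: dense_nz_def)
  have W: "open W" "W \<noteq> {}"
    unfolding W_def using dense_nz_open[OF V(2) o] dense_nz_ex[OF V(2) o] V(1) assms(4) by auto
  obtain N where N: "{w \<in> space lborel. \<not> (w \<in> U \<longrightarrow> R w)} \<subseteq> N" "emeasure lborel N = 0" "N \<in> sets lborel"
    using assms(2) by (rule AE_E)
  have "\<not> W \<subseteq> N"
  proof
    assume "W \<subseteq> N"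
    have "N \<in> null_sets lebesgue"
      using N(2,3) by (intro null_sets_completionI) auto
    then have "negligible N" by (simp add: negligible_iff_null_sets)
    then have "negligible W" using \<open>W \<subseteq> N\<close> by (rule negligible_subset)
    then show False using open_not_negligible[OF W] by simp
  qed
  then obtain w where "w \<in> W" "w \<notin> N" by blast
  then show ?thesis using N(1) V(3) by (intro exI[of _ w]) (auto simp: W_def)
qed

definition mero_rep where
  "mero_rep V g h F \<longleftrightarrow> dense_nz V h \<and> scv_holomorphic_on g V \<and> (\<forall>w\<in>V. h w \<noteq> 0 \<longrightarrow> F w = g w / h w)"

lemma mero_repD:
  assumes "mero_rep V g h F"
  shows "open V" "scv_holomorphic_on g V" "scv_holomorphic_on h V" "dense_nz V h"
    "\<And>w. w \<in> V \<Longrightarrow> h w \<noteq> 0 \<Longrightarrow> F w = g w / h w"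
  using assms by (auto simp: mero_rep_def dense_nz_def)

lemma mero_rep_subset: "mero_rep V g h F \<Longrightarrow> open V' \<Longrightarrow> V' \<subseteq> V \<Longrightarrow> mero_rep V' g h F"
  unfolding mero_rep_def by (auto intro: dense_nz_subset[of V h V'] scv_subset[of g V V'])

lemma tay_dense_nz: "dense_nz V h \<Longrightarrow> z \<in> V \<Longrightarrow> tay z h \<noteq> 0"
proof
  assume h: "dense_nz V h" "z \<in> V" and 0: "tay z h = 0"
  have "scv_analytic_at h z" by (rule analytic_mono[OF dense_nzD(2,1)[OF h(1)] h(2)])
  from tay_eq_0_imp[OF this 0 dense_nzD(1)[OF h(1)] h(2)]
  obtain W where W: "open W" "W \<noteq> {}" "W \<subseteq> V" "\<forall>x\<in>W. h x = 0" by (elim exE conjE)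
  from dense_nzD(3)[OF h(1) W(1-3)] W(4) show False by simp
qed

lemma tay_zero_dense:
  assumes "dense_nz V h" "scv_holomorphic_on g V" "\<And>w. w \<in> V \<Longrightarrow> h w \<noteq> 0 \<Longrightarrow> g w = 0" "z \<in> V"
  shows "tay z g = 0"
proof -
  have "tay z g = tay z (\<lambda>_. 0)"
    by (rule tay_cong[OF dense_nzD(1)[OF assms(1)] assms(4)]) (rule dense_nz_zero[OF assms(1-3)])
  then show ?thesis by (simp add: tay_const cst_hom)
qed

text \<open>\<open>x\<close> is the image of the germ of \<open>F\<close> in the fraction field. A
  relation is used because \<open>g\<close> and \<open>h\<close> are not unique and the values of
  \<open>F\<close> on the zeros of \<open>h\<close> are arbitrary.\<close>

definition rep where
  "rep z F x \<longleftrightarrow> (\<exists>V g h. z \<in> V \<and> mero_rep V g h F \<and> x = Fract (tay z g) (tay z h))"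

lemma repI: "mero_rep V g h F \<Longrightarrow> z \<in> V \<Longrightarrow> rep z F (Fract (tay z g) (tay z h))"
  unfolding rep_def by blast

lemma mero_rep_exists:
  assumes "scv_meromorphic_on F U" "z \<in> U"
  shows "\<exists>V g h. z \<in> V \<and> V \<subseteq> U \<and> mero_rep V g h F"
proof -
  obtain V g h where "open V" "z \<in> V" "V \<subseteq> U" "scv_holomorphic_on g V" "scv_holomorphic_on h V"
    "\<forall>W. open W \<and> W \<noteq> {} \<and> W \<subseteq> V \<longrightarrow> (\<exists>w\<in>W. h w \<noteq> 0)" "\<forall>w\<in>V. h w \<noteq> 0 \<longrightarrow> F w = g w / h w"
    using bspec[OF assms(1)[unfolded scv_meromorphic_on_def] assms(2)] by (elim exE conjE)
  then show ?thesis unfolding mero_rep_def dense_nz_def by (intro exI[of _ V] exI[of _ g] exI[of _ h] conjI)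
qed

lemma rep_exists: "scv_meromorphic_on F U \<Longrightarrow> z \<in> U \<Longrightarrow> \<exists>x. rep z F x"
  by (drule (1) mero_rep_exists) (elim exE conjE, rule exI, rule repI)

lemma mero_rep_analytic:
  assumes "mero_rep V g h F" "w \<in> V" "h w \<noteq> 0"
  shows "scv_analytic_at F w"
proof -
  define W where "W = {w \<in> V. h w \<noteq> 0}"
  have W: "open W" unfolding W_def by (rule dense_nz_open[OF mero_repD(4)[OF assms(1)]]) (use mero_repD(1)[OF assms(1)] in auto)
  have "scv_holomorphic_on (\<lambda>w. g w / h w) W"
    by (rule scv_divide) (auto simp: W_def intro: scv_subset[OF mero_repD(2)[OF assms(1)]] scv_subset[OF mero_repD(3)[OF assms(1)]])
  then have "scv_holomorphic_on F W"
    by (rule scv_cong[OF W, rotated]) (use mero_repD(5)[OF assms(1)] in \<open>auto simp: W_def\<close>)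
  then show ?thesis by (rule analytic_mono) (use W assms in \<open>auto simp: W_def\<close>)
qed

lemma rep_analytic: "rep z F x \<Longrightarrow> generically z (scv_analytic_at F)"
  unfolding rep_def generically_def
proof (elim exE conjE)
  fix V g h assume r: "z \<in> V" "mero_rep V g h F"
  show "\<exists>V h. z \<in> V \<and> dense_nz V h \<and> (\<forall>w\<in>V. h w \<noteq> 0 \<longrightarrow> scv_analytic_at F w)"
    by (intro exI[of _ V] exI[of _ h] conjI ballI impI r mero_repD(4)[OF r(2)] mero_rep_analytic[OF r(2)])
qed

lemma rep_zeroI:
  assumes "rep z F x" "generically z (\<lambda>w. F w = 0)"
  shows "x = 0"
proof -
  obtain V g h where r: "z \<in> V" "mero_rep V g h F" "x = Fract (tay z g) (tay z h)"
    using assms(1) unfolding rep_def by blast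
  obtain V' k where k: "z \<in> V'" "dense_nz V' k" "\<And>w. w \<in> V' \<Longrightarrow> k w \<noteq> 0 \<Longrightarrow> F w = 0"
    using assms(2) unfolding generically_def by blast
  note rD = mero_repD[OF r(2)]
  have o: "open (V \<inter> V')" by (intro open_Int rD(1) dense_nzD(1)[OF k(2)])
  have "tay z g = 0"
  proof (rule tay_zero_dense)
    show "dense_nz (V \<inter> V') (\<lambda>w. h w * k w)"
      by (rule dense_nz_mult[OF dense_nz_subset[OF rD(4) o] dense_nz_subset[OF k(2) o]]) auto
    show "scv_holomorphic_on g (V \<inter> V')" by (rule scv_subset[OF rD(2)]) simp
    show "g w = 0" if "w \<in> V \<inter> V'" "h w * k w \<noteq> 0" for w
      using rD(5)[of w] k(3)[of w] that by auto
  qed (use r k in auto)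
  then show ?thesis using r(3) by (simp add: Zero_fract_def eq_fract tay_dense_nz[OF rD(4) r(1)])
qed

lemma cscale_scaleR: "cscale (u *\<^sub>R s) w = u *\<^sub>R cscale s w"
  by (simp add: cscale_of_real[symmetric] cscale_add scaleR_conv_of_real[where 'a = complex])

text \<open>Join \<open>w\<close> to a point of \<open>W\<close> by a complex line: its part inside
  the ball is a convex plane domain, and the one-variable identity theorem applies there.\<close>

lemma scv_identity:
  assumes "scv_holomorphic_on g (ball z r)" "open W" "W \<noteq> {}" "W \<subseteq> ball z r" "\<And>w. w \<in> W \<Longrightarrow> g w = 0" "w \<in> ball z r"
  shows "g w = 0"
proof -
  obtain w0 where w0: "w0 \<in> W" using assms(3) by blast
  define l where "l t = w0 + cscale t (w - w0)" for t
  have cl: "continuous_on A l" for A unfolding l_def by (intro continuous_intros)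
  define T where "T = l -` ball z r"
  have T: "open T" unfolding T_def by (rule open_vimage[OF open_ball cl])
  have convT: "convex T"
    unfolding convex_def
  proof (intro ballI allI impI)
    fix s t and u v :: real assume st: "s \<in> T" "t \<in> T" and uv: "0 \<le> u" "0 \<le> v" "u + v = 1"
    have "l (u *\<^sub>R s + v *\<^sub>R t) = (u + v) *\<^sub>R w0 + cscale (u *\<^sub>R s + v *\<^sub>R t) (w - w0)"
      by (simp add: l_def uv)
    also have "\<dots> = u *\<^sub>R l s + v *\<^sub>R l t"
      by (simp add: l_def cscale_add(1) cscale_scaleR scaleR_add_left scaleR_add_right)
    finally have e: "l (u *\<^sub>R s + v *\<^sub>R t) = u *\<^sub>R l s + v *\<^sub>R l t" .
    have "u *\<^sub>R l s + v *\<^sub>R l t \<in> ball z r"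
      using convexD[OF convex_ball _ _ uv] st by (auto simp: T_def)
    then show "u *\<^sub>R s + v *\<^sub>R t \<in> T" by (simp add: T_def e)
  qed
  have hol: "(\<lambda>t. g (l t)) holomorphic_on T"
  proof (rule holomorphic_on_derivI)
    fix t assume "t \<in> T"
    then show "((\<lambda>t. g (l t)) has_field_derivative dir g (w - w0) (l t)) (at t)"
      unfolding l_def T_def by (intro scv_line[OF assms(1)]) simp
  qed
  have "g (l 1) = 0"
  proof (rule analytic_continuation_open[of "l -` W \<inter> T" T "\<lambda>t. g (l t)" "\<lambda>_. 0"])
    show "open (l -` W \<inter> T)" using open_vimage[OF assms(2) cl] T by auto
    show "l -` W \<inter> T \<noteq> {}" 
    proof -
      have "0 \<in> l -` W \<inter> T" using w0 assms(4) by (auto simp: l_def T_def)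
      then show ?thesis by blast
    qed
    show "1 \<in> T" using assms(6) by (simp add: T_def l_def)
    show "connected T" by (rule convex_connected[OF convT])
    show "g (l t) = 0" if "t \<in> l -` W \<inter> T" for t using that assms(5) by simp
  qed (use T hol in simp_all)
  then show ?thesis by (simp add: l_def)
qed

text \<open>Injectivity of the passage to the fraction field: a numerator with zero Taylor series
  vanishes on some open set near \<open>z\<close>, hence on a whole ball around
  \<open>z\<close>.\<close>

lemma rep_zeroD:
  assumes "rep z F 0"
  shows "generically z (\<lambda>w. F w = 0)"
proof -
  obtain V g h where r: "z \<in> V" "mero_rep V g h F" "0 = Fract (tay z g) (tay z h)"
    using assms(1) unfolding rep_def by blast
  note rD = mero_repD[OF r(2)]
  have t0: "tay z g = 0" using r(3) tay_dense_nz[OF rD(4) r(1)] by (simp add: Zero_fract_def eq_fract)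
  obtain \<rho> where \<rho>: "\<rho> > 0" "ball z \<rho> \<subseteq> V" using rD(1) r(1) open_contains_ball by blast
  have "scv_analytic_at g z" by (rule analytic_mono[OF rD(2,1) r(1)])
  from tay_eq_0_imp[OF this t0 open_ball, of z \<rho>] \<rho>(1) obtain W where
    W: "open W" "W \<noteq> {}" "W \<subseteq> ball z \<rho>" "\<forall>x\<in>W. g x = 0" by (auto simp del: split_paired_All)
  have "g w = 0" if "w \<in> ball z \<rho>" for w
    by (rule scv_identity[OF scv_subset[OF rD(2) \<rho>(2)] W(1-3) _ that]) (use W(4) in blast)
  then show ?thesis
    unfolding generically_def using rD(5) \<rho> dense_nz_subset[OF rD(4) open_ball \<rho>(2)]
    by (intro exI[of _ "ball z \<rho>"] exI[of _ h]) auto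
qed

lemma mero_rep_pairE:
  assumes "rep z F x" "rep z G y"
  obtains V g h g' h' where "z \<in> V" "mero_rep V g h F" "x = Fract (tay z g) (tay z h)"
    "mero_rep V g' h' G" "y = Fract (tay z g') (tay z h')"
proof -
  obtain V g h V' g' h' where "z \<in> V" "mero_rep V g h F" "x = Fract (tay z g) (tay z h)"
    "z \<in> V'" "mero_rep V' g' h' G" "y = Fract (tay z g') (tay z h')"
    using assms unfolding rep_def by blast
  moreover from this have "open (V \<inter> V')" by (intro open_Int mero_repD(1))
  ultimately show ?thesis
    using that[of "V \<inter> V'"] mero_rep_subset[of V g h F "V \<inter> V'"] mero_rep_subset[of V' g' h' G "V \<inter> V'"] by simp
qed

lemma rep_add: 
  assumes "rep z F x" "rep z G y"
  shows "rep z (\<lambda>w. F w + G w) (x + y)"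
proof -
  obtain V g h g' h' where r: "z \<in> V" "mero_rep V g h F" "x = Fract (tay z g) (tay z h)"
    "mero_rep V g' h' G" "y = Fract (tay z g') (tay z h')" by (rule mero_rep_pairE[OF assms])
  note D = mero_repD[OF r(2)] and D' = mero_repD[OF r(4)]
  have an: "scv_analytic_at g z" "scv_analytic_at h z" "scv_analytic_at g' z" "scv_analytic_at h' z"
    by (rule analytic_mono[OF D(2,1) r(1)] analytic_mono[OF D(3,1) r(1)] analytic_mono[OF D'(2,1) r(1)] analytic_mono[OF D'(3,1) r(1)])+
  have "mero_rep V (\<lambda>w. g w * h' w + g' w * h w) (\<lambda>w. h w * h' w) (\<lambda>w. F w + G w)"
    unfolding mero_rep_def
  proof (intro conjI ballI impI)
    show "F w + G w = (g w * h' w + g' w * h w) / (h w * h' w)" if "w \<in> V" "h w * h' w \<noteq> 0" for w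
      using that D(5)[of w] D'(5)[of w] by (simp add: add_frac_eq)
  qed (intro dense_nz_mult scv_add scv_mult D(2-4) D'(2-4))+
  from repI[OF this r(1)] show ?thesis
    using tay_dense_nz[OF D(4) r(1)] tay_dense_nz[OF D'(4) r(1)]
    by (simp add: r(3,5) tay_add tay_mult an analytic_mult)
qed

lemma rep_mult: 
  assumes "rep z F x" "rep z G y"
  shows "rep z (\<lambda>w. F w * G w) (x * y)"
proof -
  obtain V g h g' h' where r: "z \<in> V" "mero_rep V g h F" "x = Fract (tay z g) (tay z h)"
    "mero_rep V g' h' G" "y = Fract (tay z g') (tay z h')" by (rule mero_rep_pairE[OF assms])
  note D = mero_repD[OF r(2)] and D' = mero_repD[OF r(4)]
  have an: "scv_analytic_at g z" "scv_analytic_at h z" "scv_analytic_at g' z" "scv_analytic_at h' z"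
    by (rule analytic_mono[OF D(2,1) r(1)] analytic_mono[OF D(3,1) r(1)] analytic_mono[OF D'(2,1) r(1)] analytic_mono[OF D'(3,1) r(1)])+
  have "mero_rep V (\<lambda>w. g w * g' w) (\<lambda>w. h w * h' w) (\<lambda>w. F w * G w)"
    unfolding mero_rep_def
  proof (intro conjI ballI impI)
    show "F w * G w = (g w * g' w) / (h w * h' w)" if "w \<in> V" "h w * h' w \<noteq> 0" for w
      using that D(5)[of w] D'(5)[of w] by simp
  qed (intro dense_nz_mult scv_mult D(2-4) D'(2-4))+
  from repI[OF this r(1)] show ?thesis
    by (simp add: r(3,5) tay_mult an)
qed

lemma rep_analytic_fun: "scv_analytic_at g z \<Longrightarrow> rep z g (emb (tay z g))"
proof -
  assume "scv_analytic_at g z"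
  then obtain V where V: "open V" "z \<in> V" "scv_holomorphic_on g V" unfolding scv_analytic_at_def by blast
  have "mero_rep V g (\<lambda>_. 1) g" unfolding mero_rep_def using V(3) dense_nz_1[OF V(1)] by simp
  from repI[OF this V(2)] show ?thesis by (simp add: tay_const cst_hom)
qed

lemma rep_const: "rep z (\<lambda>_. c) (emb (fps_const (cst c)))"
  using rep_analytic_fun[OF analytic_const] by (simp add: tay_const)

lemma rep_0_1: "rep z (\<lambda>_. 0) 0" "rep z (\<lambda>_. 1) 1"
  using rep_const[of z 0] rep_const[of z 1] by (simp_all add: cst_hom emb_simps)

lemma rep_minus: "rep z F x \<Longrightarrow> rep z (\<lambda>w. - F w) (- x)"
proof -
  assume r: "rep z F x"
  have "fps_const (cst (- 1)) = (- 1 :: ('a + 'a) pol fps)"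
    by (simp add: cst_hom flip: fps_const_neg)
  then have "emb (fps_const (cst (- 1)) :: ('a + 'a) pol fps) = - 1"
    by (simp add: One_fract_def)
  with rep_mult[OF rep_const[of z "-1"] r] show "rep z (\<lambda>w. - F w) (- x)" by simp
qed

lemma rep_diff: "rep z F x \<Longrightarrow> rep z G y \<Longrightarrow> rep z (\<lambda>w. F w - G w) (x - y)"
  using rep_add[OF _ rep_minus, of z F x G y] by simp

lemma rep_sum: "(\<And>i. i \<in> I \<Longrightarrow> rep z (F i) (x i)) \<Longrightarrow> rep z (\<lambda>w. \<Sum>i\<in>I. F i w) (\<Sum>i\<in>I. x i)"
  by (induction I rule: infinite_finite_induct) (auto intro: rep_add rep_0_1)

lemma rep_prod: "(\<And>i. i \<in> I \<Longrightarrow> rep z (F i) (x i)) \<Longrightarrow> rep z (\<lambda>w. \<Prod>i\<in>I. F i w) (\<Prod>i\<in>I. x i)"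
  by (induction I rule: infinite_finite_induct) (auto intro: rep_mult rep_0_1)

lemma rep_unique: "rep z F x \<Longrightarrow> rep z F y \<Longrightarrow> x = y"
  using rep_zeroI[OF rep_diff, of z F x F y] generically_mono[OF generically_open[of UNIV z]] by simp

text \<open>The power of \<open>\<mu>\<close> evens out the weights: these operators all act on Taylor series as
  \<open>\<mu>\<^sup>2\<close> times a partial derivative.\<close>

definition eop :: "'l + 'l \<Rightarrow> ('l::finite + 'l) pol fps \<Rightarrow> ('l + 'l) pol fps" where
  "eop m A = fps_X ^ (2 - wt m) * dR m A"

lemma eop_derivation: "is_derivation (eop m)"
  by (simp add: is_derivation_def eop_def dR_add dR_mult algebra_simps)

lemma eop_tay:
  assumes "scv_analytic_at g z"
  shows "eop m (tay z g) = fps_X ^ 2 * tay z (dir g (bas m))"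
  by (simp add: eop_def dR_tay[OF assms] mult.assoc[symmetric] power_add[symmetric])

lemma rep_dir:
  assumes "rep z F x"
  shows "\<exists>y. rep z (dir F (bas m)) y \<and> fder (eop m) x = emb (fps_X ^ 2) * y"
proof -
  obtain V g h where r: "z \<in> V" "mero_rep V g h F" "x = Fract (tay z g) (tay z h)"
    using assms(1) unfolding rep_def by blast
  note D = mero_repD[OF r(2)]
  note hd = dir_holomorphic(1)[OF D(2,1)] dir_holomorphic(1)[OF D(3,1)]
  have an: "scv_analytic_at g z" "scv_analytic_at h z" "scv_analytic_at (dir g v) z" "scv_analytic_at (dir h v) z" for v
    by (rule analytic_mono[OF D(2,1) r(1)] analytic_mono[OF D(3,1) r(1)] analytic_mono[OF hd(1) D(1) r(1)] analytic_mono[OF hd(2) D(1) r(1)])+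
  have "mero_rep V (\<lambda>w. dir g (bas m) w * h w - g w * dir h (bas m) w) (\<lambda>w. h w * h w) (dir F (bas m))"
    unfolding mero_rep_def
  proof (intro conjI ballI impI)
    show "dense_nz V (\<lambda>w. h w * h w)" by (intro dense_nz_mult D)
    show "scv_holomorphic_on (\<lambda>w. dir g (bas m) w * h w - g w * dir h (bas m) w) V"
      by (intro scv_diff scv_mult D hd)
    fix w assume w: "w \<in> V" "h w * h w \<noteq> 0"
    define W where "W = {w \<in> V. h w \<noteq> 0}"
    have W: "open W" unfolding W_def by (rule dense_nz_open[OF D(4) D(1)]) simp
    have "dir F (bas m) w = dir (\<lambda>w. g w / h w) (bas m) w"
      by (rule dir_cong[OF W]) (use D(5) w in \<open>auto simp: W_def\<close>)
    also have "\<dots> = (dir g (bas m) w * h w - g w * dir h (bas m) w) / (h w * h w)"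
      using dir_simps(5)[OF D(2,3) w(1)] w by (simp add: power2_eq_square)
    finally show "dir F (bas m) w = (dir g (bas m) w * h w - g w * dir h (bas m) w) / (h w * h w)" .
  qed
  from repI[OF this r(1)]
  have "rep z (dir F (bas m)) (Fract (tay z (dir g (bas m)) * tay z h - tay z g * tay z (dir h (bas m))) (tay z h * tay z h))"
    by (simp add: tay_diff tay_mult an analytic_mult)
  moreover have "fder (eop m) x = emb (fps_X ^ 2) * Fract (tay z (dir g (bas m)) * tay z h - tay z g * tay z (dir h (bas m))) (tay z h * tay z h)"
    unfolding r(3) fder_Fract[OF eop_derivation tay_dense_nz[OF D(4) r(1)]] eop_tay[OF an(1)] eop_tay[OF an(2)]
    by (simp add: algebra_simps)
  ultimately show ?thesis by blast
qed

text \<open>For a function with period \<open>a\<close>, a quotient representation near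
  \<open>z + a\<close> pulls back to one near \<open>z\<close> with the same Taylor series. This
  closes the path over one real period.\<close>

lemma rep_translate:
  assumes "rep (z + a) F x" "open U" "z \<in> U" "\<And>w. w \<in> U \<Longrightarrow> F (w + a) = F w"
  shows "rep z F x"
proof -
  obtain V g h where r: "z + a \<in> V" "mero_rep V g h F" "x = Fract (tay (z + a) g) (tay (z + a) h)"
    using assms(1) unfolding rep_def by blast
  note D = mero_repD[OF r(2)]
  define V' where "V' = (\<lambda>w. w + a) -` V"
  have V': "open V'" unfolding V'_def by (intro open_vimage D continuous_intros)
  have dn: "dense_nz V' (\<lambda>w. h (w + a))"
  proof (rule dense_nzI[OF V'])
    show "scv_holomorphic_on (\<lambda>w. h (w + a)) V'" unfolding V'_def by (rule scv_translate[OF D(3)])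
    fix W assume W: "open W" "W \<noteq> {}" "W \<subseteq> V'"
    have "open ((+) a ` W)" by (rule open_translation[OF W(1)])
    moreover have "(+) a ` W \<noteq> {}" "(+) a ` W \<subseteq> V" using W(2,3) by (auto simp: V'_def add.commute)
    ultimately have "\<exists>w\<in>(+) a ` W. h w \<noteq> 0" by (rule dense_nzD(3)[OF D(4)])
    then show "\<exists>w\<in>W. h (w + a) \<noteq> 0" by (simp add: add.commute)
  qed
  have gh: "scv_holomorphic_on (\<lambda>w. g (w + a)) V'" unfolding V'_def by (rule scv_translate[OF D(2)])
  have "mero_rep (V' \<inter> U) (\<lambda>w. g (w + a)) (\<lambda>w. h (w + a)) F"
    unfolding mero_rep_def
  proof (intro conjI ballI impI)
    show "dense_nz (V' \<inter> U) (\<lambda>w. h (w + a))" by (rule dense_nz_subset[OF dn]) (use V' assms(2) in auto)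
    show "scv_holomorphic_on (\<lambda>w. g (w + a)) (V' \<inter> U)" by (rule scv_subset[OF gh]) simp
    show "F w = g (w + a) / h (w + a)" if "w \<in> V' \<inter> U" "h (w + a) \<noteq> 0" for w
      using that D(5)[of "w + a"] assms(4)[of w] by (simp add: V'_def)
  qed
  from repI[OF this, of z] show ?thesis
    using r(1,3) assms(3) by (simp add: tay_translate V'_def)
qed

lemma rep_det:
  fixes A :: "(complex ^ ('l::finite + 'l)) \<times> complex \<Rightarrow> complex ^ 'b ^ 'b"
    and B :: "('l + 'l) pol fps fract ^ 'b ^ 'b"
  assumes "\<And>i k. rep z (\<lambda>w. A w $ i $ k) (B $ i $ k)"
  shows "rep z (\<lambda>w. det (A w)) (det B)"
proof -
  have s: "rep z (\<lambda>_. of_int (sign p)) (of_int (sign p))" for p :: "'b \<Rightarrow> 'b"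
    using rep_0_1(2)[of z] rep_minus[OF rep_0_1(2)[of z]] by (auto simp: sign_def)
  show ?thesis unfolding det_def by (intro rep_sum rep_mult s rep_prod assms)
qed

text \<open>If the formal vectors were dependent, every completion to a square matrix would have
  determinant zero; injectivity of the formal germs would carry this back to actual points, against
  independence almost everywhere.\<close>

lemma lin_indep_transfer:
  fixes v :: "nat \<Rightarrow> (complex ^ ('l::finite + 'l)) \<times> complex \<Rightarrow> complex ^ ('l + 'l)"
  assumes J: "finite J" and rep: "\<And>j i. j \<in> J \<Longrightarrow> rep z (\<lambda>w. v j w $ i) (x j $ i)"
    and AE: "AE w in lborel. w \<in> U \<longrightarrow> lin_indep_family (\<lambda>j. v j w) J" and U: "open U" "z \<in> U"
  shows "lin_indep x J"
proof (rule ccontr)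
  assume nli: "\<not> lin_indep x J"
  \<comment> \<open>The completions by unit rows. There are finitely many, so all determinants
    vanish simultaneously at a generic point.\<close>
  define Rs where "Rs = {r :: 'l + 'l \<Rightarrow> nat + ('l + 'l). (\<forall>j\<in>J. \<exists>i. r i = Inl j) \<and> (\<forall>i j. r i = Inl j \<longrightarrow> j \<in> J)}"
  have "finite Rs"
  proof (rule finite_subset)
    show "Rs \<subseteq> (UNIV \<rightarrow>\<^sub>E (Inl ` J \<union> range Inr))"
    proof
      fix r assume "r \<in> Rs"
      then have "r i \<in> Inl ` J \<union> range Inr" for i by (cases "r i") (auto simp: Rs_def)
      then show "r \<in> UNIV \<rightarrow>\<^sub>E (Inl ` J \<union> range Inr)" by auto
    qed
    show "finite ((UNIV :: ('l + 'l) set) \<rightarrow>\<^sub>E (Inl ` J \<union> range Inr :: (nat + ('l + 'l)) set))"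
      by (rule finite_PiE) (use J in auto)
  qed
  have "generically z (\<lambda>w. \<forall>r\<in>Rs. det (rowmat (\<lambda>j. v j w) r) = 0)"
  proof (rule generically_finite[OF \<open>finite Rs\<close>])
    fix r assume r: "r \<in> Rs"
    have "rep z (\<lambda>w. det (rowmat (\<lambda>j. v j w) r)) (det (rowmat x r))"
    proof (rule rep_det)
      fix i k
      show "rep z (\<lambda>w. rowmat (\<lambda>j. v j w) r $ i $ k) (rowmat x r $ i $ k)"
      proof (cases "r i")
        case (Inl j)
        then have "j \<in> J" using r by (auto simp: Rs_def)
        then show ?thesis using rep by (simp add: rowmat_def Inl)
      next
        case (Inr m)
        then show ?thesis by (simp add: rowmat_def axis_def rep_0_1)
      qed
    qed
    moreover have "det (rowmat x r) = 0"
      using rowmat_det_imp_indep[of x r J] nli r J by (auto simp: Rs_def)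
    ultimately show "generically z (\<lambda>w. det (rowmat (\<lambda>j. v j w) r) = 0)" using rep_zeroD by simp
  qed
  from generically_AE[OF this AE U] obtain w where
    w: "\<forall>r\<in>Rs. det (rowmat (\<lambda>j. v j w) r) = 0" "lin_indep_family (\<lambda>j. v j w) J" by blast
  have "lin_indep (\<lambda>j. v j w) J" using w(2) unfolding lin_indep_family_def lin_indep_def .
  from indep_imp_rowmat_det[OF this J] w(1) show False by (auto simp: Rs_def)
qed

section \<open>Common denominators and propagation along a path\<close>

lemma mero_rep_common:
  assumes "finite I" "\<And>i. i \<in> I \<Longrightarrow> \<exists>V g h. z \<in> V \<and> mero_rep V g h (F i)"
  shows "\<exists>V h G. z \<in> V \<and> dense_nz V h \<and> (\<forall>i\<in>I. mero_rep V (G i) h (F i))"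
  using assms
proof (induction I rule: finite_induct)
  case empty
  show ?case by (intro exI[of _ UNIV] exI[of _ "\<lambda>_. 1"]) (simp add: dense_nz_1)
next
  case (insert x I)
  obtain V h G where V: "z \<in> V" "dense_nz V h" "\<forall>i\<in>I. mero_rep V (G i) h (F i)"
    using insert.IH insert.prems by blast
  obtain V' g' h' where V': "z \<in> V'" "mero_rep V' g' h' (F x)" using insert.prems by blast
  define W where "W = V \<inter> V'"
  have W: "open W" unfolding W_def by (intro open_Int dense_nzD(1)[OF V(2)] mero_repD(1)[OF V'(2)])
  have hh: "dense_nz W h" "dense_nz W h'"
    by (rule dense_nz_subset[OF V(2) W], simp add: W_def, rule dense_nz_subset[OF mero_repD(4)[OF V'(2)] W], simp add: W_def)
  have g': "scv_holomorphic_on g' W" by (rule scv_subset[OF mero_repD(2)[OF V'(2)]]) (simp add: W_def)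
  have G: "scv_holomorphic_on (G i) W" if "i \<in> I" for i
    by (rule scv_subset[OF mero_repD(2)[OF bspec[OF V(3) that]]]) (simp add: W_def)
  define G' where "G' i = (if i = x then (\<lambda>w. g' w * h w) else (\<lambda>w. G i w * h' w))" for i
  show ?case
  proof (intro exI[of _ W] exI[of _ "\<lambda>w. h w * h' w"] exI[of _ G'] conjI ballI)
    show "z \<in> W" using V V' by (simp add: W_def)
    show d: "dense_nz W (\<lambda>w. h w * h' w)" by (rule dense_nz_mult[OF hh])
    fix i assume i: "i \<in> insert x I"
    show "mero_rep W (G' i) (\<lambda>w. h w * h' w) (F i)"
    proof (cases "i = x")
      case True
      have "F x w = g' w * h w / (h w * h' w)" if "w \<in> W" "h w * h' w \<noteq> 0" for w
        using that mero_repD(5)[OF V'(2), of w] by (simp add: W_def)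
      then show ?thesis
        unfolding mero_rep_def G'_def using True d scv_mult[OF g' dense_nzD(2)[OF hh(1)]] by simp
    next
      case False
      then have iI: "i \<in> I" using i by simp
      have "F i w = G i w * h' w / (h w * h' w)" if "w \<in> W" "h w * h' w \<noteq> 0" for w
        using that mero_repD(5)[OF bspec[OF V(3) iI], of w] by (simp add: W_def)
      then show ?thesis
        unfolding mero_rep_def G'_def using False d scv_mult[OF G[OF iI] dense_nzD(2)[OF hh(2)]] by simp
    qed
  qed
qed

lemma mero_rep_dir:
  assumes r: "mero_rep V g h F" and w: "w \<in> V" "h w \<noteq> 0"
  shows "dir F v w = (dir g v w * h w - g w * dir h v w) / (h w)\<^sup>2"
proof -
  note D = mero_repD[OF r]
  define W where "W = {w \<in> V. h w \<noteq> 0}"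
  have W: "open W" unfolding W_def by (rule dense_nz_open[OF D(4) D(1)]) simp
  have "dir F v w = dir (\<lambda>w. g w / h w) v w"
    by (rule dir_cong[OF W]) (use D(5) w in \<open>auto simp: W_def\<close>)
  then show ?thesis using dir_simps(5)[OF D(2,3) w] by simp
qed

definition germ where "germ z F = (THE x. rep z F x)"

lemma germ: "rep z F x \<Longrightarrow> germ z F = x"
  unfolding germ_def using rep_unique by blast

context transport
begin

text \<open>Locally \<open>q\<close> is a fraction solving the transport equation, and
  \<open>quotient_propagation\<close> carries agreement with \<open>Jy / Jd\<close> from any point
  of a small ball to all of it. The points of agreement thus form a set that is open with open
  complement in the connected \<open>S\<close>. Only \<open>Jy\<close> and \<open>Jd\<close> have to
  exist globally; the representation of \<open>q\<close> may change from ball to ball.\<close>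

lemma propagate:
  assumes J: "sol Jy" "sol Jd"
    and loc: "\<And>\<zeta>0. \<zeta>0 \<in> S \<Longrightarrow> \<exists>r A A' B B'. r > 0 \<and> ball \<zeta>0 r \<subseteq> S \<and> fh (ball \<zeta>0 r) A \<and> HD (ball \<zeta>0 r) A A' \<and>
       fh (ball \<zeta>0 r) B \<and> HD (ball \<zeta>0 r) B B' \<and>
       (\<forall>\<zeta>\<in>ball \<zeta>0 r. (A' \<zeta> + L \<zeta> (A \<zeta>)) * B \<zeta> = A \<zeta> * (B' \<zeta> + L \<zeta> (B \<zeta>)) \<and> B \<zeta> \<noteq> 0 \<and> q \<zeta> = Fract (A \<zeta>) (B \<zeta>))"
    and start: "\<zeta>1 \<in> S" "q \<zeta>1 * emb (Jd \<zeta>1) = emb (Jy \<zeta>1)" and z: "\<zeta> \<in> S"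
  shows "q \<zeta> * emb (Jd \<zeta>) = emb (Jy \<zeta>)"
proof -
  define P where "P \<zeta> \<longleftrightarrow> q \<zeta> * emb (Jd \<zeta>) = emb (Jy \<zeta>)" for \<zeta>
  have key: "\<exists>r>0. ball \<zeta>0 r \<subseteq> S \<and> (\<forall>x\<in>ball \<zeta>0 r. \<forall>y\<in>ball \<zeta>0 r. P x \<longrightarrow> P y)" if z0: "\<zeta>0 \<in> S" for \<zeta>0
  proof -
    obtain r A A' B B' where r: "r > 0" "ball \<zeta>0 r \<subseteq> S" "fh (ball \<zeta>0 r) A" "HD (ball \<zeta>0 r) A A'"
       "fh (ball \<zeta>0 r) B" "HD (ball \<zeta>0 r) B B'"
       and e: "\<forall>\<zeta>\<in>ball \<zeta>0 r. (A' \<zeta> + L \<zeta> (A \<zeta>)) * B \<zeta> = A \<zeta> * (B' \<zeta> + L \<zeta> (B \<zeta>)) \<and> B \<zeta> \<noteq> 0 \<and> q \<zeta> = Fract (A \<zeta>) (B \<zeta>)"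
      using loc[OF z0] by (elim exE conjE)
    have P: "P x \<longleftrightarrow> A x * Jd x = Jy x * B x" if "x \<in> ball \<zeta>0 r" for x
      using bspec[OF e that] by (simp add: P_def eq_fract)
    have "P y" if x: "x \<in> ball \<zeta>0 r" and y: "y \<in> ball \<zeta>0 r" and "P x" for x y
    proof -
      have "A y * Jd y = Jy y * B y"
        by (rule quotient_propagation[OF open_ball _ r(2) x r(3-6) _ J _ _ y])
          (use e x P[OF x] \<open>P x\<close> in auto)
      then show ?thesis using P[OF y] by simp
    qed
    with r(1,2) show ?thesis by blast
  qed
  define \<Omega> where "\<Omega> = {\<zeta> \<in> S. P \<zeta>}"
  have "open \<Omega>"
    unfolding open_contains_ball
  proof
    fix x assume "x \<in> \<Omega>"
    then have x: "x \<in> S" "P x" by (auto simp: \<Omega>_def)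
    obtain r where "r > 0" "ball x r \<subseteq> S" "\<forall>u\<in>ball x r. \<forall>y\<in>ball x r. P u \<longrightarrow> P y" using key[OF x(1)] by blast
    then show "\<exists>e>0. ball x e \<subseteq> \<Omega>" using x by (intro exI[of _ r]) (auto simp: \<Omega>_def)
  qed
  moreover have "open (S - \<Omega>)"
    unfolding open_contains_ball
  proof
    fix x assume "x \<in> S - \<Omega>"
    then have x: "x \<in> S" "\<not> P x" by (auto simp: \<Omega>_def)
    obtain r where "r > 0" "ball x r \<subseteq> S" "\<forall>u\<in>ball x r. \<forall>y\<in>ball x r. P u \<longrightarrow> P y" using key[OF x(1)] by blast
    then show "\<exists>e>0. ball x e \<subseteq> S - \<Omega>" using x by (intro exI[of _ r]) (auto simp: \<Omega>_def)
  qed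
  moreover have "connected S" by (rule convex_connected[OF S_convex])
  ultimately have "\<Omega> \<inter> S = {} \<or> (S - \<Omega>) \<inter> S = {}"
    by (intro connectedD) auto
  moreover have "\<zeta>1 \<in> \<Omega> \<inter> S" using start by (simp add: \<Omega>_def P_def)
  ultimately have "\<zeta> \<in> \<Omega>" using z by blast
  then show ?thesis by (simp add: \<Omega>_def P_def)
qed

end

section \<open>Transport of first integrals and commuting fields\<close>

text \<open>The expansion centre moves with velocity \<open>c' * v\<close> along the unperturbed
  orbit, and \<open>\<kappa>\<close> is the field relative to it in blown-up variables: component
  \<open>m\<close> is \<open>c' * (f m - v m)\<close> divided by \<mu> to the power
  \<open>wt m\<close>. The equation \<open>\<kappa>_eq\<close> is multiplied by
  \<open>fps_X ^ 2\<close> to avoid negative powers.\<close>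

locale field_transport = transport S \<kappa>
  for S and \<kappa> :: "complex \<Rightarrow> 'l + 'l \<Rightarrow> ('l::finite + 'l) pol fps" +
  fixes c c' :: "complex \<Rightarrow> complex" and z0 v :: "(complex ^ ('l + 'l)) \<times> complex"
    and f :: "'l + 'l \<Rightarrow> (complex ^ ('l + 'l)) \<times> complex \<Rightarrow> complex" and Uf :: "((complex ^ ('l + 'l)) \<times> complex) set"
  assumes c: "\<And>\<zeta>. \<zeta> \<in> S \<Longrightarrow> (c has_field_derivative c' \<zeta>) (at \<zeta>)"
    and Uf: "open Uf" "\<And>\<zeta>. \<zeta> \<in> S \<Longrightarrow> z0 + cscale (c \<zeta>) v \<in> Uf"
    and f: "\<And>m. scv_holomorphic_on (f m) Uf"
    and v: "snd v = 0"
    and \<kappa>_eq: "\<And>\<zeta> m. \<zeta> \<in> S \<Longrightarrow> fps_X ^ 2 * \<kappa> \<zeta> m =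
      fps_const (cst (c' \<zeta>)) * (tay (z0 + cscale (c \<zeta>) v) (f m) - fps_const (cst (fst v $ m))) * fps_X ^ (2 - wt m)"
begin

definition Z where "Z \<zeta> = z0 + cscale (c \<zeta>) v"

definition adv :: "((complex ^ ('l + 'l)) \<times> complex \<Rightarrow> complex) \<Rightarrow> (complex ^ ('l + 'l)) \<times> complex \<Rightarrow> complex" where
  "adv g w = (\<Sum>m\<in>UNIV. f m w * dir g (bas m) w)"

lemma Z_mem: "\<zeta> \<in> S \<Longrightarrow> Z \<zeta> \<in> Uf" using Uf(2) by (simp add: Z_def)

lemma f_an: "\<zeta> \<in> S \<Longrightarrow> scv_analytic_at (f m) (Z \<zeta>)"
  by (rule analytic_mono[OF f Uf(1) Z_mem])

lemma adv_an: "\<zeta> \<in> S \<Longrightarrow> scv_analytic_at g (Z \<zeta>) \<Longrightarrow> scv_analytic_at (adv g) (Z \<zeta>)"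
  unfolding adv_def[abs_def] by (intro analytic_sum analytic_mult f_an analytic_dir)

lemma X2_L:
  assumes "\<zeta> \<in> S"
  shows "fps_X ^ 2 * L \<zeta> A = fps_const (cst (c' \<zeta>)) *
    (\<Sum>m\<in>UNIV. (tay (Z \<zeta>) (f m) - fps_const (cst (fst v $ m))) * eop m A)"
proof -
  have "fps_X ^ 2 * L \<zeta> A = (\<Sum>m\<in>UNIV. (fps_X ^ 2 * \<kappa> \<zeta> m) * dR m A)"
    by (simp add: L_def sum_distrib_left mult.assoc)
  also have "\<dots> = (\<Sum>m\<in>UNIV. fps_const (cst (c' \<zeta>)) * ((tay (Z \<zeta>) (f m) - fps_const (cst (fst v $ m))) * eop m A))"
    unfolding \<kappa>_eq[OF assms] by (simp only: eop_def mult.assoc Z_def)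
  finally show ?thesis by (simp only: sum_distrib_left)
qed

text \<open>The motion of the centre contributes the derivative along \<open>v\<close>, and
  \<open>L\<close> the derivative along the field minus \<open>v\<close>; the two occurrences of
  \<open>v\<close> cancel. The comparison is made after multiplication by \<open>fps_X ^ 2\<close>,
  where \<open>L\<close> is a combination of the \<open>eop m\<close>.\<close>

lemma total_derivative:
  assumes z: "\<zeta> \<in> S" and g: "scv_analytic_at g (Z \<zeta>)"
  shows "fps_const (cst (c' \<zeta>)) * tay (Z \<zeta>) (dir g v) + L \<zeta> (tay (Z \<zeta>) g) = fps_const (cst (c' \<zeta>)) * tay (Z \<zeta>) (adv g)"
proof -
  obtain U where U: "open U" "Z \<zeta> \<in> U" "scv_holomorphic_on g U" using g unfolding scv_analytic_at_def by blast
  have dv: "tay (Z \<zeta>) (dir g v) = (\<Sum>m\<in>UNIV. fps_const (cst (fst v $ m)) * tay (Z \<zeta>) (dir g (bas m)))"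
  proof -
    have "tay (Z \<zeta>) (dir g v) = tay (Z \<zeta>) (\<lambda>w. \<Sum>m\<in>UNIV. fst v $ m * dir g (bas m) w)"
      by (rule tay_cong[OF U(1,2)]) (simp add: dir_expand[OF U(3), of _ v] v)
    also have "\<dots> = (\<Sum>m\<in>UNIV. tay (Z \<zeta>) (\<lambda>w. fst v $ m * dir g (bas m) w))"
      by (rule tay_sum) (intro analytic_mult analytic_const analytic_dir g)
    also have "\<dots> = (\<Sum>m\<in>UNIV. fps_const (cst (fst v $ m)) * tay (Z \<zeta>) (dir g (bas m)))"
      by (simp only: tay_mult[OF analytic_const analytic_dir[OF g]] tay_const)
    finally show ?thesis .
  qed
  have adv: "tay (Z \<zeta>) (adv g) = (\<Sum>m\<in>UNIV. tay (Z \<zeta>) (f m) * tay (Z \<zeta>) (dir g (bas m)))"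
    unfolding adv_def[abs_def]
  proof -
    have "tay (Z \<zeta>) (\<lambda>w. \<Sum>m\<in>UNIV. f m w * dir g (bas m) w) = (\<Sum>m\<in>UNIV. tay (Z \<zeta>) (\<lambda>w. f m w * dir g (bas m) w))"
      by (rule tay_sum) (intro analytic_mult f_an[OF z] analytic_dir g)
    then show "tay (Z \<zeta>) (\<lambda>w. \<Sum>m\<in>UNIV. f m w * dir g (bas m) w) = (\<Sum>m\<in>UNIV. tay (Z \<zeta>) (f m) * tay (Z \<zeta>) (dir g (bas m)))"
      by (simp only: tay_mult[OF f_an[OF z] analytic_dir[OF g]])
  qed
  have "fps_X ^ 2 * (fps_const (cst (c' \<zeta>)) * tay (Z \<zeta>) (dir g v) + L \<zeta> (tay (Z \<zeta>) g)) =
    fps_X ^ 2 * (fps_const (cst (c' \<zeta>)) * tay (Z \<zeta>) (adv g))"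
    unfolding distrib_left X2_L[OF z] dv adv eop_tay[OF g] sum_distrib_left sum.distrib[symmetric]
    by (rule sum.cong[OF refl]) (simp add: algebra_simps)
  then show ?thesis by simp
qed

lemma eop_\<kappa>:
  assumes z: "\<zeta> \<in> S"
  shows "eop i (\<kappa> \<zeta> m) = fps_const (cst (c' \<zeta>)) * tay (Z \<zeta>) (dir (f m) (bas i)) * fps_X ^ (2 - wt m)"
proof -
  note D = is_derivationD[OF eop_derivation]
  have 0: "eop i (fps_X ^ k) = 0" "eop i (fps_const (cst a)) = 0" for k a by (simp_all add: eop_def)
  have "fps_X ^ 2 * eop i (\<kappa> \<zeta> m) = eop i (fps_X ^ 2 * \<kappa> \<zeta> m)" by (simp add: D(2) 0)
  also have "\<dots> = fps_X ^ 2 * (fps_const (cst (c' \<zeta>)) * tay (Z \<zeta>) (dir (f m) (bas i)) * fps_X ^ (2 - wt m))"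
    unfolding \<kappa>_eq[OF z] D(2) D(6) 0 Z_def[symmetric] eop_tay[OF f_an[OF z]] by (simp add: mult_ac)
  finally show ?thesis by simp
qed

text \<open>The commutator of a coordinate derivation with transport is the Jacobian of the field.
  It is this term that the bracket condition on a commuting field compensates.\<close>

lemma eop_L:
  assumes z: "\<zeta> \<in> S"
  shows "eop i (L \<zeta> A) = L \<zeta> (eop i A) + fps_const (cst (c' \<zeta>)) * (\<Sum>m\<in>UNIV. tay (Z \<zeta>) (dir (f m) (bas i)) * eop m A)"
proof -
  note D = is_derivationD[OF eop_derivation]
  have "eop i (dR m A) = dR m (eop i A)" for m
    by (simp add: eop_def dR_mult dR_commute)
  then have "eop i (L \<zeta> A) = (\<Sum>m\<in>UNIV. eop i (\<kappa> \<zeta> m) * dR m A) + L \<zeta> (eop i A)"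
    unfolding L_def D(7) D(2) sum.distrib by simp
  also have "(\<Sum>m\<in>UNIV. eop i (\<kappa> \<zeta> m) * dR m A) = fps_const (cst (c' \<zeta>)) * (\<Sum>m\<in>UNIV. tay (Z \<zeta>) (dir (f m) (bas i)) * eop m A)"
    unfolding eop_\<kappa>[OF z] by (simp add: eop_def sum_distrib_left mult_ac)
  finally show ?thesis by (simp add: add.commute)
qed

lemma Z_nbhd:
  assumes "\<zeta>0 \<in> S" "open V" "Z \<zeta>0 \<in> V"
  shows "\<exists>r>0. ball \<zeta>0 r \<subseteq> S \<and> (\<forall>\<zeta>\<in>ball \<zeta>0 r. Z \<zeta> \<in> V)"
proof -
  have "continuous_on S c" by (rule DERIV_continuous_on) (rule has_field_derivative_at_within[OF c])
  then have "continuous_on S Z" unfolding Z_def[abs_def] by (intro continuous_intros)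
  then have "open (S \<inter> Z -` V)" using S_open assms(2) by (intro continuous_open_preimage)
  moreover have "\<zeta>0 \<in> S \<inter> Z -` V" using assms by simp
  ultimately obtain r where "r > 0" "ball \<zeta>0 r \<subseteq> S \<inter> Z -` V" using open_contains_ball by blast
  then show ?thesis by (intro exI[of _ r]) auto
qed

lemma tay_ball:
  assumes "ball \<zeta>0 r \<subseteq> S" "\<And>\<zeta>. \<zeta> \<in> ball \<zeta>0 r \<Longrightarrow> Z \<zeta> \<in> V" "open V" "scv_holomorphic_on g V"
  shows "fh (ball \<zeta>0 r) (\<lambda>\<zeta>. tay (Z \<zeta>) g)"
    "HD (ball \<zeta>0 r) (\<lambda>\<zeta>. tay (Z \<zeta>) g) (\<lambda>\<zeta>. fps_const (cst (c' \<zeta>)) * tay (Z \<zeta>) (dir g v))"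
proof -
  have c': "\<And>\<zeta>. \<zeta> \<in> ball \<zeta>0 r \<Longrightarrow> (c has_field_derivative c' \<zeta>) (at \<zeta>)" using c assms(1) by blast
  note fam = tay_family[OF open_ball c' assms(3) assms(2)[unfolded Z_def] assms(4)]
  show "fh (ball \<zeta>0 r) (\<lambda>\<zeta>. tay (Z \<zeta>) g)" unfolding Z_def by (rule fam(1))
  show "HD (ball \<zeta>0 r) (\<lambda>\<zeta>. tay (Z \<zeta>) g) (\<lambda>\<zeta>. fps_const (cst (c' \<zeta>)) * tay (Z \<zeta>) (dir g v))"
    unfolding Z_def by (rule fam(2))
qed

lemma tay_eq_generically:
  assumes "scv_analytic_at g z" "scv_analytic_at k z" "generically z (\<lambda>w. g w = k w)"
  shows "tay z g = tay z k"
proof -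
  have "rep z (\<lambda>w. g w - k w) (emb (tay z g) - emb (tay z k))"
    by (intro rep_diff rep_analytic_fun assms)
  from rep_zeroI[OF this] have "emb (tay z g) - emb (tay z k) = 0"
    using generically_mono[OF assms(3)] by simp
  then show ?thesis by (simp add: Zero_fract_def eq_fract)
qed

text \<open>For \<open>F = g / h\<close> the condition \<open>adv F = 0\<close> becomes
  \<open>adv g * h = g * adv h\<close>. By \<open>total_derivative\<close> its Taylor series is the
  cross-multiplied transport equation that \<open>propagate\<close> asks for.\<close>

lemma first_integral_transport:
  assumes F: "scv_meromorphic_on F U" "\<And>\<zeta>. \<zeta> \<in> S \<Longrightarrow> Z \<zeta> \<in> U"
    and inv: "\<And>\<zeta>. \<zeta> \<in> S \<Longrightarrow> generically (Z \<zeta>) (\<lambda>w. adv F w = 0)"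
    and J: "sol Jy" "sol Jd" and start: "\<zeta>1 \<in> S" "germ (Z \<zeta>1) F * emb (Jd \<zeta>1) = emb (Jy \<zeta>1)" and z: "\<zeta> \<in> S"
  shows "germ (Z \<zeta>) F * emb (Jd \<zeta>) = emb (Jy \<zeta>)"
proof (rule propagate[where q = "\<lambda>\<zeta>. germ (Z \<zeta>) F", OF J _ start z])
  fix \<zeta>0 assume z0: "\<zeta>0 \<in> S"
  obtain V g h where V: "Z \<zeta>0 \<in> V" "V \<subseteq> U" "mero_rep V g h F"
    using mero_rep_exists[OF F(1) F(2)[OF z0]] by (elim exE conjE)
  note D = mero_repD[OF V(3)]
  obtain r where r: "r > 0" "ball \<zeta>0 r \<subseteq> S" "\<forall>\<zeta>\<in>ball \<zeta>0 r. Z \<zeta> \<in> V"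
    using Z_nbhd[OF z0 D(1) V(1)] by (elim exE conjE)
  let ?A = "\<lambda>\<zeta>. tay (Z \<zeta>) g" and ?B = "\<lambda>\<zeta>. tay (Z \<zeta>) h"
  let ?A' = "\<lambda>\<zeta>. fps_const (cst (c' \<zeta>)) * tay (Z \<zeta>) (dir g v)"
  let ?B' = "\<lambda>\<zeta>. fps_const (cst (c' \<zeta>)) * tay (Z \<zeta>) (dir h v)"
  have "(?A' \<zeta> + L \<zeta> (?A \<zeta>)) * ?B \<zeta> = ?A \<zeta> * (?B' \<zeta> + L \<zeta> (?B \<zeta>)) \<and> ?B \<zeta> \<noteq> 0 \<and> germ (Z \<zeta>) F = Fract (?A \<zeta>) (?B \<zeta>)"
    if zb: "\<zeta> \<in> ball \<zeta>0 r" for \<zeta>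
  proof (intro conjI)
    have zS: "\<zeta> \<in> S" and zV: "Z \<zeta> \<in> V" using zb r(2,3) by auto
    have an: "scv_analytic_at g (Z \<zeta>)" "scv_analytic_at h (Z \<zeta>)"
      by (rule analytic_mono[OF D(2,1) zV], rule analytic_mono[OF D(3,1) zV])
    note an' = adv_an[OF zS an(1)] adv_an[OF zS an(2)]
    have "generically (Z \<zeta>) (\<lambda>w. w \<in> V \<and> h w \<noteq> 0)"
      unfolding generically_def using zV D(4) by blast
    from generically_conj[OF this inv[OF zS]]
    have "generically (Z \<zeta>) (\<lambda>w. adv g w * h w = g w * adv h w)"
    proof (rule generically_mono)
      fix w assume w: "(w \<in> V \<and> h w \<noteq> 0) \<and> adv F w = 0"
      have "adv F w = (\<Sum>m\<in>UNIV. f m w * ((dir g (bas m) w * h w - g w * dir h (bas m) w) / (h w)\<^sup>2))"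
        unfolding adv_def using mero_rep_dir[OF V(3)] w by simp
      also have "\<dots> = (adv g w * h w - g w * adv h w) / (h w)\<^sup>2"
        by (simp add: adv_def sum_distrib_left sum_distrib_right sum_subtractf[symmetric] sum_divide_distrib algebra_simps diff_divide_distrib)
      finally show "adv g w * h w = g w * adv h w" using w by simp
    qed
    from tay_eq_generically[OF _ _ this]
    have "tay (Z \<zeta>) (adv g) * tay (Z \<zeta>) h = tay (Z \<zeta>) g * tay (Z \<zeta>) (adv h)"
      by (simp add: tay_mult an an' analytic_mult)
    then show "(?A' \<zeta> + L \<zeta> (?A \<zeta>)) * ?B \<zeta> = ?A \<zeta> * (?B' \<zeta> + L \<zeta> (?B \<zeta>))"
      unfolding total_derivative[OF zS an(1)] total_derivative[OF zS an(2)] by (simp add: mult_ac)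
    show "?B \<zeta> \<noteq> 0" by (rule tay_dense_nz[OF D(4) zV])
    show "germ (Z \<zeta>) F = Fract (?A \<zeta>) (?B \<zeta>)" by (rule germ[OF repI[OF V(3) zV]])
  qed
  moreover note tay_ball[OF r(2) bspec[OF r(3)] D(1) D(2)] tay_ball[OF r(2) bspec[OF r(3)] D(1) D(3)]
  ultimately show "\<exists>r A A' B B'. r > 0 \<and> ball \<zeta>0 r \<subseteq> S \<and> fh (ball \<zeta>0 r) A \<and> HD (ball \<zeta>0 r) A A' \<and>
       fh (ball \<zeta>0 r) B \<and> HD (ball \<zeta>0 r) B B' \<and>
       (\<forall>\<zeta>\<in>ball \<zeta>0 r. (A' \<zeta> + L \<zeta> (A \<zeta>)) * B \<zeta> = A \<zeta> * (B' \<zeta> + L \<zeta> (B \<zeta>)) \<and> B \<zeta> \<noteq> 0 \<and> germ (Z \<zeta>) F = Fract (A \<zeta>) (B \<zeta>))"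
    using r(1,2) by (intro exI[of _ r] exI[of _ ?A] exI[of _ ?A'] exI[of _ ?B] exI[of _ ?B'] conjI ballI) auto
qed

text \<open>A field commuting with the flow maps transported functions to transported functions, so
  \<open>X\<close> applied to the solution \<open>J\<close> solves the transport equation again, now
  as a fraction.\<close>

lemma vector_field_transport:
  assumes X: "\<And>i. scv_meromorphic_on (X i) U" "\<And>\<zeta>. \<zeta> \<in> S \<Longrightarrow> Z \<zeta> \<in> U"
    and comm: "\<And>\<zeta>. \<zeta> \<in> S \<Longrightarrow> generically (Z \<zeta>) (\<lambda>w. \<forall>i. adv (X i) w = (\<Sum>m\<in>UNIV. dir (f i) (bas m) w * X m w))"
    and K: "sol J" and J: "sol Jy" "sol Jd"
    and start: "\<zeta>1 \<in> S" "(\<Sum>i\<in>UNIV. germ (Z \<zeta>1) (X i) * emb (eop i (J \<zeta>1))) * emb (Jd \<zeta>1) = emb (Jy \<zeta>1)" and z: "\<zeta> \<in> S"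
  shows "(\<Sum>i\<in>UNIV. germ (Z \<zeta>) (X i) * emb (eop i (J \<zeta>))) * emb (Jd \<zeta>) = emb (Jy \<zeta>)"
proof (rule propagate[where q = "\<lambda>\<zeta>. \<Sum>i\<in>UNIV. germ (Z \<zeta>) (X i) * emb (eop i (J \<zeta>))", OF J _ start z])
  fix \<zeta>0 assume z0: "\<zeta>0 \<in> S"
  have "\<exists>V g h. Z \<zeta>0 \<in> V \<and> mero_rep V g h (X i)" for i
    using mero_rep_exists[OF X(1) X(2)[OF z0], of i] by blast
  from mero_rep_common[of UNIV "Z \<zeta>0" X, OF finite_class.finite_UNIV this]
  obtain V h G where V: "Z \<zeta>0 \<in> V" "dense_nz V h" "\<forall>i\<in>UNIV. mero_rep V (G i) h (X i)" by (elim exE conjE)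
  note rep = bspec[OF V(3) UNIV_I]
  note D = mero_repD[OF rep]
  obtain r where r: "r > 0" "ball \<zeta>0 r \<subseteq> S" "\<forall>\<zeta>\<in>ball \<zeta>0 r. Z \<zeta> \<in> V"
    using Z_nbhd[OF z0 D(1) V(1)] by (elim exE conjE)
  note tb = tay_ball[OF r(2) bspec[OF r(3)] D(1) D(2)] tay_ball[OF r(2) bspec[OF r(3)] D(1) D(3)]
  note De = is_derivationD[OF eop_derivation]
  define A where "A \<zeta> = (\<Sum>i\<in>UNIV. tay (Z \<zeta>) (G i) * eop i (J \<zeta>))" for \<zeta>
  define A' where "A' \<zeta> = (\<Sum>i\<in>UNIV. fps_const (cst (c' \<zeta>)) * tay (Z \<zeta>) (dir (G i) v) * eop i (J \<zeta>)
      + tay (Z \<zeta>) (G i) * eop i (- L \<zeta> (J \<zeta>)))" for \<zeta>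
  let ?B = "\<lambda>\<zeta>. tay (Z \<zeta>) h" and ?B' = "\<lambda>\<zeta>. fps_const (cst (c' \<zeta>)) * tay (Z \<zeta>) (dir h v)"
  have JB: "fh (ball \<zeta>0 r) J" "HD (ball \<zeta>0 r) J (\<lambda>\<zeta>. - L \<zeta> (J \<zeta>))"
    using K fh_subset[OF _ r(2)] HD_subset[OF _ r(2)] by (auto simp: sol_def)
  have eJ: "fh (ball \<zeta>0 r) (\<lambda>\<zeta>. eop i (J \<zeta>))" for i
    unfolding eop_def by (intro fh_mult fh_const fh_dR JB)
  have eJ': "HD (ball \<zeta>0 r) (\<lambda>\<zeta>. eop i (J \<zeta>)) (\<lambda>\<zeta>. eop i (- L \<zeta> (J \<zeta>)))" for i
    unfolding eop_def
    by (rule HD_cong[OF open_ball refl _ HD_mult[OF HD_const HD_dR(1)[OF open_ball JB]]]) simp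
  have fA: "fh (ball \<zeta>0 r) A"
    unfolding A_def[abs_def] by (intro fh_sum fh_mult tb eJ)
  have hA: "HD (ball \<zeta>0 r) A A'"
    unfolding A_def[abs_def] A'_def[abs_def] by (intro HD_sum HD_mult tb eJ')
  have main: "(A' \<zeta> + L \<zeta> (A \<zeta>)) * ?B \<zeta> = A \<zeta> * (?B' \<zeta> + L \<zeta> (?B \<zeta>)) \<and> ?B \<zeta> \<noteq> 0 \<and>
      (\<Sum>i\<in>UNIV. germ (Z \<zeta>) (X i) * emb (eop i (J \<zeta>))) = Fract (A \<zeta>) (?B \<zeta>)"
    if zb: "\<zeta> \<in> ball \<zeta>0 r" for \<zeta>
  proof (intro conjI)
    have zS: "\<zeta> \<in> S" and zV: "Z \<zeta> \<in> V" using zb r(2,3) by auto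
    have an: "scv_analytic_at (G i) (Z \<zeta>)" "scv_analytic_at h (Z \<zeta>)" for i
      by (rule analytic_mono[OF D(2,1) zV], rule analytic_mono[OF D(3,1) zV])
    note an' = adv_an[OF zS an(1)] adv_an[OF zS an(2)] analytic_dir[OF f_an[OF zS]]
    show nz: "?B \<zeta> \<noteq> 0" by (rule tay_dense_nz[OF D(4) zV])
    have "germ (Z \<zeta>) (X i) = Fract (tay (Z \<zeta>) (G i)) (?B \<zeta>)" for i by (rule germ[OF repI[OF rep zV]])
    then have gX: "germ (Z \<zeta>) (X i) = emb (tay (Z \<zeta>) (G i)) / emb (?B \<zeta>)" for i using nz by simp
    have "(\<Sum>i\<in>UNIV. germ (Z \<zeta>) (X i) * emb (eop i (J \<zeta>))) = (\<Sum>i\<in>UNIV. emb (tay (Z \<zeta>) (G i) * eop i (J \<zeta>))) / emb (?B \<zeta>)"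
      unfolding gX by (simp add: sum_divide_distrib)
    also have "\<dots> = Fract (A \<zeta>) (?B \<zeta>)" by (simp add: A_def emb_sum[symmetric])
    finally show "(\<Sum>i\<in>UNIV. germ (Z \<zeta>) (X i) * emb (eop i (J \<zeta>))) = Fract (A \<zeta>) (?B \<zeta>)" .
    \<comment> \<open>\<open>Y\<close> is the bracket formed with the numerators alone. Clearing
      \<open>X = G / h\<close> from the bracket condition turns it into
      \<open>Y i * h = G i * adv h\<close>.\<close>
    define Y where "Y i w = adv (G i) w - (\<Sum>m\<in>UNIV. G m w * dir (f i) (bas m) w)" for i w
    have anY: "scv_analytic_at (Y i) (Z \<zeta>)" for i
      unfolding Y_def[abs_def] by (intro analytic_diff an'(1) analytic_sum analytic_mult an(1) an'(3))
    have tY: "tay (Z \<zeta>) (Y i) = tay (Z \<zeta>) (adv (G i)) - (\<Sum>m\<in>UNIV. tay (Z \<zeta>) (G m) * tay (Z \<zeta>) (dir (f i) (bas m)))" for i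
      unfolding Y_def[abs_def]
    proof -
      have "tay (Z \<zeta>) (\<lambda>w. \<Sum>m\<in>UNIV. G m w * dir (f i) (bas m) w) = (\<Sum>m\<in>UNIV. tay (Z \<zeta>) (\<lambda>w. G m w * dir (f i) (bas m) w))"
        by (rule tay_sum) (intro analytic_mult an(1) an'(3))
      also have "\<dots> = (\<Sum>m\<in>UNIV. tay (Z \<zeta>) (G m) * tay (Z \<zeta>) (dir (f i) (bas m)))"
        by (simp only: tay_mult[OF an(1) an'(3)])
      finally have s: "tay (Z \<zeta>) (\<lambda>w. \<Sum>m\<in>UNIV. G m w * dir (f i) (bas m) w) = (\<Sum>m\<in>UNIV. tay (Z \<zeta>) (G m) * tay (Z \<zeta>) (dir (f i) (bas m)))" .
      have "scv_analytic_at (\<lambda>w. \<Sum>m\<in>UNIV. G m w * dir (f i) (bas m) w) (Z \<zeta>)"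
        by (intro analytic_sum analytic_mult an(1) an'(3))
      from tay_diff[OF an'(1) this] show "tay (Z \<zeta>) (\<lambda>w. adv (G i) w - (\<Sum>m\<in>UNIV. G m w * dir (f i) (bas m) w)) =
        tay (Z \<zeta>) (adv (G i)) - (\<Sum>m\<in>UNIV. tay (Z \<zeta>) (G m) * tay (Z \<zeta>) (dir (f i) (bas m)))" by (simp only: s)
    qed
    have FA: "A' \<zeta> + L \<zeta> (A \<zeta>) = fps_const (cst (c' \<zeta>)) * (\<Sum>i\<in>UNIV. tay (Z \<zeta>) (Y i) * eop i (J \<zeta>))"
    proof -
      have Lsum: "L \<zeta> (sum b I) = (\<Sum>i\<in>I. L \<zeta> (b i))" for b and I :: "('l + 'l) set"
        by (induction I rule: infinite_finite_induct) (auto simp: L_add)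
      have "A' \<zeta> + L \<zeta> (A \<zeta>) = (\<Sum>i\<in>UNIV. (fps_const (cst (c' \<zeta>)) * tay (Z \<zeta>) (dir (G i) v) + L \<zeta> (tay (Z \<zeta>) (G i))) * eop i (J \<zeta>)
          + tay (Z \<zeta>) (G i) * (L \<zeta> (eop i (J \<zeta>)) - eop i (L \<zeta> (J \<zeta>))))"
        unfolding A'_def A_def Lsum L_mult sum.distrib[symmetric] De(5)
        by (intro sum.cong refl) (simp add: algebra_simps)
      also have "\<dots> = (\<Sum>i\<in>UNIV. fps_const (cst (c' \<zeta>)) * tay (Z \<zeta>) (adv (G i)) * eop i (J \<zeta>)
          - (\<Sum>m\<in>UNIV. fps_const (cst (c' \<zeta>)) * (tay (Z \<zeta>) (G i) * tay (Z \<zeta>) (dir (f m) (bas i)) * eop m (J \<zeta>))))"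
        unfolding total_derivative[OF zS an(1)] eop_L[OF zS]
        by (intro sum.cong refl) (simp add: sum_distrib_left mult_ac)
      also have "\<dots> = (\<Sum>i\<in>UNIV. fps_const (cst (c' \<zeta>)) * tay (Z \<zeta>) (adv (G i)) * eop i (J \<zeta>))
          - (\<Sum>m\<in>UNIV. \<Sum>i\<in>UNIV. fps_const (cst (c' \<zeta>)) * (tay (Z \<zeta>) (G i) * tay (Z \<zeta>) (dir (f m) (bas i)) * eop m (J \<zeta>)))"
        by (subst sum.swap) (simp add: sum_subtractf)
      also have "\<dots> = fps_const (cst (c' \<zeta>)) * (\<Sum>i\<in>UNIV. tay (Z \<zeta>) (Y i) * eop i (J \<zeta>))"
        unfolding tY left_diff_distrib sum_subtractf right_diff_distrib sum_distrib_left sum_distrib_right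
        by (simp only: mult_ac)
      finally show ?thesis .
    qed
    have "tay (Z \<zeta>) (Y i) * tay (Z \<zeta>) h = tay (Z \<zeta>) (G i) * tay (Z \<zeta>) (adv h)" for i
    proof -
      have "generically (Z \<zeta>) (\<lambda>w. w \<in> V \<and> h w \<noteq> 0)"
        unfolding generically_def using zV D(4) by blast
      from generically_conj[OF this comm[OF zS]]
      have "generically (Z \<zeta>) (\<lambda>w. Y i w * h w = G i w * adv h w)"
      proof (rule generically_mono)
        fix w assume w: "(w \<in> V \<and> h w \<noteq> 0) \<and> (\<forall>i. adv (X i) w = (\<Sum>m\<in>UNIV. dir (f i) (bas m) w * X m w))"
        then have hw: "h w \<noteq> 0" and wV: "w \<in> V" by auto
        have "adv (X i) w = (\<Sum>m\<in>UNIV. f m w * ((dir (G i) (bas m) w * h w - G i w * dir h (bas m) w) / (h w)\<^sup>2))"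
          unfolding adv_def using mero_rep_dir[OF rep wV hw] by simp
        also have "\<dots> = (adv (G i) w * h w - G i w * adv h w) / (h w)\<^sup>2"
          by (simp add: adv_def sum_distrib_left sum_distrib_right sum_subtractf[symmetric] sum_divide_distrib algebra_simps diff_divide_distrib)
        finally have 1: "adv (X i) w = (adv (G i) w * h w - G i w * adv h w) / (h w)\<^sup>2" .
        have "adv (X i) w = (\<Sum>m\<in>UNIV. dir (f i) (bas m) w * (G m w / h w))"
          using w D(5)[OF wV hw] by simp
        also have "\<dots> = (\<Sum>m\<in>UNIV. G m w * dir (f i) (bas m) w) / h w"
          by (simp add: sum_divide_distrib mult.commute)
        finally have 2: "(adv (G i) w * h w - G i w * adv h w) / (h w)\<^sup>2 = (\<Sum>m\<in>UNIV. G m w * dir (f i) (bas m) w) / h w"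
          using 1 by simp
        have "adv (G i) w * h w - G i w * adv h w = (\<Sum>m\<in>UNIV. G m w * dir (f i) (bas m) w) * h w"
        proof -
          have "p = q * a" if e: "p / a\<^sup>2 = q / a" and a: "a \<noteq> 0" for p q a :: complex
          proof -
            have "p = p / a\<^sup>2 * a\<^sup>2" using a by simp
            also have "\<dots> = q * a" unfolding e using a by (simp add: power2_eq_square)
            finally show ?thesis .
          qed
          from this[OF 2 hw] show ?thesis .
        qed
        then show "Y i w * h w = G i w * adv h w"
          by (simp add: Y_def left_diff_distrib algebra_simps)
      qed
      from tay_eq_generically[OF _ _ this] show ?thesis
        by (simp add: tay_mult an an' anY analytic_mult)
    qed
    note Yh = this
    have "(\<Sum>i\<in>UNIV. tay (Z \<zeta>) (Y i) * eop i (J \<zeta>)) * ?B \<zeta> = A \<zeta> * tay (Z \<zeta>) (adv h)"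
      unfolding A_def sum_distrib_right
    proof (rule sum.cong[OF refl])
      fix i
      have "tay (Z \<zeta>) (Y i) * eop i (J \<zeta>) * ?B \<zeta> = (tay (Z \<zeta>) (Y i) * ?B \<zeta>) * eop i (J \<zeta>)" by (simp only: mult_ac)
      also have "\<dots> = tay (Z \<zeta>) (G i) * eop i (J \<zeta>) * tay (Z \<zeta>) (adv h)" unfolding Yh by (simp only: mult_ac)
      finally show "tay (Z \<zeta>) (Y i) * eop i (J \<zeta>) * ?B \<zeta> = tay (Z \<zeta>) (G i) * eop i (J \<zeta>) * tay (Z \<zeta>) (adv h)"
        .
    qed
    then show "(A' \<zeta> + L \<zeta> (A \<zeta>)) * ?B \<zeta> = A \<zeta> * (?B' \<zeta> + L \<zeta> (?B \<zeta>))"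
      unfolding FA total_derivative[OF zS an(2)] by (simp add: mult_ac)
  qed
  show "\<exists>r A A' B B'. r > 0 \<and> ball \<zeta>0 r \<subseteq> S \<and> fh (ball \<zeta>0 r) A \<and> HD (ball \<zeta>0 r) A A' \<and>
       fh (ball \<zeta>0 r) B \<and> HD (ball \<zeta>0 r) B B' \<and>
       (\<forall>\<zeta>\<in>ball \<zeta>0 r. (A' \<zeta> + L \<zeta> (A \<zeta>)) * B \<zeta> = A \<zeta> * (B' \<zeta> + L \<zeta> (B \<zeta>)) \<and> B \<zeta> \<noteq> 0 \<and>
        (\<Sum>i\<in>UNIV. germ (Z \<zeta>) (X i) * emb (eop i (J \<zeta>))) = Fract (A \<zeta>) (B \<zeta>))"
    by (intro exI[of _ r] exI[of _ A] exI[of _ A'] exI[of _ ?B] exI[of _ ?B'] conjI[OF r(1)] conjI[OF r(2)]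
        conjI[OF fA] conjI[OF hA] conjI[OF tb(3)] conjI[OF tb(4)] ballI main)
qed

end

section \<open>Monodromy around loops\<close>

definition vf :: "('l::finite + 'l) pol fps fract ^ ('l + 'l) \<Rightarrow> ('l + 'l) pol fps fract \<Rightarrow> ('l + 'l) pol fps fract" where
  "vf v y = (\<Sum>m\<in>UNIV. v $ m * fder (eop m) y)"

text \<open>Components of a derivation in the frame of the \<open>eop i\<close> rather than the
  \<open>dR i\<close>; the frames differ by \<open>fps_X ^ (2 - wt i)\<close>, hence the
  division.\<close>

definition coords :: "(('l::finite + 'l) pol fps \<Rightarrow> ('l + 'l) pol fps) \<Rightarrow> ('l + 'l) pol fps fract ^ ('l + 'l)" where
  "coords D = (\<chi> i. emb (D (fps_const (pvar i))) / emb (fps_X ^ (2 - wt i)))"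

lemma fder_quotient:
  assumes "is_derivation \<delta>" "b \<noteq> 0"
  shows "fder \<delta> (Fract a b) = (emb (\<delta> a) * emb b - emb a * emb (\<delta> b)) / (emb b * emb b)"
  using assms(2) unfolding fder_Fract[OF assms] by (simp add: emb_simps[symmetric] mult_ac)

lemma X_power_nonzero: "(fps_X :: ('n::finite) pol fps) ^ k \<noteq> 0" by simp

lemma emb_X_power_nonzero: "emb ((fps_X :: ('n::finite) pol fps) ^ k) \<noteq> 0"
  by (simp add: Zero_fract_def eq_fract)

lemma dR_via_eop: "emb (dR m a) = emb (eop m a) / emb (fps_X ^ (2 - wt m))"
  by (simp add: eop_def emb_simps emb_X_power_nonzero del: mult_fract divide_fract)

lemma vf_coords:
  assumes D: "is_derivation D" and chain: "\<And>a. D a = (\<Sum>i\<in>UNIV. D (fps_const (pvar i)) * dR i a)"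
  shows "vf (coords D) y = fder D y"
proof -
  obtain a b where y: "y = Fract a b" "b \<noteq> 0" by (metis Fract_cases)
  have eD: "emb (D a) = (\<Sum>i\<in>UNIV. coords D $ i * emb (eop i a))" for a
    by (subst chain) (simp add: emb_sum emb_simps dR_via_eop coords_def del: mult_fract divide_fract)
  have "vf (coords D) y = (\<Sum>m\<in>UNIV. coords D $ m * emb (eop m a) * emb b - emb a * (coords D $ m * emb (eop m b))) / (emb b * emb b)"
    unfolding vf_def y fder_quotient[OF eop_derivation y(2)]
    by (simp add: sum_divide_distrib right_diff_distrib mult_ac del: mult_fract divide_fract)
  also have "\<dots> = (emb (D a) * emb b - emb a * emb (D b)) / (emb b * emb b)"
    unfolding eD by (simp add: sum_subtractf sum_distrib_left sum_distrib_right del: mult_fract divide_fract)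
  also have "\<dots> = fder D y" unfolding y fder_quotient[OF D y(2)] ..
  finally show ?thesis .
qed

lemma eop_simps: "eop m (fps_X ^ k) = 0" "eop m (fps_const (cst c)) = 0"
  "eop m (fps_const (pvar i)) = (if m = i then fps_X ^ (2 - wt m) else 0)"
proof -
  have "dR m (fps_const (pvar i)) = (if m = i then 1 else 0)" by (auto simp: fps_eq_iff dpol_pvar)
  then show "eop m (fps_const (pvar i)) = (if m = i then fps_X ^ (2 - wt m) else 0)" by (simp add: eop_def)
qed (simp_all add: eop_def)

locale loop_transport = field_transport S \<kappa> c c' z0 v f Uf
  for S and \<kappa> :: "complex \<Rightarrow> 'l + 'l \<Rightarrow> ('l::finite + 'l) pol fps" and c c' z0 v f Uf +
  assumes ends: "0 \<in> S" "1 \<in> S"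
begin

text \<open>Monodromy of the path: initial data at parameter 0 are transported to parameter 1. The
  two end points will differ by a period of the state space, so their expansions can be
  compared.\<close>

definition E where "E a = (SOME J. sol J \<and> J 0 = a) 1"

lemma E_eq: "sol J \<Longrightarrow> E (J 0) = J 1"
proof -
  assume J: "sol J"
  have *: "sol (SOME K. sol K \<and> K 0 = J 0) \<and> (SOME K. sol K \<and> K 0 = J 0) 0 = J 0"
    by (rule someI[of _ J]) (simp add: J)
  show ?thesis unfolding E_def by (rule sol_eq[OF conjunct1[OF *] J conjunct2[OF *] ends])
qed

lemma E_obtain: obtains J where "sol J" "J 0 = a" "E a = J 1"
  using sol_exists[OF ends(1), of a] E_eq by blast

sublocale formal_automorphism E
proof
  fix a b :: "('l + 'l) pol fps"
  obtain J where J: "sol J" "J 0 = a" "E a = J 1" by (rule E_obtain)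
  obtain J' where J': "sol J'" "J' 0 = b" "E b = J' 1" by (rule E_obtain)
  show "E (a + b) = E a + E b" using E_eq[OF sol_add[OF J(1) J'(1)]] J J' by simp
  show "E (a * b) = E a * E b" using E_eq[OF sol_mult[OF J(1) J'(1)]] J J' by simp
next
  have "L \<zeta> fps_X = 0" for \<zeta> using L_X[of \<zeta> 1] by simp
  then show "E fps_X = fps_X" using E_eq[OF sol_constant[of fps_X]] by simp
next
  fix c show "E (fps_const (cst c)) = fps_const (cst c)"
    using E_eq[OF sol_constant[of "fps_const (cst c)"]] by simp
next
  fix n and a :: "('l + 'l) pol fps"
  assume low: "\<And>m. m < n \<Longrightarrow> a $ m = 0"
  obtain J where J: "sol J" "J 0 = a" "E a = J 1" by (rule E_obtain)
  show "E a $ n = a $ n" using sol_const_coeff[OF J(1) _ ends, of n] low J by simp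
qed

lemma germ_periodic:
  assumes F: "scv_meromorphic_on F U" and U: "open U" "Z 0 \<in> U" "Z 1 \<in> U"
    and per: "Z 1 = Z 0 + p" "\<And>w. w \<in> U \<Longrightarrow> F (w + p) = F w"
  shows "germ (Z 1) F = germ (Z 0) F"
proof -
  obtain x where x: "rep (Z 1) F x" using rep_exists[OF F U(3)] by blast
  then have "rep (Z 0) F x" unfolding per(1) by (rule rep_translate[of "Z 0" p F x U]) (use U per(2) in auto)
  with x show ?thesis by (simp add: germ)
qed

text \<open>Write the integral at the start as \<open>g / h\<close>. Transport says that at the end
  it is \<open>E g / E h\<close>, periodicity that it is still \<open>g / h\<close>; so
  \<open>E\<close> fixes it and the logarithm annihilates it.\<close>

lemma D_kills_integral:
  assumes F: "scv_meromorphic_on F U" "\<And>\<zeta>. \<zeta> \<in> S \<Longrightarrow> Z \<zeta> \<in> U" "open U"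
    and inv: "\<And>\<zeta>. \<zeta> \<in> S \<Longrightarrow> generically (Z \<zeta>) (\<lambda>w. adv F w = 0)"
    and per: "Z 1 = Z 0 + p" "\<And>w. w \<in> U \<Longrightarrow> F (w + p) = F w"
  shows "fder D (germ (Z 0) F) = 0"
proof -
  obtain g h where gh: "h \<noteq> 0" "germ (Z 0) F = Fract g h" by (metis Fract_cases)
  obtain Jy where Jy: "sol Jy" "Jy 0 = g" "E g = Jy 1" by (rule E_obtain)
  obtain Jd where Jd: "sol Jd" "Jd 0 = h" "E h = Jd 1" by (rule E_obtain)
  have "germ (Z 1) F * emb (Jd 1) = emb (Jy 1)"
    by (rule first_integral_transport[OF F(1,2) inv Jy(1) Jd(1) ends(1) _ ends(2)])
      (use gh Jy Jd in \<open>simp_all add: eq_fract\<close>)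
  then have "Fract g h * emb (E h) = emb (E g)"
    using germ_periodic[OF F(1,3) F(2)[OF ends(1)] F(2)[OF ends(2)] per] gh Jy Jd by simp
  then have "E g * h = E h * g" using gh(1) by (simp add: eq_fract mult.commute)
  from D_first_integral[OF this] show ?thesis
    using gh(1) by (simp add: gh(2) fder_Fract[OF D_derivation gh(1)] Zero_fract_def eq_fract mult.commute)
qed

text \<open>The same comparison of end points shows that the field, over a common denominator,
  commutes with \<open>E\<close>. Applying the resulting relation for \<open>D\<close> to the
  coordinate functions gives the vanishing of the bracket component by component.\<close>

lemma D_commutes:
  fixes X :: "'l + 'l \<Rightarrow> (complex ^ ('l + 'l)) \<times> complex \<Rightarrow> complex"
  assumes X: "\<And>i. scv_meromorphic_on (X i) U" "\<And>\<zeta>. \<zeta> \<in> S \<Longrightarrow> Z \<zeta> \<in> U" "open U"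
    and comm: "\<And>\<zeta>. \<zeta> \<in> S \<Longrightarrow> generically (Z \<zeta>) (\<lambda>w. \<forall>i. adv (X i) w = (\<Sum>m\<in>UNIV. dir (f i) (bas m) w * X m w))"
    and per: "Z 1 = Z 0 + p" "\<And>w i. w \<in> U \<Longrightarrow> X i (w + p) = X i w"
  shows "fder D (germ (Z 0) (X i)) = vf (\<chi> m. germ (Z 0) (X m)) (coords D $ i)"
proof -
  have "\<exists>V g h. Z 0 \<in> V \<and> mero_rep V g h (X i)" for i
    using mero_rep_exists[OF X(1) X(2)[OF ends(1)], of i] by blast
  from mero_rep_common[of UNIV "Z 0" X, OF finite_class.finite_UNIV this]
  obtain V h H where V: "Z 0 \<in> V" "dense_nz V h" "\<forall>i\<in>UNIV. mero_rep V (H i) h (X i)" by (elim exE conjE)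
  define d where "d = tay (Z 0) h"
  define G where "G i = tay (Z 0) (H i)" for i
  have d: "d \<noteq> 0" unfolding d_def by (rule tay_dense_nz[OF V(2,1)])
  have ed: "emb d \<noteq> 0" using d by (simp add: Zero_fract_def eq_fract)
  have gX: "germ (Z 0) (X i) = emb (G i) / emb d" for i
    using germ[OF repI[OF bspec[OF V(3) UNIV_I] V(1)], of i] d by (simp add: d_def G_def)
  define XX where "XX a = (\<Sum>i\<in>UNIV. (G i * fps_X ^ (2 - wt i)) * dR i a)" for a
  have XX: "XX a = (\<Sum>i\<in>UNIV. G i * eop i a)" for a by (simp add: XX_def eop_def mult.assoc)
  have Xsum: "(\<Sum>i\<in>UNIV. emb (G i) / emb d * emb (eop i a)) = emb (XX a) / emb d" for a
    by (simp add: XX emb_sum emb_simps sum_divide_distrib del: mult_fract divide_fract)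
  have com: "E (XX a) * d = E d * XX (E a)" for a
  proof -
    obtain J where J: "sol J" "J 0 = a" "E a = J 1" by (rule E_obtain)
    obtain Jy where Jy: "sol Jy" "Jy 0 = XX a" "E (XX a) = Jy 1" by (rule E_obtain)
    obtain Jd where Jd: "sol Jd" "Jd 0 = d" "E d = Jd 1" by (rule E_obtain)
    have "(\<Sum>i\<in>UNIV. germ (Z 1) (X i) * emb (eop i (J 1))) * emb (Jd 1) = emb (Jy 1)"
    proof (rule vector_field_transport[OF X(1,2) comm J(1) Jy(1) Jd(1) ends(1) _ ends(2)])
      show "(\<Sum>i\<in>UNIV. germ (Z 0) (X i) * emb (eop i (J 0))) * emb (Jd 0) = emb (Jy 0)"
        unfolding gX J(2) Jd(2) Jy(2) Xsum using ed by (simp del: mult_fract divide_fract)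
    qed
    moreover have "germ (Z 1) (X i) = germ (Z 0) (X i)" for i
      by (rule germ_periodic[OF X(1,3) X(2)[OF ends(1)] X(2)[OF ends(2)] per])
    ultimately have "emb (XX (E a)) / emb d * emb (E d) = emb (E (XX a))"
      by (simp only: gX Xsum J(3) Jy(3) Jd(3))
    then have "emb (E (XX a)) * emb d = emb (E d) * emb (XX (E a))"
      using ed by (simp add: field_simps del: mult_fract divide_fract)
    then show ?thesis by (simp add: emb_simps[symmetric] del: mult_fract)
  qed
  have Dv: "D (XX a) * d = D d * XX a + d * XX (D a)" for a
    using D_vector_field[of d "\<lambda>i. G i * fps_X ^ (2 - wt i)", OF d] com unfolding XX_def by blast
  note DD = is_derivationD[OF D_derivation]
  define k where "k = 2 - wt i"
  have DX: "D (fps_X ^ k) = 0"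
    using D_fixed[OF E_X] by (induction k) (simp_all add: DD(2,4))
  have "XX (fps_const (pvar i)) = G i * fps_X ^ k"
    by (simp add: XX eop_simps k_def if_distrib cong: if_cong)
  with Dv[of "fps_const (pvar i)"] have
    "D (G i) * fps_X ^ k * d = D d * (G i * fps_X ^ k) + d * XX (D (fps_const (pvar i)))"
    by (simp add: DD(2) DX)
  then have "emb (D (G i) * fps_X ^ k * d) = emb (D d * (G i * fps_X ^ k) + d * XX (D (fps_const (pvar i))))" by simp
  then have e1: "emb (D (G i)) * emb (fps_X ^ k) * emb d =
      emb (D d) * (emb (G i) * emb (fps_X ^ k)) + emb d * emb (XX (D (fps_const (pvar i))))"
    by (simp only: emb_simps)
  have "fder D (germ (Z 0) (X i)) = fder D (Fract (G i) d)" using d by (simp add: gX)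
  also have "\<dots> = (emb (D (G i)) * emb d - emb (G i) * emb (D d)) / (emb d * emb d)"
    by (rule fder_quotient[OF D_derivation d])
  also have "\<dots> = emb (XX (D (fps_const (pvar i)))) / emb d / emb (fps_X ^ k)"
  proof -
    have "(emb (D (G i)) * emb d - emb (G i) * emb (D d)) * emb (fps_X ^ k) = emb d * emb (XX (D (fps_const (pvar i))))"
      using e1 by (simp add: algebra_simps del: mult_fract divide_fract)
    then have "emb (D (G i)) * emb d - emb (G i) * emb (D d) = emb d * emb (XX (D (fps_const (pvar i)))) / emb (fps_X ^ k)"
      by (simp add: eq_divide_eq emb_X_power_nonzero del: mult_fract divide_fract)
    then show ?thesis using ed by (simp del: mult_fract divide_fract)
  qed
  also have "\<dots> = vf (\<chi> m. germ (Z 0) (X m)) (coords D $ i)"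
  proof -
    have "fder (eop m) (emb a / emb (fps_X ^ k)) = emb (eop m a) / emb (fps_X ^ k)" for m :: "'l + 'l" and a
    proof -
      have "emb a / emb (fps_X ^ k) = Fract a (fps_X ^ k)" by simp
      then have "fder (eop m) (emb a / emb (fps_X ^ k)) = (emb (eop m a) * emb (fps_X ^ k)) / (emb (fps_X ^ k) * emb (fps_X ^ k))"
        using fder_quotient[OF eop_derivation X_power_nonzero, of m a k] by (simp only: eop_simps emb_simps mult_zero_right diff_0_right)
      then show ?thesis by (simp add: emb_X_power_nonzero del: mult_fract divide_fract)
    qed
    then have "vf (\<chi> m. germ (Z 0) (X m)) (coords D $ i) =
      (\<Sum>m\<in>UNIV. emb (G m) / emb d * (emb (eop m (D (fps_const (pvar i)))) / emb (fps_X ^ k)))"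
      unfolding vf_def coords_def vec_lambda_beta gX k_def[symmetric] by (simp only:)
    also have "\<dots> = emb (XX (D (fps_const (pvar i)))) / emb d / emb (fps_X ^ k)"
      unfolding Xsum[symmetric] sum_divide_distrib by (simp only: times_divide_eq_right)
    finally show ?thesis by simp
  qed
  finally show ?thesis .
qed

text \<open>At order 0 the transported variable stays \<open>pvar m\<close>, so at order 1 the
  transport equation only integrates \<open>- \<kappa> \<zeta> m\<close>. A primitive
  \<open>w\<close> states this integral without choosing a contour.\<close>

lemma D_leading:
  assumes "HDp S w (\<lambda>\<zeta>. \<kappa> \<zeta> m $ 1)"
  shows "D (fps_const (pvar m)) $ 1 = w 0 - w 1"
proof -
  obtain J where J: "sol J" "J 0 = fps_const (pvar m)" "E (fps_const (pvar m)) = J 1" by (rule E_obtain)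
  have J0: "J \<zeta> $ 0 = pvar m" if "\<zeta> \<in> S" for \<zeta>
    using sol_const_coeff[OF J(1) _ ends(1) that, of 0] J(2) by simp
  have "HDp S (\<lambda>\<zeta>. J \<zeta> $ 1 + w \<zeta>) (\<lambda>_. 0)"
  proof (rule HDp_cong[OF S_open refl _ HDp_add[OF _ assms]])
    show "HDp S (\<lambda>\<zeta>. J \<zeta> $ 1) (\<lambda>\<zeta>. (- L \<zeta> (J \<zeta>)) $ 1)" using J(1) by (simp add: sol_def HD_def)
    fix \<zeta> assume z: "\<zeta> \<in> S"
    have "L \<zeta> (J \<zeta>) $ 1 = \<kappa> \<zeta> m $ 1"
    proof -
      have "L \<zeta> (J \<zeta>) $ 1 = (\<Sum>k\<in>UNIV. \<kappa> \<zeta> k $ 1 * (if m = k then 1 else 0))"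
        unfolding L_nth[OF z] by (simp add: J0[OF z] dpol_pvar)
      then show ?thesis by (simp only: mult_1_right mult_zero_right mult_delta_right sum.delta' finite_class.finite_UNIV UNIV_I if_True)
    qed
    then show "(- L \<zeta> (J \<zeta>)) $ 1 + \<kappa> \<zeta> m $ 1 = 0" by simp
  qed
  from HDp_zero_const[OF this ends] have "J 1 $ 1 + w 1 = w 0" by (simp add: J(2))
  moreover have "D (fps_const (pvar m)) $ 1 = J 1 $ 1"
    using D_nth_1[of "fps_const (pvar m)"] by (simp add: J(3))
  ultimately show ?thesis by (simp add: eq_diff_eq)
qed

end

section \<open>From integrability to commuting leading terms\<close>

lemma lin_indep_scale:
  assumes "lin_indep v K" "c \<noteq> 0"
  shows "lin_indep (\<lambda>k. c *s v k) K"
  unfolding lin_indep_def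
proof (intro allI impI ballI)
  fix a k assume 0: "(\<Sum>k\<in>K. a k *s (c *s v k)) = 0" and k: "k \<in> K"
  have "(\<Sum>k\<in>K. (a k * c) *s v k) = 0" using 0 by simp
  from lin_indepD[OF assms(1) this k] show "a k = 0" using assms(2) by simp
qed

text \<open>All data of \<open>bogoyavlenskij_commute\<close> become germs at the common base point,
  and the two logarithms are the vectors \<open>d\<close> and \<open>d'\<close>. The conclusion is
  the lowest-order part of their commutator applied to an angle: the bracket of the leading fields
  \<open>u1\<close> and \<open>u2\<close>.\<close>

lemma integrable_imp_commute:
  fixes ff :: "(complex ^ ('l::finite + 'l)) \<times> complex \<Rightarrow> complex ^ ('l + 'l)"
    and \<kappa>1 \<kappa>2 :: "complex \<Rightarrow> 'l + 'l \<Rightarrow> ('l + 'l) pol fps"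
  assumes l1: "loop_transport S1 \<kappa>1 c1 c1' z0 v (\<lambda>m w. ff w $ m) Uf"
    and l2: "loop_transport S2 \<kappa>2 c2 c2' z0 v (\<lambda>m w. ff w $ m) Uf"
    and U: "open U" "\<And>\<zeta>. \<zeta> \<in> S1 \<Longrightarrow> z0 + cscale (c1 \<zeta>) v \<in> U" "\<And>\<zeta>. \<zeta> \<in> S2 \<Longrightarrow> z0 + cscale (c2 \<zeta>) v \<in> U"
    and p: "p1 \<in> P" "z0 + cscale (c1 1) v = z0 + cscale (c1 0) v + (p1, 0)"
      "p2 \<in> P" "z0 + cscale (c2 1) v = z0 + cscale (c2 0) v + (p2, 0)"
    and base: "c1 0 = c2 0"
    and q: "1 \<le> q" "q \<le> CARD('l + 'l)" and int: "bogoyavlenskij_integrable_on P ff U q"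
    and u1: "\<And>i. \<exists>w. HDp S1 w (\<lambda>\<zeta>. \<kappa>1 \<zeta> i $ 1) \<and> u1 i = w 0 - w 1"
    and u2: "\<And>i. \<exists>w. HDp S2 w (\<lambda>\<zeta>. \<kappa>2 \<zeta> i $ 1) \<and> u2 i = w 0 - w 1"
  shows "(\<Sum>i\<in>UNIV. u1 i * dpol i (u2 (Inr j))) = (\<Sum>i\<in>UNIV. u2 i * dpol i (u1 (Inr j)))"
proof -
  interpret A: loop_transport S1 \<kappa>1 c1 c1' z0 v "\<lambda>m w. ff w $ m" Uf by (rule l1)
  interpret B: loop_transport S2 \<kappa>2 c2 c2' z0 v "\<lambda>m w. ff w $ m" Uf by (rule l2)
  define J where "J = {1..q}"
  define K where "K = {1..CARD('l + 'l) - q}"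
  obtain X F where XF0: "let J = {1..q}; K = {1..CARD('l + 'l) - q} in
        (\<forall>z\<in>U. X 1 z = ff z) \<and>
        (\<forall>j\<in>J. periodic_fun_on P (X j) U \<and> (\<forall>i. scv_meromorphic_on (\<lambda>z. X j z $ i) U)) \<and>
        (\<forall>k\<in>K. periodic_fun_on P (F k) U \<and> scv_meromorphic_on (F k) U) \<and>
        (AE z in lborel. z \<in> U \<longrightarrow> lin_indep_family (\<lambda>j. X j z) J) \<and>
        (\<forall>j\<in>J. \<forall>k\<in>J. \<forall>z\<in>U.
           (\<forall>i. scv_analytic_at (\<lambda>w. X j w $ i) z \<and> scv_analytic_at (\<lambda>w. X k w $ i) z) \<longrightarrow>
           lie_bracket_state (X j) (X k) z = 0) \<and>
        (AE z in lborel. z \<in> U \<longrightarrow> lin_indep_family (\<lambda>k. grad_state (F k) z) K) \<and>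
        (\<forall>k\<in>K. \<forall>j\<in>J. \<forall>z\<in>U.
           scv_analytic_at (F k) z \<and> (\<forall>i. scv_analytic_at (\<lambda>w. X j w $ i) z) \<longrightarrow>
           (\<Sum>m\<in>UNIV. grad_state (F k) z $ m * X j z $ m) = 0)"
    using int unfolding bogoyavlenskij_integrable_on_def by (elim exE)
  note XF1 = XF0[unfolded Let_def J_def[symmetric] K_def[symmetric]]
  have X1: "\<And>z. z \<in> U \<Longrightarrow> X 1 z = ff z"
    and Xper: "\<And>j. j \<in> J \<Longrightarrow> periodic_fun_on P (X j) U"
    and Xmer: "\<And>j i. j \<in> J \<Longrightarrow> scv_meromorphic_on (\<lambda>z. X j z $ i) U"
    and Fper: "\<And>k. k \<in> K \<Longrightarrow> periodic_fun_on P (F k) U"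
    and Fmer: "\<And>k. k \<in> K \<Longrightarrow> scv_meromorphic_on (F k) U"
    and Xind: "AE z in lborel. z \<in> U \<longrightarrow> lin_indep_family (\<lambda>j. X j z) J"
    and brk: "\<And>j k z. j \<in> J \<Longrightarrow> k \<in> J \<Longrightarrow> z \<in> U \<Longrightarrow>
         (\<forall>i. scv_analytic_at (\<lambda>w. X j w $ i) z \<and> scv_analytic_at (\<lambda>w. X k w $ i) z) \<Longrightarrow>
           lie_bracket_state (X j) (X k) z = 0"
    and Find: "AE z in lborel. z \<in> U \<longrightarrow> lin_indep_family (\<lambda>k. grad_state (F k) z) K"
    and inv: "\<And>k j z. k \<in> K \<Longrightarrow> j \<in> J \<Longrightarrow> z \<in> U \<Longrightarrow>
           scv_analytic_at (F k) z \<and> (\<forall>i. scv_analytic_at (\<lambda>w. X j w $ i) z) \<Longrightarrow>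
           (\<Sum>m\<in>UNIV. grad_state (F k) z $ m * X j z $ m) = 0"
    using XF1 by simp_all
  have J1: "1 \<in> J" using q by (simp add: J_def)
  have fin: "finite J" "finite K" by (simp_all add: J_def K_def)
  \<comment> \<open>The identities of integrability are stated only where the functions are
    analytic; such points are generic, so the identities hold in the fraction field.\<close>
  have good: "generically z (\<lambda>w. w \<in> U \<and> (\<forall>j\<in>J. \<forall>i. scv_analytic_at (\<lambda>w. X j w $ i) w) \<and> (\<forall>k\<in>K. scv_analytic_at (F k) w))"
    if z: "z \<in> U" for z
  proof (intro generically_conj)
    show "generically z (\<lambda>w. w \<in> U)" by (rule generically_open[OF U(1) z])
    show "generically z (\<lambda>w. \<forall>k\<in>K. scv_analytic_at (F k) w)"
      by (rule generically_finite[OF fin(2)]) (use rep_exists[OF Fmer z] rep_analytic in blast)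
    have "generically z (\<lambda>w. \<forall>i\<in>UNIV. scv_analytic_at (\<lambda>w. X j w $ i) w)" if "j \<in> J" for j
      by (rule generically_finite[OF finite_class.finite_UNIV]) (use rep_exists[OF Xmer[OF that] z] rep_analytic in blast)
    then show "generically z (\<lambda>w. \<forall>j\<in>J. \<forall>i. scv_analytic_at (\<lambda>w. X j w $ i) w)"
      by (intro generically_finite[OF fin(1)]) simp
  qed
  have comm0: "(\<Sum>m\<in>UNIV. dir (\<lambda>w. X k w $ i) (bas m) w * X j w $ m) = (\<Sum>m\<in>UNIV. dir (\<lambda>w. X j w $ i) (bas m) w * X k w $ m)"
    if "j \<in> J" "k \<in> J" "w \<in> U" "\<forall>j\<in>J. \<forall>i. scv_analytic_at (\<lambda>w. X j w $ i) w" for j k i w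
  proof -
    have "lie_bracket_state (X j) (X k) w $ i = 0" using brk[OF that(1-3)] that by simp
    then show ?thesis
      by (simp add: lie_bracket_state_def jacobian_state_def matrix_vector_mult_def pderiv_state_dir)
  qed
  have inv0: "(\<Sum>m\<in>UNIV. dir (F k) (bas m) w * X j w $ m) = 0"
    if "k \<in> K" "j \<in> J" "w \<in> U" "\<forall>j\<in>J. \<forall>i. scv_analytic_at (\<lambda>w. X j w $ i) w" "\<forall>k\<in>K. scv_analytic_at (F k) w" for j k w
    using inv[OF that(1-3)] that by (simp add: grad_state_def pderiv_state_dir)
  define z where "z = A.Z 0"
  have zB: "B.Z 0 = z" by (simp add: z_def A.Z_def B.Z_def base)
  have zU: "z \<in> U" using U(2)[OF A.ends(1)] by (simp add: z_def A.Z_def)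
  define x :: "nat \<Rightarrow> ('l + 'l) pol fps fract ^ ('l + 'l)" where "x j = (\<chi> i. germ z (\<lambda>w. X j w $ i))" for j
  have rx: "rep z (\<lambda>w. X j w $ i) (x j $ i)" if "j \<in> J" for j i
    using rep_exists[OF Xmer[OF that] zU, of i] germ by (fastforce simp: x_def)
  have rF: "rep z (F k) (germ z (F k))" if "k \<in> K" for k
    using rep_exists[OF Fmer[OF that] zU] germ by fastforce
  have "\<exists>y. rep z (dir (F k) (bas m)) y \<and> fder (eop m) (germ z (F k)) = emb (fps_X ^ 2) * y" if "k \<in> K" for k m
    by (rule rep_dir[OF rF[OF that]])
  then obtain y where y: "\<And>k m. k \<in> K \<Longrightarrow> rep z (dir (F k) (bas m)) (y k m)"
     "\<And>k m. k \<in> K \<Longrightarrow> fder (eop m) (germ z (F k)) = emb (fps_X ^ 2) * y k m" by metis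
  have "\<exists>y. rep z (dir (\<lambda>w. X j w $ i) (bas m)) y \<and> fder (eop m) (x j $ i) = emb (fps_X ^ 2) * y" if "j \<in> J" for j i m
    by (rule rep_dir[OF rx[OF that]])
  then obtain t where t: "\<And>j i m. j \<in> J \<Longrightarrow> rep z (dir (\<lambda>w. X j w $ i) (bas m)) (t j i m)"
     "\<And>j i m. j \<in> J \<Longrightarrow> fder (eop m) (x j $ i) = emb (fps_X ^ 2) * t j i m" by metis
  have ix: "lin_indep x J"
    by (rule lin_indep_transfer[OF fin(1) rx Xind U(1) zU])
  have "lin_indep (\<lambda>k. \<chi> m. y k m) K"
    by (rule lin_indep_transfer[OF fin(2) _ Find U(1) zU]) (simp add: grad_state_def pderiv_state_dir y)
  \<comment> \<open>The frame derivations produce gradients multiplied by \<open>fps_X ^ 2\<close>;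
    scaling by this nonzero element keeps them independent.\<close>
  from lin_indep_scale[OF this emb_X_power_nonzero[of 2]]
  have "lin_indep (\<lambda>k. emb (fps_X ^ 2) *s (\<chi> m. y k m)) K" .
  moreover have "(\<Sum>k\<in>K. a k *s (emb (fps_X ^ 2) *s (\<chi> m. y k m))) = (\<Sum>k\<in>K. a k *s (\<chi> m. fder (eop m) (germ z (F k))))" for a
    by (rule sum.cong[OF refl]) (simp add: vec_eq_iff y(2) del: mult_fract)
  ultimately have iF: "lin_indep (\<lambda>k. \<chi> m. fder (eop m) (germ z (F k))) K"
    unfolding lin_indep_def by simp
  have ann: "vf (x j) (germ z (F k)) = 0" if jk: "j \<in> J" "k \<in> K" for j k
  proof -
    have "rep z (\<lambda>w. \<Sum>m\<in>UNIV. dir (F k) (bas m) w * X j w $ m) (\<Sum>m\<in>UNIV. y k m * x j $ m)"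
      by (intro rep_sum rep_mult y rx jk)
    from rep_zeroI[OF this generically_mono[OF good[OF zU]]] have "(\<Sum>m\<in>UNIV. y k m * x j $ m) = 0"
      using inv0 jk by blast
    moreover have "vf (x j) (germ z (F k)) = emb (fps_X ^ 2) * (\<Sum>m\<in>UNIV. y k m * x j $ m)"
      unfolding vf_def y(2)[OF jk(2)] by (simp add: sum_distrib_left mult_ac del: mult_fract)
    ultimately show ?thesis by simp
  qed
  have comm: "vf (x j) (x k $ i) = vf (x k) (x j $ i)" if jk: "j \<in> J" "k \<in> J" for j k i
  proof -
    have "rep z (\<lambda>w. (\<Sum>m\<in>UNIV. dir (\<lambda>w. X k w $ i) (bas m) w * X j w $ m) - (\<Sum>m\<in>UNIV. dir (\<lambda>w. X j w $ i) (bas m) w * X k w $ m))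
       ((\<Sum>m\<in>UNIV. t k i m * x j $ m) - (\<Sum>m\<in>UNIV. t j i m * x k $ m))"
      by (intro rep_diff rep_sum rep_mult t rx jk)
    from rep_zeroI[OF this generically_mono[OF good[OF zU]]]
    have "(\<Sum>m\<in>UNIV. t k i m * x j $ m) = (\<Sum>m\<in>UNIV. t j i m * x k $ m)"
      using comm0[OF jk] by fastforce
    moreover have "vf (x j) (x k $ i) = emb (fps_X ^ 2) * (\<Sum>m\<in>UNIV. t k i m * x j $ m)" if "j \<in> J" "k \<in> J" for j k
      unfolding vf_def t(2)[OF that(2)] by (simp add: sum_distrib_left mult_ac del: mult_fract)
    ultimately show ?thesis using jk by simp
  qed
  have AU: "A.Z \<zeta> \<in> U" if "\<zeta> \<in> S1" for \<zeta> using U(2)[OF that] by (simp add: A.Z_def)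
  have BU: "B.Z \<zeta> \<in> U" if "\<zeta> \<in> S2" for \<zeta> using U(3)[OF that] by (simp add: B.Z_def)
  have per: "G (w + (p, 0)) = G w" if "periodic_fun_on P G U" "p \<in> P" "w \<in> U" for p w and G :: "(complex ^ ('l + 'l)) \<times> complex \<Rightarrow> 'b"
    using that unfolding periodic_fun_on_def by (cases w) auto
  have advF: "generically z (\<lambda>w. (\<Sum>m\<in>UNIV. ff w $ m * dir (F k) (bas m) w) = 0)" if z: "z \<in> U" and k: "k \<in> K" for z k
  proof (rule generically_mono[OF good[OF z]])
    fix w assume "w \<in> U \<and> (\<forall>j\<in>J. \<forall>i. scv_analytic_at (\<lambda>w. X j w $ i) w) \<and> (\<forall>k\<in>K. scv_analytic_at (F k) w)"
    then show "(\<Sum>m\<in>UNIV. ff w $ m * dir (F k) (bas m) w) = 0"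
      using inv0[OF k J1, of w] X1[of w] by (simp add: mult.commute)
  qed
  have advX: "generically z (\<lambda>w. \<forall>i. (\<Sum>m\<in>UNIV. ff w $ m * dir (\<lambda>w. X j w $ i) (bas m) w) =
      (\<Sum>m\<in>UNIV. dir (\<lambda>w. ff w $ i) (bas m) w * X j w $ m))" if z: "z \<in> U" and j: "j \<in> J" for z j
  proof (rule generically_mono[OF good[OF z]], rule allI)
    fix w i assume w: "w \<in> U \<and> (\<forall>j\<in>J. \<forall>i. scv_analytic_at (\<lambda>w. X j w $ i) w) \<and> (\<forall>k\<in>K. scv_analytic_at (F k) w)"
    have d: "dir (\<lambda>w. X 1 w $ i) (bas m) w = dir (\<lambda>w. ff w $ i) (bas m) w" for m
      by (rule dir_cong[OF U(1)]) (use X1 w in simp_all)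
    have "(\<Sum>m\<in>UNIV. dir (\<lambda>w. X j w $ i) (bas m) w * X 1 w $ m) = (\<Sum>m\<in>UNIV. dir (\<lambda>w. X 1 w $ i) (bas m) w * X j w $ m)"
      by (rule comm0[OF J1 j]) (use w in auto)
    then show "(\<Sum>m\<in>UNIV. ff w $ m * dir (\<lambda>w. X j w $ i) (bas m) w) = (\<Sum>m\<in>UNIV. dir (\<lambda>w. ff w $ i) (bas m) w * X j w $ m)"
      unfolding d X1[OF conjunct1[OF w]] by (simp add: mult.commute)
  qed
  note vA = vf_coords[OF A.D_derivation A.D_chain] and vB = vf_coords[OF B.D_derivation B.D_chain]
  have dA: "vf (coords A.D) (germ z (F k)) = 0" if k: "k \<in> K" for k
    unfolding vA z_def
  proof (rule A.D_kills_integral[OF Fmer[OF k] AU U(1)])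
    show "generically (A.Z \<zeta>) (\<lambda>w. A.adv (F k) w = 0)" if "\<zeta> \<in> S1" for \<zeta>
      unfolding A.adv_def by (rule advF[OF AU[OF that] k])
    show "A.Z 1 = A.Z 0 + (p1, 0)" using p(2) by (simp add: A.Z_def)
    show "F k (w + (p1, 0)) = F k w" if "w \<in> U" for w by (rule per[OF Fper[OF k] p(1) that])
  qed
  have dB: "vf (coords B.D) (germ z (F k)) = 0" if k: "k \<in> K" for k
    unfolding vB zB[symmetric]
  proof (rule B.D_kills_integral[OF Fmer[OF k] BU U(1)])
    show "generically (B.Z \<zeta>) (\<lambda>w. B.adv (F k) w = 0)" if "\<zeta> \<in> S2" for \<zeta>
      unfolding B.adv_def by (rule advF[OF BU[OF that] k])
    show "B.Z 1 = B.Z 0 + (p2, 0)" using p(4) by (simp add: B.Z_def)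
    show "F k (w + (p2, 0)) = F k w" if "w \<in> U" for w by (rule per[OF Fper[OF k] p(3) that])
  qed
  have xA: "vf (coords A.D) (x j $ i) = vf (x j) (coords A.D $ i)" if j: "j \<in> J" for j i
  proof -
    have "fder A.D (germ (A.Z 0) (\<lambda>w. X j w $ i)) = vf (\<chi> m. germ (A.Z 0) (\<lambda>w. X j w $ m)) (coords A.D $ i)"
    proof (rule A.D_commutes[where X = "\<lambda>i w. X j w $ i", OF Xmer[OF j] AU U(1)])
      show "generically (A.Z \<zeta>) (\<lambda>w. \<forall>i. A.adv (\<lambda>w. X j w $ i) w = (\<Sum>m\<in>UNIV. dir (\<lambda>w. ff w $ i) (bas m) w * X j w $ m))"
        if "\<zeta> \<in> S1" for \<zeta>
        unfolding A.adv_def by (rule advX[OF AU[OF that] j])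
      show "A.Z 1 = A.Z 0 + (p1, 0)" using p(2) by (simp add: A.Z_def)
      show "X j (w + (p1, 0)) $ i = X j w $ i" if "w \<in> U" for w i using per[OF Xper[OF j] p(1) that] by simp
    qed
    then show ?thesis unfolding vA by (simp add: x_def[abs_def] z_def)
  qed
  have xB: "vf (coords B.D) (x j $ i) = vf (x j) (coords B.D $ i)" if j: "j \<in> J" for j i
  proof -
    have "fder B.D (germ (B.Z 0) (\<lambda>w. X j w $ i)) = vf (\<chi> m. germ (B.Z 0) (\<lambda>w. X j w $ m)) (coords B.D $ i)"
    proof (rule B.D_commutes[where X = "\<lambda>i w. X j w $ i", OF Xmer[OF j] BU U(1)])
      show "generically (B.Z \<zeta>) (\<lambda>w. \<forall>i. B.adv (\<lambda>w. X j w $ i) w = (\<Sum>m\<in>UNIV. dir (\<lambda>w. ff w $ i) (bas m) w * X j w $ m))"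
        if "\<zeta> \<in> S2" for \<zeta>
        unfolding B.adv_def by (rule advX[OF BU[OF that] j])
      show "B.Z 1 = B.Z 0 + (p2, 0)" using p(4) by (simp add: B.Z_def)
      show "X j (w + (p2, 0)) $ i = X j w $ i" if "w \<in> U" for w i using per[OF Xper[OF j] p(3) that] by simp
    qed
    then show ?thesis unfolding vB by (simp add: x_def[abs_def] zB)
  qed
  have card: "card J + card K = CARD('l + 'l)" using q by (simp add: J_def K_def)
  have "vf (coords A.D) (coords B.D $ Inr j) = vf (coords B.D) (coords A.D $ Inr j)"
    unfolding vf_def
    by (rule bogoyavlenskij_commute[where e = "\<lambda>m. fder (eop m)" and x = x and \<phi> = "\<lambda>k. germ z (F k)",
          OF fder_derivation[OF eop_derivation] ix fin(1) iF fin(2) card])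
      (fold vf_def, simp_all add: ann dA dB comm xA xB)
  then have e: "fder A.D (coords B.D $ Inr j) = fder B.D (coords A.D $ Inr j)" unfolding vA vB .
  let ?\<eta> = "fps_const (pvar (Inr j)) :: ('l + 'l) pol fps"
  have fX: "fder \<delta> (emb a / emb (fps_X ^ 1)) = emb (\<delta> a) / emb (fps_X ^ 1)"
    if \<delta>: "is_derivation \<delta>" "\<delta> fps_X = 0" for \<delta> and a :: "('l + 'l) pol fps"
  proof -
    have "emb a / emb (fps_X ^ 1) = Fract a fps_X" by simp
    then have "fder \<delta> (emb a / emb (fps_X ^ 1)) = (emb (\<delta> a) * emb fps_X) / (emb fps_X * emb fps_X)"
      using fder_quotient[OF \<delta>(1) X_power_nonzero, of a 1] \<delta>(2) by (simp only: power_one_right emb_simps mult_zero_right diff_0_right)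
    then show ?thesis using emb_X_power_nonzero[of 1] by (simp add: Zero_fract_def eq_fract)
  qed
  have w1: "2 - wt (Inr j :: 'l + 'l) = 1" by simp
  have "emb (A.D (B.D ?\<eta>)) / emb (fps_X ^ 1) = emb (B.D (A.D ?\<eta>)) / emb (fps_X ^ 1)"
    using e unfolding coords_def vec_lambda_beta w1
      fX[OF A.D_derivation A.D_fixed[OF A.E_X]] fX[OF B.D_derivation B.D_fixed[OF B.E_X]] .
  then have "A.D (B.D ?\<eta>) = B.D (A.D ?\<eta>)"
    by (simp add: eq_fract)
  \<comment> \<open>Logarithms have no constant term, so a composite of two of them starts at order
    2, and that coefficient depends only on their coefficients of order 1.\<close>
  then have e2: "A.D (B.D ?\<eta>) $ 2 = B.D (A.D ?\<eta>) $ 2" by simp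
  have prod2: "(a * b) $ 2 = a $ 1 * b $ 1" if "a $ 0 = 0" "b $ 0 = 0" for a b :: "('l + 'l) pol fps"
    using that by (simp add: fps_mult_nth numeral_2_eq_2)
  have uA: "A.D (fps_const (pvar i)) $ 1 = u1 i" for i
    using u1[of i] A.D_leading by auto
  have uB: "B.D (fps_const (pvar i)) $ 1 = u2 i" for i
    using u2[of i] B.D_leading by auto
  have "A.D (B.D ?\<eta>) $ 2 = (\<Sum>i\<in>UNIV. u1 i * dpol i (u2 (Inr j)))"
    by (subst A.D_chain) (simp add: fps_sum_nth prod2 A.D_nth_0 B.D_nth_0 uA[unfolded One_nat_def] uB[unfolded One_nat_def])
  moreover have "B.D (A.D ?\<eta>) $ 2 = (\<Sum>i\<in>UNIV. u2 i * dpol i (u1 (Inr j)))"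
    by (subst B.D_chain) (simp add: fps_sum_nth prod2 A.D_nth_0 B.D_nth_0 uA[unfolded One_nat_def] uB[unfolded One_nat_def])
  ultimately show ?thesis using e2 by simp
qed

section \<open>Loops in complex time\<close>

text \<open>At a zero of the denominator the residue is
  \<open>sin x / (\<kappa> * \<omega> * sin x)\<close>, the same
  \<open>1 / (\<kappa> * \<omega>)\<close> at every pole. Poles of several coupling terms at one
  time therefore cannot cancel, and an integer multiplicity \<open>m\<close> records whether there
  is a pole.\<close>

lemma pendulum_pole:
  fixes a \<omega> \<kappa> :: real and \<tau>0 :: complex
  assumes \<kappa>: "0 < \<kappa>" "\<kappa> < 1" and \<omega>: "\<omega> \<noteq> 0"
  defines "x \<equiv> \<lambda>\<tau>. of_real a + \<tau> * of_real \<omega>"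
  defines "\<phi> \<equiv> \<lambda>\<tau>. 1 - of_real \<kappa> * cos (x \<tau>)"
  shows "\<exists>R>0. \<exists>G (m::nat). G holomorphic_on ball \<tau>0 R \<and> (\<phi> \<tau>0 = 0 \<longrightarrow> m = 1) \<and>
    (\<forall>\<tau>\<in>ball \<tau>0 R - {\<tau>0}. \<phi> \<tau> \<noteq> 0 \<and>
      sin (x \<tau>) / \<phi> \<tau> = of_nat m / (of_real (\<kappa> * \<omega>) * (\<tau> - \<tau>0)) + G \<tau>)"
proof -
  have hx: "x holomorphic_on A" for A unfolding x_def by (intro holomorphic_intros)
  have h\<phi>: "\<phi> holomorphic_on A" for A unfolding \<phi>_def x_def by (intro holomorphic_intros)
  have hs: "(\<lambda>\<tau>. sin (x \<tau>)) holomorphic_on A" for A unfolding x_def by (intro holomorphic_intros)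
  have nz: "\<exists>R>0. \<forall>\<tau>\<in>ball \<tau>0 R. g \<tau> \<noteq> 0" if "g holomorphic_on UNIV" "g \<tau>0 \<noteq> 0" for g :: "complex \<Rightarrow> complex"
  proof -
    have "open (g -` (- {0}))"
      using holomorphic_on_imp_continuous_on[OF that(1)] by (intro open_vimage) auto
    moreover have "\<tau>0 \<in> g -` (- {0})" using that(2) by simp
    ultimately obtain R where "R > 0" "ball \<tau>0 R \<subseteq> g -` (- {0})" using open_contains_ball by blast
    then show ?thesis by (intro exI[of _ R]) auto
  qed
  show ?thesis
  proof (cases "\<phi> \<tau>0 = 0")
    case False
    obtain R where R: "R > 0" "\<forall>\<tau>\<in>ball \<tau>0 R. \<phi> \<tau> \<noteq> 0" using nz[OF h\<phi> False] by blast
    have "(\<lambda>\<tau>. sin (x \<tau>) / \<phi> \<tau>) holomorphic_on ball \<tau>0 R"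
      by (rule holomorphic_on_divide[OF hs h\<phi>]) (use R in auto)
    then show ?thesis using R False
      by (intro exI[of _ R] conjI exI[of _ "\<lambda>\<tau>. sin (x \<tau>) / \<phi> \<tau>"] exI[of _ 0]) auto
  next
    case True
    define \<psi> where "\<psi> = (\<lambda>\<tau>. if \<tau> = \<tau>0 then deriv \<phi> \<tau>0 else (\<phi> \<tau> - \<phi> \<tau>0) / (\<tau> - \<tau>0))"
    have h\<psi>: "\<psi> holomorphic_on UNIV" unfolding \<psi>_def by (rule pole_lemma_open[OF h\<phi> open_UNIV])
    have d\<phi>: "deriv \<phi> \<tau>0 = of_real \<kappa> * of_real \<omega> * sin (x \<tau>0)"
      unfolding \<phi>_def x_def by (rule DERIV_imp_deriv) (auto intro!: derivative_eq_intros)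
    \<comment> \<open>At a zero of the denominator the cosine is \<open>1 / \<kappa>\<close>,
      different from 1 and -1; so the zero is simple and the numerator does not vanish.\<close>
    have sx: "sin (x \<tau>0) \<noteq> 0"
    proof
      assume "sin (x \<tau>0) = 0"
      then have c2: "(cos (x \<tau>0))\<^sup>2 = 1" using sin_cos_squared_add[of "x \<tau>0"] by simp
      have "of_real \<kappa> * cos (x \<tau>0) = 1" using True by (simp add: \<phi>_def)
      then have "(of_real \<kappa>)\<^sup>2 * (cos (x \<tau>0))\<^sup>2 = 1" by (metis power_mult_distrib power_one)
      then have "(of_real (\<kappa>\<^sup>2) :: complex) = of_real 1" using c2 by simp
      then have "\<kappa>\<^sup>2 = 1" by (simp only: of_real_eq_iff)
      then show False using \<kappa> by (simp add: power2_eq_1_iff)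
    qed
    have \<psi>0: "\<psi> \<tau>0 \<noteq> 0" using \<kappa> \<omega> sx by (simp add: \<psi>_def d\<phi>)
    obtain R where R: "R > 0" "\<forall>\<tau>\<in>ball \<tau>0 R. \<psi> \<tau> \<noteq> 0" using nz[OF h\<psi> \<psi>0] by blast
    define s where "s \<tau> = sin (x \<tau>) / \<psi> \<tau>" for \<tau>
    have hsb: "s holomorphic_on ball \<tau>0 R"
      unfolding s_def by (rule holomorphic_on_divide[OF hs holomorphic_on_subset[OF h\<psi>]]) (use R in auto)
    have s0: "s \<tau>0 = 1 / of_real (\<kappa> * \<omega>)"
      using sx \<kappa> \<omega> by (simp add: s_def \<psi>_def d\<phi>)
    define G where "G = (\<lambda>\<tau>. if \<tau> = \<tau>0 then deriv s \<tau>0 else (s \<tau> - s \<tau>0) / (\<tau> - \<tau>0))"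
    have hG: "G holomorphic_on ball \<tau>0 R" unfolding G_def by (rule pole_lemma_open[OF hsb open_ball])
    have "\<phi> \<tau> \<noteq> 0 \<and> sin (x \<tau>) / \<phi> \<tau> = of_nat 1 / (of_real (\<kappa> * \<omega>) * (\<tau> - \<tau>0)) + G \<tau>"
      if t: "\<tau> \<in> ball \<tau>0 R - {\<tau>0}" for \<tau>
    proof -
      have ne: "\<tau> - \<tau>0 \<noteq> 0" and \<psi>t: "\<psi> \<tau> \<noteq> 0" using t R by auto
      have f: "\<phi> \<tau> = (\<tau> - \<tau>0) * \<psi> \<tau>" using t True by (simp add: \<psi>_def)
      have "sin (x \<tau>) / \<phi> \<tau> = s \<tau> / (\<tau> - \<tau>0)" by (simp add: f s_def)
      also have "\<dots> = s \<tau>0 / (\<tau> - \<tau>0) + G \<tau>" using t by (simp add: G_def diff_divide_distrib)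
      also have "s \<tau>0 / (\<tau> - \<tau>0) = of_nat 1 / (of_real (\<kappa> * \<omega>) * (\<tau> - \<tau>0))" by (simp add: s0)
      finally show ?thesis using f ne \<psi>t by simp
    qed
    then show ?thesis using R(1) hG by (intro exI[of _ R] conjI exI[of _ G] exI[of _ 1]) auto
  qed
qed

text \<open>Transport needs a convex open parameter domain, whereas a path only supplies the real
  segment; a thin tube around the segment is convex and still inside.\<close>

lemma segment_nbhd:
  fixes O' :: "complex set"
  assumes "open O'" "\<And>s. s \<in> {0..1} \<Longrightarrow> of_real s \<in> O'"
  shows "\<exists>S. open S \<and> convex S \<and> 0 \<in> S \<and> 1 \<in> S \<and> S \<subseteq> O'"
proof -
  define A where "A = complex_of_real ` {0..1}"
  have "compact A" unfolding A_def by (intro compact_continuous_image continuous_intros compact_Icc)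
  moreover have "A \<subseteq> O'" using assms(2) by (auto simp: A_def)
  ultimately obtain \<epsilon> where \<epsilon>: "\<epsilon> > 0" "(\<Union>x\<in>A. ball x \<epsilon>) \<subseteq> O'"
    using compact_subset_open_imp_ball_epsilon_subset[OF _ assms(1)] by blast
  define S where "S = (\<Union>x\<in>A. ball x \<epsilon>)"
  have "convex A" unfolding A_def by (intro convex_linear_image bounded_linear.linear bounded_linear_of_real) simp
  then have "convex (\<Union>x\<in>A. \<Union>y\<in>ball 0 \<epsilon>. {x + y})" by (rule convex_sums) simp
  moreover have "(\<Union>x\<in>A. \<Union>y\<in>ball 0 \<epsilon>. {x + y}) = S"
  proof -
    have be: "ball x \<epsilon> = (\<Union>y\<in>ball 0 \<epsilon>. {x + y})" for x :: complex
    proof (intro set_eqI iffI)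
      fix w assume "w \<in> ball x \<epsilon>"
      then have "w - x \<in> ball 0 \<epsilon>" "w = x + (w - x)" by (auto simp: dist_norm norm_minus_commute)
      then show "w \<in> (\<Union>y\<in>ball 0 \<epsilon>. {x + y})" by blast
    qed (auto simp: dist_norm)
    show ?thesis unfolding S_def by (intro SUP_cong refl be[symmetric])
  qed
  ultimately have "convex S" by (simp only:)
  have "0 \<in> A" unfolding A_def by (rule image_eqI[of _ _ 0]) auto
  then have S0: "0 \<in> S" unfolding S_def by (rule UN_I) (use \<epsilon>(1) in simp)
  have "1 \<in> A" unfolding A_def by (rule image_eqI[of _ _ 1]) auto
  then have S1: "1 \<in> S" unfolding S_def by (rule UN_I) (use \<epsilon>(1) in simp)
  have "open S" unfolding S_def by (intro open_UN ballI open_ball)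
  then show ?thesis using \<open>convex S\<close> S0 S1 \<epsilon>(2) unfolding S_def[symmetric] by (intro exI[of _ S] conjI)
qed

text \<open>A polynomial path extends to complex parameters by reading its real polynomial
  coordinates as complex ones, which makes the path usable as holomorphic time.\<close>

lemma entire_path:
  fixes O' :: "complex set"
  assumes "open O'" "connected O'" "x \<in> O'" "y \<in> O'"
  shows "\<exists>c. c holomorphic_on UNIV \<and> c 0 = x \<and> c 1 = y \<and> (\<forall>s\<in>{0..1}. c (of_real s) \<in> O')"
proof -
  obtain g where g: "polynomial_function g" "path_image g \<subseteq> O'" "pathstart g = x" "pathfinish g = y"
    using connected_open_polynomial_connected[OF assms] by blast
  have p: "real_polynomial_function (f \<circ> g)" if "bounded_linear f" for f
    by (rule g(1)[unfolded polynomial_function_def, rule_format, OF that])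
  obtain a n where a: "Re \<circ> g = (\<lambda>x. \<Sum>i\<le>n. a i * x ^ i)"
    using p[OF bounded_linear_Re] unfolding real_polynomial_function_iff_sum by (elim exE)
  obtain b m where b: "Im \<circ> g = (\<lambda>x. \<Sum>i\<le>m. b i * x ^ i)"
    using p[OF bounded_linear_Im] unfolding real_polynomial_function_iff_sum by (elim exE)
  define c where "c \<zeta> = (\<Sum>i\<le>n. of_real (a i) * \<zeta> ^ i) + \<i> * (\<Sum>i\<le>m. of_real (b i) * \<zeta> ^ i)" for \<zeta>
  have cg: "c (of_real s) = g s" for s
  proof -
    have "g s = of_real ((Re \<circ> g) s) + \<i> * of_real ((Im \<circ> g) s)" by (simp add: complex_eq[symmetric])
    then show ?thesis unfolding a b c_def by simp
  qed
  show ?thesis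
  proof (intro exI[of _ c] conjI ballI)
    show "c holomorphic_on UNIV" unfolding c_def by (intro holomorphic_intros)
    show "c 0 = x" using cg[of 0] g(3) by (simp add: pathstart_def)
    show "c 1 = y" using cg[of 1] g(4) by (simp add: pathfinish_def)
    show "c (of_real s) \<in> O'" if "s \<in> {0..1}" for s
      unfolding cg by (rule subsetD[OF g(2)], unfold path_image_def, rule imageI[OF that])
  qed
qed

text \<open>Connectedness in the quotient does not in general pass to the preimage. Here the
  preimage contains the real line, so every translate of the component of 0 meets that component;
  the component is invariant, and so is its complement.\<close>

lemma domain_mod_connected:
  assumes "domain_mod T \<Gamma>" "range of_real \<subseteq> \<Gamma>"
  shows "connected \<Gamma>"
proof -
  have \<Gamma>: "open \<Gamma>" "mod_invariant T \<Gamma>" using assms(1) by (auto simp: domain_mod_def)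
  define C where "C = connected_component_set \<Gamma> 0"
  have real: "range complex_of_real \<subseteq> C"
    unfolding C_def
    by (rule connected_component_maximal)
      (use assms(2) in \<open>auto intro!: connected_continuous_image continuous_intros image_eqI[of _ _ 0]\<close>)
  have inv: "z + of_int k * of_real T \<in> C" if z: "z \<in> C" for z k
  proof -
    define t :: complex where "t = of_int k * of_real T"
    have "connected ((\<lambda>w. w + t) ` C)"
      by (intro connected_continuous_image continuous_intros) (simp add: C_def)
    moreover have "connected (range complex_of_real)"
      by (intro connected_continuous_image continuous_intros) simp
    moreover have "t \<in> (\<lambda>w. w + t) ` C" using real by (intro image_eqI[of _ _ 0]) (auto intro: image_eqI[of _ _ 0])
    moreover have "t \<in> range complex_of_real" unfolding t_def by (intro image_eqI[of _ _ "of_int k * T"]) auto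
    ultimately have "connected ((\<lambda>w. w + t) ` C \<union> range complex_of_real)"
      by (intro connected_Un) auto
    moreover have "(\<lambda>w. w + t) ` C \<subseteq> \<Gamma>"
      using \<Gamma>(2) connected_component_subset[of \<Gamma> 0] unfolding mod_invariant_def t_def C_def by blast
    ultimately have "(\<lambda>w. w + t) ` C \<union> range complex_of_real \<subseteq> C"
      unfolding C_def
      by (intro connected_component_maximal) (use assms(2) in \<open>auto intro: image_eqI[of _ _ 0]\<close>)
    then show ?thesis using z by (auto simp: t_def)
  qed
  have "mod_invariant T C" using inv by (simp add: mod_invariant_def)
  moreover have "mod_invariant T (\<Gamma> - C)"
    unfolding mod_invariant_def
  proof (intro ballI allI)
    fix z and k :: int assume z: "z \<in> \<Gamma> - C"
    have "z + of_int k * of_real T \<notin> C"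
    proof
      assume "z + of_int k * of_real T \<in> C"
      from inv[OF this, of "- k"] z show False by simp
    qed
    then show "z + of_int k * of_real T \<in> \<Gamma> - C" using z \<Gamma>(2) by (simp add: mod_invariant_def)
  qed
  moreover have "open C" unfolding C_def by (rule open_connected_component[OF \<Gamma>(1)])
  moreover have "open (\<Gamma> - C)"
    unfolding open_contains_ball
  proof (intro ballI)
    fix z assume z: "z \<in> \<Gamma> - C"
    have "open (connected_component_set \<Gamma> z)" by (rule open_connected_component[OF \<Gamma>(1)])
    moreover have "z \<in> connected_component_set \<Gamma> z" using z by (simp add: connected_component_refl)
    ultimately obtain e where e: "e > 0" "ball z e \<subseteq> connected_component_set \<Gamma> z" using open_contains_ball by blast
    have "connected_component_set \<Gamma> z \<inter> C = {}"
      using z unfolding C_def by (auto simp: connected_component_disjoint)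
    then have "ball z e \<subseteq> \<Gamma> - C" using e(2) connected_component_subset[of \<Gamma> z] by blast
    then show "\<exists>e>0. ball z e \<subseteq> \<Gamma> - C" using e(1) by blast
  qed
  moreover have "C \<noteq> {}" using real by blast
  moreover have CG: "C \<subseteq> \<Gamma>" unfolding C_def by (rule connected_component_subset)
  ultimately have "\<Gamma> - C = {}"
    using assms(1) Diff_disjoint[of C \<Gamma>] Diff_partition[OF CG] unfolding domain_mod_def by blast
  then have "\<Gamma> = C" using CG by blast
  moreover have "connected C" unfolding C_def by (rule connected_connected_component)
  ultimately show ?thesis by simp
qed

section \<open>The coupled oscillators\<close>

definition osc_force :: "real \<Rightarrow> real \<Rightarrow> real \<Rightarrow> real ^ 'l \<Rightarrow> 'l \<Rightarrow> (complex ^ ('l::finite + 'l)) \<times> complex \<Rightarrow> complex" where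
  "osc_force \<delta> \<beta> \<kappa> \<Omega> j w = - of_real \<delta> * fst w $ Inl j + of_real (\<Omega> $ j) +
     of_real \<beta> * (\<Sum>k\<in>UNIV. sin (fst w $ Inr k - fst w $ Inr j) / (1 - of_real \<kappa> * cos (fst w $ Inr k - fst w $ Inr j)))"

definition osc_regular :: "real \<Rightarrow> ((complex ^ ('l::finite + 'l)) \<times> complex) set" where
  "osc_regular \<kappa> = {w. \<forall>k j. 1 - of_real \<kappa> * cos (fst w $ Inr k - fst w $ Inr j) \<noteq> 0}"

definition osc_point :: "real ^ 'l \<Rightarrow> real ^ 'l \<Rightarrow> complex \<Rightarrow> (complex ^ ('l::finite + 'l)) \<times> complex" where
  "osc_point I \<theta> \<tau> = (\<chi> i. case i of Inl j \<Rightarrow> of_real (I $ j)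
                                  | Inr j \<Rightarrow> of_real (I $ j) * \<tau> + of_real (\<theta> $ j), 0)"

definition osc_dir :: "real ^ 'l \<Rightarrow> (complex ^ ('l::finite + 'l)) \<times> complex" where
  "osc_dir I = (\<chi> i. case i of Inl j \<Rightarrow> 0 | Inr j \<Rightarrow> of_real (I $ j), 0)"

lemma oscillator_field_nth:
  "oscillator_field \<delta> \<beta> \<kappa> \<Omega> w $ Inl j = snd w * osc_force \<delta> \<beta> \<kappa> \<Omega> j w"
  "oscillator_field \<delta> \<beta> \<kappa> \<Omega> w $ Inr j = fst w $ Inl j"
  by (simp_all add: oscillator_field_def osc_force_def case_prod_beta)

lemma osc_point_simps [simp]:
  "fst (osc_point I \<theta> \<tau>) $ Inl j = of_real (I $ j)"
  "fst (osc_point I \<theta> \<tau>) $ Inr j = of_real (I $ j) * \<tau> + of_real (\<theta> $ j)"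
  "snd (osc_point I \<theta> \<tau>) = 0"
  by (simp_all add: osc_point_def)

lemma osc_dir_simps [simp]:
  "fst (osc_dir I) $ Inl j = 0" "fst (osc_dir I) $ Inr j = of_real (I $ j)" "snd (osc_dir I) = 0"
  by (simp_all add: osc_dir_def)

lemma osc_point_line: "osc_point I \<theta> 0 + cscale \<tau> (osc_dir I) = osc_point I \<theta> \<tau>"
proof (rule prod_eqI)
  show "fst (osc_point I \<theta> 0 + cscale \<tau> (osc_dir I)) = fst (osc_point I \<theta> \<tau>)"
    by (subst vec_eq_iff, rule allI) (simp add: cscale_def osc_point_def osc_dir_def split: sum.split)
qed (simp add: cscale_def)

lemma osc_point_orbit: "osc_point I \<theta> \<tau> \<in> unperturbed_orbit I \<theta> \<Gamma> \<times> {0}" if "\<tau> \<in> \<Gamma>"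
  using that by (simp add: osc_point_def unperturbed_orbit_def)

lemma open_osc_regular: "open (osc_regular \<kappa> :: ((complex ^ ('l::finite + 'l)) \<times> complex) set)"
proof -
  have "osc_regular \<kappa> = (\<Inter>k. \<Inter>j. {w :: (complex ^ ('l + 'l)) \<times> complex.
      1 - of_real \<kappa> * cos (fst w $ Inr k - fst w $ Inr j) \<noteq> 0})"
    by (auto simp: osc_regular_def)
  then show ?thesis
    by (simp only:) (intro open_INT finite ballI open_Collect_neq continuous_intros)
qed

lemma scv_osc_force: "scv_holomorphic_on (osc_force \<delta> \<beta> \<kappa> \<Omega> j) (osc_regular \<kappa>)"
proof -
  have sin: "(sin :: complex \<Rightarrow> complex) field_differentiable at x" for x
    by (rule field_differentiable_within_sin)
  have cos: "(cos :: complex \<Rightarrow> complex) field_differentiable at x" for x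
    by (rule field_differentiable_within_cos)
  show ?thesis
    unfolding osc_force_def
    apply (intro scv_add scv_cmult scv_const scv_coord scv_sum scv_divide scv_diff)
      apply (rule scv_compose[OF _ sin], intro scv_diff scv_coord)
     apply (rule scv_compose[OF _ cos], intro scv_diff scv_coord)
    by (simp add: osc_regular_def)
qed

lemma scv_oscillator_field: "scv_holomorphic_on (\<lambda>w. oscillator_field \<delta> \<beta> \<kappa> \<Omega> w $ m) (osc_regular \<kappa>)"
  by (cases m) (simp_all add: oscillator_field_nth scv_mult[OF scv_snd scv_osc_force] scv_coord)

text \<open>The action rows carry \<epsilon>, of weight 3, over weight 2; the angle rows carry the
  deviation of the action, of weight 2, over weight 1. Both leave one power of \<mu>, with the full
  Taylor series of the force but an exact linear drift.\<close>

definition osc_transport where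
  "osc_transport \<delta> \<beta> \<kappa> \<Omega> I \<theta> c c' \<zeta> m = fps_const (cst (c' \<zeta>)) * (case m of
     Inl j \<Rightarrow> fps_X * tay (osc_point I \<theta> (c \<zeta>)) (osc_force \<delta> \<beta> \<kappa> \<Omega> j)
   | Inr j \<Rightarrow> fps_X * fps_const (pvar (Inl j)))"

lemma osc_loop:
  assumes S: "open S" "convex S" "0 \<in> S" "1 \<in> S"
    and c: "\<And>\<zeta>. \<zeta> \<in> S \<Longrightarrow> (c has_field_derivative c' \<zeta>) (at \<zeta>)" "c' holomorphic_on S"
    and reg: "\<And>\<zeta>. \<zeta> \<in> S \<Longrightarrow> osc_point I \<theta> (c \<zeta>) \<in> osc_regular \<kappa>"
  shows "loop_transport S (osc_transport \<delta> \<beta> \<kappa> \<Omega> I \<theta> c c') c c' (osc_point I \<theta> 0) (osc_dir I)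
    (\<lambda>m w. oscillator_field \<delta> \<beta> \<kappa> \<Omega> w $ m) (osc_regular \<kappa>)"
proof (unfold_locales)
  show "open S" "convex S" "0 \<in> S" "1 \<in> S" by fact+
  fix m
  have "fh S (\<lambda>\<zeta>. case m of
     Inl j \<Rightarrow> fps_X * tay (osc_point I \<theta> (c \<zeta>)) (osc_force \<delta> \<beta> \<kappa> \<Omega> j)
   | Inr j \<Rightarrow> fps_X * fps_const (pvar (Inl j)))"
  proof (cases m)
    case (Inl j)
    have "fh S (\<lambda>\<zeta>. tay (osc_point I \<theta> 0 + cscale (c \<zeta>) (osc_dir I)) (osc_force \<delta> \<beta> \<kappa> \<Omega> j))"
      by (rule tay_family(1)[OF S(1) c(1) open_osc_regular _ scv_osc_force]) (simp_all add: osc_point_line reg)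
    then show ?thesis unfolding Inl sum.case osc_point_line by (intro fh_mult fh_const)
  next
    case (Inr j)
    show ?thesis unfolding Inr sum.case by (rule fh_const)
  qed
  then show "fh S (\<lambda>\<zeta>. osc_transport \<delta> \<beta> \<kappa> \<Omega> I \<theta> c c' \<zeta> m)"
    unfolding osc_transport_def by (intro fh_mult fh_scalar c(2))
next
  fix \<zeta> m assume "\<zeta> \<in> S"
  show "osc_transport \<delta> \<beta> \<kappa> \<Omega> I \<theta> c c' \<zeta> m $ 0 = 0"
    by (cases m) (simp_all add: osc_transport_def)
next
  fix \<zeta> assume "\<zeta> \<in> S"
  then show "(c has_field_derivative c' \<zeta>) (at \<zeta>)" by (rule c(1))
next
  show "open (osc_regular \<kappa>)" by (rule open_osc_regular)
next
  fix \<zeta> assume "\<zeta> \<in> S"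
  then show "osc_point I \<theta> 0 + cscale (c \<zeta>) (osc_dir I) \<in> osc_regular \<kappa>" by (simp add: osc_point_line reg)
next
  fix m show "scv_holomorphic_on (\<lambda>w. oscillator_field \<delta> \<beta> \<kappa> \<Omega> w $ m) (osc_regular \<kappa>)"
    by (rule scv_oscillator_field)
next
  show "snd (osc_dir I) = 0" by simp
next
  fix \<zeta> m assume z: "\<zeta> \<in> S"
  have an: "scv_analytic_at (osc_force \<delta> \<beta> \<kappa> \<Omega> j) (osc_point I \<theta> (c \<zeta>))" for j
    by (rule analytic_mono[OF scv_osc_force open_osc_regular reg[OF z]])
  have ansnd: "scv_analytic_at snd (osc_point I \<theta> (c \<zeta>))"
    by (rule analytic_mono[OF scv_snd open_UNIV UNIV_I])
  show "fps_X\<^sup>2 * osc_transport \<delta> \<beta> \<kappa> \<Omega> I \<theta> c c' \<zeta> m =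
    fps_const (cst (c' \<zeta>)) * (tay (osc_point I \<theta> 0 + cscale (c \<zeta>) (osc_dir I)) (\<lambda>w. oscillator_field \<delta> \<beta> \<kappa> \<Omega> w $ m) -
      fps_const (cst (fst (osc_dir I) $ m))) * fps_X ^ (2 - wt m)"
    unfolding osc_point_line
  proof (cases m)
    case (Inl j)
    have "tay (osc_point I \<theta> (c \<zeta>)) (\<lambda>w. oscillator_field \<delta> \<beta> \<kappa> \<Omega> w $ m) =
        fps_X ^ 3 * tay (osc_point I \<theta> (c \<zeta>)) (osc_force \<delta> \<beta> \<kappa> \<Omega> j)"
      unfolding Inl oscillator_field_nth by (simp add: tay_mult[OF ansnd an] tay_snd)
    then show "fps_X\<^sup>2 * osc_transport \<delta> \<beta> \<kappa> \<Omega> I \<theta> c c' \<zeta> m = fps_const (cst (c' \<zeta>)) *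
      (tay (osc_point I \<theta> (c \<zeta>)) (\<lambda>w. oscillator_field \<delta> \<beta> \<kappa> \<Omega> w $ m) - fps_const (cst (fst (osc_dir I) $ m))) *
      fps_X ^ (2 - wt m)"
      by (simp add: Inl osc_transport_def wt_simps cst_hom algebra_simps power2_eq_square power3_eq_cube)
  next
    case (Inr j)
    have "tay (osc_point I \<theta> (c \<zeta>)) (\<lambda>w. oscillator_field \<delta> \<beta> \<kappa> \<Omega> w $ m) =
        fps_const (cst (of_real (I $ j))) + fps_X\<^sup>2 * fps_const (pvar (Inl j))"
      unfolding Inr oscillator_field_nth tay_coord by (simp add: wt_simps)
    then show "fps_X\<^sup>2 * osc_transport \<delta> \<beta> \<kappa> \<Omega> I \<theta> c c' \<zeta> m = fps_const (cst (c' \<zeta>)) *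
      (tay (osc_point I \<theta> (c \<zeta>)) (\<lambda>w. oscillator_field \<delta> \<beta> \<kappa> \<Omega> w $ m) - fps_const (cst (fst (osc_dir I) $ m))) *
      fps_X ^ (2 - wt m)"
      by (simp add: Inr osc_transport_def wt_simps algebra_simps power2_eq_square)
  qed
qed

lemma osc_transport_1:
  "osc_transport \<delta> \<beta> \<kappa> \<Omega> I \<theta> c c' \<zeta> (Inl j) $ 1 = cst (c' \<zeta> * osc_force \<delta> \<beta> \<kappa> \<Omega> j (osc_point I \<theta> (c \<zeta>)))"
  "osc_transport \<delta> \<beta> \<kappa> \<Omega> I \<theta> c c' \<zeta> (Inr j) $ 1 = cst (c' \<zeta>) * pvar (Inl j)"
  by (simp_all add: osc_transport_def cst_hom tc_0)

text \<open>The commutator of the two monodromy translations is the product of the residue and the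
  period, so a nonzero residue contradicts integrability.\<close>

lemma osc_obstruction:
  fixes I \<theta> \<Omega> :: "real ^ ('l::finite)"
  assumes S1: "open S1" "convex S1" "0 \<in> S1" "1 \<in> S1"
    and c1: "\<And>\<zeta>. \<zeta> \<in> S1 \<Longrightarrow> (c1 has_field_derivative c1' \<zeta>) (at \<zeta>)" "c1' holomorphic_on S1"
    and r1: "\<And>\<zeta>. \<zeta> \<in> S1 \<Longrightarrow> osc_point I \<theta> (c1 \<zeta>) \<in> osc_regular \<kappa> \<inter> U"
    and S2: "open S2" "convex S2" "0 \<in> S2" "1 \<in> S2"
    and c2: "\<And>\<zeta>. \<zeta> \<in> S2 \<Longrightarrow> (c2 has_field_derivative c2' \<zeta>) (at \<zeta>)" "c2' holomorphic_on S2"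
    and r2: "\<And>\<zeta>. \<zeta> \<in> S2 \<Longrightarrow> osc_point I \<theta> (c2 \<zeta>) \<in> osc_regular \<kappa> \<inter> U"
    and base: "c1 0 = c2 0" "c1 1 = c1 0" "c2 1 = c2 0 + of_real T" "T \<noteq> 0"
    and T: "\<And>j. \<exists>k::int. I $ j * T = 2 * pi * of_int k"
    and W: "\<And>\<zeta>. \<zeta> \<in> S1 \<Longrightarrow> (W has_field_derivative c1' \<zeta> * osc_force \<delta> \<beta> \<kappa> \<Omega> j (osc_point I \<theta> (c1 \<zeta>))) (at \<zeta>)"
      "W 0 \<noteq> W 1"
    and U: "open U" and q: "1 \<le> q" "q \<le> CARD('l + 'l)"
  shows "\<not> bogoyavlenskij_integrable_on angle_periods (oscillator_field \<delta> \<beta> \<kappa> \<Omega>) U q"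
proof
  assume int: "bogoyavlenskij_integrable_on angle_periods (oscillator_field \<delta> \<beta> \<kappa> \<Omega>) U q"
  let ?k1 = "osc_transport \<delta> \<beta> \<kappa> \<Omega> I \<theta> c1 c1'" and ?k2 = "osc_transport \<delta> \<beta> \<kappa> \<Omega> I \<theta> c2 c2'"
  let ?z = "osc_point I \<theta> 0" and ?v = "osc_dir I"
  have reg1: "\<And>\<zeta>. \<zeta> \<in> S1 \<Longrightarrow> osc_point I \<theta> (c1 \<zeta>) \<in> osc_regular \<kappa>" using r1 by simp
  have reg2: "\<And>\<zeta>. \<zeta> \<in> S2 \<Longrightarrow> osc_point I \<theta> (c2 \<zeta>) \<in> osc_regular \<kappa>" using r2 by simp
  have l1: "loop_transport S1 ?k1 c1 c1' ?z ?v (\<lambda>m w. oscillator_field \<delta> \<beta> \<kappa> \<Omega> w $ m) (osc_regular \<kappa>)"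
    by (rule osc_loop[OF S1 c1 reg1])
  have l2: "loop_transport S2 ?k2 c2 c2' ?z ?v (\<lambda>m w. oscillator_field \<delta> \<beta> \<kappa> \<Omega> w $ m) (osc_regular \<kappa>)"
    by (rule osc_loop[OF S2 c2 reg2])
  define p :: "complex ^ ('l + 'l)" where "p = (\<chi> i. case i of Inl j \<Rightarrow> 0 | Inr j \<Rightarrow> of_real (I $ j * T))"
  have p: "p \<in> angle_periods"
    unfolding angle_periods_def
  proof (intro CollectI conjI allI)
    fix j obtain k :: int where "I $ j * T = 2 * pi * of_int k" using T by blast
    then have "p $ Inr j = of_real (2 * pi * of_int k)" by (simp add: p_def)
    then show "\<exists>k::int. p $ Inr j = 2 * of_real pi * of_int k" by (intro exI[of _ k]) simp
  qed (simp add: p_def)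
  have p0: "0 \<in> angle_periods" by (auto simp: angle_periods_def intro: exI[of _ 0])
  have e2: "?z + cscale (c2 1) ?v = ?z + cscale (c2 0) ?v + (p, 0)"
    unfolding osc_point_line
  proof (rule prod_eqI)
    show "fst (osc_point I \<theta> (c2 1)) = fst (osc_point I \<theta> (c2 0) + (p, 0))"
      by (subst vec_eq_iff, rule allI) (simp add: osc_point_def p_def base algebra_simps split: sum.split)
  qed simp
  have e1: "?z + cscale (c1 1) ?v = ?z + cscale (c1 0) ?v + (0, 0)"
    by (simp add: base zero_prod_def[symmetric])
  have prim: "\<exists>w. HDp S w (\<lambda>\<zeta>. fps_nth (k \<zeta> i) 1)"
    if l: "loop_transport S k c c' ?z ?v f Uf" for S k c c' f Uf and i :: "'l + 'l"
  proof -
    interpret loop_transport S k c c' ?z ?v f Uf by (rule l)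
    have "fhp S (\<lambda>\<zeta>. fps_nth (k \<zeta> i) 1)" using \<kappa>_fh[of i] unfolding fh_def by (rule spec)
    from fhp_primitive[OF S_open S_convex ends(1) this, of 0] show ?thesis by (elim exE conjE) (rule exI)
  qed
  have wInr: "HDp S (\<lambda>\<zeta>. cst (c \<zeta>) * pvar (Inl i)) (\<lambda>\<zeta>. osc_transport \<delta> \<beta> \<kappa> \<Omega> I \<theta> c c' \<zeta> (Inr i) $ 1)"
    if "\<And>\<zeta>. \<zeta> \<in> S \<Longrightarrow> (c has_field_derivative c' \<zeta>) (at \<zeta>)" for c c' S i
    using HDp_mult[OF HDp_scalar[of S, OF that] HDp_const[of S "pvar (Inl i)"]]
    unfolding osc_transport_1 by simp
  have wInl: "HDp S1 (\<lambda>\<zeta>. cst (W \<zeta>)) (\<lambda>\<zeta>. ?k1 \<zeta> (Inl j) $ 1)"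
    unfolding osc_transport_1 by (rule HDp_scalar[OF W(1)])
  obtain a1 where a1: "\<And>i. HDp S1 (a1 i) (\<lambda>\<zeta>. ?k1 \<zeta> i $ 1)" using prim[OF l1] by metis
  obtain a2 where a2: "\<And>i. HDp S2 (a2 i) (\<lambda>\<zeta>. ?k2 \<zeta> i $ 1)" using prim[OF l2] by metis
  \<comment> \<open>Explicit primitives for the entries that survive in the final bracket:
    \<open>W\<close> for the force on oscillator \<open>j\<close>, and time itself times the action
    deviation for the angles.\<close>
  define w1 where "w1 i = (case i of Inl k \<Rightarrow> (if k = j then \<lambda>\<zeta>. cst (W \<zeta>) else a1 i) | Inr k \<Rightarrow> \<lambda>\<zeta>. cst (c1 \<zeta>) * pvar (Inl k))" for i
  define w2 where "w2 i = (case i of Inl k \<Rightarrow> a2 i | Inr k \<Rightarrow> \<lambda>\<zeta>. cst (c2 \<zeta>) * pvar (Inl k))" for i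
  have w1: "HDp S1 (w1 i) (\<lambda>\<zeta>. ?k1 \<zeta> i $ 1)" for i
    by (cases i) (simp_all add: w1_def wInr[OF c1(1)] wInl a1 del: One_nat_def)
  have w2: "HDp S2 (w2 i) (\<lambda>\<zeta>. ?k2 \<zeta> i $ 1)" for i
    by (cases i) (simp_all add: w2_def wInr[OF c2(1)] a2 del: One_nat_def)
  define u1 where "u1 i = w1 i 0 - w1 i 1" for i
  define u2 where "u2 i = w2 i 0 - w2 i 1" for i
  have "(\<Sum>i\<in>UNIV. u1 i * dpol i (u2 (Inr j))) = (\<Sum>i\<in>UNIV. u2 i * dpol i (u1 (Inr j)))"
  proof (rule integrable_imp_commute[OF l1 l2 U _ _ p0 e1 p e2 base(1) q int])
    show "?z + cscale (c1 \<zeta>) ?v \<in> U" if "\<zeta> \<in> S1" for \<zeta> using r1[OF that] by (simp add: osc_point_line)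
    show "?z + cscale (c2 \<zeta>) ?v \<in> U" if "\<zeta> \<in> S2" for \<zeta> using r2[OF that] by (simp add: osc_point_line)
    show "\<exists>w. HDp S1 w (\<lambda>\<zeta>. ?k1 \<zeta> i $ 1) \<and> u1 i = w 0 - w 1" for i
      by (intro exI[of _ "w1 i"] conjI w1) (simp add: u1_def)
    show "\<exists>w. HDp S2 w (\<lambda>\<zeta>. ?k2 \<zeta> i $ 1) \<and> u2 i = w 0 - w 1" for i
      by (intro exI[of _ "w2 i"] conjI w2) (simp add: u2_def)
  qed
  \<comment> \<open>A closed loop in time has no net drift, so the right-hand sum vanishes. On the
    left only the derivative of \<open>u2 (Inr j)\<close> with respect to
    \<open>pvar (Inl j)\<close> remains, multiplied by the change of \<open>W\<close>.\<close>
  moreover have "u1 (Inr j) = 0" by (simp add: u1_def w1_def base)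
  moreover have "u2 (Inr j) = cst (- of_real T) * pvar (Inl j)"
    by (simp add: u2_def w2_def base cst_hom algebra_simps)
  moreover have "u1 (Inl j) = cst (W 0 - W 1)" by (simp add: u1_def w1_def cst_hom)
  ultimately have "cst (W 0 - W 1) * cst (- of_real T) = (0 :: ('l + 'l) pol)"
    by (simp add: dpol_pvar if_distrib[of "\<lambda>x. _ * x"] sum.delta cong: if_cong)
  then have "ev (cst (W 0 - W 1) * cst (- of_real T) :: ('l + 'l) pol) 0 = 0" by simp
  then show False using W(2) base(4) by simp
qed

text \<open>Relative to \<open>j1\<close> every other phase difference advances with speed \<omega>,
  so each coupling term is of the form treated in \<open>pendulum_pole\<close>. The multiplicities
  are natural numbers with a common residue factor; their sum is positive as soon as one term has a
  pole.\<close>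

lemma osc_force_pole:
  fixes I \<theta> \<Omega> :: "real ^ ('l::finite)" and \<tau>0 :: complex
  assumes \<kappa>: "0 < \<kappa>" "\<kappa> < 1" and \<omega>: "\<omega> \<noteq> 0" "I $ j1 = \<omega>" "\<And>k. k \<noteq> j1 \<Longrightarrow> I $ k = 2 * \<omega>"
  shows "\<exists>R>0. \<exists>G (m::nat). G holomorphic_on ball \<tau>0 R \<and>
    (\<forall>k. k \<noteq> j1 \<longrightarrow> of_real \<kappa> * cos (of_real (\<theta> $ k - \<theta> $ j1) + \<tau>0 * of_real \<omega>) = 1 \<longrightarrow> m > 0) \<and>
    (\<forall>\<tau>\<in>ball \<tau>0 R - {\<tau>0}. osc_point I \<theta> \<tau> \<in> osc_regular \<kappa> \<and>
      osc_force \<delta> \<beta> \<kappa> \<Omega> j1 (osc_point I \<theta> \<tau>) = of_real \<beta> * of_nat m / (of_real (\<kappa> * \<omega>) * (\<tau> - \<tau>0)) + G \<tau>)"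
proof -
  define x where "x k \<tau> = of_real (\<theta> $ k - \<theta> $ j1) + \<tau> * of_real \<omega>" for k and \<tau> :: complex
  define X where "X k \<tau> = fst (osc_point I \<theta> \<tau>) $ Inr k - fst (osc_point I \<theta> \<tau>) $ Inr j1" for k \<tau>
  define Y where "Y k \<tau> = sin (X k \<tau>) / (1 - of_real \<kappa> * cos (X k \<tau>))" for k \<tau>
  have Xx: "X k \<tau> = x k \<tau>" if "k \<noteq> j1" for k \<tau>
    using that by (simp add: X_def x_def \<omega> algebra_simps)
  have X0: "X j1 \<tau> = 0" for \<tau> by (simp add: X_def)
  define D where "D k R G m \<longleftrightarrow> R > 0 \<and> G holomorphic_on ball \<tau>0 R \<and>
      (k \<noteq> j1 \<and> 1 - of_real \<kappa> * cos (x k \<tau>0) = 0 \<longrightarrow> m = (1::nat)) \<and>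
      (\<forall>\<tau>\<in>ball \<tau>0 R - {\<tau>0}. 1 - of_real \<kappa> * cos (X k \<tau>) \<noteq> 0 \<and>
        Y k \<tau> = of_nat m / (of_real (\<kappa> * \<omega>) * (\<tau> - \<tau>0)) + G \<tau>)" for k R G m
  have one: "1 - complex_of_real \<kappa> \<noteq> 0"
    using \<kappa> by (metis eq_iff_diff_eq_0 less_irrefl of_real_eq_1_iff)
  have ex: "\<exists>t. D k (fst t) (fst (snd t)) (snd (snd t))" for k
  proof (cases "k = j1")
    case True
    have "D k 1 (\<lambda>_. 0) 0" using one by (simp add: D_def True X0 Y_def)
    then show ?thesis by (intro exI[of _ "(1, \<lambda>_. 0, 0)"]) simp
  next
    case False
    obtain R G m where "R > 0" and G: "G holomorphic_on ball \<tau>0 R" "1 - of_real \<kappa> * cos (x k \<tau>0) = 0 \<longrightarrow> m = (1::nat)"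
      "\<forall>\<tau>\<in>ball \<tau>0 R - {\<tau>0}. 1 - of_real \<kappa> * cos (x k \<tau>) \<noteq> 0 \<and>
         sin (x k \<tau>) / (1 - of_real \<kappa> * cos (x k \<tau>)) = of_nat m / (of_real (\<kappa> * \<omega>) * (\<tau> - \<tau>0)) + G \<tau>"
      using pendulum_pole[OF \<kappa> \<omega>(1), of \<tau>0 "\<theta> $ k - \<theta> $ j1"] unfolding x_def by (elim exE conjE)
    then have "D k R G m" unfolding D_def Y_def Xx[OF False] by simp
    then show ?thesis by (intro exI[of _ "(R, G, m)"]) simp
  qed
  have "\<exists>t. \<forall>k. D k (fst (t k)) (fst (snd (t k))) (snd (snd (t k)))"
    by (rule choice) (rule allI, rule ex)
  then obtain t where t: "\<forall>k. D k (fst (t k)) (fst (snd (t k))) (snd (snd (t k)))" by (elim exE)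
  define r G m where "r k = fst (t k)" and "G k = fst (snd (t k))" and "m k = snd (snd (t k))" for k
  have D: "D k (r k) (G k) (m k)" for k using spec[OF t, of k] by (simp only: r_def G_def m_def)
  define R where "R = Min (range r)"
  have "R > 0" using D unfolding R_def D_def by (subst Min_gr_iff) auto
  have "R \<le> r k" for k unfolding R_def by (intro Min_le) auto
  then have sub: "ball \<tau>0 R \<subseteq> ball \<tau>0 (r k)" for k by (intro subset_ball)
  have G: "G k holomorphic_on ball \<tau>0 R" for k
    using D[of k] holomorphic_on_subset[OF _ sub] unfolding D_def by (elim conjE)
  have nz: "1 - of_real \<kappa> * cos (X k \<tau>) \<noteq> 0"
    and Y: "Y k \<tau> = of_nat (m k) / (of_real (\<kappa> * \<omega>) * (\<tau> - \<tau>0)) + G k \<tau>"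
    if "\<tau> \<in> ball \<tau>0 R - {\<tau>0}" for k \<tau>
  proof -
    have "\<tau> \<in> ball \<tau>0 (r k) - {\<tau>0}" using that sub[of k] by blast
    then show "1 - of_real \<kappa> * cos (X k \<tau>) \<noteq> 0"
      "Y k \<tau> = of_nat (m k) / (of_real (\<kappa> * \<omega>) * (\<tau> - \<tau>0)) + G k \<tau>"
      using D[of k] unfolding D_def by simp_all
  qed
  have reg: "osc_point I \<theta> \<tau> \<in> osc_regular \<kappa>" if \<tau>: "\<tau> \<in> ball \<tau>0 R - {\<tau>0}" for \<tau>
    unfolding osc_regular_def
  proof (intro CollectI allI)
    fix k j
    let ?d = "fst (osc_point I \<theta> \<tau>) $ Inr k - fst (osc_point I \<theta> \<tau>) $ Inr j"
    consider "j = j1" | "k = j1" | "j \<noteq> j1" "k \<noteq> j1" by blast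
    then show "1 - of_real \<kappa> * cos ?d \<noteq> 0"
    proof cases
      case 1
      then show ?thesis using nz[OF \<tau>, of k] by (simp add: X_def)
    next
      case 2
      have "cos ?d = cos (X j \<tau>)"
        unfolding X_def 2 by (subst cos_minus[symmetric]) simp
      then show ?thesis using nz[OF \<tau>, of j] by (simp only: not_False_eq_True)
    next
      case 3
      \<comment> \<open>Oscillators other than \<open>j1\<close> have equal speed, so this
        difference is constant and real, and \<open>\<kappa> < 1\<close> keeps the denominator
        positive.\<close>
      have "?d = of_real (\<theta> $ k - \<theta> $ j)" using 3 by (simp add: \<omega>)
      then have c: "cos ?d = of_real (cos (\<theta> $ k - \<theta> $ j))" by (simp only: cos_of_real)
      have "\<kappa> * cos (\<theta> $ k - \<theta> $ j) \<le> \<kappa> * 1" using \<kappa> by (intro mult_left_mono) auto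
      then have "1 - \<kappa> * cos (\<theta> $ k - \<theta> $ j) \<noteq> 0" using \<kappa> by linarith
      then have "complex_of_real (1 - \<kappa> * cos (\<theta> $ k - \<theta> $ j)) \<noteq> 0" by (simp only: of_real_eq_0_iff not_False_eq_True)
      then show ?thesis unfolding c by simp
    qed
  qed
  define H where "H \<tau> = - of_real \<delta> * of_real \<omega> + of_real (\<Omega> $ j1) + of_real \<beta> * (\<Sum>k\<in>UNIV. G k \<tau>)" for \<tau>
  have hH: "H holomorphic_on ball \<tau>0 R" unfolding H_def by (intro holomorphic_intros G)
  have f: "osc_force \<delta> \<beta> \<kappa> \<Omega> j1 (osc_point I \<theta> \<tau>) =
      of_real \<beta> * of_nat (sum m UNIV) / (of_real (\<kappa> * \<omega>) * (\<tau> - \<tau>0)) + H \<tau>"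
    if \<tau>: "\<tau> \<in> ball \<tau>0 R - {\<tau>0}" for \<tau>
  proof -
    have "osc_force \<delta> \<beta> \<kappa> \<Omega> j1 (osc_point I \<theta> \<tau>) =
        - of_real \<delta> * of_real \<omega> + of_real (\<Omega> $ j1) + of_real \<beta> * (\<Sum>k\<in>UNIV. Y k \<tau>)"
      unfolding osc_force_def X_def[symmetric] Y_def[symmetric] by (simp add: \<omega>)
    also have "(\<Sum>k\<in>UNIV. Y k \<tau>) = of_nat (sum m UNIV) / (of_real (\<kappa> * \<omega>) * (\<tau> - \<tau>0)) + (\<Sum>k\<in>UNIV. G k \<tau>)"
      by (simp add: Y[OF \<tau>] sum.distrib sum_divide_distrib)
    finally show ?thesis by (simp add: H_def distrib_left)
  qed
  have pos: "sum m UNIV > 0" if k: "k \<noteq> j1" "of_real \<kappa> * cos (of_real (\<theta> $ k - \<theta> $ j1) + \<tau>0 * of_real \<omega>) = 1" for k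
  proof -
    have "m k = 1" using D[of k] k unfolding D_def x_def by simp
    moreover have "m k \<le> sum m UNIV" by (rule member_le_sum) auto
    ultimately show ?thesis by simp
  qed
  show ?thesis
    by (intro exI[of _ R] exI[of _ H] exI[of _ "sum m UNIV"] conjI \<open>R > 0\<close> hH allI impI ballI)
      (erule (1) pos, erule reg, erule f)
qed

theorem proposition5p1:
  fixes \<delta> \<beta> \<kappa> \<omega> T :: real and \<Omega> I \<theta> :: "real ^ 'l" and j1 j2 :: 'l
    and \<tau>s :: complex and \<Gamma> :: "complex set"
  assumes "CARD('l) \<ge> 2" and "j1 \<noteq> j2"
    and "\<delta> > 0" and "\<beta> > 0" and "\<kappa> > 0" and "\<kappa> < 1" and "\<And>j. \<Omega> $ j > 0"
    and "2 * I $ j1 = I $ j2" and "\<And>j. j \<noteq> j1 \<Longrightarrow> I $ j = I $ j2" and "I $ j2 \<noteq> 0"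
    and "\<omega> = I $ j1" and "T = 2 * pi / \<omega>"
    and "\<tau>s = of_real ((\<theta> $ j1 - \<theta> $ j2) / \<omega>) + \<i> / of_real \<omega> * of_real (arcosh (1 / \<kappa>))"
    and "domain_mod T \<Gamma>" and "range of_real \<subseteq> \<Gamma>" and "\<tau>s \<in> \<Gamma>"
  shows "\<not> meromorphically_integrable_near angle_periods (oscillator_field \<delta> \<beta> \<kappa> \<Omega>)
            (unperturbed_orbit I \<theta> \<Gamma>)"
proof
  assume "meromorphically_integrable_near angle_periods (oscillator_field \<delta> \<beta> \<kappa> \<Omega>) (unperturbed_orbit I \<theta> \<Gamma>)"
  then obtain q U where q: "q \<in> {1..CARD('l + 'l)}" and U: "open U" "unperturbed_orbit I \<theta> \<Gamma> \<times> {0} \<subseteq> U"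
    and int: "bogoyavlenskij_integrable_on angle_periods (oscillator_field \<delta> \<beta> \<kappa> \<Omega>) U q"
    unfolding meromorphically_integrable_near_def by (elim bexE exE conjE)
  have orb: "osc_point I \<theta> \<tau> \<in> U" if "\<tau> \<in> \<Gamma>" for \<tau> using osc_point_orbit[OF that] U(2) by blast
  have \<kappa>: "0 < \<kappa>" "\<kappa> < 1" by fact+
  have \<omega>: "\<omega> \<noteq> 0" "I $ j1 = \<omega>" "\<And>k. k \<noteq> j1 \<Longrightarrow> I $ k = 2 * \<omega>"
    using assms(8-11) by auto
  have T: "T \<noteq> 0" using \<omega>(1) assms(12) by simp
  \<comment> \<open>During \<open>T\<close> the phase of \<open>j1\<close> advances by one full turn
    and every other phase by two.\<close>
  have IT: "\<exists>k::int. I $ j * T = 2 * pi * of_int k" for j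
    by (cases "j = j1") (auto simp: \<omega> assms(12) intro: exI[of _ 1] exI[of _ 2])
  have \<Gamma>: "open \<Gamma>" "mod_invariant T \<Gamma>" using assms(14) by (auto simp: domain_mod_def)
  have pole: "\<exists>R>0. \<exists>G (m::nat). G holomorphic_on ball \<tau>0 R \<and>
    (\<forall>k. k \<noteq> j1 \<longrightarrow> of_real \<kappa> * cos (of_real (\<theta> $ k - \<theta> $ j1) + \<tau>0 * of_real \<omega>) = 1 \<longrightarrow> m > 0) \<and>
    (\<forall>\<tau>\<in>ball \<tau>0 R - {\<tau>0}. osc_point I \<theta> \<tau> \<in> osc_regular \<kappa> \<and>
      osc_force \<delta> \<beta> \<kappa> \<Omega> j1 (osc_point I \<theta> \<tau>) = of_real \<beta> * of_nat m / (of_real (\<kappa> * \<omega>) * (\<tau> - \<tau>0)) + G \<tau>)"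
    for \<tau>0 by (rule osc_force_pole[OF \<kappa> \<omega>])
  \<comment> \<open>Singular times are isolated, so removing them from the connected \<Gamma> leaves
    an open connected set in which a period path can avoid all poles.\<close>
  define Bad where "Bad = {\<tau>. osc_point I \<theta> \<tau> \<notin> osc_regular \<kappa>}"
  have "Bad sparse_in \<Gamma>"
    unfolding sparse_in_open[OF \<Gamma>(1)]
  proof
    fix \<tau>0 obtain R where R: "R > 0" "\<forall>\<tau>\<in>ball \<tau>0 R - {\<tau>0}. osc_point I \<theta> \<tau> \<in> osc_regular \<kappa>"
      using pole[of \<tau>0] by (elim exE conjE) (rule that, auto)
    then show "\<not> \<tau>0 islimpt Bad"
      unfolding islimpt_def by (auto simp: Bad_def intro!: exI[of _ "ball \<tau>0 R"])
  qed
  then have GB: "open (\<Gamma> - Bad)" "connected (\<Gamma> - Bad)"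
    using open_diff_sparse_pts[OF \<Gamma>(1)]
      sparse_imp_connected[OF _ domain_mod_connected[OF assms(14,15)] \<Gamma>(1)] by auto
  obtain R G m where R: "R > 0" and G: "G holomorphic_on ball \<tau>s R"
    and m: "\<forall>k. k \<noteq> j1 \<longrightarrow> of_real \<kappa> * cos (of_real (\<theta> $ k - \<theta> $ j1) + \<tau>s * of_real \<omega>) = 1 \<longrightarrow> (m::nat) > 0"
    and Rp: "\<forall>\<tau>\<in>ball \<tau>s R - {\<tau>s}. osc_point I \<theta> \<tau> \<in> osc_regular \<kappa> \<and>
      osc_force \<delta> \<beta> \<kappa> \<Omega> j1 (osc_point I \<theta> \<tau>) = of_real \<beta> * of_nat m / (of_real (\<kappa> * \<omega>) * (\<tau> - \<tau>s)) + G \<tau>"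
    using pole[of \<tau>s] by (elim exE conjE)
  have "m > 0"
  proof -
    \<comment> \<open>\<open>\<tau>s\<close> is chosen so that the phase difference is purely
      imaginary there and its cosine equals
      \<open>cosh (arcosh (1 / \<kappa>)) = 1 / \<kappa>\<close>.\<close>
    have x: "of_real (\<theta> $ j2 - \<theta> $ j1) + \<tau>s * of_real \<omega> = \<i> * of_real (arcosh (1 / \<kappa>))"
      using \<omega>(1) by (simp add: assms(13) field_simps)
    have "cos (\<i> * complex_of_real (arcosh (1 / \<kappa>))) = of_real (cosh (arcosh (1 / \<kappa>)))"
      by (simp add: cosh_conv_cos[symmetric] cosh_field_def exp_of_real[symmetric])
    also have "\<dots> = of_real (1 / \<kappa>)" using \<kappa> by (subst cosh_arcosh_real) simp_all
    finally have "of_real \<kappa> * cos (of_real (\<theta> $ j2 - \<theta> $ j1) + \<tau>s * of_real \<omega>) = 1"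
      unfolding x using \<kappa> by simp
    then show ?thesis using m assms(2) by (metis (no_types))
  qed
  define A where "A = of_real \<beta> * of_nat m / complex_of_real (\<kappa> * \<omega>)"
  have A: "A \<noteq> 0" using \<open>m > 0\<close> \<omega>(1) \<kappa> assms(4) by (simp add: A_def)
  obtain R' where R': "R' > 0" "ball \<tau>s R' \<subseteq> \<Gamma>" using \<Gamma>(1) assms(16) unfolding open_contains_ball by blast
  define B where "B = ball \<tau>s (min R R')"
  have B: "open (B - {\<tau>s})" "B \<subseteq> ball \<tau>s R" "B - {\<tau>s} \<subseteq> \<Gamma> - Bad"
    using R' Rp by (auto simp: B_def Bad_def)
  define \<rho> where "\<rho> = min R R' / 2"
  have \<rho>: "\<rho> > 0" "\<rho> < min R R'" using R R' by (auto simp: \<rho>_def)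
  obtain P where P: "\<And>\<tau>. \<tau> \<in> ball \<tau>s R \<Longrightarrow> (P has_field_derivative G \<tau>) (at \<tau> within ball \<tau>s R)"
    by (rule holomorphic_convex_primitive'[OF convex_ball open_ball G])
      (rule that, drule meta_spec, drule meta_mp, assumption+)
  have P: "(P has_field_derivative G \<tau>) (at \<tau>)" if "\<tau> \<in> ball \<tau>s R" for \<tau>
    using P[OF that] that by (simp add: at_within_open[OF _ open_ball] del: mem_ball)
  \<comment> \<open>A small circle around \<open>\<tau>s\<close>, written as an entire function of
    the loop parameter and never equal to the pole.\<close>
  define c1 where "c1 \<zeta> = \<tau>s + of_real \<rho> * exp (2 * of_real pi * \<i> * \<zeta>)" for \<zeta>
  define c1' where "c1' \<zeta> = 2 * of_real pi * \<i> * (c1 \<zeta> - \<tau>s)" for \<zeta>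
  have dc1: "(c1 has_field_derivative c1' \<zeta>) (at \<zeta>)" for \<zeta>
    unfolding c1_def c1'_def by (auto intro!: derivative_eq_intros)
  have hc1: "c1 holomorphic_on S" for S by (rule holomorphic_on_derivI[OF dc1])
  have hc1': "c1' holomorphic_on S" for S unfolding c1'_def by (intro holomorphic_intros hc1)
  have c1s: "c1 \<zeta> \<noteq> \<tau>s" for \<zeta> using \<rho> by (simp add: c1_def)
  have "open (c1 -` (B - {\<tau>s}))"
    using holomorphic_on_imp_continuous_on[OF hc1] B(1) by (intro open_vimage) auto
  moreover have "of_real s \<in> c1 -` (B - {\<tau>s})" for s
  proof -
    have "norm (exp (2 * of_real pi * \<i> * complex_of_real s)) = 1" by simp
    then have "dist \<tau>s (c1 (of_real s)) = \<rho>" using \<rho>(1) by (simp add: c1_def dist_norm norm_mult)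
    then show ?thesis using \<rho>(2) c1s by (simp add: B_def)
  qed
  ultimately obtain S1 where S1: "open S1" "convex S1" "0 \<in> S1" "1 \<in> S1" and S1B: "S1 \<subseteq> c1 -` (B - {\<tau>s})"
    using segment_nbhd by (metis (no_types))
  have c1B: "c1 \<zeta> \<in> B - {\<tau>s}" if "\<zeta> \<in> S1" for \<zeta> using that S1B by blast
  \<comment> \<open>A primitive of the force along the circle: in the parameter \<zeta> the
    logarithm at the pole unwinds to a linear term, and \<open>P\<close> integrates the regular
    part. Its increment over the loop is therefore \<open>2 * pi * \<i> * A\<close>, with
    \<open>A\<close> the residue.\<close>
  define W where "W \<zeta> = 2 * of_real pi * \<i> * A * \<zeta> + P (c1 \<zeta>)" for \<zeta>
  have W: "(W has_field_derivative c1' \<zeta> * osc_force \<delta> \<beta> \<kappa> \<Omega> j1 (osc_point I \<theta> (c1 \<zeta>))) (at \<zeta>)"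
    if \<zeta>: "\<zeta> \<in> S1" for \<zeta>
  proof -
    have b: "c1 \<zeta> \<in> ball \<tau>s R - {\<tau>s}" using c1B[OF \<zeta>] B(2) by blast
    have "((\<lambda>\<zeta>. P (c1 \<zeta>)) has_field_derivative G (c1 \<zeta>) * c1' \<zeta>) (at \<zeta>)"
      by (rule DERIV_chain2[OF P dc1]) (use b in blast)
    then have "(W has_field_derivative 2 * of_real pi * \<i> * A + G (c1 \<zeta>) * c1' \<zeta>) (at \<zeta>)"
      unfolding W_def by (auto intro!: derivative_eq_intros)
    moreover have "osc_force \<delta> \<beta> \<kappa> \<Omega> j1 (osc_point I \<theta> (c1 \<zeta>)) = A / (c1 \<zeta> - \<tau>s) + G (c1 \<zeta>)"
      using Rp[rule_format, OF b] by (simp add: A_def)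
    moreover have "c1' \<zeta> * (A / (c1 \<zeta> - \<tau>s)) = 2 * of_real pi * \<i> * A"
      using c1s[of \<zeta>] by (simp add: c1'_def)
    ultimately show ?thesis by (simp add: distrib_left mult.commute)
  qed
  have c10: "c1 1 = c1 0" by (simp add: c1_def exp_two_pi_i')
  have W01: "W 0 \<noteq> W 1" using A by (simp add: W_def c10)
  have b0: "c1 0 \<in> \<Gamma> - Bad" using c1B[OF S1(3)] B(3) by blast
  \<comment> \<open>Advancing time by \<open>T\<close> changes phase differences by multiples of a
    full turn, so the end point is as regular as the start.\<close>
  have bT: "c1 0 + of_real T \<in> \<Gamma> - Bad"
  proof -
    have "c1 0 + of_real T \<in> \<Gamma>" using \<Gamma>(2) b0 unfolding mod_invariant_def by (metis DiffD1 mult_1 of_int_1)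
    moreover have "cos (fst (osc_point I \<theta> (c1 0 + of_real T)) $ Inr k - fst (osc_point I \<theta> (c1 0 + of_real T)) $ Inr j) =
        cos (fst (osc_point I \<theta> (c1 0)) $ Inr k - fst (osc_point I \<theta> (c1 0)) $ Inr j)" for k j
    proof -
      obtain a b :: int where ab: "I $ k * T = 2 * pi * of_int a" "I $ j * T = 2 * pi * of_int b" using IT by metis
      have "fst (osc_point I \<theta> (c1 0 + of_real T)) $ Inr k - fst (osc_point I \<theta> (c1 0 + of_real T)) $ Inr j =
          (fst (osc_point I \<theta> (c1 0)) $ Inr k - fst (osc_point I \<theta> (c1 0)) $ Inr j) + (of_real (I $ k * T) - of_real (I $ j * T))"
        by (simp add: algebra_simps)
      also have "of_real (I $ k * T) - of_real (I $ j * T) = complex_of_real (2 * pi * of_int (a - b))"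
        unfolding ab by (simp add: algebra_simps)
      finally show ?thesis by (simp only: cos_add cos_of_real sin_of_real cos_int_2pin sin_int_2pin) simp
    qed
    ultimately show ?thesis using b0 by (simp add: Bad_def osc_regular_def)
  qed
  \<comment> \<open>The second path starts at the base point of the circle and covers one period
    inside the regular part of \<Gamma>; it may leave the real axis.\<close>
  obtain c2 where c2: "c2 holomorphic_on UNIV" "c2 0 = c1 0" "c2 1 = c1 0 + of_real T"
    and c2p: "\<forall>s\<in>{0..1}. c2 (of_real s) \<in> \<Gamma> - Bad"
    using entire_path[OF GB b0 bT] by (elim exE conjE)
  have "open (c2 -` (\<Gamma> - Bad))"
    using holomorphic_on_imp_continuous_on[OF c2(1)] GB(1) by (intro open_vimage) auto
  then have "\<exists>S. open S \<and> convex S \<and> 0 \<in> S \<and> 1 \<in> S \<and> S \<subseteq> c2 -` (\<Gamma> - Bad)"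
    by (rule segment_nbhd) (use c2p in blast)
  then obtain S2 where S2: "open S2" "convex S2" "0 \<in> S2" "1 \<in> S2" and S2B: "S2 \<subseteq> c2 -` (\<Gamma> - Bad)"
    by (elim exE conjE)
  have dc2: "(c2 has_field_derivative deriv c2 \<zeta>) (at \<zeta>)" for \<zeta>
    by (rule holomorphic_derivI[OF c2(1) open_UNIV UNIV_I])
  have hc2': "deriv c2 holomorphic_on S2"
    by (rule holomorphic_on_subset[OF holomorphic_deriv[OF c2(1) open_UNIV]]) simp
  have good: "osc_point I \<theta> \<tau> \<in> osc_regular \<kappa> \<inter> U" if "\<tau> \<in> \<Gamma> - Bad" for \<tau>
    using that orb by (simp add: Bad_def)
  have r1: "osc_point I \<theta> (c1 \<zeta>) \<in> osc_regular \<kappa> \<inter> U" if "\<zeta> \<in> S1" for \<zeta>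
    by (rule good) (use c1B[OF that] B(3) in blast)
  have r2: "osc_point I \<theta> (c2 \<zeta>) \<in> osc_regular \<kappa> \<inter> U" if "\<zeta> \<in> S2" for \<zeta>
    by (rule good) (use that S2B in blast)
  have c2T: "c2 1 = c2 0 + of_real T" using c2 by simp
  have "\<not> bogoyavlenskij_integrable_on angle_periods (oscillator_field \<delta> \<beta> \<kappa> \<Omega>) U q"
    by (rule osc_obstruction[OF S1 dc1 hc1' r1 S2 dc2 hc2' r2 c2(2)[symmetric] c10 c2T T IT W W01 U(1)])
      (use q in auto)
  then show False using int by contradiction
qed

end
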